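(* Let $\phi$ be a smooth metric on $L$ over $U\times Z$ satisfying $\omega^\phi:=i\partial\bar\partial\phi\ge0$, and assume in addition that $\omega^\phi_{n+1}=0$ on $U\times Z$ (equivalently $c(\phi)=0$). Then $\Theta^F\le 0$, i.e. $\langle\Theta^F u,u\rangle\le0$ for all $t\in U$ and all $u\in F_t$.
   Context: $Z$ is a compact complex manifold of dimension $n$, $\hat L$ a positive line bundle over $Z$, $U\subset\mathbb{C}$ a domain, and $L$ the pullback of $\hat L$ to $U\times Z$. Metrics are written additively: $|u|^2e^{-\phi}$ is the pointwise squared norm. Write $\phi=\phi_0+\psi$ with $\phi_0$ a fixed metric on $\hat L$ and $\psi=\psi(t,z)$ a smooth real function. Throughout, $\phi$ restricts to a positive metric on each fiber: $\omega=\omega^t:=i\partial\bar\partial_z\phi|_{\{t\}\times Z}>0$. Notation: $\omega_k=\omega^{k}/k!$, $\omega^\phi_{k}=(\omega^\phi)^k/k!$. $F=U\times H^0(Z,\hat L)$ is the trivial holomorphic vector bundle over $U$ with the Hermitian metric $\|u\|_t^2=\int_{\{t\}\times Z}|u|^2e^{-\phi}\omega_n$, and $\Theta^F$ is its Chern curvature viewed as an endomorphism (coefficient of $dt\wedge d\bar t$). $c(\phi)=\psi_{t\bar t}-|\bar\partial_z\psi_t|^2_{\omega^t}$, where $\psi_t=\partial\psi/\partial t$; it satisfies $c(\phi)\,i\,dt\wedge d\bar t\wedge\omega^t_n=\omega^\phi_{n+1}$. *)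

theory Defs
  imports "HOL-Analysis.Analysis"
begin

section \<open>Calculus on complex vector spaces\<close>

text \<open>A complex structure on a real vector space is given by its operator \<open>J\<close>,
  multiplication by \<open>\<i>\<close>.  Derivatives are only used at interior points of the
  domains on which the functions are meaningful.\<close>

definition J_vec :: "complex^'n \<Rightarrow> complex^'n"
  where "J_vec v = \<i> *s v"

definition J_prod :: "complex \<times> (complex^'n) \<Rightarrow> complex \<times> (complex^'n)"
  where "J_prod p = (\<i> * fst p, \<i> *s snd p)"

primrec Ck_on ::
  "nat \<Rightarrow> 'a::real_normed_vector set \<Rightarrow> ('a \<Rightarrow> 'b::real_normed_vector) \<Rightarrow> bool"
where
  "Ck_on 0 S f = continuous_on S f"
| "Ck_on (Suc k) S f =
     (f differentiable_on S \<and> (\<forall>v. Ck_on k S (\<lambda>x. frechet_derivative f (at x) v)))"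

definition smooth_on :: "'a::real_normed_vector set \<Rightarrow> ('a \<Rightarrow> 'b::real_normed_vector) \<Rightarrow> bool"
  where "smooth_on S f \<longleftrightarrow> (\<forall>k. Ck_on k S f)"

definition holo_on :: "(complex^'n) set \<Rightarrow> (complex^'n \<Rightarrow> complex) \<Rightarrow> bool"
  where "holo_on S f \<longleftrightarrow>
    (\<forall>x\<in>S. \<exists>D. (f has_derivative D) (at x) \<and> (\<forall>v. D (\<i> *s v) = \<i> * D v))"

text \<open>The values \<open>\<partial>f(v)\<close> and \<open>\<partial>\<close>-bar \<open>f(v)\<close> of the (1,0)- and (0,1)-parts of \<open>df\<close>.
  For \<open>J = (*) \<i>\<close> on \<open>\<complex>\<close> and \<open>v = 1\<close> these are the Wirtinger derivatives.\<close>

definition del ::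
  "('v \<Rightarrow> 'v) \<Rightarrow> ('v::real_normed_vector \<Rightarrow> complex) \<Rightarrow> 'v \<Rightarrow> 'v \<Rightarrow> complex"
  where "del J f x v =
    (frechet_derivative f (at x) v - \<i> * frechet_derivative f (at x) (J v)) / 2"

definition dbar ::
  "('v \<Rightarrow> 'v) \<Rightarrow> ('v::real_normed_vector \<Rightarrow> complex) \<Rightarrow> 'v \<Rightarrow> 'v \<Rightarrow> complex"
  where "dbar J f x v =
    (frechet_derivative f (at x) v + \<i> * frechet_derivative f (at x) (J v)) / 2"

abbreviation wirtinger :: "(complex \<Rightarrow> complex) \<Rightarrow> complex \<Rightarrow> complex"
  where "wirtinger f t \<equiv> del ((*) \<i>) f t 1"

abbreviation wirtinger_bar :: "(complex \<Rightarrow> complex) \<Rightarrow> complex \<Rightarrow> complex"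
  where "wirtinger_bar f t \<equiv> dbar ((*) \<i>) f t 1"


section \<open>Forms\<close>

text \<open>A complex-valued \<open>p\<close>-form at a point is a function of a sequence of vectors, of which only
  the entries \<open>0, \<dots>, p - 1\<close> are relevant.  The wedge product is normalised so that
  \<open>(dx \<and> dy)(\<partial>\<^sub>x, \<partial>\<^sub>y) = 1\<close>.\<close>

type_synonym 'v form = "(nat \<Rightarrow> 'v) \<Rightarrow> complex"

definition wedge :: "nat \<Rightarrow> nat \<Rightarrow> 'v form \<Rightarrow> 'v form \<Rightarrow> 'v form"
  where "wedge p q \<alpha> \<beta> v =
    (\<Sum>\<sigma> | \<sigma> permutes {..<p+q}. of_int (sign \<sigma>) * \<alpha> (\<lambda>i. v (\<sigma> i)) * \<beta> (\<lambda>i. v (\<sigma> (p + i))))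
      / (fact p * fact q)"

primrec form_power :: "'v form \<Rightarrow> nat \<Rightarrow> 'v form"
where
  "form_power \<alpha> 0 = (\<lambda>_. 1)"
| "form_power \<alpha> (Suc k) = wedge 2 (2 * k) \<alpha> (form_power \<alpha> k)"

definition divided_power :: "'v form \<Rightarrow> nat \<Rightarrow> 'v form"
  where "divided_power \<alpha> k v = form_power \<alpha> k v / fact k"

text \<open>The form \<open>\<i> \<partial> \<partial>\<close>-bar \<open>f\<close>.  The (0,1)-form \<open>\<partial>\<close>-bar \<open>f\<close> has constant-coefficient basis
  \<open>dz\<close>-bar, so \<open>\<partial>\<close> of it at \<open>(v, w)\<close> is the antisymmetrised \<open>\<partial>\<close>-derivative along \<open>v\<close> of its
  value on \<open>w\<close>.\<close>

definition i_ddbar :: "('v \<Rightarrow> 'v) \<Rightarrow> ('v::real_normed_vector \<Rightarrow> real) \<Rightarrow> 'v \<Rightarrow> 'v form"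
  where "i_ddbar J f x v =
    \<i> * (del J (\<lambda>y. dbar J (\<lambda>p. complex_of_real (f p)) y (v 1)) x (v 0)
        - del J (\<lambda>y. dbar J (\<lambda>p. complex_of_real (f p)) y (v 0)) x (v 1))"

text \<open>Positivity of a real (1,1)-form \<open>\<alpha>\<close>: \<open>\<alpha>(v, Jv) > 0\<close>; for instance
  \<open>\<i> dz \<and> dz\<close>-bar takes the value 2 on \<open>(1, \<i>)\<close>.\<close>

definition positive_form :: "('v::zero \<Rightarrow> 'v) \<Rightarrow> 'v form \<Rightarrow> bool"
  where "positive_form J \<alpha> \<longleftrightarrow>
    (\<forall>v. v \<noteq> 0 \<longrightarrow> 0 < Re (\<alpha> (\<lambda>i. if i = 0 then v else J v)))"

definition semipositive_form :: "('v \<Rightarrow> 'v) \<Rightarrow> 'v form \<Rightarrow> bool"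
  where "semipositive_form J \<alpha> \<longleftrightarrow>
    (\<forall>v. 0 \<le> Re (\<alpha> (\<lambda>i. if i = 0 then v else J v)))"


section \<open>Compact complex manifolds\<close>

text \<open>The manifold is the whole Hausdorff type \<open>'z\<close>; a chart is a pair of its domain and its
  coordinate map.\<close>

type_synonym ('z, 'n) chart = "'z set \<times> ('z \<Rightarrow> complex^'n)"

definition chart_inv :: "('z, 'n) chart \<Rightarrow> complex^'n \<Rightarrow> 'z"
  where "chart_inv c = inv_into (fst c) (snd c)"

definition compact_complex_manifold :: "('z::t2_space, 'n::finite) chart set \<Rightarrow> bool"
  where "compact_complex_manifold A \<longleftrightarrow>
    compact (UNIV :: 'z set) \<and>
    (\<Union>c\<in>A. fst c) = UNIV \<and>
    (\<forall>c\<in>A. open (fst c) \<and> open (snd c ` fst c) \<and>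
           homeomorphism (fst c) (snd c ` fst c) (snd c) (chart_inv c)) \<and>
    (\<forall>c\<in>A. \<forall>d\<in>A. \<forall>a.
       holo_on (snd c ` (fst c \<inter> fst d)) (\<lambda>y. snd d (chart_inv c y) $ a))"

definition holo_fun_on :: "('z, 'n::finite) chart set \<Rightarrow> 'z set \<Rightarrow> ('z \<Rightarrow> complex) \<Rightarrow> bool"
  where "holo_fun_on A W f \<longleftrightarrow>
    (\<forall>c\<in>A. holo_on (snd c ` (fst c \<inter> W)) (\<lambda>y. f (chart_inv c y)))"

definition smooth_fun_on :: "('z, 'n::finite) chart set \<Rightarrow> 'z set \<Rightarrow> ('z \<Rightarrow> real) \<Rightarrow> bool"
  where "smooth_fun_on A W f \<longleftrightarrow>
    (\<forall>c\<in>A. smooth_on (snd c ` (fst c \<inter> W)) (\<lambda>y. f (chart_inv c y)))"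

text \<open>Integration of a form \<open>\<eta>\<close> of top degree, given by its expressions \<open>\<eta> c y\<close> in the charts.
  The frame is \<open>e\<^sub>1, \<i> e\<^sub>1, e\<^sub>2, \<i> e\<^sub>2, \<dots>\<close> (the complex orientation); the order in which the
  index type is enumerated does not affect orientation.  As usual, the value does not depend on the
  partition of unity.\<close>

definition std_frame :: "nat \<Rightarrow> complex^'n::finite"
  where "std_frame k =
    (let e = axis (from_nat_into UNIV (k div 2)) 1 in if even k then e else J_vec e)"

definition partition_of_unity ::
  "('z::topological_space, 'n::finite) chart set \<Rightarrow> (('z, 'n) chart \<times> ('z \<Rightarrow> real)) set \<Rightarrow> bool"
  where "partition_of_unity A P \<longleftrightarrow>
    finite P \<and>
    (\<forall>(c, \<rho>)\<in>P. c \<in> A \<and> smooth_fun_on A UNIV \<rho> \<and> (\<forall>z. 0 \<le> \<rho> z) \<and>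
                 closure {z. \<rho> z \<noteq> 0} \<subseteq> fst c) \<and>
    (\<forall>z. (\<Sum>(c, \<rho>)\<in>P. \<rho> z) = 1)"

definition form_integral ::
  "('z::topological_space, 'n::finite) chart set \<Rightarrow>
   (('z, 'n) chart \<Rightarrow> complex^'n \<Rightarrow> (complex^'n) form) \<Rightarrow> complex"
  where "form_integral A \<eta> =
    (\<Sum>(c, \<rho>)\<in>(SOME P. partition_of_unity A P).
       LINT y:snd c ` fst c|lborel. complex_of_real (\<rho> (chart_inv c y)) * \<eta> c y std_frame)"


section \<open>Line bundles, metrics and sections\<close>

text \<open>A holomorphic line bundle is given by a trivialising open cover \<open>V\<close> with local frames
  \<open>e\<^sub>j\<close> and the transition functions \<open>g\<close>.  A section \<open>u\<close> is represented by its coefficients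
  \<open>u (j, z)\<close> with respect to \<open>e\<^sub>j\<close>, which transform by \<open>u\<^sub>j = g\<^sub>j\<^sub>k u\<^sub>k\<close>; they are
  normalised to be zero outside \<open>V j\<close>, so that sections are determined as functions.\<close>

definition line_bundle ::
  "('z::topological_space, 'n::finite) chart set \<Rightarrow> ('j \<Rightarrow> 'z set) \<Rightarrow> ('j \<Rightarrow> 'j \<Rightarrow> 'z \<Rightarrow> complex) \<Rightarrow> bool"
  where "line_bundle A V g \<longleftrightarrow>
    (\<forall>j. open (V j)) \<and> (\<Union>j. V j) = UNIV \<and>
    (\<forall>j k. holo_fun_on A (V j \<inter> V k) (g j k)) \<and>
    (\<forall>j k. \<forall>z \<in> V j \<inter> V k. g j k z \<noteq> 0) \<and>
    (\<forall>j. \<forall>z \<in> V j. g j j z = 1) \<and>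
    (\<forall>j k l. \<forall>z \<in> V j \<inter> V k \<inter> V l. g j k z * g k l z = g j l z)"

definition hol_sections ::
  "('z, 'n::finite) chart set \<Rightarrow> ('j \<Rightarrow> 'z set) \<Rightarrow> ('j \<Rightarrow> 'j \<Rightarrow> 'z \<Rightarrow> complex) \<Rightarrow> ('j \<times> 'z \<Rightarrow> complex) set"
  where "hol_sections A V g = {u.
    (\<forall>j. holo_fun_on A (V j) (\<lambda>z. u (j, z))) \<and>
    (\<forall>j k. \<forall>z \<in> V j \<inter> V k. u (j, z) = g j k z * u (k, z)) \<and>
    (\<forall>j. \<forall>z. z \<notin> V j \<longrightarrow> u (j, z) = 0)}"

text \<open>A local frame near \<open>z\<close>.  The forms and pairings below do not depend on the choice of it,
  because \<open>log |g\<^sub>j\<^sub>k|\<^sup>2\<close> is pluriharmonic and \<open>|u\<^sub>j|\<^sup>2 exp (- \<phi>\<^sub>j)\<close> is invariant.\<close>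

definition frame_at :: "('j \<Rightarrow> 'z set) \<Rightarrow> 'z \<Rightarrow> 'j"
  where "frame_at V z = (SOME j. z \<in> V j)"

text \<open>Metrics are given by their local weights: \<open>exp (- \<phi>\<^sub>j)\<close> is the squared norm of \<open>e\<^sub>j\<close>.\<close>

definition smooth_metric ::
  "('z, 'n::finite) chart set \<Rightarrow> ('j \<Rightarrow> 'z set) \<Rightarrow> ('j \<Rightarrow> 'j \<Rightarrow> 'z \<Rightarrow> complex) \<Rightarrow>
   ('j \<Rightarrow> 'z \<Rightarrow> real) \<Rightarrow> bool"
  where "smooth_metric A V g \<phi> \<longleftrightarrow>
    (\<forall>j. smooth_fun_on A (V j) (\<phi> j)) \<and>
    (\<forall>j k. \<forall>z \<in> V j \<inter> V k. \<phi> j z - \<phi> k z = ln ((cmod (g j k z))\<^sup>2))"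

definition curvature_form ::
  "('j \<Rightarrow> 'z set) \<Rightarrow> ('j \<Rightarrow> 'z \<Rightarrow> real) \<Rightarrow> ('z, 'n::finite) chart \<Rightarrow> complex^'n \<Rightarrow>
   (complex^'n) form"
  where "curvature_form V \<phi> c y =
    i_ddbar J_vec (\<lambda>y'. \<phi> (frame_at V (chart_inv c y)) (chart_inv c y')) y"

definition positive_metric ::
  "('z, 'n::finite) chart set \<Rightarrow> ('j \<Rightarrow> 'z set) \<Rightarrow> ('j \<Rightarrow> 'z \<Rightarrow> real) \<Rightarrow> bool"
  where "positive_metric A V \<phi> \<longleftrightarrow>
    (\<forall>c\<in>A. \<forall>y \<in> snd c ` fst c. positive_form J_vec (curvature_form V \<phi> c y))"

definition positive_line_bundle ::
  "('z::topological_space, 'n::finite) chart set \<Rightarrow> ('j \<Rightarrow> 'z set) \<Rightarrow>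
   ('j \<Rightarrow> 'j \<Rightarrow> 'z \<Rightarrow> complex) \<Rightarrow> bool"
  where "positive_line_bundle A V g \<longleftrightarrow>
    line_bundle A V g \<and> (\<exists>\<phi>. smooth_metric A V g \<phi> \<and> positive_metric A V \<phi>)"

text \<open>The pullback of the line bundle to \<open>U \<times> Z\<close> has the trivialising cover \<open>U \<times> V j\<close> and the
  transition functions \<open>g j k\<close>, independent of \<open>t\<close>.  A metric on it has weights \<open>\<phi> j t z\<close>.\<close>

definition smooth_metric_pullback ::
  "('z, 'n::finite) chart set \<Rightarrow> ('j \<Rightarrow> 'z set) \<Rightarrow> ('j \<Rightarrow> 'j \<Rightarrow> 'z \<Rightarrow> complex) \<Rightarrow>
   complex set \<Rightarrow> ('j \<Rightarrow> complex \<Rightarrow> 'z \<Rightarrow> real) \<Rightarrow> bool"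
  where "smooth_metric_pullback A V g U \<phi> \<longleftrightarrow>
    (\<forall>j. \<forall>c\<in>A. smooth_on (U \<times> snd c ` (fst c \<inter> V j)) (\<lambda>(t, y). \<phi> j t (chart_inv c y))) \<and>
    (\<forall>j k. \<forall>t\<in>U. \<forall>z \<in> V j \<inter> V k. \<phi> j t z - \<phi> k t z = ln ((cmod (g j k z))\<^sup>2))"

definition curvature_form_pullback ::
  "('j \<Rightarrow> 'z set) \<Rightarrow> ('j \<Rightarrow> complex \<Rightarrow> 'z \<Rightarrow> real) \<Rightarrow> ('z, 'n::finite) chart \<Rightarrow>
   complex \<times> (complex^'n) \<Rightarrow> (complex \<times> (complex^'n)) form"
  where "curvature_form_pullback V \<phi> c p =
    i_ddbar J_prod (\<lambda>(t, y). \<phi> (frame_at V (chart_inv c (snd p))) t (chart_inv c y)) p"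


section \<open>The bundle of holomorphic sections and its Chern curvature\<close>

definition pointwise_inner ::
  "('j \<Rightarrow> 'z set) \<Rightarrow> ('j \<Rightarrow> 'z \<Rightarrow> real) \<Rightarrow> ('j \<times> 'z \<Rightarrow> complex) \<Rightarrow> ('j \<times> 'z \<Rightarrow> complex) \<Rightarrow> 'z \<Rightarrow> complex"
  where "pointwise_inner V \<phi> u v z =
    (let j = frame_at V z in u (j, z) * cnj (v (j, z)) * complex_of_real (exp (- \<phi> j z)))"

text \<open>The polarisation of \<open>\<parallel>u\<parallel>\<^sub>t\<^sup>2\<close>, the integral of \<open>|u|\<^sup>2 exp (- \<phi>) \<omega>\<^sub>n\<close> over \<open>{t} \<times> Z\<close>.\<close>

definition L2_inner ::
  "('z::topological_space, 'n::finite) chart set \<Rightarrow> ('j \<Rightarrow> 'z set) \<Rightarrow>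
   ('j \<Rightarrow> complex \<Rightarrow> 'z \<Rightarrow> real) \<Rightarrow> complex \<Rightarrow>
   ('j \<times> 'z \<Rightarrow> complex) \<Rightarrow> ('j \<times> 'z \<Rightarrow> complex) \<Rightarrow> complex"
  where "L2_inner A V \<phi> t u v =
    form_integral A (\<lambda>c y w. pointwise_inner V (\<lambda>j. \<phi> j t) u v (chart_inv c y)
      * divided_power (curvature_form V (\<lambda>j. \<phi> j t) c y) CARD('n) w)"

text \<open>The Chern connection of the trivial bundle with fibre \<open>H\<close>, a finite-dimensional space of
  functions, and Hermitian metric \<open>h\<close>: for constant, hence holomorphic, sections \<open>u\<close>, \<open>v\<close>, metric
  compatibility reads \<open>\<partial>\<^sub>t h(u, v) = h(D\<^sub>t u, v)\<close>, and the curvature coefficient of \<open>dt \<and> dt\<close>-bar is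
  the commutator of \<open>D\<^sub>t\<close> with \<open>\<partial>\<close>-bar in the direction \<open>t\<close>-bar, that is, minus the
  \<open>t\<close>-bar derivative of \<open>D\<^sub>t u\<close>.\<close>

definition chern_connection ::
  "('x \<Rightarrow> complex) set \<Rightarrow> (complex \<Rightarrow> ('x \<Rightarrow> complex) \<Rightarrow> ('x \<Rightarrow> complex) \<Rightarrow> complex) \<Rightarrow>
   complex \<Rightarrow> ('x \<Rightarrow> complex) \<Rightarrow> ('x \<Rightarrow> complex)"
  where "chern_connection H h t u =
    (THE w. w \<in> H \<and> (\<forall>v\<in>H. h t w v = wirtinger (\<lambda>s. h s u v) t))"

definition chern_curvature ::
  "('x \<Rightarrow> complex) set \<Rightarrow> (complex \<Rightarrow> ('x \<Rightarrow> complex) \<Rightarrow> ('x \<Rightarrow> complex) \<Rightarrow> complex) \<Rightarrow>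
   complex \<Rightarrow> ('x \<Rightarrow> complex) \<Rightarrow> ('x \<Rightarrow> complex)"
  where "chern_curvature H h t u =
    (\<lambda>x. - wirtinger_bar (\<lambda>s. chern_connection H h s u x) t)"

end

theory Submission
  imports Defs "HOL-Complex_Analysis.Complex_Analysis"
begin

text \<open>Let \<open>V\<close> be the horizontal lift of \<open>\<partial>/\<partial>t\<close>, that is, the lift which is orthogonal to the fibres with
  respect to \<open>\<omega>\<^sup>\<phi>\<close>.  The Lie derivative of the fibre volume along \<open>V\<close> vanishes, so for holomorphic sections
  \<open>\<partial>\<^sub>t \<langle>u, v\<rangle>\<close> is the integral of \<open>(\<nabla>\<^sub>V u) v\<close>-bar with the weight \<open>exp (- \<phi>) \<omega>\<^sub>n\<close>; hence \<open>D\<^sub>t u\<close> is the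
  orthogonal projection of \<open>\<nabla>\<^sub>V u\<close> to the holomorphic sections.  If \<open>\<omega>\<^sup>\<phi>\<close> is semipositive with vanishing top power, then
  \<open>V\<close> spans its kernel.  Since \<open>\<omega>\<^sup>\<phi>\<close> is closed, \<open>V\<close> is holomorphic along its own leaves, and so is
  \<open>\<nabla>\<^sub>V u\<close>.  Differentiating once more gives \<open>\<partial>\<close>-bar\<open>\<^sub>t \<partial>\<^sub>t \<langle>u, u\<rangle> = \<parallel>\<nabla>\<^sub>V u\<parallel>\<^sup>2\<close> and therefore
  \<open>\<langle>\<Theta> u, u\<rangle> = \<parallel>D\<^sub>t u\<parallel>\<^sup>2 - \<parallel>\<nabla>\<^sub>V u\<parallel>\<^sup>2 = - \<parallel>\<nabla>\<^sub>V u - D\<^sub>t u\<parallel>\<^sup>2 \<le> 0\<close>.\<close>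

section \<open>Smooth maps\<close>

text \<open>The curvature is the pointwise derivative of \<open>chern_connection\<close>, which in
  turn is given by a \<open>THE\<close>; so existence, uniqueness and smoothness in t of D_t u have
  to be proved. They need a finite-dimensional space of sections, which comes from compactness and
  the Schwarz lemma. Sections dual to evaluations at finitely many points form a basis that does not
  move with t, and in it D_t u solves a positive definite system with smooth coefficients. V spans
  the kernel because it is orthogonal to the fibres, where the form is positive: a positive value on
  V would make the whole form positive definite and its top power nonzero. V is of type (1,0) while
  all derivatives are real, so V is split into lifts of the two real coordinate fields of
  \<open>U\<close>. The last equality of the overview is obtained by integrating
  \<open>|\<nabla>_V u - D_t u|^2\<close>: D_t u is itself a holomorphic section, so it may be
  tested against the projection property, and each cross term equals the squared norm of D_t u.
  Powers of forms are handled as permutation sums of Pfaffian type; this one expression yields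
  positivity of volumes, the Jacobian factor and the trace formula.\<close>

abbreviation fderiv where "fderiv f x \<equiv> frechet_derivative f (at x)"

lemma fderiv_eqI: "(f has_derivative f') (at x) \<Longrightarrow> fderiv f x = f'"
  by (metis frechet_derivative_at)

lemma fderiv_cong:
  assumes "open S" "x \<in> S" "\<And>y. y \<in> S \<Longrightarrow> f y = g y"
  shows "fderiv f x = fderiv g x"
proof -
  have "(f has_derivative h) (at x) \<longleftrightarrow> (g has_derivative h) (at x)" for h
    using has_derivative_transform_within_open[of f h x UNIV S g]
      has_derivative_transform_within_open[of g h x UNIV S f] assms by auto
  then show ?thesis by (simp add: frechet_derivative_def)
qed

text \<open>\<open>Ck_on\<close> combines differentiability within \<open>S\<close> with derivatives
  taken at the point. The two agree on open sets, and there the values of a function on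
  \<open>S\<close> determine its derivatives; hence the recurring assumption
  \<open>open S\<close>.\<close>

lemma Ck_on_cong:
  assumes "open S" "\<And>x. x \<in> S \<Longrightarrow> f x = g x"
  shows "Ck_on k S f \<longleftrightarrow> Ck_on k S g"
  using assms(2)
proof (induction k arbitrary: f g)
  case 0
  then show ?case by (simp cong: continuous_on_cong)
next
  case (Suc k)
  have "f differentiable_on S \<longleftrightarrow> g differentiable_on S"
    using Suc.prems unfolding differentiable_on_def
    by (metis differentiable_transform_within zero_less_one)
  moreover have "Ck_on k S (\<lambda>x. fderiv f x v) \<longleftrightarrow> Ck_on k S (\<lambda>x. fderiv g x v)" for v
    by (rule Suc.IH) (metis Suc.prems assms(1) fderiv_cong)
  ultimately show ?case by simp
qed

lemma Ck_on_SucD: "Ck_on (Suc k) S f \<Longrightarrow> Ck_on k S f"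
proof (induction k arbitrary: f)
  case 0
  then show ?case by (simp add: differentiable_imp_continuous_on)
next
  case (Suc k)
  then show ?case by (metis Ck_on.simps(2))
qed

lemma Ck_on_subset: "Ck_on k S f \<Longrightarrow> T \<subseteq> S \<Longrightarrow> Ck_on k T f"
  by (induction k arbitrary: f)
    (auto intro: continuous_on_subset differentiable_on_subset)

text \<open>Any explicit derivative on an open set may stand in for
  \<open>frechet_derivative\<close>; the closure properties below mostly become inductions on
  \<open>k\<close> over the formula for the derivative.\<close>

lemma Ck_on_SucI:
  assumes "open S" "\<And>x. x \<in> S \<Longrightarrow> (f has_derivative f' x) (at x)"
    and "\<And>v. Ck_on k S (\<lambda>x. f' x v)"
  shows "Ck_on (Suc k) S f"
proof -
  have "Ck_on k S (\<lambda>x. fderiv f x v)" for v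
    using Ck_on_cong[OF assms(1), of "\<lambda>x. fderiv f x v" "\<lambda>x. f' x v" k] assms(2,3)
      fderiv_eqI by metis
  moreover have "f differentiable_on S"
    using assms(2) by (meson differentiableI differentiable_at_imp_differentiable_on)
  ultimately show ?thesis by simp
qed

lemma Ck_on_local:
  assumes "\<And>x. x \<in> S \<Longrightarrow> \<exists>N. open N \<and> x \<in> N \<and> Ck_on k N f"
  shows "Ck_on k S f"
  using assms
proof (induction k arbitrary: f)
  case 0
  show ?case unfolding Ck_on.simps
  proof (rule continuous_at_imp_continuous_on, rule ballI)
    fix x assume "x \<in> S"
    then obtain N where "open N" "x \<in> N" "continuous_on N f" using 0 by auto
    then show "isCont f x" by (simp add: continuous_on_eq_continuous_at)
  qed
next
  case (Suc k)
  have "f differentiable_on S"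
    unfolding differentiable_on_def
  proof
    fix x assume "x \<in> S"
    then obtain N where N: "open N" "x \<in> N" "f differentiable_on N" using Suc.prems by auto
    then have "f differentiable (at x)" by (metis differentiable_on_eq_differentiable_at)
    then show "f differentiable (at x within S)" by (metis differentiable_at_withinI)
  qed
  moreover have "Ck_on k S (\<lambda>x. fderiv f x v)" for v
    by (rule Suc.IH) (use Suc.prems in fastforce)
  ultimately show ?case by simp
qed

lemma Ck_on_has_derivative:
  assumes "open S" "Ck_on (Suc k) S f" "x \<in> S"
  shows "(f has_derivative fderiv f x) (at x)"
proof -
  have "f differentiable (at x)" using assms by (simp add: differentiable_on_eq_differentiable_at)
  then show ?thesis by (simp add: frechet_derivative_works)
qed

lemma Ck_on_const: "open S \<Longrightarrow> Ck_on k S (\<lambda>x. c)"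
proof (induction k arbitrary: c)
  case (Suc k)
  show ?case by (rule Ck_on_SucI[where f' = "\<lambda>x v. 0"]) (use Suc in auto)
qed auto

lemma Ck_on_bounded_linear: "open S \<Longrightarrow> bounded_linear f \<Longrightarrow> Ck_on k S f"
proof (cases k)
  case (Suc j)
  assume "open S" "bounded_linear f"
  then show ?thesis unfolding Suc
    by (intro Ck_on_SucI[where f' = "\<lambda>x. f"]) (auto intro: bounded_linear_imp_has_derivative Ck_on_const)
qed (auto intro: linear_continuous_on)

lemma Ck_on_bounded_linear_comp:
  "open S \<Longrightarrow> bounded_linear h \<Longrightarrow> Ck_on k S f \<Longrightarrow> Ck_on k S (\<lambda>x. h (f x))"
proof (induction k arbitrary: f)
  case 0
  then show ?case by (auto intro: bounded_linear.continuous_on)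
next
  case (Suc k)
  show ?case
  proof (rule Ck_on_SucI[where f' = "\<lambda>x v. h (fderiv f x v)"])
    show "((\<lambda>x. h (f x)) has_derivative (\<lambda>v. h (fderiv f x v))) (at x)" if "x \<in> S" for x
      by (intro bounded_linear.has_derivative[OF Suc.prems(2)] Ck_on_has_derivative[OF Suc.prems(1,3) that])
  qed (use Suc in auto)
qed

lemma Ck_on_add: "open S \<Longrightarrow> Ck_on k S f \<Longrightarrow> Ck_on k S g \<Longrightarrow> Ck_on k S (\<lambda>x. f x + g x)"
proof (induction k arbitrary: f g)
  case 0
  then show ?case by (auto intro: continuous_on_add)
next
  case (Suc k)
  show ?case
  proof (rule Ck_on_SucI[where f' = "\<lambda>x v. fderiv f x v + fderiv g x v"])
    show "((\<lambda>x. f x + g x) has_derivative (\<lambda>v. fderiv f x v + fderiv g x v)) (at x)" if "x \<in> S" for x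
      by (rule has_derivative_add[OF Ck_on_has_derivative[OF Suc.prems(1,2) that] Ck_on_has_derivative[OF Suc.prems(1,3) that]])
  qed (use Suc in auto)
qed

lemma Ck_on_bilinear:
  assumes "bounded_bilinear h" "open S"
  shows "Ck_on k S f \<Longrightarrow> Ck_on k S g \<Longrightarrow> Ck_on k S (\<lambda>x. h (f x) (g x))"
proof (induction k arbitrary: f g)
  case 0
  then show ?case using assms by (auto intro: bounded_bilinear.continuous_on)
next
  case (Suc k)
  show ?case
  proof (rule Ck_on_SucI[where f' = "\<lambda>x v. h (f x) (fderiv g x v) + h (fderiv f x v) (g x)"])
    show "((\<lambda>x. h (f x) (g x)) has_derivative
        (\<lambda>v. h (f x) (fderiv g x v) + h (fderiv f x v) (g x))) (at x)" if "x \<in> S" for x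
      by (rule bounded_bilinear.FDERIV[OF assms(1) Ck_on_has_derivative[OF assms(2) Suc.prems(1) that] Ck_on_has_derivative[OF assms(2) Suc.prems(2) that]])
    show "Ck_on k S (\<lambda>x. h (f x) (fderiv g x v) + h (fderiv f x v) (g x))" for v
      using Suc.prems by (intro Ck_on_add assms Suc.IH Ck_on_SucD[OF Suc.prems(1)] Ck_on_SucD[OF Suc.prems(2)]) auto
  qed (use assms in auto)
qed

lemma Ck_on_sum:
  assumes "open S" "\<And>i. i \<in> I \<Longrightarrow> Ck_on k S (f i)"
  shows "Ck_on k S (\<lambda>x. \<Sum>i\<in>I. f i x)"
  using assms(2)
  by (induction I rule: infinite_finite_induct) (auto intro: Ck_on_const Ck_on_add assms(1))

lemma fderiv_eval_basis:
  fixes f :: "'a::euclidean_space \<Rightarrow> 'b::real_normed_vector"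
  assumes "f differentiable (at x)"
  shows "fderiv f x u = (\<Sum>b\<in>Basis. (u \<bullet> b) *\<^sub>R fderiv f x b)"
proof -
  note lin = linear_frechet_derivative[OF assms]
  have "fderiv f x (\<Sum>b\<in>Basis. (u \<bullet> b) *\<^sub>R b) = (\<Sum>b\<in>Basis. (u \<bullet> b) *\<^sub>R fderiv f x b)"
    by (simp only: linear_sum[OF lin] linear_scale[OF lin])
  then show ?thesis by (simp only: euclidean_representation)
qed

text \<open>The chain rule evaluates the derivative of \<open>g\<close> in a direction that depends
  on the point. Expanded in the basis of the middle space, it is a finite sum of products with fixed
  directions, to which the induction hypothesis applies.\<close>

lemma Ck_on_compose:
  fixes f :: "'a::real_normed_vector \<Rightarrow> 'b::euclidean_space" and g :: "'b \<Rightarrow> 'c::real_normed_vector"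
  assumes "open S" "open T" "f ` S \<subseteq> T"
  shows "Ck_on k S f \<Longrightarrow> Ck_on k T g \<Longrightarrow> Ck_on k S (\<lambda>x. g (f x))"
proof (induction k arbitrary: g)
  case 0
  then show ?case using assms by (auto intro: continuous_on_compose2)
next
  case (Suc k)
  show ?case
  proof (rule Ck_on_SucI[where f' = "\<lambda>x v. \<Sum>b\<in>Basis. (fderiv f x v \<bullet> b) *\<^sub>R fderiv g (f x) b"])
    fix x assume x: "x \<in> S"
    have g: "g differentiable (at (f x))"
      using Suc.prems x assms by (auto simp: differentiable_on_eq_differentiable_at)
    have "((\<lambda>x. g (f x)) has_derivative (\<lambda>v. fderiv g (f x) (fderiv f x v))) (at x)"
      by (rule has_derivative_compose[OF Ck_on_has_derivative[OF assms(1) Suc.prems(1) x]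
            Ck_on_has_derivative[OF assms(2) Suc.prems(2)]]) (use x assms in auto)
    then show "((\<lambda>x. g (f x)) has_derivative
        (\<lambda>v. \<Sum>b\<in>Basis. (fderiv f x v \<bullet> b) *\<^sub>R fderiv g (f x) b)) (at x)"
      by (simp only: fderiv_eval_basis[OF g, symmetric])
  next
    fix v
    have "Ck_on k S (\<lambda>x. fderiv f x v \<bullet> b)" for b
      by (rule Ck_on_bounded_linear_comp[OF assms(1) bounded_linear_inner_left]) (use Suc in auto)
    moreover have "Ck_on k S (\<lambda>x. fderiv g (f x) b)" for b
      using Suc.prems by (intro Suc.IH Ck_on_SucD[OF Suc.prems(1)]) auto
    ultimately show "Ck_on k S (\<lambda>x. \<Sum>b\<in>Basis. (fderiv f x v \<bullet> b) *\<^sub>R fderiv g (f x) b)"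
      by (intro Ck_on_sum Ck_on_bilinear[OF bounded_bilinear_scaleR] assms)
  qed (use assms in auto)
qed

lemma Ck_on_inverse:
  "open S \<Longrightarrow> Ck_on k S f \<Longrightarrow> (\<And>x. x \<in> S \<Longrightarrow> f x \<noteq> 0) \<Longrightarrow> Ck_on k S (\<lambda>x. inverse (f x :: 'a::real_normed_field))"
proof (induction k)
  case 0
  then show ?case by (auto intro: continuous_on_inverse)
next
  case (Suc k)
  have *: "Ck_on k S (\<lambda>x. inverse (f x))" using Suc.IH[OF Suc.prems(1) Ck_on_SucD[OF Suc.prems(2)] Suc.prems(3)] by simp
  show ?case
  proof (rule Ck_on_SucI[where f' = "\<lambda>x v. (-1) *\<^sub>R ((inverse (f x) * inverse (f x)) * fderiv f x v)"])
    show "((\<lambda>x. inverse (f x)) has_derivative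
        (\<lambda>v. (-1) *\<^sub>R ((inverse (f x) * inverse (f x)) * fderiv f x v))) (at x)" if "x \<in> S" for x
      using Deriv.has_derivative_inverse[OF Suc.prems(3)[OF that] Ck_on_has_derivative[OF Suc.prems(1,2) that]]
      by (simp add: mult_ac)
    show "Ck_on k S (\<lambda>x. (-1) *\<^sub>R ((inverse (f x) * inverse (f x)) * fderiv f x v))" for v
      using Suc.prems *
      by (intro Ck_on_bounded_linear_comp[OF _ bounded_linear_scaleR_right]
          Ck_on_bilinear[OF bounded_bilinear_mult]) auto
  qed (use Suc in auto)
qed

lemma Ck_on_exp:
  "open S \<Longrightarrow> Ck_on k S f \<Longrightarrow> Ck_on k S (\<lambda>x. exp (f x :: real))"
proof (induction k)
  case 0
  then show ?case by (auto intro: continuous_on_exp)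
next
  case (Suc k)
  have *: "Ck_on k S (\<lambda>x. exp (f x))" by (rule Suc.IH[OF Suc.prems(1) Ck_on_SucD[OF Suc.prems(2)]])
  show ?case
  proof (rule Ck_on_SucI[where f' = "\<lambda>x v. fderiv f x v * exp (f x)"])
    show "((\<lambda>x. exp (f x)) has_derivative (\<lambda>v. fderiv f x v * exp (f x))) (at x)" if "x \<in> S" for x
      by (rule has_derivative_exp[OF Ck_on_has_derivative[OF Suc.prems that]])
    show "Ck_on k S (\<lambda>x. fderiv f x v * exp (f x))" for v
      using Suc.prems * by (intro Ck_on_bilinear[OF bounded_bilinear_mult]) auto
  qed (use Suc in auto)
qed

lemma smooth_on_cong:
  "open S \<Longrightarrow> (\<And>x. x \<in> S \<Longrightarrow> f x = g x) \<Longrightarrow> smooth_on S f \<longleftrightarrow> smooth_on S g"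
  unfolding smooth_on_def using Ck_on_cong by blast

lemma smooth_on_subset: "smooth_on S f \<Longrightarrow> T \<subseteq> S \<Longrightarrow> smooth_on T f"
  unfolding smooth_on_def using Ck_on_subset by blast

lemma smooth_on_local:
  assumes "\<And>x. x \<in> S \<Longrightarrow> \<exists>N. open N \<and> x \<in> N \<and> smooth_on N f"
  shows "smooth_on S f"
  unfolding smooth_on_def using assms by (metis Ck_on_local smooth_on_def)

lemma smooth_on_imp_continuous_on: "smooth_on S f \<Longrightarrow> continuous_on S f"
  unfolding smooth_on_def by (metis Ck_on.simps(1))

lemma smooth_on_fderiv: "smooth_on S f \<Longrightarrow> smooth_on S (\<lambda>x. fderiv f x v)"
  unfolding smooth_on_def by (metis Ck_on.simps(2))

lemma smooth_on_differentiable: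
  "open S \<Longrightarrow> smooth_on S f \<Longrightarrow> x \<in> S \<Longrightarrow> f differentiable (at x)"
  unfolding smooth_on_def by (metis Ck_on.simps(2) differentiable_on_eq_differentiable_at)

lemma smooth_on_has_derivative:
  "open S \<Longrightarrow> smooth_on S f \<Longrightarrow> x \<in> S \<Longrightarrow> (f has_derivative fderiv f x) (at x)"
  using smooth_on_differentiable by (metis frechet_derivative_works)

lemma smooth_on_linear:
  "open S \<Longrightarrow> smooth_on S f \<Longrightarrow> x \<in> S \<Longrightarrow> linear (fderiv f x)"
  using smooth_on_differentiable by (metis linear_frechet_derivative)

text \<open>A class of differentiable functions closed under directional derivatives can be
  differentiated indefinitely without leaving it. The classes used are the holomorphic functions,
  the functions \<open>p (1/x) * exp (- 1/x)\<close> behind the bump function, and the fibre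
  integrals.\<close>

lemma smooth_on_coinduct:
  assumes "P f"
    and step: "\<And>f. P f \<Longrightarrow> f differentiable_on S \<and> (\<forall>v. P (\<lambda>x. fderiv f x v))"
  shows "smooth_on S f"
proof -
  have "P f \<Longrightarrow> Ck_on k S f" for k f
  proof (induction k arbitrary: f)
    case 0
    then show ?case using step by (simp add: differentiable_imp_continuous_on)
  qed (use step in auto)
  then show ?thesis using assms(1) by (simp add: smooth_on_def)
qed

lemma smooth_on_const: "open S \<Longrightarrow> smooth_on S (\<lambda>x. c)"
  by (simp add: smooth_on_def Ck_on_const)

lemma smooth_on_bounded_linear: "open S \<Longrightarrow> bounded_linear f \<Longrightarrow> smooth_on S f"
  by (simp add: smooth_on_def Ck_on_bounded_linear)

lemma smooth_on_bounded_linear_comp: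
  "bounded_linear h \<Longrightarrow> open S \<Longrightarrow> smooth_on S f \<Longrightarrow> smooth_on S (\<lambda>x. h (f x))"
  by (simp add: smooth_on_def Ck_on_bounded_linear_comp)

lemma smooth_on_bilinear:
  "bounded_bilinear h \<Longrightarrow> open S \<Longrightarrow> smooth_on S f \<Longrightarrow> smooth_on S g
    \<Longrightarrow> smooth_on S (\<lambda>x. h (f x) (g x))"
  by (simp add: smooth_on_def Ck_on_bilinear)

lemma smooth_on_add:
  "open S \<Longrightarrow> smooth_on S f \<Longrightarrow> smooth_on S g \<Longrightarrow> smooth_on S (\<lambda>x. f x + g x)"
  by (simp add: smooth_on_def Ck_on_add)

lemma smooth_on_uminus: "open S \<Longrightarrow> smooth_on S f \<Longrightarrow> smooth_on S (\<lambda>x. - f x)"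
  by (rule smooth_on_bounded_linear_comp[OF bounded_linear_minus[OF bounded_linear_ident]])

lemma smooth_on_diff:
  "open S \<Longrightarrow> smooth_on S f \<Longrightarrow> smooth_on S g \<Longrightarrow> smooth_on S (\<lambda>x. f x - g x)"
  using smooth_on_add[of S f "\<lambda>x. - g x"] smooth_on_uminus[of S g] by simp

lemma smooth_on_sum:
  "open S \<Longrightarrow> (\<And>i. i \<in> I \<Longrightarrow> smooth_on S (f i)) \<Longrightarrow> smooth_on S (\<lambda>x. \<Sum>i\<in>I. f i x)"
  by (simp add: smooth_on_def Ck_on_sum)

lemmas smooth_on_mult = smooth_on_bilinear[OF bounded_bilinear_mult]
lemmas smooth_on_scaleR = smooth_on_bilinear[OF bounded_bilinear_scaleR]
lemmas smooth_on_inner = smooth_on_bilinear[OF bounded_bilinear_inner]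

lemma smooth_on_prod:
  fixes f :: "'i \<Rightarrow> 'a::real_normed_vector \<Rightarrow> 'b::{real_normed_algebra_1,comm_ring_1}"
  shows "open S \<Longrightarrow> (\<And>i. i \<in> I \<Longrightarrow> smooth_on S (f i)) \<Longrightarrow> smooth_on S (\<lambda>x. \<Prod>i\<in>I. f i x)"
  by (induction I rule: infinite_finite_induct) (auto intro: smooth_on_const smooth_on_mult)

lemma smooth_on_inverse:
  "open S \<Longrightarrow> smooth_on S f \<Longrightarrow> (\<And>x. x \<in> S \<Longrightarrow> f x \<noteq> 0)
    \<Longrightarrow> smooth_on S (\<lambda>x. inverse (f x :: 'a::real_normed_field))"
  by (simp add: smooth_on_def Ck_on_inverse)

lemma smooth_on_divide:
  "open S \<Longrightarrow> smooth_on S f \<Longrightarrow> smooth_on S g \<Longrightarrow> (\<And>x. x \<in> S \<Longrightarrow> g x \<noteq> 0)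
    \<Longrightarrow> smooth_on S (\<lambda>x. f x / (g x :: 'a::real_normed_field))"
  unfolding divide_inverse by (intro smooth_on_mult smooth_on_inverse) auto

lemma smooth_on_exp: "open S \<Longrightarrow> smooth_on S f \<Longrightarrow> smooth_on S (\<lambda>x. exp (f x :: real))"
  by (simp add: smooth_on_def Ck_on_exp)

lemma smooth_on_compose:
  fixes f :: "'a::real_normed_vector \<Rightarrow> 'b::euclidean_space"
  shows "open S \<Longrightarrow> open T \<Longrightarrow> smooth_on S f \<Longrightarrow> smooth_on T g \<Longrightarrow> f ` S \<subseteq> T
    \<Longrightarrow> smooth_on S (\<lambda>x. g (f x))"
  by (simp add: smooth_on_def Ck_on_compose)

lemma smooth_on_euclidean:
  fixes f :: "'a::real_normed_vector \<Rightarrow> 'b::euclidean_space"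
  assumes "open S" "\<And>b. b \<in> Basis \<Longrightarrow> smooth_on S (\<lambda>x. f x \<bullet> b)"
  shows "smooth_on S f"
proof -
  have "smooth_on S (\<lambda>x. \<Sum>b\<in>Basis. (f x \<bullet> b) *\<^sub>R b)"
    by (intro smooth_on_sum smooth_on_scaleR smooth_on_const assms)
  then show ?thesis by (simp add: euclidean_representation)
qed

lemma smooth_on_of_real: "open S \<Longrightarrow> smooth_on S f
    \<Longrightarrow> smooth_on S (\<lambda>x. of_real (f x) :: 'b::{real_normed_algebra_1})"
  by (rule smooth_on_bounded_linear_comp[OF bounded_linear_of_real])

lemma smooth_on_cnj: "open S \<Longrightarrow> smooth_on S f \<Longrightarrow> smooth_on S (\<lambda>x. cnj (f x))"
  by (rule smooth_on_bounded_linear_comp[OF bounded_linear_cnj])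

lemma smooth_on_Re: "open S \<Longrightarrow> smooth_on S f \<Longrightarrow> smooth_on S (\<lambda>x. Re (f x))"
  by (rule smooth_on_bounded_linear_comp[OF bounded_linear_Re])

lemma smooth_on_Pair:
  fixes f :: "'a::real_normed_vector \<Rightarrow> 'b::euclidean_space"
    and g :: "'a \<Rightarrow> 'c::euclidean_space"
  assumes "open S" "smooth_on S f" "smooth_on S g"
  shows "smooth_on S (\<lambda>x. (f x, g x))"
proof -
  have "bounded_linear (\<lambda>x::'b. (x, 0::'c))" "bounded_linear (\<lambda>y::'c. (0::'b, y))"
    by (auto intro: bounded_linear_Pair bounded_linear_ident bounded_linear_zero)
  then have "smooth_on S (\<lambda>x. (f x, 0::'c))" "smooth_on S (\<lambda>x. (0::'b, g x))"
    using smooth_on_bounded_linear_comp[of "\<lambda>x::'b. (x, 0::'c)" S f]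
      smooth_on_bounded_linear_comp[of "\<lambda>y::'c. (0::'b, y)" S g] assms by auto
  from smooth_on_add[OF assms(1) this] show ?thesis by simp
qed

text \<open>Both the base point and the direction of the derivative move with \<open>q\<close>; this
  occurs in second derivatives of composites and when a derivative along the horizontal lift is
  differentiated again.\<close>

lemma smooth_on_has_derivative_moving:
  fixes f :: "'a::euclidean_space \<Rightarrow> 'b::real_normed_vector"
  assumes f: "open S" "smooth_on S f" "\<gamma> q \<in> S"
    and \<gamma>: "(\<gamma> has_derivative \<gamma>') (at q)" and u: "(u has_derivative u') (at q)"
  shows "((\<lambda>q. fderiv f (\<gamma> q) (u q)) has_derivative
     (\<lambda>v. fderiv (\<lambda>x. fderiv f x (u q)) (\<gamma> q) (\<gamma>' v) + fderiv f (\<gamma> q) (u' v))) (at q)"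
proof -
  define F where "F b x = fderiv f x b" for b x
  have F: "(F b has_derivative fderiv (F b) x) (at x)" if "x \<in> S" for b x
    unfolding F_def by (rule smooth_on_has_derivative[OF f(1) smooth_on_fderiv[OF f(2)] that])
  have dec: "F c x = (\<Sum>b\<in>Basis. (c \<bullet> b) *\<^sub>R F b x)" if "x \<in> S" for c x
    unfolding F_def by (rule fderiv_eval_basis[OF smooth_on_differentiable[OF f(1,2) that]])
  have Fu: "fderiv (F c) x w = (\<Sum>b\<in>Basis. (c \<bullet> b) *\<^sub>R fderiv (F b) x w)" if "x \<in> S" for c x w
  proof -
    have "fderiv (F c) x = fderiv (\<lambda>x. \<Sum>b\<in>Basis. (c \<bullet> b) *\<^sub>R F b x) x"
      by (rule fderiv_cong[OF f(1) that dec])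
    also have "\<dots> = (\<lambda>w. \<Sum>b\<in>Basis. (c \<bullet> b) *\<^sub>R fderiv (F b) x w)"
      by (intro fderiv_eqI has_derivative_sum has_derivative_scaleR_right F that)
    finally show ?thesis by simp
  qed
  have "((\<lambda>q. \<Sum>b\<in>Basis. (u q \<bullet> b) *\<^sub>R F b (\<gamma> q)) has_derivative
     (\<lambda>v. \<Sum>b\<in>Basis. (u q \<bullet> b) *\<^sub>R fderiv (F b) (\<gamma> q) (\<gamma>' v) + (u' v \<bullet> b) *\<^sub>R F b (\<gamma> q))) (at q)"
    by (intro has_derivative_sum has_derivative_scaleR has_derivative_inner_left u
        has_derivative_compose[OF \<gamma>, of "F b" for b] F f(3))
  also have "(\<lambda>v. \<Sum>b\<in>Basis. (u q \<bullet> b) *\<^sub>R fderiv (F b) (\<gamma> q) (\<gamma>' v) + (u' v \<bullet> b) *\<^sub>R F b (\<gamma> q))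
    = (\<lambda>v. fderiv (F (u q)) (\<gamma> q) (\<gamma>' v) + F (u' v) (\<gamma> q))"
    by (simp add: sum.distrib Fu[OF f(3), of "u q"] dec[OF f(3), of "u' _"])
  finally have D: "((\<lambda>q. \<Sum>b\<in>Basis. (u q \<bullet> b) *\<^sub>R F b (\<gamma> q)) has_derivative
     (\<lambda>v. fderiv (F (u q)) (\<gamma> q) (\<gamma>' v) + F (u' v) (\<gamma> q))) (at q)" .
  have "isCont \<gamma> q" using \<gamma> by (rule has_derivative_continuous)
  then obtain N where N: "open N" "q \<in> N" "\<gamma> ` N \<subseteq> S"
    by (metis continuous_at_open f(1) f(3) image_subsetI)
  show ?thesis
    by (rule has_derivative_transform_within_open[OF D[unfolded F_def] N(1,2)])
      (use dec N in \<open>auto simp: F_def\<close>)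
qed

section \<open>Symmetry of second derivatives\<close>

definition fderiv2 where "fderiv2 f x a b = fderiv (\<lambda>y. fderiv f y b) x a"

text \<open>The second difference of \<open>f\<close> over the parallelogram spanned by
  \<open>h *\<^sub>R a\<close> and \<open>h *\<^sub>R b\<close> is symmetric in \<open>a\<close> and
  \<open>b\<close>. Two applications of the mean value theorem, in either order, express it by the
  two mixed derivatives at points close to \<open>x\<close>; continuity of the second derivatives
  does the rest.\<close>

lemma fderiv2_symmetric_real:
  fixes f :: "'a::real_normed_vector \<Rightarrow> real"
  assumes S: "open S" and f: "smooth_on S f" and x: "x \<in> S"
  shows "fderiv2 f x a b = fderiv2 f x b a"
proof -
  have mv: "\<exists>p. norm (p - x) \<le> h * (norm a + norm b) \<and>
      f (x + h *\<^sub>R a + h *\<^sub>R b) - f (x + h *\<^sub>R a) - f (x + h *\<^sub>R b) + f x = h * (h * fderiv2 f p b a)"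
    if h: "0 < h" and ball: "\<And>p. norm (p - x) \<le> h * (norm a + norm b) \<Longrightarrow> p \<in> S" for h a b
  proof -
    have nrm: "norm (x + s *\<^sub>R a + t *\<^sub>R b - x) \<le> h * (norm a + norm b)"
      if "0 \<le> s" "s \<le> h" "0 \<le> t" "t \<le> h" for s t
    proof -
      have "norm (s *\<^sub>R a + t *\<^sub>R b) \<le> s * norm a + t * norm b"
        using that by (metis abs_of_nonneg norm_scaleR norm_triangle_ineq)
      also have "\<dots> \<le> h * norm a + h * norm b" using that by (intro add_mono mult_right_mono) auto
      finally show ?thesis by (simp add: algebra_simps)
    qed
    have inS: "x + s *\<^sub>R a + t *\<^sub>R b \<in> S" if "0 \<le> s" "s \<le> h" "0 \<le> t" "t \<le> h" for s t
      using ball nrm that by blast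
    have d1: "((\<lambda>s. f (x + s *\<^sub>R a + t *\<^sub>R b)) has_derivative
        (\<lambda>d. d * fderiv f (x + s *\<^sub>R a + t *\<^sub>R b) a)) (at s)"
      if st: "0 \<le> s" "s \<le> h" "0 \<le> t" "t \<le> h" for s t
    proof -
      have "((\<lambda>s. x + s *\<^sub>R a + t *\<^sub>R b) has_derivative (\<lambda>d. d *\<^sub>R a)) (at s)"
        by (auto intro!: derivative_eq_intros)
      from has_derivative_compose[OF this smooth_on_has_derivative[OF S f inS[OF st]]]
      show ?thesis using linear_scale[OF smooth_on_linear[OF S f inS[OF st]]] by simp
    qed
    have d2: "((\<lambda>t. fderiv f (x + s *\<^sub>R a + t *\<^sub>R b) a) has_derivative
        (\<lambda>d. d * fderiv2 f (x + s *\<^sub>R a + t *\<^sub>R b) b a)) (at t)"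
      if st: "0 \<le> s" "s \<le> h" "0 \<le> t" "t \<le> h" for s t
    proof -
      have g: "smooth_on S (\<lambda>x. fderiv f x a)" by (rule smooth_on_fderiv[OF f])
      have "((\<lambda>t. x + s *\<^sub>R a + t *\<^sub>R b) has_derivative (\<lambda>d. d *\<^sub>R b)) (at t)"
        by (auto intro!: derivative_eq_intros)
      from has_derivative_compose[OF this smooth_on_has_derivative[OF S g inS[OF st]]]
      show ?thesis using linear_scale[OF smooth_on_linear[OF S g inS[OF st]]]
        by (simp add: fderiv2_def)
    qed
    define \<phi> where "\<phi> s = f (x + s *\<^sub>R a + h *\<^sub>R b) - f (x + s *\<^sub>R a)" for s
    have "\<exists>z>0. z < h \<and> \<phi> h - \<phi> 0 =
        (h - 0) * (fderiv f (x + z *\<^sub>R a + h *\<^sub>R b) a - fderiv f (x + z *\<^sub>R a) a)"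
    proof (rule MVT2[OF h])
      fix s assume s: "0 \<le> s" "s \<le> h"
      show "DERIV \<phi> s :> fderiv f (x + s *\<^sub>R a + h *\<^sub>R b) a - fderiv f (x + s *\<^sub>R a) a"
        unfolding \<phi>_def using has_derivative_diff[OF d1[OF s, of h] d1[OF s, of 0]] h
        by (intro has_derivative_imp_has_field_derivative) (auto simp: algebra_simps)
    qed
    then obtain z where z: "0 < z" "z < h"
      and ze: "\<phi> h - \<phi> 0 = h * (fderiv f (x + z *\<^sub>R a + h *\<^sub>R b) a - fderiv f (x + z *\<^sub>R a) a)"
      by auto
    have "\<exists>t>0. t < h \<and> fderiv f (x + z *\<^sub>R a + h *\<^sub>R b) a - fderiv f (x + z *\<^sub>R a + 0 *\<^sub>R b) a =
        (h - 0) * fderiv2 f (x + z *\<^sub>R a + t *\<^sub>R b) b a"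
    proof (rule MVT2[OF h])
      fix t assume "0 \<le> t" "t \<le> h"
      then show "DERIV (\<lambda>t. fderiv f (x + z *\<^sub>R a + t *\<^sub>R b) a) t
          :> fderiv2 f (x + z *\<^sub>R a + t *\<^sub>R b) b a"
        using d2[of z t] z by (intro has_derivative_imp_has_field_derivative) (auto simp: mult.commute)
    qed
    then obtain t where t: "0 < t" "t < h"
      and te: "fderiv f (x + z *\<^sub>R a + h *\<^sub>R b) a - fderiv f (x + z *\<^sub>R a) a
        = h * fderiv2 f (x + z *\<^sub>R a + t *\<^sub>R b) b a"
      by auto
    show ?thesis
      by (rule exI[of _ "x + z *\<^sub>R a + t *\<^sub>R b"])
        (use nrm[of z t] z t ze te in \<open>simp add: \<phi>_def algebra_simps\<close>)
  qed
  have cont: "isCont (\<lambda>y. fderiv2 f y a b) x" for a b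
    unfolding fderiv2_def
    using smooth_on_imp_continuous_on[OF smooth_on_fderiv[OF smooth_on_fderiv[OF f]]] S x
    by (metis continuous_on_eq_continuous_at)
  have "\<bar>fderiv2 f x a b - fderiv2 f x b a\<bar> \<le> e + e" if e: "e > 0" for e
  proof -
    obtain d1 where d1: "d1 > 0" "\<And>y. dist y x < d1 \<Longrightarrow> dist (fderiv2 f y a b) (fderiv2 f x a b) < e"
      using cont e unfolding continuous_at_eps_delta by blast
    obtain d2 where d2: "d2 > 0" "\<And>y. dist y x < d2 \<Longrightarrow> dist (fderiv2 f y b a) (fderiv2 f x b a) < e"
      using cont e unfolding continuous_at_eps_delta by blast
    obtain d3 where d3: "d3 > 0" "ball x d3 \<subseteq> S" using S x by (metis openE)
    define m where "m = min d1 (min d2 d3)"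
    define h where "h = m / (norm a + norm b + 1)"
    have m: "m > 0" using d1 d2 d3 by (simp add: m_def)
    have pos: "norm a + norm b + 1 > 0" by (smt (verit) norm_ge_zero)
    then have h: "h > 0" using m by (simp add: h_def)
    have hs: "h * (norm a + norm b) < m"
    proof -
      have "h * (norm a + norm b) < h * (norm a + norm b + 1)" using h by simp
      also have "\<dots> = m" using pos by (simp add: h_def)
      finally show ?thesis .
    qed
    have near: "dist p x < d1" "dist p x < d2" "p \<in> S" if "norm (p - x) \<le> h * (norm a + norm b)" for p
      using that hs d3 by (auto simp: dist_norm m_def norm_minus_commute subset_eq)
    obtain p where p: "norm (p - x) \<le> h * (norm a + norm b)"
       "f (x + h *\<^sub>R a + h *\<^sub>R b) - f (x + h *\<^sub>R a) - f (x + h *\<^sub>R b) + f x = h * (h * fderiv2 f p b a)"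
      using mv[OF h, of a b] near by blast
    obtain q where q: "norm (q - x) \<le> h * (norm a + norm b)"
       "f (x + h *\<^sub>R b + h *\<^sub>R a) - f (x + h *\<^sub>R b) - f (x + h *\<^sub>R a) + f x = h * (h * fderiv2 f q a b)"
      using mv[OF h, of b a] near by (auto simp: add.commute)
    have "h * (h * fderiv2 f p b a) = h * (h * fderiv2 f q a b)"
      using p(2) q(2) by (simp add: algebra_simps)
    then have "fderiv2 f p b a = fderiv2 f q a b" using h by simp
    then show ?thesis
      using d1(2)[OF near(1)[OF q(1)]] d2(2)[OF near(2)[OF p(1)]] by (simp add: dist_real_def)
  qed
  \<comment> \<open>With a quarter of the gap for \<open>e\<close>, the gap is bounded by half of
    itself.\<close>
  from this[of "\<bar>fderiv2 f x a b - fderiv2 f x b a\<bar> / 4"] show ?thesis by (auto intro: ccontr)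
qed

lemma fderiv2_symmetric:
  fixes f :: "'a::real_normed_vector \<Rightarrow> 'b::euclidean_space"
  assumes S: "open S" and f: "smooth_on S f" and x: "x \<in> S"
  shows "fderiv2 f x a b = fderiv2 f x b a"
proof (rule euclidean_eqI)
  fix e :: 'b
  have *: "fderiv2 f x a b \<bullet> e = fderiv2 (\<lambda>y. f y \<bullet> e) x a b" for a b
  proof -
    have 1: "fderiv (\<lambda>y. f y \<bullet> e) y b = fderiv f y b \<bullet> e" if "y \<in> S" for y
      using fderiv_eqI[OF has_derivative_inner_left[OF smooth_on_has_derivative[OF S f that], of e]]
      by simp
    have "fderiv2 (\<lambda>y. f y \<bullet> e) x a b = fderiv (\<lambda>y. fderiv f y b \<bullet> e) x a"
      unfolding fderiv2_def using fderiv_cong[OF S x 1] by auto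
    also have "\<dots> = fderiv2 f x a b \<bullet> e" unfolding fderiv2_def
      using fderiv_eqI[OF has_derivative_inner_left[OF
            smooth_on_has_derivative[OF S smooth_on_fderiv[OF f] x], of b e]] by simp
    finally show ?thesis by simp
  qed
  have "smooth_on S (\<lambda>y. f y \<bullet> e)"
    by (rule smooth_on_bounded_linear_comp[OF bounded_linear_inner_left S f])
  from fderiv2_symmetric_real[OF S this x, of a b]
  show "fderiv2 f x a b \<bullet> e = fderiv2 f x b a \<bullet> e" using * by simp
qed

section \<open>Integrals depending on a parameter\<close>

lemma set_integrable_compact:
  fixes f :: "'a::euclidean_space \<Rightarrow> 'b::{banach, second_countable_topology}"
  shows "compact K \<Longrightarrow> continuous_on K f \<Longrightarrow> set_integrable lborel K f"
  unfolding set_integrable_def by (rule borel_integrable_compact)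

lemma set_integral_cong_support:
  assumes "K \<subseteq> S" "\<And>y. y \<in> S - K \<Longrightarrow> f y = 0"
  shows "(LINT y:S|M. f y) = (LINT y:K|M. f y)"
  unfolding set_lebesgue_integral_def
  by (rule Bochner_Integration.integral_cong[OF refl]) (use assms in \<open>auto simp: indicator_def\<close>)

lemma set_integrable_cong_support:
  assumes "K \<subseteq> S" "\<And>y. y \<in> S - K \<Longrightarrow> f y = 0"
  shows "set_integrable M S f \<longleftrightarrow> set_integrable M K f"
  unfolding set_integrable_def
  by (rule Bochner_Integration.integrable_cong[OF refl]) (use assms in \<open>auto simp: indicator_def\<close>)

lemma norm_set_integral_compact_le:
  fixes f :: "'a::euclidean_space \<Rightarrow> 'b::{banach, second_countable_topology}"
  assumes K: "compact K" "continuous_on K f" and B: "\<And>y. y \<in> K \<Longrightarrow> norm (f y) \<le> B"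
  shows "norm (LINT y:K|lborel. f y) \<le> B * measure lborel K"
proof -
  have fin: "emeasure lborel K < \<infinity>" using emeasure_compact_finite[OF K(1)] by simp
  have "norm (LINT y:K|lborel. f y) \<le> (LINT y:K|lborel. norm (f y))"
    using set_integral_norm_bound[OF set_integrable_compact[OF K]] .
  also have "\<dots> \<le> (LINT y:K|lborel. B)"
    using K B fin by (intro set_integral_mono set_integrable_compact continuous_intros) auto
  also have "\<dots> = B * measure lborel K"
    using K(1) fin by (subst set_integral_const) (auto simp: borel_compact)
  finally show ?thesis .
qed

text \<open>Uniform continuity on a compact product yields one radius for all
  \<open>y \<in> K\<close>, which is what an estimate under the integral over \<open>K\<close>
  requires.\<close>

lemma continuous_uniform_on_compact:
  fixes H :: "'a::euclidean_space \<Rightarrow> 'b::euclidean_space \<Rightarrow> 'c::real_normed_vector"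
  assumes "open T" "compact K" "t0 \<in> T" "continuous_on (T \<times> K) (\<lambda>(t, y). H t y)" "e > 0"
  obtains d where "d > 0" "ball t0 d \<subseteq> T"
    "\<And>t y. t \<in> ball t0 d \<Longrightarrow> y \<in> K \<Longrightarrow> norm (H t y - H t0 y) \<le> e"
proof -
  obtain r where r: "r > 0" "cball t0 r \<subseteq> T" using assms(1,3) by (metis open_contains_cball)
  have "uniformly_continuous_on (cball t0 r \<times> K) (\<lambda>(t, y). H t y)"
    by (rule compact_uniformly_continuous[OF continuous_on_subset[OF assms(4)]])
      (use r assms(2) in \<open>auto intro: compact_Times\<close>)
  then obtain d where d: "d > 0" "\<And>p q. p \<in> cball t0 r \<times> K \<Longrightarrow> q \<in> cball t0 r \<times> K
      \<Longrightarrow> dist p q < d \<Longrightarrow> dist ((\<lambda>(t, y). H t y) p) ((\<lambda>(t, y). H t y) q) < e"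
    using assms(5) unfolding uniformly_continuous_on_def by metis
  show ?thesis
  proof (rule that[of "min r d"])
    fix t y assume t: "t \<in> ball t0 (min r d)" and y: "y \<in> K"
    have "dist (t, y) (t0, y) < d" using t by (simp add: dist_Pair_Pair dist_commute)
    then show "norm (H t y - H t0 y) \<le> e"
      using d(2)[of "(t, y)" "(t0, y)"] t y r by (auto simp: dist_norm)
  qed (use r d in auto)
qed

lemma continuous_on_integral_compact:
  fixes H :: "'a::euclidean_space \<Rightarrow> 'b::euclidean_space \<Rightarrow> 'c::{banach, second_countable_topology}"
  assumes T: "open T" and K: "compact K" and H: "continuous_on (T \<times> K) (\<lambda>(t, y). H t y)"
  shows "continuous_on T (\<lambda>t. LINT y:K|lborel. H t y)"
proof (rule continuous_at_imp_continuous_on, rule ballI)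
  fix t0 assume t0: "t0 \<in> T"
  have Ht: "continuous_on K (H t)" if "t \<in> T" for t
    using continuous_on_compose2[OF H, of K "\<lambda>y. (t, y)"] that
    by (auto simp: continuous_on_Pair continuous_on_id)
  show "isCont (\<lambda>t. LINT y:K|lborel. H t y) t0"
    unfolding continuous_at_eps_delta
  proof (intro allI impI)
    fix e :: real assume e: "e > 0"
    define m where "m = measure lborel K + 1"
    have m: "m > 0" by (simp add: m_def add_nonneg_pos)
    obtain d where d: "d > 0" "ball t0 d \<subseteq> T"
      "\<And>t y. t \<in> ball t0 d \<Longrightarrow> y \<in> K \<Longrightarrow> norm (H t y - H t0 y) \<le> e / m"
      using continuous_uniform_on_compact[OF T K t0 H, of "e / m"] e m by auto
    have "dist (LINT y:K|lborel. H t y) (LINT y:K|lborel. H t0 y) < e" if "dist t t0 < d" for t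
    proof -
      have t: "t \<in> ball t0 d" "t \<in> T" using that d(2) by (auto simp: dist_commute)
      have "dist (LINT y:K|lborel. H t y) (LINT y:K|lborel. H t0 y) = norm (LINT y:K|lborel. H t y - H t0 y)"
        unfolding dist_norm
        by (subst set_integral_diff) (use Ht t t0 K in \<open>auto intro: set_integrable_compact\<close>)
      also have "\<dots> \<le> e / m * measure lborel K"
        by (rule norm_set_integral_compact_le[OF K])
          (use Ht t t0 d in \<open>auto intro!: continuous_intros\<close>)
      also have "\<dots> < e / m * m" using e m by (intro mult_strict_left_mono) (auto simp: m_def)
      finally show ?thesis using m by simp
    qed
    then show "\<exists>d>0. \<forall>t. dist t t0 < d \<longrightarrow> dist (LINT y:K|lborel. H t y) (LINT y:K|lborel. H t0 y) < e"
      using d(1) by blast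
  qed
qed

text \<open>The mean value inequality bounds the remainder of the linearisation uniformly in
  \<open>y\<close>, and a uniform bound integrates over the set \<open>K\<close> of finite
  measure.\<close>

lemma has_derivative_integral_compact:
  fixes G :: "'a::euclidean_space \<Rightarrow> 'b::euclidean_space \<Rightarrow> 'c::euclidean_space"
  assumes T: "open T" and K: "compact K" and t0: "t0 \<in> T"
    and cont: "\<And>t. t \<in> T \<Longrightarrow> continuous_on K (G t)"
    and der: "\<And>t y. t \<in> T \<Longrightarrow> y \<in> K \<Longrightarrow> ((\<lambda>t. G t y) has_derivative G' t y) (at t)"
    and cont': "\<And>v. continuous_on (T \<times> K) (\<lambda>(t, y). G' t y v)"
  shows "((\<lambda>t. LINT y:K|lborel. G t y) has_derivative (\<lambda>v. LINT y:K|lborel. G' t0 y v)) (at t0)"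
proof -
  have lin: "linear (G' t y)" if "t \<in> T" "y \<in> K" for t y
    using der[OF that] by (metis has_derivative_linear)
  have cont't: "continuous_on K (\<lambda>y. G' t y v)" if "t \<in> T" for t v
    using continuous_on_compose2[OF cont', of K "\<lambda>y. (t, y)"] that
    by (auto simp: continuous_on_Pair continuous_on_id)
  have blin: "bounded_linear (\<lambda>v. LINT y:K|lborel. G' t0 y v)"
  proof (rule linear_conv_bounded_linear[THEN iffD1], rule linearI)
    fix v w
    have "(LINT y:K|lborel. G' t0 y (v + w)) = (LINT y:K|lborel. G' t0 y v + G' t0 y w)"
      by (rule set_lebesgue_integral_cong) (use K lin t0 in \<open>auto simp: linear_add borel_compact\<close>)
    then show "(LINT y:K|lborel. G' t0 y (v + w)) = (LINT y:K|lborel. G' t0 y v) + (LINT y:K|lborel. G' t0 y w)"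
      by (simp add: set_integral_add set_integrable_compact K cont't t0)
  next
    fix r :: real and v
    have "(LINT y:K|lborel. G' t0 y (r *\<^sub>R v)) = (LINT y:K|lborel. r *\<^sub>R G' t0 y v)"
      by (rule set_lebesgue_integral_cong) (use K lin t0 in \<open>auto simp: linear_scale borel_compact\<close>)
    then show "(LINT y:K|lborel. G' t0 y (r *\<^sub>R v)) = r *\<^sub>R (LINT y:K|lborel. G' t0 y v)" by simp
  qed
  have "\<exists>d>0. \<forall>t. norm (t - t0) < d \<longrightarrow> norm ((LINT y:K|lborel. G t y) - (LINT y:K|lborel. G t0 y)
      - (LINT y:K|lborel. G' t0 y (t - t0))) \<le> e * norm (t - t0)" if e: "e > 0" for e
  proof -
    \<comment> \<open>\<open>DIM('a)\<close> accounts for bounding the operator norm by the values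
      on the basis vectors, the measure for the integration over \<open>K\<close>; adding 1 keeps
      \<open>m\<close> positive when \<open>K\<close> is a null set.\<close>
    define m where "m = (measure lborel K + 1) * DIM('a)"
    have m: "m > 0" "measure lborel K * DIM('a) \<le> m"
      by (auto simp: m_def add_nonneg_pos mult_le_cancel_right)
    have "\<exists>d>0. ball t0 d \<subseteq> T \<and> (\<forall>t y. t \<in> ball t0 d \<longrightarrow> y \<in> K \<longrightarrow> norm (G' t y b - G' t0 y b) \<le> e / m)" for b
      using continuous_uniform_on_compact[OF T K t0 cont', of "e / m" b] e m by (metis divide_pos_pos)
    then obtain d where d: "\<And>b. d b > 0" "\<And>b. ball t0 (d b) \<subseteq> T"
      "\<And>b t y. t \<in> ball t0 (d b) \<Longrightarrow> y \<in> K \<Longrightarrow> norm (G' t y b - G' t0 y b) \<le> e / m"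
      by metis
    define d0 where "d0 = Min (d ` (Basis :: 'a set))"
    have d0: "d0 > 0" "\<And>b. b \<in> Basis \<Longrightarrow> d0 \<le> d b" using d(1) by (auto simp: d0_def)
    have "norm ((LINT y:K|lborel. G t y) - (LINT y:K|lborel. G t0 y)
      - (LINT y:K|lborel. G' t0 y (t - t0))) \<le> e * norm (t - t0)" if t: "norm (t - t0) < d0" for t
    proof -
      have inT: "ball t0 d0 \<subseteq> T" using d0(2)[OF SOME_Basis] d(2)[of "SOME i. i \<in> Basis"] by (meson order_trans subset_ball)
      have tT: "t \<in> T" using inT t by (auto simp: dist_norm norm_minus_commute)
      have on: "norm (G' s y v - G' t0 y v) \<le> e / m * DIM('a) * norm v" if s: "s \<in> ball t0 d0" and y: "y \<in> K" for s y v
      proof -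
        have sT: "s \<in> T" using s inT by auto
        define L where "L v = G' s y v - G' t0 y v" for v
        have L: "linear L" unfolding L_def[abs_def] using lin[OF sT y] lin[OF t0 y] by (rule linear_compose_sub)
        have "L v = (\<Sum>b\<in>Basis. (v \<bullet> b) *\<^sub>R L b)"
          using linear_sum[OF L, of "\<lambda>b. (v \<bullet> b) *\<^sub>R b" Basis] by (simp add: linear_scale[OF L] euclidean_representation)
        also have "norm \<dots> \<le> (\<Sum>b\<in>(Basis::'a set). norm v * (e / m))"
        proof (rule sum_norm_le)
          fix b :: 'a assume b: "b \<in> Basis"
          have "norm (L b) \<le> e / m" unfolding L_def using d(3)[of s b y] s y d0(2)[OF b] by auto
          with Basis_le_norm[OF b, of v] show "norm ((v \<bullet> b) *\<^sub>R L b) \<le> norm v * (e / m)"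
            unfolding norm_scaleR by (intro mult_mono) auto
        qed
        finally show ?thesis by (simp add: L_def mult_ac)
      qed
      have pt: "norm (G t y - G t0 y - G' t0 y (t - t0)) \<le> norm (t - t0) * (e / m * DIM('a))" if y: "y \<in> K" for y
      proof (rule differentiable_bound_linearization[where S = "ball t0 d0" and f = "\<lambda>t. G t y" and f' = "\<lambda>t. G' t y"])
        show "t0 + s *\<^sub>R (t - t0) \<in> ball t0 d0" if "s \<in> {0..1}" for s
        proof -
          have "norm (s *\<^sub>R (t - t0)) \<le> 1 * norm (t - t0)" using that by (auto intro: mult_right_mono mult_left_le_one_le)
          then show ?thesis using t by (simp add: dist_norm)
        qed
        show "((\<lambda>t. G t y) has_derivative G' s y) (at s within ball t0 d0)" if "s \<in> ball t0 d0" for s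
          using der[of s y] that inT y has_derivative_at_withinI by blast
        show "onorm (G' s y - G' t0 y) \<le> e / m * DIM('a)" if "s \<in> ball t0 d0" for s
          by (rule onorm_bound) (use on[OF that y] e m in \<open>auto simp: fun_diff_def\<close>)
        show "t0 \<in> ball t0 d0" using d0 by simp
      qed
      have "(LINT y:K|lborel. G t y) - (LINT y:K|lborel. G t0 y) - (LINT y:K|lborel. G' t0 y (t - t0))
        = (LINT y:K|lborel. G t y - G t0 y - G' t0 y (t - t0))"
      proof -
        have i: "set_integrable lborel K (G t)" "set_integrable lborel K (G t0)"
           "set_integrable lborel K (\<lambda>y. G' t0 y (t - t0))"
          using K cont tT t0 cont't by (auto intro: set_integrable_compact)
        show ?thesis using set_integral_diff[OF i(1,2)] set_integral_diff[OF set_integral_diff(1)[OF i(1,2)] i(3)] by simp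
      qed
      also have "norm \<dots> \<le> (norm (t - t0) * (e / m * DIM('a))) * measure lborel K"
        by (rule norm_set_integral_compact_le[OF K]) (use cont tT t0 cont't pt in \<open>auto intro!: continuous_intros\<close>)
      also have "\<dots> = (e / m * norm (t - t0)) * (measure lborel K * DIM('a))" by simp
      also have "\<dots> \<le> (e / m * norm (t - t0)) * m" using e m by (intro mult_left_mono) auto
      finally show ?thesis using m by (simp add: mult_ac)
    qed
    then show ?thesis using d0(1) by blast
  qed
  then show ?thesis unfolding has_derivative_at_alt using blin by blast
qed

text \<open>By translation invariance the integral of \<open>f (y + s *\<^sub>R e)\<close>, with
  \<open>f\<close> extended by zero, is constant in \<open>s\<close>. Its derivative at
  \<open>s = 0\<close>, taken under the integral, is the integral of the directional
  derivative.\<close>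

lemma integral_fderiv_compact_support:
  fixes f :: "'a::euclidean_space \<Rightarrow> 'b::euclidean_space"
  assumes S: "open S" and f: "smooth_on S f" and K: "compact K" "K \<subseteq> S"
    and supp: "\<And>y. y \<in> S - K \<Longrightarrow> f y = 0"
  shows "(LINT y:S|lborel. fderiv f y e) = 0"
proof -
  define f0 where "f0 y = (if y \<in> K then f y else 0)" for y
  define f1 where "f1 y = (if y \<in> K then fderiv f y else (\<lambda>_. 0))" for y
  have oK: "open (- K)" using K(1) by (simp add: compact_imp_closed open_Compl)
  have eqS: "f0 y = f y" if "y \<in> S" for y using supp that by (auto simp: f0_def)
  have der0: "fderiv f y = (\<lambda>_. 0)" if y: "y \<in> S - K" for y
  proof -
    have "fderiv f y = fderiv (\<lambda>_. 0) y"
      by (rule fderiv_cong[of "S - K"]) (use S oK supp y in \<open>auto simp: Diff_eq open_Int\<close>)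
    then show ?thesis by (simp add: frechet_derivative_const)
  qed
  have f1S: "f1 y = fderiv f y" if "y \<in> S" for y using der0 that by (auto simp: f1_def)
  have der: "(f0 has_derivative f1 y) (at y)" for y
  proof (cases "y \<in> S")
    case True
    then show ?thesis unfolding f1S[OF True]
      using has_derivative_transform_within_open[OF smooth_on_has_derivative[OF S f True] S True, of f0] eqS by simp
  next
    case False
    then have "y \<in> - K" using K by auto
    then have "f1 y = (\<lambda>_. 0)" "\<And>z. z \<in> - K \<Longrightarrow> 0 = f0 z" by (auto simp: f0_def f1_def)
    then show ?thesis
      using has_derivative_transform_within_open[OF has_derivative_const oK \<open>y \<in> - K\<close>] by metis
  qed
  have cont1: "continuous_on UNIV (\<lambda>y. f1 y e)"
  proof -
    have "continuous_on S (\<lambda>y. f1 y e)"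
      using smooth_on_imp_continuous_on[OF smooth_on_fderiv[OF f]] f1S by (simp cong: continuous_on_cong)
    moreover have "continuous_on (- K) (\<lambda>y. f1 y e)"
      by (rule continuous_on_eq[of _ "\<lambda>_. 0"]) (auto simp: f1_def)
    ultimately have "continuous_on (S \<union> - K) (\<lambda>y. f1 y e)" using S oK by (rule continuous_on_open_Un[rotated 2])
    then show ?thesis using K(2) by (metis Compl_subset_Compl_iff Un_commute boolean_algebra.disj_cancel_right sup.absorb_iff2 sup.orderE sup_left_commute)
  qed
  have cont0: "continuous_on X f0" for X
    using der by (meson continuous_at_imp_continuous_on has_derivative_continuous)
  \<comment> \<open>The set swept out by the translates of \<open>K\<close> for \<open>s\<close>
    between -1 and 1: one compact domain that contains the supports of all functions to be
    differentiated in \<open>s\<close>.\<close>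
  define K' where "K' = (\<lambda>(k, s). k - s *\<^sub>R e) ` (K \<times> {-1..1::real})"
  have K': "compact K'" unfolding K'_def
    by (rule compact_continuous_image) (auto intro!: continuous_intros compact_Times K simp: case_prod_unfold)
  have supp': "f0 (y + s *\<^sub>R e) = 0" if "y \<notin> K'" "s \<in> {-1<..<1}" for y s
  proof (rule ccontr)
    assume "f0 (y + s *\<^sub>R e) \<noteq> 0"
    then have "y + s *\<^sub>R e \<in> K" by (auto simp: f0_def split: if_splits)
    then have "(y + s *\<^sub>R e, s) \<in> K \<times> {-1..1}" using that by auto
    from imageI[OF this, of "\<lambda>(k, s). k - s *\<^sub>R e"] show False using that by (simp add: K'_def)
  qed
  have const: "(LINT y:K'|lborel. f0 (y + s *\<^sub>R e)) = (LINT y|lborel. f0 y)" if "s \<in> {-1<..<1}" for s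
  proof -
    have "(LINT y:K'|lborel. f0 (y + s *\<^sub>R e)) = (LINT y:UNIV|lborel. f0 (y + s *\<^sub>R e))"
      by (rule set_integral_cong_support[symmetric]) (use supp' that in auto)
    also have "\<dots> = (LINT y|lborel. f0 ((+) (s *\<^sub>R e) y))"
      by (simp add: set_lebesgue_integral_def add.commute)
    also have "\<dots> = (LINT y|distr lborel borel ((+) (s *\<^sub>R e)). f0 y)"
      using cont0[of UNIV] by (intro integral_distr[symmetric]) (auto intro: borel_measurable_continuous_onI)
    finally show ?thesis by (simp add: lborel_distr_plus)
  qed
  have "((\<lambda>s. LINT y:K'|lborel. f0 (y + s *\<^sub>R e)) has_derivative
      (\<lambda>v. LINT y:K'|lborel. (\<lambda>s y v. v *\<^sub>R f1 (y + s *\<^sub>R e) e) 0 y v)) (at 0)"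
  proof (rule has_derivative_integral_compact[where T = "{-1<..<1}"])
    show "((\<lambda>s. f0 (y + s *\<^sub>R e)) has_derivative (\<lambda>v. v *\<^sub>R f1 (y + s *\<^sub>R e) e)) (at s)" for s y
    proof -
      have "((\<lambda>s. y + s *\<^sub>R e) has_derivative (\<lambda>v. v *\<^sub>R e)) (at s)" by (auto intro!: derivative_eq_intros)
      from has_derivative_compose[OF this der] show ?thesis
        using linear_scale[OF has_derivative_linear[OF der]] by simp
    qed
    show "continuous_on ({-1<..<1} \<times> K') (\<lambda>(s, y). v *\<^sub>R f1 (y + s *\<^sub>R e) e)" for v :: real
      unfolding case_prod_unfold
      by (intro continuous_intros continuous_on_compose2[OF cont1]) auto
    show "continuous_on K' (\<lambda>y. f0 (y + s *\<^sub>R e))" for s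
      by (rule continuous_on_compose2[OF cont0[of UNIV]]) (auto intro!: continuous_intros)
  qed (use K' in auto)
  moreover have "((\<lambda>s. LINT y:K'|lborel. f0 (y + s *\<^sub>R e)) has_derivative (\<lambda>_. 0)) (at 0)"
    by (rule has_derivative_transform_within_open[OF has_derivative_const, of "{-1<..<1}"]) (use const in auto)
  ultimately have "(\<lambda>v. LINT y:K'|lborel. v *\<^sub>R f1 y e) = (\<lambda>_. 0)"
    by (auto dest: has_derivative_unique)
  from fun_cong[OF this, of 1] have "(LINT y:K'|lborel. f1 y e) = 0" by simp
  moreover have "(LINT y:K'|lborel. f1 y e) = (LINT y:K|lborel. f1 y e)"
  proof (rule set_integral_cong_support)
    show "K \<subseteq> K'"
    proof
      fix y assume "y \<in> K"
      then have "(y, 0) \<in> K \<times> {-1..1::real}" by auto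
      from imageI[OF this, of "\<lambda>(k, s). k - s *\<^sub>R e"] show "y \<in> K'" by (simp add: K'_def)
    qed
  qed (auto simp: f1_def)
  moreover have "(LINT y:S|lborel. fderiv f y e) = (LINT y:K|lborel. fderiv f y e)"
    by (rule set_integral_cong_support) (use K der0 in auto)
  moreover have "(LINT y:K|lborel. fderiv f y e) = (LINT y:K|lborel. f1 y e)"
    by (rule set_lebesgue_integral_cong) (use K f1S in \<open>auto simp: borel_compact\<close>)
  ultimately show ?thesis by simp
qed

section \<open>Powers of a two-form\<close>

definition pf_term :: "('v \<Rightarrow> 'v \<Rightarrow> real) \<Rightarrow> nat \<Rightarrow> (nat \<Rightarrow> 'v) \<Rightarrow> (nat \<Rightarrow> nat) \<Rightarrow> real"
  where "pf_term B k v \<sigma> = of_int (sign \<sigma>) * (\<Prod>i<k. B (v (\<sigma> (2*i))) (v (\<sigma> (2*i+1))))"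

text \<open>For antisymmetric \<open>B\<close> this is \<open>2 ^ k * fact k\<close> times the
  Pfaffian of the matrix with the entries \<open>B (v a) (v b)\<close> for
  \<open>a, b < 2 * k\<close>.\<close>

definition pf_sum :: "('v \<Rightarrow> 'v \<Rightarrow> real) \<Rightarrow> nat \<Rightarrow> (nat \<Rightarrow> 'v) \<Rightarrow> real"
  where "pf_sum B k v = (\<Sum>\<sigma> | \<sigma> permutes {..<2*k}. pf_term B k v \<sigma>)"

text \<open>This lets a permutation act on the arguments left for the inner factor of
  \<open>wedge 2 (2 * k)\<close>, while the arguments 0 and 1 go to the outer two-form.\<close>

definition shift2 :: "(nat \<Rightarrow> nat) \<Rightarrow> nat \<Rightarrow> nat"
  where "shift2 \<tau> j = (if j < 2 then j else \<tau> (j - 2) + 2)"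

lemma shift2_eq_map_permutation:
  assumes "\<tau> permutes {..<m}"
  shows "shift2 \<tau> = map_permutation {..<m} (\<lambda>j. j + 2) \<tau>"
proof
  fix j
  have inj: "inj_on (\<lambda>j::nat. j + 2) {..<m}" by (auto intro: inj_onI)
  show "shift2 \<tau> j = map_permutation {..<m} (\<lambda>j. j + 2) \<tau> j"
  proof (cases "j < 2 \<or> m \<le> j - 2")
    case True
    have "map_permutation {..<m} (\<lambda>j. j + 2) \<tau> permutes (\<lambda>j. j + 2) ` {..<m}"
      by (rule map_permutation_permutes) (use assms inj in \<open>auto intro: inj_on_imp_bij_betw\<close>)
    moreover have "j \<notin> (\<lambda>j. j + 2) ` {..<m}" using True by auto
    ultimately have "map_permutation {..<m} (\<lambda>j. j + 2) \<tau> j = j" by (rule permutes_not_in)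
    moreover have "shift2 \<tau> j = j"
      using True permutes_not_in[OF assms, of "j - 2"] by (auto simp: shift2_def)
    ultimately show ?thesis by simp
  next
    case False
    then obtain l where l: "j = l + 2" "l < m"
      by (metis add.commute le_add_diff_inverse not_le)
    then have "map_permutation {..<m} (\<lambda>j. j + 2) \<tau> (l + 2) = \<tau> l + 2"
      by (intro map_permutation_apply inj) auto
    then show ?thesis using l by (simp add: shift2_def)
  qed
qed

lemma shift2_permutes:
  assumes "\<tau> permutes {..<m}"
  shows "shift2 \<tau> permutes {..<2 + m}" "sign (shift2 \<tau>) = sign \<tau>"
proof -
  have inj: "inj_on (\<lambda>j::nat. j + 2) {..<m}" by (auto intro: inj_onI)
  have "map_permutation {..<m} (\<lambda>j. j + 2) \<tau> permutes (\<lambda>j. j + 2) ` {..<m}"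
    by (rule map_permutation_permutes) (use assms inj in \<open>auto intro: inj_on_imp_bij_betw\<close>)
  then show "shift2 \<tau> permutes {..<2 + m}"
    unfolding shift2_eq_map_permutation[OF assms] by (rule permutes_subset) auto
  show "sign (shift2 \<tau>) = sign \<tau>"
    unfolding shift2_eq_map_permutation[OF assms] by (rule sign_map_permutation[OF inj assms]) simp
qed

lemma sign_compose_permutes:
  "finite S \<Longrightarrow> p permutes S \<Longrightarrow> q permutes S \<Longrightarrow> sign (p \<circ> q) = sign p * sign q"
  by (intro sign_compose permutes_imp_permutation) auto

lemma prod_double_Suc_shift:
  fixes f :: "nat \<Rightarrow> nat \<Rightarrow> 'a::comm_monoid_mult"
  shows "(\<Prod>i<Suc k. f (2*i) (2*i+1)) = f 0 1 * (\<Prod>i<k. f (2 + 2*i) (2 + (2*i+1)))"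
  by (subst prod.lessThan_Suc_shift) simp

text \<open>Unfolding one wedge gives a double sum over \<open>\<sigma>\<close> and a permutation
  \<open>\<tau>\<close> of the remaining arguments. The summand depends only on
  \<open>\<sigma> \<circ> shift2 \<tau>\<close>, so each of the \<open>fact (2 * k)\<close>
  permutations \<open>\<tau>\<close> contributes the same sum; this factor cancels in the
  normalisation of \<open>wedge\<close>, and \<open>fact 2\<close> leaves one further power of
  2.\<close>

lemma form_power_eq_pf_sum:
  assumes \<alpha>: "\<And>w. \<alpha> w = complex_of_real (B (w 0) (w 1))"
  shows "form_power \<alpha> k v = complex_of_real (pf_sum B k v / 2 ^ k)"
proof (induction k arbitrary: v)
  case 0
  then show ?case by (simp add: pf_sum_def pf_term_def)
next
  case (Suc k)
  let ?S = "{..<2 + 2 * k}"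
  define Q where "Q \<sigma> = of_int (sign \<sigma>) * (B (v (\<sigma> 0)) (v (\<sigma> 1)) *
      (\<Prod>i<k. B (v (\<sigma> (2 + 2*i))) (v (\<sigma> (2 + (2*i+1))))))" for \<sigma>
  have Q: "pf_term B (Suc k) v \<sigma> = Q \<sigma>" for \<sigma>
    unfolding pf_term_def Q_def prod_double_Suc_shift[of "\<lambda>i j. B (v (\<sigma> i)) (v (\<sigma> j))"] ..
  have "(\<Sum>\<sigma> | \<sigma> permutes ?S. of_int (sign \<sigma>) * \<alpha> (\<lambda>i. v (\<sigma> i)) * form_power \<alpha> k (\<lambda>i. v (\<sigma> (2 + i))))
    = (\<Sum>\<sigma> | \<sigma> permutes ?S. complex_of_real (\<Sum>\<tau> | \<tau> permutes {..<2*k}. Q (\<sigma> \<circ> shift2 \<tau>) / 2 ^ k))"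
  proof (rule sum.cong[OF refl])
    fix \<sigma> assume "\<sigma> \<in> {\<sigma>. \<sigma> permutes ?S}"
    then have \<sigma>: "\<sigma> permutes ?S" by simp
    have "of_int (sign \<sigma>) * B (v (\<sigma> 0)) (v (\<sigma> 1)) * pf_term B k (\<lambda>i. v (\<sigma> (2 + i))) \<tau> = Q (\<sigma> \<circ> shift2 \<tau>)"
      if \<tau>: "\<tau> permutes {..<2*k}" for \<tau>
    proof -
      have s: "sign (\<sigma> \<circ> shift2 \<tau>) = sign \<sigma> * sign \<tau>"
        using sign_compose_permutes[OF _ \<sigma> shift2_permutes(1)[OF \<tau>]] shift2_permutes(2)[OF \<tau>] by simp
      show ?thesis unfolding Q_def s pf_term_def
        by (simp add: shift2_def add.commute mult_ac)
    qed
    then have "of_int (sign \<sigma>) * B (v (\<sigma> 0)) (v (\<sigma> 1)) * (pf_sum B k (\<lambda>i. v (\<sigma> (2 + i))) / 2 ^ k)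
      = (\<Sum>\<tau> | \<tau> permutes {..<2*k}. Q (\<sigma> \<circ> shift2 \<tau>) / 2 ^ k)"
      unfolding pf_sum_def by (simp add: sum_distrib_left sum_divide_distrib)
    then show "of_int (sign \<sigma>) * \<alpha> (\<lambda>i. v (\<sigma> i)) * form_power \<alpha> k (\<lambda>i. v (\<sigma> (2 + i)))
      = complex_of_real (\<Sum>\<tau> | \<tau> permutes {..<2*k}. Q (\<sigma> \<circ> shift2 \<tau>) / 2 ^ k)"
      unfolding Suc.IH \<alpha> by (metis of_real_mult of_real_of_int_eq)
  qed
  also have "\<dots> = complex_of_real (\<Sum>\<sigma> | \<sigma> permutes ?S. \<Sum>\<tau> | \<tau> permutes {..<2*k}. Q (\<sigma> \<circ> shift2 \<tau>) / 2 ^ k)"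
    by simp
  also have "(\<Sum>\<sigma> | \<sigma> permutes ?S. \<Sum>\<tau> | \<tau> permutes {..<2*k}. Q (\<sigma> \<circ> shift2 \<tau>) / 2 ^ k)
      = (\<Sum>\<tau> | \<tau> permutes {..<2*k}. \<Sum>\<sigma> | \<sigma> permutes ?S. Q (\<sigma> \<circ> shift2 \<tau>) / 2 ^ k)"
    by (rule sum.swap)
  also have "\<dots> = (\<Sum>\<tau> | \<tau> permutes {..<2*k}. \<Sum>\<sigma> | \<sigma> permutes ?S. Q \<sigma> / 2 ^ k)"
  proof (rule sum.cong[OF refl])
    fix \<tau> assume "\<tau> \<in> {\<tau>. \<tau> permutes {..<2*k}}"
    then have "shift2 \<tau> permutes ?S" by (intro shift2_permutes) simp
    from sum_permutations_compose_right[OF this, of "\<lambda>\<sigma>. Q \<sigma> / 2 ^ k"]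
    show "(\<Sum>\<sigma> | \<sigma> permutes ?S. Q (\<sigma> \<circ> shift2 \<tau>) / 2 ^ k) = (\<Sum>\<sigma> | \<sigma> permutes ?S. Q \<sigma> / 2 ^ k)"
      by simp
  qed
  also have "\<dots> = fact (2 * k) * (pf_sum B (Suc k) v / 2 ^ k)"
    by (simp add: card_permutations[of _ "2 * k"] pf_sum_def Q sum_divide_distrib)
  finally show ?case by (simp add: wedge_def fact_numeral)
qed

text \<open>The argument with index \<open>\<sigma> p\<close> occurs only in the pair numbered
  \<open>p div 2\<close>, as its left or right entry according to the parity of \<open>p\<close>.
  Multilinearity and the product rule in \<open>pf_sum_derivation\<close> both rest on this.\<close>

lemma pf_term_upd:
  assumes \<sigma>: "\<sigma> permutes {..<2*k}" and p: "p < 2*k"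
  shows "pf_term B k (v(\<sigma> p := x)) \<sigma> = of_int (sign \<sigma>) *
    ((if even p then B x (v (\<sigma> (p+1))) else B (v (\<sigma> (p-1))) x) *
     (\<Prod>i\<in>{..<k}-{p div 2}. B (v (\<sigma> (2*i))) (v (\<sigma> (2*i+1)))))"
proof -
  have inj: "\<sigma> i = \<sigma> j \<longleftrightarrow> i = j" for i j using permutes_inj[OF \<sigma>] by (auto dest: injD)
  let ?w = "v(\<sigma> p := x)"
  have pk: "p div 2 \<in> {..<k}" using p by auto
  have "(\<Prod>i<k. B (?w (\<sigma> (2*i))) (?w (\<sigma> (2*i+1))))
    = B (?w (\<sigma> (2*(p div 2)))) (?w (\<sigma> (2*(p div 2)+1))) *
      (\<Prod>i\<in>{..<k}-{p div 2}. B (?w (\<sigma> (2*i))) (?w (\<sigma> (2*i+1))))"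
    by (rule prod.remove[OF _ pk]) simp
  also have "(\<Prod>i\<in>{..<k}-{p div 2}. B (?w (\<sigma> (2*i))) (?w (\<sigma> (2*i+1))))
    = (\<Prod>i\<in>{..<k}-{p div 2}. B (v (\<sigma> (2*i))) (v (\<sigma> (2*i+1))))"
    by (rule prod.cong) (auto simp: inj)
  also have "B (?w (\<sigma> (2*(p div 2)))) (?w (\<sigma> (2*(p div 2)+1)))
    = (if even p then B x (v (\<sigma> (p+1))) else B (v (\<sigma> (p-1))) x)"
  proof (cases "even p")
    case True
    then have "2 * (p div 2) = p" by simp
    then show ?thesis using True by (simp add: inj)
  next
    case False
    then have "2 * (p div 2) = p - 1" "p > 0" by (auto elim: oddE)
    then show ?thesis using False by (auto simp: inj)
  qed
  finally show ?thesis unfolding pf_term_def by simp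
qed

lemma linear_pf_sum:
  fixes B :: "'v::real_vector \<Rightarrow> 'v \<Rightarrow> real"
  assumes B: "bilinear B" and m: "m < 2*k"
  shows "linear (\<lambda>x. pf_sum B k (v(m := x)))"
proof -
  have "linear (\<lambda>x. pf_term B k (v(m := x)) \<sigma>)" if \<sigma>: "\<sigma> permutes {..<2*k}" for \<sigma>
  proof -
    define p where "p = inv \<sigma> m"
    have p: "p < 2*k" "\<sigma> p = m"
      using permutes_inv[OF \<sigma>] m permutes_inverses(1)[OF \<sigma>] permutes_in_image[of "inv \<sigma>" "{..<2*k}" m]
      by (auto simp: p_def)
    have "linear (\<lambda>x. if even p then B x (v (\<sigma> (p+1))) else B (v (\<sigma> (p-1))) x)"
      using B by (cases "even p") (auto simp: bilinear_def)
    then have "linear (\<lambda>x. c * ((if even p then B x (v (\<sigma> (p+1))) else B (v (\<sigma> (p-1))) x) * d))" for c d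
      by (auto simp: linear_iff algebra_simps)
    then show ?thesis using pf_term_upd[OF \<sigma> p(1), of B v] unfolding p(2) by simp
  qed
  then show ?thesis unfolding pf_sum_def by (intro linear_compose_sum) auto
qed

lemma pf_sum_permute:
  assumes \<pi>: "\<pi> permutes {..<2*k}"
  shows "pf_sum B k (\<lambda>i. v (\<pi> i)) = of_int (sign \<pi>) * pf_sum B k v"
proof -
  have "pf_term B k (\<lambda>i. v (\<pi> i)) \<sigma> = of_int (sign \<pi>) * pf_term B k v (\<pi> \<circ> \<sigma>)"
    if \<sigma>: "\<sigma> permutes {..<2*k}" for \<sigma>
  proof -
    have "sign (\<pi> \<circ> \<sigma>) = sign \<pi> * sign \<sigma>" by (rule sign_compose_permutes[OF _ \<pi> \<sigma>]) simp
    then have "sign \<sigma> = sign \<pi> * sign (\<pi> \<circ> \<sigma>)" by (simp add: sign_idempotent mult.assoc[symmetric])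
    then show ?thesis unfolding pf_term_def by simp
  qed
  then have "pf_sum B k (\<lambda>i. v (\<pi> i)) = of_int (sign \<pi>) * (\<Sum>\<sigma> | \<sigma> permutes {..<2*k}. pf_term B k v (\<pi> \<circ> \<sigma>))"
    unfolding pf_sum_def by (simp add: sum_distrib_left)
  also have "(\<Sum>\<sigma> | \<sigma> permutes {..<2*k}. pf_term B k v (\<pi> \<circ> \<sigma>)) = pf_sum B k v"
    unfolding pf_sum_def by (rule setum_permutations_compose_left[OF \<pi>, symmetric])
  finally show ?thesis .
qed

text \<open>Exchanging the two equal arguments changes nothing and yet reverses the sign.\<close>

lemma pf_sum_repeated:
  assumes "m < 2*k" "l < 2*k" "m \<noteq> l" "v m = v l"
  shows "pf_sum B k v = 0"
proof -
  have t: "Transposition.transpose m l permutes {..<2*k}" using assms by (intro permutes_swap_id) auto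
  have "(\<lambda>i. v (Transposition.transpose m l i)) = v" using assms by (auto simp: Transposition.transpose_def)
  then show ?thesis using pf_sum_permute[OF t, of B v] assms(3) by (simp add: sign_swap_id)
qed

text \<open>All terms of the expansion but the one with index \<open>m\<close> repeat an argument.
  Summed over \<open>m\<close>, the surviving coefficients form the trace in
  \<open>fderiv_vol_hlift\<close>.\<close>

lemma pf_sum_upd_combination:
  fixes B :: "'v::real_vector \<Rightarrow> 'v \<Rightarrow> real"
  assumes B: "bilinear B" and m: "m < 2*k"
  shows "pf_sum B k (v(m := (\<Sum>b<2*k. c b *\<^sub>R v b))) = c m * pf_sum B k v"
proof -
  note lin = linear_pf_sum[OF B m, of v]
  have "pf_sum B k (v(m := (\<Sum>b<2*k. c b *\<^sub>R v b))) = (\<Sum>b<2*k. c b * pf_sum B k (v(m := v b)))"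
    by (simp add: linear_sum[OF lin] linear_scale[OF lin])
  also have "\<dots> = (\<Sum>b<2*k. if b = m then c m * pf_sum B k v else 0)"
  proof (rule sum.cong[OF refl])
    fix b assume b: "b \<in> {..<2*k}"
    show "c b * pf_sum B k (v(m := v b)) = (if b = m then c m * pf_sum B k v else 0)"
      using pf_sum_repeated[of m k b "v(m := v b)" B] b m by auto
  qed
  finally show ?thesis using m by simp
qed

lemma pf_sum_multilinear_expansion:
  fixes B :: "'v::real_vector \<Rightarrow> 'v \<Rightarrow> real"
  assumes B: "bilinear B" and S: "S \<subseteq> {..<2*k}"
  shows "pf_sum B k (\<lambda>m. if m \<in> S then (\<Sum>b<N. c m b *\<^sub>R v b) else x m) =
    (\<Sum>f\<in>S \<rightarrow>\<^sub>E {..<N}. (\<Prod>m\<in>S. c m (f m)) * pf_sum B k (\<lambda>m. if m \<in> S then v (f m) else x m))"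
proof -
  have "finite S" using S finite_subset by blast
  then show ?thesis using S
  proof (induction S arbitrary: x rule: finite_induct)
    case empty
    then show ?case by simp
  next
    case (insert a S)
    let ?x = "x(a := (\<Sum>b<N. c a b *\<^sub>R v b))"
    have a: "a < 2*k" using insert.prems by auto
    have "pf_sum B k (\<lambda>m. if m \<in> insert a S then (\<Sum>b<N. c m b *\<^sub>R v b) else x m)
      = pf_sum B k (\<lambda>m. if m \<in> S then (\<Sum>b<N. c m b *\<^sub>R v b) else ?x m)"
      by (rule arg_cong[where f = "pf_sum B k"]) (use insert.hyps in auto)
    also have "\<dots> = (\<Sum>f\<in>S \<rightarrow>\<^sub>E {..<N}. (\<Prod>m\<in>S. c m (f m)) * pf_sum B k (\<lambda>m. if m \<in> S then v (f m) else ?x m))"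
      using insert by auto
    also have "\<dots> = (\<Sum>f\<in>S \<rightarrow>\<^sub>E {..<N}. \<Sum>b<N. c a b * (\<Prod>m\<in>S. c m (f m)) *
        pf_sum B k ((\<lambda>m. if m \<in> S then v (f m) else x m)(a := v b)))"
    proof (rule sum.cong[OF refl])
      fix f
      let ?g = "\<lambda>m. if m \<in> S then v (f m) else x m"
      note lin = linear_pf_sum[OF B a, of ?g]
      have "(\<lambda>m. if m \<in> S then v (f m) else ?x m) = ?g(a := (\<Sum>b<N. c a b *\<^sub>R v b))"
        using insert.hyps by auto
      then show "(\<Prod>m\<in>S. c m (f m)) * pf_sum B k (\<lambda>m. if m \<in> S then v (f m) else ?x m) =
        (\<Sum>b<N. c a b * (\<Prod>m\<in>S. c m (f m)) * pf_sum B k (?g(a := v b)))"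
        by (simp add: linear_sum[OF lin] linear_scale[OF lin] sum_distrib_left mult_ac)
    qed
    also have "\<dots> = (\<Sum>b<N. \<Sum>f\<in>S \<rightarrow>\<^sub>E {..<N}. c a b * (\<Prod>m\<in>S. c m (f m)) *
        pf_sum B k ((\<lambda>m. if m \<in> S then v (f m) else x m)(a := v b)))"
      by (rule sum.swap)
    also have "\<dots> = (\<Sum>(b, f)\<in>{..<N} \<times> (S \<rightarrow>\<^sub>E {..<N}). c a b * (\<Prod>m\<in>S. c m (f m)) *
        pf_sum B k ((\<lambda>m. if m \<in> S then v (f m) else x m)(a := v b)))"
      by (rule sum.cartesian_product)
    also have "\<dots> = (\<Sum>(b, f)\<in>{..<N} \<times> (S \<rightarrow>\<^sub>E {..<N}). (\<Prod>m\<in>insert a S. c m ((f(a := b)) m)) *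
        pf_sum B k (\<lambda>m. if m \<in> insert a S then v ((f(a := b)) m) else x m))"
    proof (rule sum.cong[OF refl], clarify)
      fix b f assume "f \<in> S \<rightarrow>\<^sub>E {..<N}"
      have 1: "(\<Prod>m\<in>insert a S. c m ((f(a := b)) m)) = c a b * (\<Prod>m\<in>S. c m (f m))"
        using insert.hyps by (simp, intro disjI2 prod.cong) auto
      have 2: "(\<lambda>m. if m \<in> insert a S then v ((f(a := b)) m) else x m)
          = (\<lambda>m. if m \<in> S then v (f m) else x m)(a := v b)"
        using insert.hyps by auto
      show "c a b * (\<Prod>m\<in>S. c m (f m)) * pf_sum B k ((\<lambda>m. if m \<in> S then v (f m) else x m)(a := v b))
        = (\<Prod>m\<in>insert a S. c m ((f(a := b)) m)) *
        pf_sum B k (\<lambda>m. if m \<in> insert a S then v ((f(a := b)) m) else x m)"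
        unfolding 1 2 ..
    qed
    also have "\<dots> = (\<Sum>f\<in>insert a S \<rightarrow>\<^sub>E {..<N}. (\<Prod>m\<in>insert a S. c m (f m)) *
        pf_sum B k (\<lambda>m. if m \<in> insert a S then v (f m) else x m))"
      unfolding PiE_insert_eq
      by (subst sum.reindex[OF inj_combinator[OF insert.hyps(2)]]) (simp add: case_prod_unfold)
    finally show ?case .
  qed
qed

text \<open>The Leibniz formula for determinants: in the multilinear expansion over all index maps,
  those that are not injective repeat an argument, and the others are permutations, which contribute
  their sign. The factor becomes the Jacobian determinant in the transformation of volume
  forms.\<close>

lemma pf_sum_linear_image:
  fixes B :: "'v::real_vector \<Rightarrow> 'v \<Rightarrow> real"
  assumes B: "bilinear B"
  shows "pf_sum B k (\<lambda>m. \<Sum>b<2*k. c m b *\<^sub>R v b) =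
    (\<Sum>\<sigma> | \<sigma> permutes {..<2*k}. of_int (sign \<sigma>) * (\<Prod>m<2*k. c m (\<sigma> m))) * pf_sum B k v"
proof -
  let ?N = "{..<2*k}"
  have restr: "pf_sum B k w = pf_sum B k w'" if "\<And>m. m < 2*k \<Longrightarrow> w m = w' m" for w w' :: "nat \<Rightarrow> 'v"
  proof -
    have "pf_term B k w \<sigma> = pf_term B k w' \<sigma>" if "\<sigma> permutes ?N" for \<sigma>
    proof -
      have "\<sigma> j < 2*k" if "j < 2*k" for j
        using permutes_in_image[OF \<open>\<sigma> permutes ?N\<close>, of j] that by simp
      then show ?thesis unfolding pf_term_def by (auto intro!: prod.cong simp: \<open>\<And>m. m < 2*k \<Longrightarrow> w m = w' m\<close>)
    qed
    then show ?thesis unfolding pf_sum_def by simp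
  qed
  have "pf_sum B k (\<lambda>m. \<Sum>b<2*k. c m b *\<^sub>R v b) =
     pf_sum B k (\<lambda>m. if m \<in> ?N then \<Sum>b<2*k. c m b *\<^sub>R v b else v m)"
    by (rule restr) simp
  also have "\<dots> = (\<Sum>f\<in>?N \<rightarrow>\<^sub>E ?N. (\<Prod>m\<in>?N. c m (f m)) * pf_sum B k (\<lambda>m. if m \<in> ?N then v (f m) else v m))"
    by (rule pf_sum_multilinear_expansion[OF B]) simp
  \<comment> \<open>The index maps are extensional functions on \<open>{..<2 * k}\<close>, whereas
    permutations are the identity outside; \<open>restrict\<close> matches the two.\<close>
  also have "\<dots> = (\<Sum>f\<in>(\<lambda>\<sigma>. restrict \<sigma> ?N) ` {\<sigma>. \<sigma> permutes ?N}.
      (\<Prod>m\<in>?N. c m (f m)) * pf_sum B k (\<lambda>m. if m \<in> ?N then v (f m) else v m))"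
  proof (rule sum.mono_neutral_right)
    show "finite (?N \<rightarrow>\<^sub>E ?N)" by (simp add: finite_PiE)
    show "(\<lambda>\<sigma>. restrict \<sigma> ?N) ` {\<sigma>. \<sigma> permutes ?N} \<subseteq> ?N \<rightarrow>\<^sub>E ?N"
      using permutes_in_image by fastforce
    show "\<forall>f\<in>(?N \<rightarrow>\<^sub>E ?N) - (\<lambda>\<sigma>. restrict \<sigma> ?N) ` {\<sigma>. \<sigma> permutes ?N}.
        (\<Prod>m\<in>?N. c m (f m)) * pf_sum B k (\<lambda>m. if m \<in> ?N then v (f m) else v m) = 0"
    proof
      fix f assume f: "f \<in> (?N \<rightarrow>\<^sub>E ?N) - (\<lambda>\<sigma>. restrict \<sigma> ?N) ` {\<sigma>. \<sigma> permutes ?N}"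
      have "\<not> inj_on f ?N"
      proof
        assume i: "inj_on f ?N"
        have "f ` ?N \<subseteq> ?N" using f by auto
        then have "f ` ?N = ?N" using i by (simp add: endo_inj_surj)
        then have "(\<lambda>m. if m \<in> ?N then f m else m) permutes ?N"
          using i by (intro bij_imp_permutes) (auto simp: bij_betw_def inj_on_def)
        moreover have "restrict (\<lambda>m. if m \<in> ?N then f m else m) ?N = f"
          using f by (auto simp: restrict_def PiE_def extensional_def)
        ultimately show False using f by (metis (mono_tags, lifting) DiffD2 imageI mem_Collect_eq)
      qed
      then obtain a b where "a \<in> ?N" "b \<in> ?N" "a \<noteq> b" "f a = f b" by (auto simp: inj_on_def)
      then have "pf_sum B k (\<lambda>m. if m \<in> ?N then v (f m) else v m) = 0"
        by (intro pf_sum_repeated[of a k b]) auto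
      then show "(\<Prod>m\<in>?N. c m (f m)) * pf_sum B k (\<lambda>m. if m \<in> ?N then v (f m) else v m) = 0" by simp
    qed
  qed
  also have "\<dots> = (\<Sum>\<sigma> | \<sigma> permutes ?N. (\<Prod>m\<in>?N. c m (\<sigma> m)) * pf_sum B k (\<lambda>m. v (\<sigma> m)))"
  proof (subst sum.reindex)
    show "inj_on (\<lambda>\<sigma>. restrict \<sigma> ?N) {\<sigma>. \<sigma> permutes ?N}"
    proof (rule inj_onI, rule ext)
      fix \<sigma> \<tau> :: "nat \<Rightarrow> nat" and j
      assume "\<sigma> \<in> {\<sigma>. \<sigma> permutes ?N}" "\<tau> \<in> {\<sigma>. \<sigma> permutes ?N}"
        and eq: "restrict \<sigma> ?N = restrict \<tau> ?N"
      then have "\<sigma> j = \<tau> j" if "j \<notin> ?N"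
        using that permutes_not_in[of \<sigma> ?N j] permutes_not_in[of \<tau> ?N j] by (simp del: lessThan_iff)
      moreover have "\<sigma> j = \<tau> j" if "j \<in> ?N"
        by (metis eq restrict_apply' that)
      ultimately show "\<sigma> j = \<tau> j" by blast
    qed
    show "sum ((\<lambda>f. (\<Prod>m\<in>?N. c m (f m)) * pf_sum B k (\<lambda>m. if m \<in> ?N then v (f m) else v m)) \<circ> (\<lambda>\<sigma>. restrict \<sigma> ?N))
      {\<sigma>. \<sigma> permutes ?N} = (\<Sum>\<sigma> | \<sigma> permutes ?N. (\<Prod>m\<in>?N. c m (\<sigma> m)) * pf_sum B k (\<lambda>m. v (\<sigma> m)))"
      by (rule sum.cong[OF refl]) (auto intro!: arg_cong2[where f = "(*)"] prod.cong restr)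
  qed
  also have "\<dots> = (\<Sum>\<sigma> | \<sigma> permutes ?N. of_int (sign \<sigma>) * (\<Prod>m\<in>?N. c m (\<sigma> m)) * pf_sum B k v)"
    by (rule sum.cong[OF refl]) (simp add: pf_sum_permute)
  finally show ?thesis by (simp add: sum_distrib_right)
qed

lemma sum_double: "(\<Sum>p<2*k. f p) = (\<Sum>i<k. f (2*i) + f (2*i+1) :: 'a::comm_monoid_add)" for k :: nat
  by (induction k) (simp_all add: add.assoc)

lemma has_derivative_pf_sum:
  fixes B :: "'q::real_normed_vector \<Rightarrow> 'v \<Rightarrow> 'v \<Rightarrow> real"
  assumes "\<And>a b. a < 2*k \<Longrightarrow> b < 2*k \<Longrightarrow> ((\<lambda>q. B q (v a) (v b)) has_derivative B' a b) (at q0)"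
  shows "((\<lambda>q. pf_sum (B q) k v) has_derivative
     (\<lambda>d. \<Sum>\<sigma> | \<sigma> permutes {..<2*k}. of_int (sign \<sigma>) *
        (\<Sum>i<k. B' (\<sigma> (2*i)) (\<sigma> (2*i+1)) d *
          (\<Prod>j\<in>{..<k}-{i}. B q0 (v (\<sigma> (2*j))) (v (\<sigma> (2*j+1))))))) (at q0)"
proof -
  have "\<sigma> j < 2*k" if "\<sigma> permutes {..<2*k}" "j < 2*k" for \<sigma> j
    using permutes_in_image[OF that(1), of j] that(2) by simp
  then show ?thesis unfolding pf_sum_def pf_term_def
    by (intro has_derivative_sum has_derivative_mult_right has_derivative_prod assms) auto
qed

text \<open>Here \<open>D\<close> stands for a derivative of the matrix entries that acts as minus
  an infinitesimal change \<open>M\<close> of the arguments. For each \<open>\<sigma>\<close>, the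
  two summands of \<open>D\<close> at the pair \<open>i\<close> are the replacements at the
  positions \<open>2*i\<close> and \<open>2*i+1\<close>, so the product rule runs through every
  argument once.\<close>

lemma pf_sum_derivation:
  assumes "\<And>a b. a < 2*k \<Longrightarrow> b < 2*k \<Longrightarrow> D a b = - (B (M a) (v b) + B (v a) (M b))"
  shows "(\<Sum>\<sigma> | \<sigma> permutes {..<2*k}. of_int (sign \<sigma>) *
        (\<Sum>i<k. D (\<sigma> (2*i)) (\<sigma> (2*i+1)) *
          (\<Prod>j\<in>{..<k}-{i}. B (v (\<sigma> (2*j))) (v (\<sigma> (2*j+1))))))
     = - (\<Sum>m<2*k. pf_sum B k (v(m := M m)))"
proof -
  have "of_int (sign \<sigma>) * (\<Sum>i<k. D (\<sigma> (2*i)) (\<sigma> (2*i+1)) *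
          (\<Prod>j\<in>{..<k}-{i}. B (v (\<sigma> (2*j))) (v (\<sigma> (2*j+1)))))
      = - (\<Sum>m<2*k. pf_term B k (v(m := M m)) \<sigma>)" (is "?l = _") if \<sigma>: "\<sigma> permutes {..<2*k}" for \<sigma>
  proof -
    let ?P = "\<lambda>i. \<Prod>j\<in>{..<k}-{i}. B (v (\<sigma> (2*j))) (v (\<sigma> (2*j+1)))"
    have lt: "\<sigma> j < 2*k" if "j < 2*k" for j
      using permutes_in_image[OF \<sigma>, of j] that by simp
    have "(\<Sum>m<2*k. pf_term B k (v(m := M m)) \<sigma>) = (\<Sum>p<2*k. pf_term B k (v(\<sigma> p := M (\<sigma> p))) \<sigma>)"
      using sum.permute[OF \<sigma>, of "\<lambda>m. pf_term B k (v(m := M m)) \<sigma>"] by (simp add: o_def)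
    also have "\<dots> = (\<Sum>i<k. pf_term B k (v(\<sigma> (2*i) := M (\<sigma> (2*i)))) \<sigma>
        + pf_term B k (v(\<sigma> (2*i+1) := M (\<sigma> (2*i+1)))) \<sigma>)"
      by (rule sum_double)
    also have "\<dots> = (\<Sum>i<k. of_int (sign \<sigma>) * (- D (\<sigma> (2*i)) (\<sigma> (2*i+1)) * ?P i))"
    proof (rule sum.cong[OF refl])
      fix i assume "i \<in> {..<k}"
      then have i: "2*i < 2*k" "2*i+1 < 2*k" by auto
      show "pf_term B k (v(\<sigma> (2*i) := M (\<sigma> (2*i)))) \<sigma> + pf_term B k (v(\<sigma> (2*i+1) := M (\<sigma> (2*i+1)))) \<sigma>
        = of_int (sign \<sigma>) * (- D (\<sigma> (2*i)) (\<sigma> (2*i+1)) * ?P i)"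
        unfolding pf_term_upd[OF \<sigma> i(1)] pf_term_upd[OF \<sigma> i(2)]
        using assms[OF lt[OF i(1)] lt[OF i(2)]] by (simp add: distrib_left distrib_right)
    qed
    also have "\<dots> = - ?l" by (simp add: sum_distrib_left sum_negf)
    finally show ?thesis by simp
  qed
  then have "(\<Sum>\<sigma> | \<sigma> permutes {..<2*k}. of_int (sign \<sigma>) *
        (\<Sum>i<k. D (\<sigma> (2*i)) (\<sigma> (2*i+1)) *
          (\<Prod>j\<in>{..<k}-{i}. B (v (\<sigma> (2*j))) (v (\<sigma> (2*j+1))))))
    = - (\<Sum>\<sigma> | \<sigma> permutes {..<2*k}. \<Sum>m<2*k. pf_term B k (v(m := M m)) \<sigma>)"
    by (simp add: sum_negf)
  also have "\<dots> = - (\<Sum>m<2*k. pf_sum B k (v(m := M m)))"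
    unfolding pf_sum_def by (subst sum.swap) simp
  finally show ?thesis .
qed

section \<open>Positivity of the top power of a positive Hermitian form\<close>

definition adapted_frame :: "('v \<Rightarrow> 'v) \<Rightarrow> (nat \<Rightarrow> 'v) \<Rightarrow> nat \<Rightarrow> 'v"
  where "adapted_frame J e m = (if even m then e (m div 2) else J (e (m div 2)))"

definition pair_swap :: "nat \<Rightarrow> nat \<Rightarrow> nat"
  where "pair_swap b = Transposition.transpose 0 (2*b) \<circ> Transposition.transpose 1 (2*b+1)"

text \<open>Exchanging two whole pairs is an even permutation and merely reorders the
  factors.\<close>

lemma pf_term_pair_swap:
  assumes \<sigma>: "\<sigma> permutes {..<2*k}" and b: "b < k"
  shows "pair_swap b permutes {..<2*k}" "pf_term B k v (\<sigma> \<circ> pair_swap b) = pf_term B k v \<sigma>"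
proof -
  have t: "Transposition.transpose 0 (2*b) permutes {..<2*k}" "Transposition.transpose 1 (2*b+1) permutes {..<2*k}"
    using b by (auto intro!: permutes_swap_id)
  then show p: "pair_swap b permutes {..<2*k}" unfolding pair_swap_def by (intro permutes_compose)
  have "sign (pair_swap b) = 1"
    unfolding pair_swap_def by (subst sign_compose_permutes[OF _ t]) (auto simp: sign_swap_id)
  then have s: "sign (\<sigma> \<circ> pair_swap b) = sign \<sigma>"
    using sign_compose_permutes[OF _ \<sigma> p] by simp
  have tb: "Transposition.transpose 0 b permutes {..<k}" using b by (intro permutes_swap_id) auto
  have v: "pair_swap b (2*i) = 2 * Transposition.transpose 0 b i"
     "pair_swap b (2*i+1) = 2 * Transposition.transpose 0 b i + 1" for i
  proof -
    have "2 * i \<noteq> Suc (2*b)" "2 * i \<noteq> 1" "2 * i + 1 \<noteq> 2 * b" by presburger+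
    then show "pair_swap b (2*i) = 2 * Transposition.transpose 0 b i"
     "pair_swap b (2*i+1) = 2 * Transposition.transpose 0 b i + 1"
      by (auto simp: pair_swap_def Transposition.transpose_def)
  qed
  have "(\<Prod>i<k. B (v (\<sigma> (2*i))) (v (\<sigma> (2*i+1))))
      = (\<Prod>i<k. B (v (\<sigma> (2 * Transposition.transpose 0 b i))) (v (\<sigma> (2 * Transposition.transpose 0 b i + 1))))"
    using prod.permute[OF tb, of "\<lambda>i. B (v (\<sigma> (2*i))) (v (\<sigma> (2*i+1)))"] by (simp add: o_def)
  then show "pf_term B k v (\<sigma> \<circ> pair_swap b) = pf_term B k v \<sigma>"
    unfolding pf_term_def s using v by simp
qed

text \<open>The sign of the transposition cancels against the antisymmetry of \<open>B\<close> in
  one factor.\<close>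

lemma pf_term_flip:
  assumes anti: "\<And>x y. B x y = - B y x" and \<sigma>: "\<sigma> permutes {..<2*k}" and b: "b < k"
  shows "Transposition.transpose (2*b) (2*b+1) permutes {..<2*k}"
    "pf_term B k v (\<sigma> \<circ> Transposition.transpose (2*b) (2*b+1)) = pf_term B k v \<sigma>"
proof -
  let ?t = "Transposition.transpose (2*b) (2*b+1)"
  show t: "?t permutes {..<2*k}" using b by (auto intro!: permutes_swap_id)
  have "sign ?t = -1" by (simp add: sign_swap_id)
  then have s: "sign (\<sigma> \<circ> ?t) = - sign \<sigma>"
    using sign_compose_permutes[OF _ \<sigma> t] by simp
  have bk: "b \<in> {..<k}" using b by simp
  have "(\<Prod>i<k. B (v (\<sigma> (?t (2*i)))) (v (\<sigma> (?t (2*i+1)))))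
    = - B (v (\<sigma> (2*b))) (v (\<sigma> (2*b+1))) * (\<Prod>i\<in>{..<k}-{b}. B (v (\<sigma> (?t (2*i)))) (v (\<sigma> (?t (2*i+1)))))"
    by (subst prod.remove[OF _ bk]) (auto simp: anti[of "v (\<sigma> (Suc (2*b)))"])
  also have "(\<Prod>i\<in>{..<k}-{b}. B (v (\<sigma> (?t (2*i)))) (v (\<sigma> (?t (2*i+1)))))
    = (\<Prod>i\<in>{..<k}-{b}. B (v (\<sigma> (2*i))) (v (\<sigma> (2*i+1))))"
  proof (rule prod.cong[OF refl])
    fix i assume "i \<in> {..<k} - {b}"
    then have "2*i \<noteq> 2*b" "2*i \<noteq> 2*b+1" "2*i+1 \<noteq> 2*b" "2*i+1 \<noteq> 2*b+1" by (simp, presburger, presburger, simp)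
    then have "?t (2*i) = 2*i" "?t (2*i+1) = 2*i+1" by (simp_all add: Transposition.transpose_def)
    then show "B (v (\<sigma> (?t (2*i)))) (v (\<sigma> (?t (2*i+1)))) = B (v (\<sigma> (2*i))) (v (\<sigma> (2*i+1)))" by simp
  qed
  also have "- B (v (\<sigma> (2*b))) (v (\<sigma> (2*b+1))) * \<dots> = - (\<Prod>i<k. B (v (\<sigma> (2*i))) (v (\<sigma> (2*i+1))))"
    by (subst prod.remove[OF _ bk, of "\<lambda>i. B (v (\<sigma> (2*i))) (v (\<sigma> (2*i+1)))"]) auto
  finally show "pf_term B k v (\<sigma> \<circ> ?t) = pf_term B k v \<sigma>"
    unfolding pf_term_def s by simp
qed

text \<open>Pair exchanges and flips bring the argument 0 to the position 0 from any of the
  \<open>2 * Suc k\<close> positions without changing the term, whence the factor. Among the terms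
  with \<open>\<sigma> 0 = 0\<close>, orthogonality leaves those with \<open>\<sigma> 1 = 1\<close>,
  and these are the \<open>shift2 \<tau>\<close>.\<close>

lemma pf_sum_split_first:
  fixes B :: "'v \<Rightarrow> 'v \<Rightarrow> real"
  assumes anti: "\<And>x y. B x y = - B y x"
    and orth: "\<And>i. 2 \<le> i \<Longrightarrow> i < 2 * Suc k \<Longrightarrow> B (v 0) (v i) = 0"
  shows "pf_sum B (Suc k) v = 2 * Suc k * (B (v 0) (v 1) * pf_sum B k (\<lambda>i. v (i + 2)))"
proof -
  let ?N = "{..<2 * Suc k}"
  let ?P = "{\<sigma>. \<sigma> permutes ?N}"
  let ?t = "pf_term B (Suc k) v"
  have fin: "finite ?P" by (simp add: finite_permutations)
  have move: "(\<Sum>\<sigma>\<in>?P. if \<sigma> p = 0 then ?t \<sigma> else 0) = (\<Sum>\<sigma>\<in>?P. if \<sigma> 0 = 0 then ?t \<sigma> else 0)"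
    if p: "p < 2 * Suc k" for p
  proof -
    have "\<exists>\<rho>. \<rho> permutes ?N \<and> \<rho> 0 = p \<and> (\<forall>\<sigma>\<in>?P. ?t (\<sigma> \<circ> \<rho>) = ?t \<sigma>)"
    proof (cases "even p")
      case True
      then obtain b where b: "p = 2*b" "b < Suc k" using p by auto
      have "pair_swap b 0 = p" by (simp add: b pair_swap_def Transposition.transpose_def)
      then show ?thesis using pf_term_pair_swap[OF _ b(2)] permutes_id by blast
    next
      case False
      \<comment> \<open>At an odd position, a flip inside the pair is combined with the exchange of
        pairs.\<close>
      then obtain b where b: "p = 2*b+1" "b < Suc k" using p by (auto elim!: oddE)
      let ?f = "Transposition.transpose (2*b) (2*b+1)"
      have f: "?f permutes ?N" using pf_term_flip(1)[OF anti permutes_id b(2)] .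
      have s: "pair_swap b permutes ?N" using pf_term_pair_swap(1)[OF permutes_id b(2)] .
      have 1: "(?f \<circ> pair_swap b) permutes ?N" by (rule permutes_compose[OF s f])
      have 2: "(?f \<circ> pair_swap b) 0 = p" by (simp add: b pair_swap_def Transposition.transpose_def)
      have 3: "?t (\<sigma> \<circ> (?f \<circ> pair_swap b)) = ?t \<sigma>" if "\<sigma> \<in> ?P" for \<sigma>
      proof -
        have \<sigma>: "\<sigma> permutes ?N" using that by simp
        have "?t ((\<sigma> \<circ> ?f) \<circ> pair_swap b) = ?t (\<sigma> \<circ> ?f)"
          by (rule pf_term_pair_swap(2)[OF permutes_compose[OF f \<sigma>] b(2)])
        also have "\<dots> = ?t \<sigma>" by (rule pf_term_flip(2)[OF anti \<sigma> b(2)])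
        finally show ?thesis by (simp add: comp_assoc)
      qed
      show ?thesis using 1 2 3 by blast
    qed
    then obtain \<rho> where \<rho>: "\<rho> permutes ?N" "\<rho> 0 = p" "\<And>\<sigma>. \<sigma> \<in> ?P \<Longrightarrow> ?t (\<sigma> \<circ> \<rho>) = ?t \<sigma>" by blast
    have "(\<Sum>\<sigma>\<in>?P. if \<sigma> 0 = 0 then ?t \<sigma> else 0) = (\<Sum>\<sigma>\<in>?P. if (\<sigma> \<circ> \<rho>) 0 = 0 then ?t (\<sigma> \<circ> \<rho>) else 0)"
      by (rule sum_permutations_compose_right[OF \<rho>(1)])
    also have "\<dots> = (\<Sum>\<sigma>\<in>?P. if \<sigma> p = 0 then ?t \<sigma> else 0)"
      by (rule sum.cong[OF refl]) (simp add: \<rho>)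
    finally show ?thesis by simp
  qed
  have "pf_sum B (Suc k) v = (\<Sum>\<sigma>\<in>?P. \<Sum>p<2 * Suc k. if \<sigma> p = 0 then ?t \<sigma> else 0)"
    unfolding pf_sum_def
  proof (rule sum.cong[OF refl])
    fix \<sigma> assume "\<sigma> \<in> ?P"
    then have \<sigma>: "\<sigma> permutes ?N" by simp
    have "\<sigma> p = 0 \<longleftrightarrow> p = inv \<sigma> 0" for p using permutes_inv_eq[OF \<sigma>, of 0 p] by auto
    moreover have "inv \<sigma> 0 < 2 * Suc k"
      using permutes_in_image[OF permutes_inv[OF \<sigma>], of 0] by simp
    ultimately show "?t \<sigma> = (\<Sum>p<2 * Suc k. if \<sigma> p = 0 then ?t \<sigma> else 0)" by (simp add: sum.delta)
  qed
  also have "\<dots> = (\<Sum>p<2 * Suc k. \<Sum>\<sigma>\<in>?P. if \<sigma> p = 0 then ?t \<sigma> else 0)" by (rule sum.swap)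
  also have "\<dots> = (\<Sum>p<2 * Suc k. \<Sum>\<sigma>\<in>?P. if \<sigma> 0 = 0 then ?t \<sigma> else 0)"
    by (rule sum.cong[OF refl]) (rule move, simp)
  also have "\<dots> = 2 * Suc k * (\<Sum>\<sigma>\<in>?P. if \<sigma> 0 = 0 then ?t \<sigma> else 0)" by simp
  also have "(\<Sum>\<sigma>\<in>?P. if \<sigma> 0 = 0 then ?t \<sigma> else 0) = (\<Sum>\<sigma>\<in>shift2 ` {\<tau>. \<tau> permutes {..<2*k}}. ?t \<sigma>)"
  proof (rule sum.mono_neutral_cong_right[OF fin])
    show "shift2 ` {\<tau>. \<tau> permutes {..<2*k}} \<subseteq> ?P" using shift2_permutes(1)[of _ "2*k"] by auto
    show "\<forall>\<sigma>\<in>?P - shift2 ` {\<tau>. \<tau> permutes {..<2*k}}. (if \<sigma> 0 = 0 then ?t \<sigma> else 0) = 0"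
    proof (rule ballI, rule ccontr)
      fix \<sigma> assume \<sigma>': "\<sigma> \<in> ?P - shift2 ` {\<tau>. \<tau> permutes {..<2*k}}"
        and nz: "(if \<sigma> 0 = 0 then ?t \<sigma> else 0) \<noteq> 0"
      from \<sigma>' have \<sigma>: "\<sigma> permutes ?N" by simp
      have inj: "\<sigma> i = \<sigma> j \<longleftrightarrow> i = j" for i j using permutes_inj[OF \<sigma>] by (auto dest: injD)
      have im: "\<sigma> i < 2 * Suc k \<longleftrightarrow> i < 2 * Suc k" for i using permutes_in_image[OF \<sigma>, of i] by simp
      have 0: "\<sigma> 0 = 0" using nz by (auto split: if_splits)
      have "B (v (\<sigma> 0)) (v (\<sigma> 1)) \<noteq> 0"
        using nz unfolding pf_term_def prod_double_Suc_shift[of "\<lambda>i j. B (v (\<sigma> i)) (v (\<sigma> j))"]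
        by (auto split: if_splits)
      then have "\<sigma> 1 < 2" using orth[of "\<sigma> 1"] im[of 1] 0 by fastforce
      moreover have "\<sigma> 1 \<noteq> 0" using inj[of 1 0] 0 by auto
      ultimately have 1: "\<sigma> 1 = 1" by auto
      have ge: "\<sigma> (i + 2) \<ge> 2" for i
        using inj[of "i + 2" 0] inj[of "i + 2" 1] 0 1 by (cases "\<sigma> (i+2)") auto
      define \<tau> where "\<tau> i = \<sigma> (i + 2) - 2" for i
      have \<tau>: "\<tau> i + 2 = \<sigma> (i + 2)" for i using ge[of i] by (simp add: \<tau>_def)
      have i: "inj_on \<tau> {..<2*k}"
      proof (rule inj_onI)
        fix i j assume "\<tau> i = \<tau> j"
        then have "\<sigma> (i + 2) = \<sigma> (j + 2)" using \<tau> by metis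
        then show "i = j" using inj by simp
      qed
      have "\<tau> ` {..<2*k} \<subseteq> {..<2*k}"
      proof clarify
        fix i assume "i < 2*k"
        then have "\<sigma> (i + 2) < 2 * Suc k" using im[of "i + 2"] by simp
        then show "\<tau> i < 2*k" using \<tau>[of i] by simp
      qed
      then have "\<tau> ` {..<2*k} = {..<2*k}" using i by (simp add: endo_inj_surj)
      moreover have "\<tau> i = i" if "i \<notin> {..<2*k}" for i
        using permutes_not_in[OF \<sigma>, of "i + 2"] that \<tau>[of i] by simp
      ultimately have "\<tau> permutes {..<2*k}" using i by (intro bij_imp_permutes) (auto simp: bij_betw_def)
      moreover have "\<sigma> = shift2 \<tau>"
      proof
        fix j :: nat
        consider "j = 0" | "j = 1" | i where "j = i + 2"
          by (metis add_2_eq_Suc' not0_implies_Suc One_nat_def)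
        then show "\<sigma> j = shift2 \<tau> j" using 0 1 \<tau> by cases (auto simp: shift2_def)
      qed
      ultimately show False using \<sigma>' by auto
    qed
  qed (auto simp: shift2_def)
  also have "\<dots> = (\<Sum>\<tau> | \<tau> permutes {..<2*k}. ?t (shift2 \<tau>))"
  proof (rule sum.reindex_cong[OF _ refl refl])
    show "inj_on shift2 {\<tau>. \<tau> permutes {..<2*k}}"
    proof (rule inj_onI, rule ext)
      fix \<sigma> \<tau> and j :: nat assume "shift2 \<sigma> = shift2 \<tau>"
      from fun_cong[OF this, of "j + 2"] show "\<sigma> j = \<tau> j" by (simp add: shift2_def)
    qed
  qed
  also have "\<dots> = (\<Sum>\<tau> | \<tau> permutes {..<2*k}. B (v 0) (v 1) * pf_term B k (\<lambda>i. v (i + 2)) \<tau>)"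
  proof (rule sum.cong[OF refl])
    fix \<tau> assume "\<tau> \<in> {\<tau>. \<tau> permutes {..<2*k}}"
    then have s: "sign (shift2 \<tau>) = sign \<tau>" by (auto intro: shift2_permutes)
    show "?t (shift2 \<tau>) = B (v 0) (v 1) * pf_term B k (\<lambda>i. v (i + 2)) \<tau>"
      unfolding pf_term_def s prod_double_Suc_shift[of "\<lambda>i j. B (v (shift2 \<tau> i)) (v (shift2 \<tau> j))"]
      by (simp add: shift2_def)
  qed
  finally show ?thesis unfolding pf_sum_def by (simp add: sum_distrib_left)
qed

text \<open>As with column operations on a determinant, adding multiples of the first two arguments
  to a later one only creates terms with a repeated argument. The arguments are changed one at a
  time, and the induction on \<open>j\<close> counts those already done.\<close>

lemma pf_sum_add_first_two:
  fixes B :: "'v::real_vector \<Rightarrow> 'v \<Rightarrow> real"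
  assumes B: "bilinear B"
    and w: "\<And>m. w m = (if m < 2 then v m else v m + a m *\<^sub>R v 0 + b m *\<^sub>R v 1)"
  shows "pf_sum B k w = pf_sum B k v"
proof -
  have "pf_sum B k (\<lambda>m. if m < j then w m else v m) = pf_sum B k v" if "j \<le> 2*k" for j
    using that
  proof (induction j)
    case (Suc j)
    define u where "u = (\<lambda>m. if m < j then w m else v m)"
    have u: "pf_sum B k u = pf_sum B k v" unfolding u_def using Suc by simp
    have j: "j < 2*k" using Suc.prems by simp
    note lin = linear_pf_sum[OF B j, of u]
    show ?case
    proof (cases "j < 2")
      case True
      then have "(\<lambda>m. if m < Suc j then w m else v m) = u" by (auto simp: u_def w less_Suc_eq)
      then show ?thesis using u by simp
    next
      case False
      then have 01: "u 0 = v 0" "u 1 = v 1" by (auto simp: u_def w)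
      have "(\<lambda>m. if m < Suc j then w m else v m) = u(j := u j + a j *\<^sub>R u 0 + b j *\<^sub>R u 1)"
        unfolding 01 using False by (auto simp: u_def w less_Suc_eq)
      then have "pf_sum B k (\<lambda>m. if m < Suc j then w m else v m)
        = pf_sum B k (u(j := u j)) + a j * pf_sum B k (u(j := u 0)) + b j * pf_sum B k (u(j := u 1))"
        by (simp only: linear_add[OF lin] linear_scale[OF lin] real_scaleR_def)
      moreover have "pf_sum B k (u(j := u 0)) = 0"
        by (rule pf_sum_repeated[of 0 k j]) (use False j in auto)
      moreover have "pf_sum B k (u(j := u 1)) = 0"
        by (rule pf_sum_repeated[of 1 k j]) (use False j in auto)
      ultimately show ?thesis using u by simp
    qed
  qed simp
  from this[of "2*k"] have "pf_sum B k (\<lambda>m. if m < 2*k then w m else v m) = pf_sum B k v" by simp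
  moreover have "pf_sum B k (\<lambda>m. if m < 2*k then w m else v m) = pf_sum B k w"
  proof -
    have "pf_term B k (\<lambda>m. if m < 2*k then w m else v m) \<sigma> = pf_term B k w \<sigma>" if "\<sigma> permutes {..<2*k}" for \<sigma>
    proof -
      have "\<sigma> j < 2*k" if "j < 2*k" for j
        using permutes_in_image[OF \<open>\<sigma> permutes {..<2*k}\<close>, of j] that by simp
      then show ?thesis unfolding pf_term_def by (auto intro!: prod.cong)
    qed
    then show ?thesis unfolding pf_sum_def by simp
  qed
  ultimately show ?thesis by simp
qed

text \<open>Gram-Schmidt for the Hermitian form with real part \<open>B x (J y)\<close>: removing
  from the later vectors their components along the complex line of \<open>e 0\<close> preserves the
  sum, and \<open>pf_sum_split_first\<close> extracts the positive factor
  \<open>B (e 0) (J (e 0))\<close>.\<close>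

lemma pf_sum_pos:
  fixes B :: "'v::real_vector \<Rightarrow> 'v \<Rightarrow> real"
  assumes J: "linear J" "\<And>x. J (J x) = - x"
    and B: "bilinear B" "\<And>x y. B x y = - B y x" "\<And>x y. B (J x) (J y) = B x y"
  shows "(\<And>c. (\<exists>i<k. c i \<noteq> 0) \<Longrightarrow>
      B (\<Sum>i<k. Re (c i) *\<^sub>R e i + Im (c i) *\<^sub>R J (e i)) (J (\<Sum>i<k. Re (c i) *\<^sub>R e i + Im (c i) *\<^sub>R J (e i))) > 0)
    \<Longrightarrow> pf_sum B k (adapted_frame J e) > 0"
proof (induction k arbitrary: e)
  case 0
  then show ?case by (simp add: pf_sum_def pf_term_def)
next
  case (Suc k)
  define cs where "cs c x = Re c *\<^sub>R x + Im c *\<^sub>R J x" for c x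
  note BL = bilinear_ladd[OF B(1)] bilinear_radd[OF B(1)] bilinear_lmul[OF B(1)] bilinear_rmul[OF B(1)]
    bilinear_lneg[OF B(1)] bilinear_rneg[OF B(1)] bilinear_lsub[OF B(1)] bilinear_rsub[OF B(1)]
  note JL = linear_add[OF J(1)] linear_scale[OF J(1)] linear_diff[OF J(1)] linear_neg[OF J(1)]
  have cs_cs: "cs c (cs d x) = cs (c * d) x" for c d x
    by (simp add: cs_def JL J(2) algebra_simps)
  have cs_diff: "cs c (x - y) = cs c x - cs c y" for c x y
    by (simp add: cs_def JL algebra_simps)
  have cs_sum: "(\<Sum>i\<in>I. cs (c i) x) = cs (\<Sum>i\<in>I. c i) x" for c I x
    by (simp add: cs_def scaleR_sum_left sum.distrib)
  define b0 where "b0 = B (e 0) (J (e 0))"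
  have "(\<Sum>i<Suc k. cs (if i = 0 then 1 else 0) (e i)) = e 0"
    by (subst sum.lessThan_Suc_shift) (simp add: cs_def)
  then have b0: "b0 > 0"
    using Suc.prems[of "\<lambda>i. if i = 0 then 1 else 0"] by (auto simp: cs_def[symmetric] b0_def)
  \<comment> \<open>With these coefficients \<open>B\<close> vanishes between \<open>e' i\<close>
    and both \<open>e 0\<close> and \<open>J (e 0)\<close>, that is, \<open>e' i\<close> is
    orthogonal to the complex line of \<open>e 0\<close>.\<close>
  define \<beta> where "\<beta> i = B (e 0) (e (Suc i)) / b0" for i
  define \<alpha> where "\<alpha> i = - B (J (e 0)) (e (Suc i)) / b0" for i
  define e' where "e' i = e (Suc i) - cs (Complex (\<alpha> i) (\<beta> i)) (e 0)" for i
  have B00: "B (e 0) (e 0) = 0" "B (J (e 0)) (J (e 0)) = 0" "B (J (e 0)) (e 0) = - b0"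
    using B(2)[of "e 0" "e 0"] B(2)[of "J (e 0)" "J (e 0)"] B(2)[of "J (e 0)" "e 0"] by (auto simp: b0_def)
  have o1: "B (e 0) (e' i) = 0" for i
    using b0 B00 by (simp add: e'_def cs_def BL \<beta>_def b0_def[symmetric])
  have o2: "B (J (e 0)) (e' i) = 0" for i
    using b0 B00 by (simp add: e'_def cs_def BL \<alpha>_def)
  have o3: "B (e 0) (J (e' i)) = 0" for i
    using B(3)[of "e 0" "J (e' i)", symmetric] o2[of i] by (simp add: J(2) BL)
  have pos: "pf_sum B k (adapted_frame J e') > 0"
  proof (rule Suc.IH)
    fix c :: "nat \<Rightarrow> complex" assume c: "\<exists>i<k. c i \<noteq> 0"
    \<comment> \<open>A combination of the \<open>e' i\<close> is rewritten in terms of the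
      \<open>e i\<close>; the coefficient of \<open>e 0\<close> collects what was subtracted, so
      positivity passes to the new vectors.\<close>
    define d where "d i = (case i of 0 \<Rightarrow> - (\<Sum>i<k. c i * Complex (\<alpha> i) (\<beta> i)) | Suc j \<Rightarrow> c j)" for i
    have "(\<Sum>i<Suc k. cs (d i) (e i)) = (\<Sum>i<k. cs (c i) (e' i))"
      unfolding e'_def cs_diff cs_cs sum_subtractf cs_sum
      by (subst sum.lessThan_Suc_shift) (simp add: d_def, simp add: cs_def)
    moreover have "\<exists>i<Suc k. d i \<noteq> 0"
    proof -
      from c obtain j where "j < k" "c j \<noteq> 0" by blast
      then show ?thesis by (intro exI[of _ "Suc j"]) (simp add: d_def)
    qed
    ultimately show "B (\<Sum>i<k. Re (c i) *\<^sub>R e' i + Im (c i) *\<^sub>R J (e' i)) (J (\<Sum>i<k. Re (c i) *\<^sub>R e' i + Im (c i) *\<^sub>R J (e' i))) > 0"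
      using Suc.prems[of d] by (simp only: cs_def)
  qed
  have tail: "adapted_frame J (case_nat (e 0) e') (m + 2) = adapted_frame J e' m" for m
    by (simp add: adapted_frame_def)
  have same: "pf_sum B (Suc k) (adapted_frame J (case_nat (e 0) e')) = pf_sum B (Suc k) (adapted_frame J e)"
  proof (rule pf_sum_add_first_two[OF B(1)])
    fix m :: nat
    consider "m = 0" | "m = 1" | i where "m = i + 2"
      by (metis add_2_eq_Suc' not0_implies_Suc One_nat_def)
    then show "adapted_frame J (case_nat (e 0) e') m = (if m < 2 then adapted_frame J e m else adapted_frame J e m
        + (if even m then - \<alpha> (m div 2 - 1) else \<beta> (m div 2 - 1)) *\<^sub>R adapted_frame J e 0
        + (if even m then - \<beta> (m div 2 - 1) else - \<alpha> (m div 2 - 1)) *\<^sub>R adapted_frame J e 1)"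
      by cases (auto simp: adapted_frame_def e'_def cs_def JL J(2) algebra_simps)
  qed
  have split: "pf_sum B (Suc k) (adapted_frame J (case_nat (e 0) e'))
      = 2 * Suc k * (b0 * pf_sum B k (\<lambda>m. adapted_frame J (case_nat (e 0) e') (m + 2)))"
  proof (subst pf_sum_split_first[OF B(2)])
    fix i :: nat assume "2 \<le> i"
    then obtain m where "i = m + 2" by (metis add.commute le_Suc_ex)
    then show "B (adapted_frame J (case_nat (e 0) e') 0) (adapted_frame J (case_nat (e 0) e') i) = 0"
      by (auto simp: adapted_frame_def o1 o3)
  qed (simp add: adapted_frame_def b0_def)
  show ?case unfolding same[symmetric] split tail using b0 pos by simp
qed

section \<open>Holomorphic functions of several variables\<close>

lemma vector_scalar_mult_Complex: "c *s (v::complex^'n) = Re c *\<^sub>R v + Im c *\<^sub>R (\<i> *s v)"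
  by (simp add: vec_eq_iff complex_eq_iff)

lemma bounded_linear_scalar_mult_left: "bounded_linear (\<lambda>z::complex. z *s (v::complex^'n::finite))"
  by (intro linear_conv_bounded_linear[THEN iffD1] linearI)
    (simp_all add: vec_eq_iff distrib_right)

lemma bounded_linear_scalar_mult_right: "bounded_linear (\<lambda>v::complex^'n::finite. c *s v)"
  by (intro linear_conv_bounded_linear[THEN iffD1] linearI)
    (simp_all add: vec_eq_iff distrib_left)

lemma norm_scalar_mult_complex: "norm (c *s (v::complex^'n::finite)) = cmod c * norm v"
  unfolding norm_vec_def by (simp add: norm_mult L2_set_right_distrib)

lemma linear_J_vec: "linear (J_vec :: complex^'n::finite \<Rightarrow> _)"
  unfolding J_vec_def[abs_def] using bounded_linear_scalar_mult_right bounded_linear.linear by blast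

lemma linear_J_prod: "linear (J_prod :: complex \<times> (complex^'n::finite) \<Rightarrow> _)"
  by (intro linearI) (simp_all add: J_prod_def vec_eq_iff distrib_left prod_eq_iff)

lemma J_vec_J_vec [simp]: "J_vec (J_vec v) = - v"
  by (simp add: J_vec_def vec_eq_iff)

lemma J_prod_J_prod [simp]: "J_prod (J_prod v) = - v"
  by (simp add: J_prod_def vec_eq_iff prod_eq_iff)

lemma holo_on_has_derivative:
  "holo_on S f \<Longrightarrow> x \<in> S \<Longrightarrow> (f has_derivative fderiv f x) (at x)"
  unfolding holo_on_def by (metis frechet_derivative_at)

lemma holo_on_fderiv_scale:
  assumes "holo_on S f" "x \<in> S"
  shows "fderiv f x (c *s v) = c * fderiv f x v"
proof -
  have lin: "linear (fderiv f x)" using holo_on_has_derivative[OF assms] has_derivative_linear by blast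
  obtain D where D: "(f has_derivative D) (at x)" "\<forall>v. D (\<i> *s v) = \<i> * D v"
    using assms unfolding holo_on_def by blast
  have i: "fderiv f x (\<i> *s v) = \<i> * fderiv f x v" using D fderiv_eqI[OF D(1)] by simp
  show ?thesis unfolding vector_scalar_mult_Complex[of c v] linear_add[OF lin] linear_scale[OF lin] i
    by (simp add: complex_eq_iff)
qed

lemma holo_on_subset: "holo_on S f \<Longrightarrow> T \<subseteq> S \<Longrightarrow> holo_on T f"
  unfolding holo_on_def by blast

lemma holo_on_continuous_on: "holo_on S f \<Longrightarrow> continuous_on S f"
  by (meson continuous_at_imp_continuous_on has_derivative_continuous holo_on_has_derivative)

text \<open>Restriction to a complex line, through which the one-variable theory enters.\<close>

lemma holo_on_line:
  fixes f :: "complex^'n::finite \<Rightarrow> complex"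
  assumes "holo_on S f" "x + z *s v \<in> S"
  shows "((\<lambda>z. f (x + z *s v)) has_field_derivative fderiv f (x + z *s v) v) (at z)"
proof -
  have "((\<lambda>z. x + z *s v) has_derivative (\<lambda>z. z *s v)) (at z)"
    using has_derivative_add[OF has_derivative_const
        bounded_linear_imp_has_derivative[OF bounded_linear_scalar_mult_left]] by simp
  from has_derivative_compose[OF this holo_on_has_derivative[OF assms]]
  show ?thesis
    by (rule has_derivative_imp_has_field_derivative)
      (simp add: holo_on_fderiv_scale[OF assms] mult.commute)
qed

text \<open>Cauchy's formula for the derivative on the complex line through \<open>x\<close> in
  direction \<open>v\<close>. The radius \<open>\<rho>\<close> is the same for all \<open>x\<close>
  in the half ball, so the right-hand side is an integral with parameter \<open>x\<close> that
  involves only values of \<open>f\<close>.\<close>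

lemma holo_on_fderiv_integral:
  fixes f :: "complex^'n::finite \<Rightarrow> complex"
  assumes f: "holo_on S f" and R: "cball x0 R \<subseteq> S"
    and \<rho>: "\<rho> > 0" "\<rho> * norm v \<le> R / 2" and x: "x \<in> ball x0 (R/2)"
  shows "fderiv f x v = (LINT t:{0..1}|lborel.
    f (x + (of_real \<rho> * exp (2 * of_real pi * \<i> * of_real t)) *s v) / (of_real \<rho> * exp (2 * of_real pi * \<i> * of_real t)))"
proof -
  let ?e = "\<lambda>t. of_real \<rho> * exp (2 * of_real pi * \<i> * of_real t)"
  have inS: "x + z *s v \<in> S" if "norm z \<le> \<rho>" for z
  proof -
    have "norm (x0 - (x + z *s v)) \<le> norm (x0 - x) + norm (z *s v)"
      by (metis diff_diff_eq norm_triangle_ineq4)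
    also have "norm (z *s v) \<le> R / 2"
      using that \<rho> mult_right_mono[OF that norm_ge_zero[of v]] by (simp add: norm_scalar_mult_complex)
    finally show ?thesis using x R by (auto simp: dist_norm)
  qed
  define g where "g z = f (x + z *s v)" for z
  have der: "(g has_field_derivative fderiv f (x + z *s v) v) (at z)" if "norm z \<le> \<rho>" for z
    unfolding g_def by (rule holo_on_line[OF f inS[OF that]])
  have hol: "g holomorphic_on cball 0 \<rho>"
    by (rule holomorphic_onI) (use der in \<open>auto simp: field_differentiable_def intro: has_field_derivative_at_within\<close>)
  have cont: "continuous_on (cball 0 \<rho>) g" by (rule holomorphic_on_imp_continuous_on[OF hol])
  have "(g has_field_derivative (1 / (2 * of_real pi * \<i>) *
      contour_integral (circlepath 0 \<rho>) (\<lambda>u. g u / (u - 0)^2))) (at 0)"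
    by (rule Cauchy_derivative_integral_circlepath(2)[OF cont])
      (use hol \<rho> in \<open>auto intro: holomorphic_on_subset\<close>)
  then have "fderiv f x v = 1 / (2 * of_real pi * \<i>) * contour_integral (circlepath 0 \<rho>) (\<lambda>u. g u / (u - 0)^2)"
    using der[of 0] \<rho> by (auto dest: DERIV_unique)
  also have "contour_integral (circlepath 0 \<rho>) (\<lambda>u. g u / (u - 0)^2)
    = integral {0..1} (\<lambda>t. (2 * of_real pi * \<i>) * (g (?e t) / ?e t))"
    unfolding contour_integral_integral
  proof (rule integral_cong)
    fix t :: real assume "t \<in> {0..1}"
    have "?e t \<noteq> 0" using \<rho> by simp
    moreover have "vector_derivative (circlepath 0 \<rho>) (at t) = 2 * of_real pi * \<i> * ?e t"
      by (simp add: vector_derivative_circlepath)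
    moreover have "circlepath 0 \<rho> t = ?e t" by (simp add: circlepath)
    ultimately show "g (circlepath 0 \<rho> t) / (circlepath 0 \<rho> t - 0)\<^sup>2 * vector_derivative (circlepath 0 \<rho>) (at t)
      = (2 * of_real pi * \<i>) * (g (?e t) / ?e t)"
      by (simp add: power2_eq_square)
  qed
  also have "\<dots> = (2 * of_real pi * \<i>) * integral {0..1} (\<lambda>t. g (?e t) / ?e t)"
    by (rule integral_mult_right)
  also have "integral {0..1} (\<lambda>t. g (?e t) / ?e t) = (LINT t:{0..1}|lborel. g (?e t) / ?e t)"
  proof (rule set_borel_integral_eq_integral(2)[symmetric], rule set_integrable_compact)
    show "continuous_on {0..1} (\<lambda>t. g (?e t) / ?e t)"
      by (intro continuous_intros continuous_on_compose2[OF cont]) (use \<rho> in \<open>auto simp: norm_mult\<close>)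
  qed simp
  finally show ?thesis by (simp add: g_def)
qed

text \<open>\<open>holo_on\<close> asks only for a complex linear derivative at each point, so even
  continuity of the derivative has to be proved. It follows from the Cauchy integral, which contains
  values of \<open>f\<close> only; with it the integral may be differentiated in \<open>x\<close>,
  and complex linearity is inherited from the integrand.\<close>

lemma holo_on_fderiv:
  fixes f :: "complex^'n::finite \<Rightarrow> complex"
  assumes S: "open S" and f: "holo_on S f"
  shows "holo_on S (\<lambda>x. fderiv f x v)"
proof -
  let ?e = "\<lambda>\<rho> t. of_real \<rho> * exp (2 * of_real pi * \<i> * of_real t) :: complex"
  have loc: "\<exists>R>0. \<exists>\<rho>>0. cball x0 R \<subseteq> S \<and> \<rho> * norm v \<le> R / 2 \<and>
     (\<forall>x\<in>ball x0 (R/2). \<forall>t. x + ?e \<rho> t *s v \<in> S)" if x0: "x0 \<in> S" for x0 v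
  proof -
    obtain R where R: "R > 0" "cball x0 R \<subseteq> S" using S x0 by (metis open_contains_cball)
    \<comment> \<open>The added 1 covers the case \<open>v = 0\<close>.\<close>
    define \<rho> where "\<rho> = R / 2 / (norm v + 1)"
    have \<rho>: "\<rho> > 0" using R by (simp add: \<rho>_def add_nonneg_pos)
    have rv: "\<rho> * norm v \<le> R / 2"
    proof -
      have "\<rho> * norm v \<le> \<rho> * (norm v + 1)" using \<rho> by simp
      also have "\<dots> = R / 2" using add_nonneg_pos[OF norm_ge_zero[of v] zero_less_one] by (metis \<rho>_def nonzero_eq_divide_eq less_irrefl)
      finally show ?thesis .
    qed
    have "x + ?e \<rho> t *s v \<in> S" if "x \<in> ball x0 (R/2)" for x t
    proof -
      have "norm (x0 - (x + ?e \<rho> t *s v)) \<le> norm (x0 - x) + norm (?e \<rho> t *s v)"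
        by (metis diff_diff_eq norm_triangle_ineq4)
      also have "norm (?e \<rho> t *s v) \<le> R / 2" using rv \<rho> by (simp add: norm_scalar_mult_complex norm_mult)
      finally show ?thesis using that R by (auto simp: dist_norm)
    qed
    then show ?thesis using R \<rho> rv by blast
  qed
  have conte: "continuous_on (UNIV \<times> UNIV) (\<lambda>(x, t). x + ?e \<rho> t *s v)" for v \<rho>
    unfolding case_prod_unfold
    by (intro continuous_intros bounded_linear.continuous_on[OF bounded_linear_scalar_mult_left])
  have cont: "continuous_on S (\<lambda>x. fderiv f x v)" for v
  proof (rule continuous_at_imp_continuous_on, rule ballI)
    fix x0 assume "x0 \<in> S"
    then obtain R \<rho> where R: "R > 0" "\<rho> > 0" "cball x0 R \<subseteq> S" "\<rho> * norm v \<le> R / 2"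
      "\<And>x t. x \<in> ball x0 (R/2) \<Longrightarrow> x + ?e \<rho> t *s v \<in> S" using loc[of x0 v] by blast
    have "continuous_on (ball x0 (R/2)) (\<lambda>x. LINT t:{0..1}|lborel. f (x + ?e \<rho> t *s v) / ?e \<rho> t)"
    proof (rule continuous_on_integral_compact)
      have "continuous_on (ball x0 (R/2) \<times> {0..1::real}) (\<lambda>p. f (fst p + ?e \<rho> (snd p) *s v))"
        by (rule continuous_on_compose2[OF holo_on_continuous_on[OF f] continuous_on_subset[OF conte[of \<rho> v, unfolded case_prod_unfold]]])
          (use R(5) in auto)
      then show "continuous_on (ball x0 (R/2) \<times> {0..1::real}) (\<lambda>(x, t). f (x + ?e \<rho> t *s v) / ?e \<rho> t)"
        unfolding case_prod_unfold by (intro continuous_intros) (use R in auto)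
    qed auto
    then have "continuous_on (ball x0 (R/2)) (\<lambda>x. fderiv f x v)"
      by (rule continuous_on_eq) (use holo_on_fderiv_integral[OF f R(3,2,4)] in auto)
    then show "isCont (\<lambda>x. fderiv f x v) x0" using R(1) by (simp add: continuous_on_eq_continuous_at)
  qed
  show ?thesis
    unfolding holo_on_def
  proof
    fix x0 assume x0: "x0 \<in> S"
    then obtain R \<rho> where R: "R > 0" "\<rho> > 0" "cball x0 R \<subseteq> S" "\<rho> * norm v \<le> R / 2"
      "\<And>x t. x \<in> ball x0 (R/2) \<Longrightarrow> x + ?e \<rho> t *s v \<in> S" using loc[of x0 v] by blast
    let ?D = "\<lambda>x t w. fderiv f (x + ?e \<rho> t *s v) w / ?e \<rho> t"
    have "((\<lambda>x. LINT t:{0..1}|lborel. f (x + ?e \<rho> t *s v) / ?e \<rho> t) has_derivative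
       (\<lambda>w. LINT t:{0..1}|lborel. ?D x0 t w)) (at x0)"
    proof (rule has_derivative_integral_compact[where T = "ball x0 (R/2)"])
      fix x assume x: "x \<in> ball x0 (R/2)"
      have "continuous_on {0..1::real} (\<lambda>t. f (x + ?e \<rho> t *s v))"
        by (rule continuous_on_compose2[OF holo_on_continuous_on[OF f]])
          (use R(5)[OF x] in \<open>auto intro!: continuous_intros bounded_linear.continuous_on[OF bounded_linear_scalar_mult_left]\<close>)
      then show "continuous_on {0..1::real} (\<lambda>t. f (x + ?e \<rho> t *s v) / ?e \<rho> t)"
        by (intro continuous_intros) (use R in auto)
      fix t :: real
      have "((\<lambda>x. x + ?e \<rho> t *s v) has_derivative (\<lambda>w. w)) (at x)" by (auto intro!: derivative_eq_intros)
      from has_derivative_compose[OF this holo_on_has_derivative[OF f R(5)[OF x]]]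
      have "((\<lambda>x. f (x + ?e \<rho> t *s v)) has_derivative fderiv f (x + ?e \<rho> t *s v)) (at x)" .
      from bounded_linear.has_derivative[OF bounded_linear_divide this]
      show "((\<lambda>x. f (x + ?e \<rho> t *s v) / ?e \<rho> t) has_derivative ?D x t) (at x)" .
    next
      fix w
      have "continuous_on (ball x0 (R/2) \<times> {0..1::real}) (\<lambda>p. fderiv f (fst p + ?e \<rho> (snd p) *s v) w)"
        by (rule continuous_on_compose2[OF cont continuous_on_subset[OF conte[of \<rho> v, unfolded case_prod_unfold]]])
          (use R(5) in auto)
      then show "continuous_on (ball x0 (R/2) \<times> {0..1::real}) (\<lambda>(x, t). ?D x t w)"
        unfolding case_prod_unfold by (intro continuous_intros) (use R in auto)
    qed (use R in auto)
    from has_derivative_transform_within_open[OF this, of "ball x0 (R/2)" "\<lambda>x. fderiv f x v"]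
    have "((\<lambda>x. fderiv f x v) has_derivative (\<lambda>w. LINT t:{0..1}|lborel. ?D x0 t w)) (at x0)"
      using holo_on_fderiv_integral[OF f R(3,2,4)] R(1) by auto
    moreover have "(LINT t:{0..1}|lborel. ?D x0 t (\<i> *s w)) = \<i> * (LINT t:{0..1}|lborel. ?D x0 t w)" for w
    proof -
      have "(LINT t:{0..1}|lborel. ?D x0 t (\<i> *s w)) = (LINT t:{0..1}|lborel. \<i> * ?D x0 t w)"
        using R(1) by (intro set_lebesgue_integral_cong) (auto simp: holo_on_fderiv_scale[OF f R(5)])
      then show ?thesis by (simp only: set_integral_mult_right)
    qed
    ultimately show "\<exists>D. ((\<lambda>x. fderiv f x v) has_derivative D) (at x0) \<and> (\<forall>w. D (\<i> *s w) = \<i> * D w)" by blast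
  qed
qed

lemma holo_on_smooth_on:
  fixes f :: "complex^'n::finite \<Rightarrow> complex"
  assumes S: "open S" and f: "holo_on S f"
  shows "smooth_on S f"
proof (rule smooth_on_coinduct[of "holo_on S"])
  fix f :: "complex^'n \<Rightarrow> complex" assume f: "holo_on S f"
  then have "f differentiable_on S"
    by (meson differentiableI differentiable_at_imp_differentiable_on holo_on_has_derivative)
  then show "f differentiable_on S \<and> (\<forall>v. holo_on S (\<lambda>x. fderiv f x v))" using holo_on_fderiv[OF S f] by blast
qed (rule f)

text \<open>The one-variable Schwarz lemma for \<open>f / M\<close> on the complex line from
  \<open>y\<close> to \<open>x\<close>, with the direction scaled to length \<open>R\<close>; the
  point \<open>x\<close> then has the parameter \<open>inverse a\<close>, of modulus
  \<open>norm (x - y) / R\<close>.\<close>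

lemma holo_on_Schwarz:
  fixes f :: "complex^'n::finite \<Rightarrow> complex"
  assumes f: "holo_on (ball y R) f" and M: "\<And>x. x \<in> ball y R \<Longrightarrow> cmod (f x) < M"
    and y: "f y = 0" and x: "x \<in> ball y R"
  shows "cmod (f x) \<le> M * norm (x - y) / R"
proof (cases "x = y")
  case False
  define v where "v = x - y"
  have v: "norm v > 0" "norm v < R" using False x by (auto simp: v_def dist_norm norm_minus_commute)
  have R: "R > 0" using v by linarith
  have Mpos: "M > 0" using M[OF x] by (metis norm_ge_zero order_le_less_trans)
  define a where "a = complex_of_real (R / norm v)"
  have a: "cmod a * norm v = R" "a \<noteq> 0" using v R by (auto simp: a_def norm_divide)
  have inb: "y + (z * a) *s v \<in> ball y R" if "cmod z < 1" for z
  proof -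
    have "norm ((z * a) *s v) = cmod z * R" using a by (simp add: norm_scalar_mult_complex norm_mult mult.assoc)
    also have "\<dots> < 1 * R" using that R by (intro mult_strict_right_mono)
    finally show ?thesis by (simp add: dist_norm)
  qed
  define g where "g z = f (y + (z * a) *s v) / of_real M" for z
  have "g holomorphic_on ball 0 1"
  proof (rule holomorphic_onI)
    fix z :: complex assume "z \<in> ball 0 1"
    then have "((\<lambda>w. f (y + w *s v)) has_field_derivative fderiv f (y + (z * a) *s v) v) (at (z * a))"
      using holo_on_line[OF f inb] by auto
    moreover have "((\<lambda>z. z * a) has_field_derivative a) (at z)" by (auto intro!: derivative_eq_intros)
    ultimately have "((\<lambda>z. f (y + (z * a) *s v)) has_field_derivative fderiv f (y + (z * a) *s v) v * a) (at z)"
      by (rule DERIV_chain2)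
    from DERIV_cdivide[OF this, of "of_real M"]
    show "g field_differentiable at z within ball 0 1"
      unfolding g_def field_differentiable_def by (blast intro: has_field_derivative_at_within)
  qed
  moreover have "g 0 = 0" using y by (simp add: g_def)
  moreover have "norm (g z) < 1" if "norm z < 1" for z
    using M[OF inb[OF that]] Mpos by (simp add: g_def norm_divide)
  moreover have "norm (inverse a) < 1" using v R by (simp add: a_def norm_inverse norm_divide)
  ultimately have "norm (g (inverse a)) \<le> norm (inverse a)" by (rule Schwarz_Lemma(1))
  moreover have "g (inverse a) = f x / of_real M" using a by (simp add: g_def v_def)
  moreover have "norm (inverse a) = norm v / R" using v R by (simp add: a_def norm_inverse norm_divide)
  ultimately have "cmod (f x) / M \<le> norm v / R" using Mpos by (simp add: norm_divide)
  then show ?thesis using Mpos by (simp add: v_def field_simps)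
qed (use y in simp)

section \<open>The Levi form\<close>

text \<open>The form \<open>\<i> \<partial> \<partial>\<close>-bar \<open>f\<close> in terms of the
  real Hessian, see \<open>i_ddbar_eq_levi\<close>. At \<open>(v, J v)\<close>, for a complex
  structure \<open>J\<close>, it is half the sum of the second derivatives along \<open>v\<close>
  and \<open>J v\<close>.\<close>

definition levi :: "('v \<Rightarrow> 'v) \<Rightarrow> ('v::real_normed_vector \<Rightarrow> real) \<Rightarrow> 'v \<Rightarrow> 'v \<Rightarrow> 'v \<Rightarrow> real"
  where "levi J f p v w = (fderiv2 f p (J v) w - fderiv2 f p v (J w)) / 2"

lemma smooth_on_fderiv2: "smooth_on S f \<Longrightarrow> smooth_on S (\<lambda>p. fderiv2 f p v w)"
  unfolding fderiv2_def by (intro smooth_on_fderiv)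

lemma fderiv2_cong:
  assumes "open S" "x \<in> S" "\<And>y. y \<in> S \<Longrightarrow> f y = g y"
  shows "fderiv2 f x a b = fderiv2 g x a b"
proof -
  have "fderiv f y b = fderiv g y b" if "y \<in> S" for y using fderiv_cong[OF assms(1) that assms(3)] by simp
  then show ?thesis unfolding fderiv2_def
    by (intro fun_cong[OF fderiv_cong[OF assms(1,2)]])
qed

lemma levi_cong:
  assumes "open S" "x \<in> S" "\<And>y. y \<in> S \<Longrightarrow> f y = g y"
  shows "levi J f x = levi J g x"
  by (intro ext) (simp add: levi_def fderiv2_cong[OF assms])

lemma smooth_on_levi: "open S \<Longrightarrow> smooth_on S f \<Longrightarrow> smooth_on S (\<lambda>p. levi J f p v w)"
  unfolding levi_def by (intro smooth_on_divide smooth_on_diff smooth_on_fderiv2 smooth_on_const) auto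

lemma bilinear_fderiv2:
  fixes f :: "'a::real_normed_vector \<Rightarrow> 'b::euclidean_space"
  assumes "open S" "smooth_on S f" "p \<in> S"
  shows "bilinear (fderiv2 f p)"
proof -
  have 1: "linear (\<lambda>a. fderiv2 f p a b)" for b
    unfolding fderiv2_def using smooth_on_linear[OF assms(1) smooth_on_fderiv[OF assms(2)] assms(3)] by simp
  moreover have "linear (\<lambda>b. fderiv2 f p a b)" for a
    using 1[of a] fderiv2_symmetric[OF assms] by simp
  ultimately show ?thesis by (simp add: bilinear_def)
qed

lemma levi_bilinear:
  assumes "open S" "smooth_on S f" "p \<in> S" "linear J"
  shows "bilinear (levi J f p)"
proof -
  note B = bilinear_fderiv2[OF assms(1-3)]
  note J = linear_add[OF assms(4)] linear_scale[OF assms(4)]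
  show ?thesis
    unfolding bilinear_def levi_def
    by (intro conjI allI linearI)
      (simp_all add: J bilinear_ladd[OF B] bilinear_radd[OF B] bilinear_lmul[OF B] bilinear_rmul[OF B] field_simps)
qed

lemma levi_antisym:
  assumes "open S" "smooth_on S f" "p \<in> S"
  shows "levi J f p v w = - levi J f p w v"
  unfolding levi_def using fderiv2_symmetric[OF assms] by (simp add: field_simps)

lemma levi_J_J:
  assumes "open S" "smooth_on S f" "p \<in> S" "\<And>v. J (J v) = - v"
  shows "levi J f p (J v) (J w) = levi J f p v w"
proof -
  note B = bilinear_fderiv2[OF assms(1-3)]
  show ?thesis unfolding levi_def by (simp add: assms(4) bilinear_lneg[OF B] bilinear_rneg[OF B])
qed

lemma levi_diff:
  assumes "open S" "smooth_on S f" "smooth_on S g" "p \<in> S"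
  shows "levi J (\<lambda>x. f x - g x) p v w = levi J f p v w - levi J g p v w"
proof -
  have "fderiv2 (\<lambda>x. f x - g x) p a b = fderiv2 f p a b - fderiv2 g p a b" for a b
  proof -
    have 1: "fderiv (\<lambda>x. f x - g x) y b = fderiv f y b - fderiv g y b" if "y \<in> S" for y
      using fderiv_eqI[OF has_derivative_diff[OF smooth_on_has_derivative[OF assms(1,2) that]
            smooth_on_has_derivative[OF assms(1,3) that]]] by simp
    have "fderiv2 (\<lambda>x. f x - g x) p a b = fderiv (\<lambda>y. fderiv f y b - fderiv g y b) p a"
      unfolding fderiv2_def using fderiv_cong[OF assms(1,4) 1] by simp
    also have "\<dots> = fderiv2 f p a b - fderiv2 g p a b"
      unfolding fderiv2_def
      using fderiv_eqI[OF has_derivative_diff[OF smooth_on_has_derivative[OF assms(1) smooth_on_fderiv[OF assms(2)] assms(4)]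
            smooth_on_has_derivative[OF assms(1) smooth_on_fderiv[OF assms(3)] assms(4)]]] by simp
    finally show ?thesis .
  qed
  then show ?thesis unfolding levi_def by (simp only:) (simp add: field_simps)
qed

text \<open>By symmetry of the Hessian, the antisymmetrisation in \<open>v 0\<close> and
  \<open>v 1\<close> cancels the terms with no or two factors \<open>J\<close> and leaves those with
  a single one.\<close>

lemma i_ddbar_eq_levi:
  fixes f :: "'v::real_normed_vector \<Rightarrow> real"
  assumes S: "open S" and f: "smooth_on S f" and p: "p \<in> S"
  shows "i_ddbar J f p v = complex_of_real (levi J f p (v 0) (v 1))"
proof -
  have 1: "fderiv (\<lambda>p. complex_of_real (f p)) y w = of_real (fderiv f y w)" if "y \<in> S" for y w
    using fderiv_eqI[OF bounded_linear.has_derivative[OF bounded_linear_of_real[where 'a = complex]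
          smooth_on_has_derivative[OF S f that]]] by simp
  have 2: "fderiv (\<lambda>y. dbar J (\<lambda>p. complex_of_real (f p)) y w) p a
     = (of_real (fderiv2 f p a w) + \<i> * of_real (fderiv2 f p a (J w))) / 2" for w a
  proof -
    have "fderiv (\<lambda>y. dbar J (\<lambda>p. complex_of_real (f p)) y w) p
      = fderiv (\<lambda>y. (of_real (fderiv f y w) + \<i> * of_real (fderiv f y (J w))) / 2) p"
      by (rule fderiv_cong[OF S p]) (simp add: dbar_def 1)
    also have "\<dots> = (\<lambda>a. (of_real (fderiv2 f p a w) + \<i> * of_real (fderiv2 f p a (J w))) / 2)"
      unfolding fderiv2_def
      by (intro fderiv_eqI bounded_linear.has_derivative[OF bounded_linear_divide] has_derivative_add
          bounded_linear.has_derivative[OF bounded_linear_mult_right]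
          bounded_linear.has_derivative[OF bounded_linear_of_real]
          smooth_on_has_derivative[OF S smooth_on_fderiv[OF f] p])
    finally show ?thesis by simp
  qed
  show ?thesis
    unfolding i_ddbar_def del_def 2 levi_def
    using fderiv2_symmetric[OF S f p, of "v 0" "v 1"] fderiv2_symmetric[OF S f p, of "J (v 0)" "J (v 1)"]
      fderiv2_symmetric[OF S f p, of "v 0" "J (v 1)"] fderiv2_symmetric[OF S f p, of "J (v 0)" "v 1"]
    by (simp add: complex_eq_iff field_simps)
qed

lemma fderiv3_symmetric:
  fixes f :: "'v::real_normed_vector \<Rightarrow> 'b::euclidean_space"
  assumes S: "open S" and f: "smooth_on S f" and p: "p \<in> S"
  shows "fderiv (\<lambda>y. fderiv2 f y b c) p a = fderiv (\<lambda>y. fderiv2 f y a c) p b"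
    and "fderiv (\<lambda>y. fderiv2 f y b c) p a = fderiv (\<lambda>y. fderiv2 f y c b) p a"
proof -
  show "fderiv (\<lambda>y. fderiv2 f y b c) p a = fderiv (\<lambda>y. fderiv2 f y a c) p b"
    using fderiv2_symmetric[OF S smooth_on_fderiv[OF f] p, of c a b] by (simp add: fderiv2_def)
  show "fderiv (\<lambda>y. fderiv2 f y b c) p a = fderiv (\<lambda>y. fderiv2 f y c b) p a"
    using fderiv_cong[OF S p, of "\<lambda>y. fderiv2 f y b c" "\<lambda>y. fderiv2 f y c b"] fderiv2_symmetric[OF S f] by auto
qed

text \<open>Third derivatives are symmetric in all arguments, so the six terms cancel in pairs. This
  is closedness of the curvature form, the source of the identities for derivatives of the
  horizontal lift.\<close>

lemma levi_closed:
  fixes f :: "'v::real_normed_vector \<Rightarrow> real"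
  assumes S: "open S" and f: "smooth_on S f" and p: "p \<in> S"
  shows "fderiv (\<lambda>y. levi J f y b c) p a + fderiv (\<lambda>y. levi J f y c a) p b + fderiv (\<lambda>y. levi J f y a b) p c = 0"
proof -
  define T where "T a b c = fderiv (\<lambda>y. fderiv2 f y b c) p a" for a b c
  have D: "fderiv (\<lambda>y. levi J f y b c) p a = (T a (J b) c - T a b (J c)) / 2" for a b c
    unfolding levi_def T_def
    using fderiv_eqI[OF bounded_linear.has_derivative[OF bounded_linear_divide has_derivative_diff[OF
          smooth_on_has_derivative[OF S smooth_on_fderiv2[OF f] p, of "J b" c]
          smooth_on_has_derivative[OF S smooth_on_fderiv2[OF f] p, of b "J c"]], of 2]] by simp
  have s1: "T a b c = T b a c" and s2: "T a b c = T a c b" for a b c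
    unfolding T_def using fderiv3_symmetric[OF S f p] by auto
  have "T a (J b) c = T c a (J b)" by (metis s1 s2)
  moreover have "T a b (J c) = T b (J c) a" by (metis s1 s2)
  moreover have "T b c (J a) = T c (J a) b" by (metis s1 s2)
  ultimately show ?thesis unfolding D by (simp add: field_simps)
qed

lemma fderiv2_compose:
  fixes f :: "'b::euclidean_space \<Rightarrow> 'c::euclidean_space" and T :: "'a::euclidean_space \<Rightarrow> 'b"
  assumes S: "open S" "open S'" and T: "smooth_on S T" "T ` S \<subseteq> S'" and f: "smooth_on S' f" and p: "p \<in> S"
  shows "fderiv2 (\<lambda>x. f (T x)) p v w
    = fderiv2 f (T p) (fderiv T p v) (fderiv T p w) + fderiv f (T p) (fderiv2 T p v w)"
proof -
  have 1: "fderiv (\<lambda>x. f (T x)) q w = fderiv f (T q) (fderiv T q w)" if "q \<in> S" for q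
    using fderiv_eqI[OF has_derivative_compose[OF smooth_on_has_derivative[OF S(1) T(1) that]
          smooth_on_has_derivative[OF S(2) f]]] T(2) that by auto
  have "fderiv2 (\<lambda>x. f (T x)) p v w = fderiv (\<lambda>q. fderiv f (T q) (fderiv T q w)) p v"
    unfolding fderiv2_def using fderiv_cong[OF S(1) p 1] by simp
  also have "\<dots> = fderiv (\<lambda>x. fderiv f x (fderiv T p w)) (T p) (fderiv T p v) + fderiv f (T p) (fderiv (\<lambda>q. fderiv T q w) p v)"
    using T p fderiv_eqI[OF smooth_on_has_derivative_moving[OF S(2) f _
          smooth_on_has_derivative[OF S(1) T(1) p] smooth_on_has_derivative[OF S(1) smooth_on_fderiv[OF T(1)] p]]] by auto
  finally show ?thesis by (simp add: fderiv2_def)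
qed

text \<open>The obstacle in the chain rule is the term with the second derivative of
  \<open>T\<close>. Holomorphy lets \<open>J\<close> pass from one argument of that derivative to
  the other, so its two occurrences cancel. Hence the Levi form is compatible with holomorphic
  changes of chart and of frame.\<close>

lemma levi_pullback:
  fixes f :: "'b::euclidean_space \<Rightarrow> real" and T :: "'a::euclidean_space \<Rightarrow> 'b"
  assumes S: "open S" "open S'" and T: "smooth_on S T" "T ` S \<subseteq> S'" and f: "smooth_on S' f" and p: "p \<in> S"
    and J': "linear J'" and hol: "\<And>q v. q \<in> S \<Longrightarrow> fderiv T q (J v) = J' (fderiv T q v)"
  shows "levi J (\<lambda>x. f (T x)) p v w = levi J' f (T p) (fderiv T p v) (fderiv T p w)"
proof -
  have h: "fderiv2 T p v (J w) = J' (fderiv2 T p v w)" for v w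
  proof -
    have "fderiv2 T p v (J w) = fderiv (\<lambda>q. J' (fderiv T q w)) p v"
      unfolding fderiv2_def using fderiv_cong[OF S(1) p, of "\<lambda>q. fderiv T q (J w)"] hol by simp
    also have "\<dots> = J' (fderiv2 T p v w)"
      unfolding fderiv2_def
      using fderiv_eqI[OF bounded_linear.has_derivative[OF linear_conv_bounded_linear[THEN iffD1, OF J']
            smooth_on_has_derivative[OF S(1) smooth_on_fderiv[OF T(1)] p]]] by simp
    finally show ?thesis .
  qed
  have "fderiv2 T p (J v) w = fderiv2 T p v (J w)"
    using h[of w v] h[of v w] fderiv2_symmetric[OF S(1) T(1) p] by metis
  then show ?thesis
    unfolding levi_def fderiv2_compose[OF S T f p] by (simp add: hol[OF p])
qed

lemma smooth_on_of_derivative: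
  assumes "open S" "\<And>x. x \<in> S \<Longrightarrow> (f has_derivative f' x) (at x)" "\<And>v. smooth_on S (\<lambda>x. f' x v)"
  shows "smooth_on S f"
  unfolding smooth_on_def
proof
  fix k
  have "Ck_on (Suc k) S f" using assms unfolding smooth_on_def by (intro Ck_on_SucI) auto
  then show "Ck_on k S f" by (rule Ck_on_SucD)
qed

lemma has_derivative_ln_cmod:
  assumes "z \<noteq> 0"
  shows "((\<lambda>z. ln ((cmod z)\<^sup>2)) has_derivative (\<lambda>w. 2 * Re (w * inverse z))) (at z)"
proof -
  have pos: "(Re z)\<^sup>2 + (Im z)\<^sup>2 > 0" using assms complex_neq_0 by blast
  have q: "((\<lambda>z. (Re z)\<^sup>2 + (Im z)\<^sup>2) has_derivative (\<lambda>w. 2 * Re w * Re z + 2 * Im w * Im z)) (at z)"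
    by (auto intro!: derivative_eq_intros)
  have l: "(ln has_derivative (\<lambda>d. inverse ((Re z)\<^sup>2 + (Im z)\<^sup>2) * d)) (at ((Re z)\<^sup>2 + (Im z)\<^sup>2))"
    using DERIV_ln[OF pos] by (simp add: has_field_derivative_def)
  have "Re (w * inverse z) = (Re w * Re z + Im w * Im z) / ((Re z)\<^sup>2 + (Im z)\<^sup>2)" for w
    by (simp only: divide_inverse[symmetric] Re_divide)
  then have "(\<lambda>w. inverse ((Re z)\<^sup>2 + (Im z)\<^sup>2) * (2 * Re w * Re z + 2 * Im w * Im z)) = (\<lambda>w. 2 * Re (w * inverse z))"
    by (simp only: fun_eq_iff) (simp add: field_simps)
  then show ?thesis using has_derivative_compose[OF q l] by (simp only: cmod_power2)
qed

lemma smooth_on_ln_cmod: "smooth_on (- {0}) (\<lambda>z. ln ((cmod z)\<^sup>2))"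
proof (rule smooth_on_of_derivative)
  show "((\<lambda>z. ln ((cmod z)\<^sup>2)) has_derivative (\<lambda>w. 2 * Re (w * inverse z))) (at z)" if "z \<in> - {0}" for z
    using that by (intro has_derivative_ln_cmod) auto
  have o: "open (- {0::complex})" by auto
  show "smooth_on (- {0}) (\<lambda>z. 2 * Re (w * inverse z))" for w
    by (rule smooth_on_mult[OF o smooth_on_const[OF o] smooth_on_Re[OF o smooth_on_mult[OF o
      smooth_on_const[OF o] smooth_on_inverse[OF o smooth_on_bounded_linear[OF o bounded_linear_ident]]]]]) simp
qed auto

text \<open>The second derivative is \<open>-2 * Re (v * w / z^2)\<close>; it depends on
  \<open>v * w\<close> only, so a factor \<open>\<i>\<close> in either argument has the same effect.
  With \<open>levi_pullback\<close> this makes the curvature independent of the frame.\<close>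

lemma levi_ln_cmod:
  assumes "z \<noteq> 0"
  shows "levi ((*) \<i>) (\<lambda>z. ln ((cmod z)\<^sup>2)) z v w = 0"
proof -
  have o: "open (- {0::complex})" by auto
  have "fderiv2 (\<lambda>z. ln ((cmod z)\<^sup>2)) z v w = - 2 * Re (v * w * inverse z * inverse z)" for v w
  proof -
    have "fderiv2 (\<lambda>z. ln ((cmod z)\<^sup>2)) z v w = fderiv (\<lambda>z. 2 * Re (w * inverse z)) z v"
      unfolding fderiv2_def
      by (rule fun_cong[OF fderiv_cong[OF o]]) (use assms fderiv_eqI[OF has_derivative_ln_cmod] in auto)
    also have "\<dots> = 2 * Re (w * (- (inverse z * v * inverse z)))"
    proof -
      have "((\<lambda>z. 2 * Re (w * inverse z)) has_derivative (\<lambda>v. 2 * Re (w * (- (inverse z * v * inverse z))))) (at z)"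
        by (rule has_derivative_mult_right[OF bounded_linear.has_derivative[OF bounded_linear_Re
              bounded_linear.has_derivative[OF bounded_linear_mult_right
                Deriv.has_derivative_inverse[OF assms has_derivative_ident]]]])
      from fderiv_eqI[OF this] show ?thesis by simp
    qed
    also have "w * (- (inverse z * v * inverse z)) = - (v * w * inverse z * inverse z)"
      by (simp only: mult_ac mult_minus_right)
    finally show ?thesis by (simp only: uminus_complex.sel mult_minus_right mult_minus_left)
  qed
  then show ?thesis by (simp only: levi_def) (simp add: mult_ac)
qed

text \<open>Only the values on constant vectors are known to be smooth in \<open>p\<close>;
  expanding \<open>u\<close> and \<open>w\<close> in the basis reduces the product rule to
  those.\<close>

lemma bilinear_field_has_derivative:
  fixes A :: "'p::real_normed_vector \<Rightarrow> 'v::euclidean_space \<Rightarrow> 'v \<Rightarrow> real"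
  assumes S: "open S" and p: "p \<in> S" and A: "\<And>p. p \<in> S \<Longrightarrow> bilinear (A p)"
    and sm: "\<And>v w. smooth_on S (\<lambda>p. A p v w)"
    and u: "(u has_derivative u') (at p)" and w: "(w has_derivative w') (at p)"
  shows "((\<lambda>q. A q (u q) (w q)) has_derivative
     (\<lambda>d. fderiv (\<lambda>q. A q (u p) (w p)) p d + A p (u' d) (w p) + A p (u p) (w' d))) (at p)"
proof -
  have dec: "A q x y = (\<Sum>a\<in>Basis. \<Sum>b\<in>Basis. (x \<bullet> a) * ((y \<bullet> b) * A q a b))" if "q \<in> S" for q x y
  proof -
    have l1: "linear (\<lambda>x. A q x y)" and l2: "linear (\<lambda>y. A q x y)" for x y
      using A[OF that] by (auto simp: bilinear_def)
    have "A q x y = A q (\<Sum>a\<in>Basis. (x \<bullet> a) *\<^sub>R a) (\<Sum>b\<in>Basis. (y \<bullet> b) *\<^sub>R b)"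
      by (simp only: euclidean_representation)
    also have "\<dots> = (\<Sum>a\<in>Basis. (x \<bullet> a) * (\<Sum>b\<in>Basis. (y \<bullet> b) * A q a b))"
      by (simp only: linear_sum[OF l1] linear_scale[OF l1] real_scaleR_def,
          simp only: linear_sum[OF l2] linear_scale[OF l2] real_scaleR_def)
    also have "\<dots> = (\<Sum>a\<in>Basis. \<Sum>b\<in>Basis. (x \<bullet> a) * ((y \<bullet> b) * A q a b))"
      by (simp only: sum_distrib_left)
    finally show ?thesis .
  qed
  have dA: "((\<lambda>q. A q a b) has_derivative fderiv (\<lambda>q. A q a b) p) (at p)" for a b
    by (rule smooth_on_has_derivative[OF S sm p])
  have "((\<lambda>q. \<Sum>a\<in>Basis. \<Sum>b\<in>Basis. (u q \<bullet> a) * ((w q \<bullet> b) * A q a b)) has_derivative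
    (\<lambda>d. \<Sum>a\<in>Basis. \<Sum>b\<in>Basis. (u p \<bullet> a) * ((w p \<bullet> b) * fderiv (\<lambda>q. A q a b) p d + (w' d \<bullet> b) * A p a b)
       + (u' d \<bullet> a) * ((w p \<bullet> b) * A p a b))) (at p)"
    by (intro has_derivative_sum has_derivative_mult has_derivative_inner_left u w dA)
  also have "(\<lambda>d. \<Sum>a\<in>Basis. \<Sum>b\<in>Basis. (u p \<bullet> a) * ((w p \<bullet> b) * fderiv (\<lambda>q. A q a b) p d + (w' d \<bullet> b) * A p a b)
       + (u' d \<bullet> a) * ((w p \<bullet> b) * A p a b))
    = (\<lambda>d. fderiv (\<lambda>q. A q (u p) (w p)) p d + A p (u' d) (w p) + A p (u p) (w' d))"
  proof
    fix d
    have "fderiv (\<lambda>q. A q (u p) (w p)) p = fderiv (\<lambda>q. \<Sum>a\<in>Basis. \<Sum>b\<in>Basis. (u p \<bullet> a) * ((w p \<bullet> b) * A q a b)) p"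
      by (rule fderiv_cong[OF S p dec])
    also have "\<dots> = (\<lambda>d. \<Sum>a\<in>Basis. \<Sum>b\<in>Basis. (u p \<bullet> a) * ((w p \<bullet> b) * fderiv (\<lambda>q. A q a b) p d))"
      by (intro fderiv_eqI has_derivative_sum has_derivative_mult_right dA)
    finally show "(\<Sum>a\<in>Basis. \<Sum>b\<in>Basis. (u p \<bullet> a) * ((w p \<bullet> b) * fderiv (\<lambda>q. A q a b) p d + (w' d \<bullet> b) * A p a b)
       + (u' d \<bullet> a) * ((w p \<bullet> b) * A p a b)) = fderiv (\<lambda>q. A q (u p) (w p)) p d + A p (u' d) (w p) + A p (u p) (w' d)"
      unfolding dec[OF p, of "u' d"] dec[OF p, of _ "w' d"] by (simp add: sum.distrib algebra_simps)
  qed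
  finally have "((\<lambda>q. \<Sum>a\<in>Basis. \<Sum>b\<in>Basis. (u q \<bullet> a) * ((w q \<bullet> b) * A q a b)) has_derivative
    (\<lambda>d. fderiv (\<lambda>q. A q (u p) (w p)) p d + A p (u' d) (w p) + A p (u p) (w' d))) (at p)" .
  from has_derivative_transform_within_open[OF this S p] show ?thesis using dec by simp
qed

section \<open>Positive definite systems\<close>

text \<open>Gaussian elimination: the pivot \<open>G x\<^sub>0 x\<^sub>0\<close> is positive, and the Schur complement is again
  positive definite.\<close>

lemma smooth_positive_definite_system:
  fixes G :: "'i \<Rightarrow> 'i \<Rightarrow> 's::real_normed_vector \<Rightarrow> complex"
  assumes "finite E" "open S"
    and "\<And>x y. x \<in> E \<Longrightarrow> y \<in> E \<Longrightarrow> smooth_on S (G x y)"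
    and "\<And>x y s. x \<in> E \<Longrightarrow> y \<in> E \<Longrightarrow> s \<in> S \<Longrightarrow> G y x s = cnj (G x y s)"
    and "\<And>s c. s \<in> S \<Longrightarrow> \<exists>x\<in>E. c x \<noteq> 0 \<Longrightarrow> 0 < Re (\<Sum>x\<in>E. \<Sum>y\<in>E. c x * cnj (c y) * G x y s)"
    and "\<And>y. y \<in> E \<Longrightarrow> smooth_on S (b y)"
  shows "\<exists>c. (\<forall>x\<in>E. smooth_on S (c x)) \<and> (\<forall>s\<in>S. \<forall>y\<in>E. (\<Sum>x\<in>E. c x s * G x y s) = b y s)"
  using assms(1,3-6)
proof (induction E arbitrary: G b rule: finite_induct)
  case empty
  then show ?case by simp
next
  case (insert p E)
  note S = assms(2)
  have g: "G p p s \<noteq> 0" if "s \<in> S" for s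
  proof -
    have "(\<Sum>x\<in>E. \<Sum>y\<in>insert p E. (if x = p then 1 else 0) * cnj (if y = p then 1 else 0) * G x y s) = 0"
      by (rule sum.neutral) (use insert.hyps in auto)
    moreover have "(\<Sum>y\<in>E. (if p = p then 1 else 0) * cnj (if y = p then 1 else 0) * G p y s) = 0"
      by (rule sum.neutral) (use insert.hyps in auto)
    moreover have "(\<Sum>x\<in>insert p E. \<Sum>y\<in>insert p E. (if x = p then 1 else 0) * cnj (if y = p then 1 else 0) * G x y s) =
      (G p p s + (\<Sum>y\<in>E. (if p = p then 1 else 0) * cnj (if y = p then 1 else 0) * G p y s)) +
      (\<Sum>x\<in>E. \<Sum>y\<in>insert p E. (if x = p then 1 else 0) * cnj (if y = p then 1 else 0) * G x y s)"
      using insert.hyps by simp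
    ultimately have "(\<Sum>x\<in>insert p E. \<Sum>y\<in>insert p E. (if x = p then 1 else 0) * cnj (if y = p then 1 else 0) * G x y s) = G p p s"
      by simp
    then show ?thesis using insert.prems(3)[OF that, of "\<lambda>x. if x = p then 1 else 0"] by auto
  qed
  have greal: "cnj (G p p s) = G p p s" if "s \<in> S" for s using insert.prems(2)[of p p s] that by simp
  define G' where "G' x y s = G x y s - G x p s * G p y s / G p p s" for x y s
  define b' where "b' y s = b y s - b p s * G p y s / G p p s" for y s
  have "\<exists>c. (\<forall>x\<in>E. smooth_on S (c x)) \<and> (\<forall>s\<in>S. \<forall>y\<in>E. (\<Sum>x\<in>E. c x s * G' x y s) = b' y s)"
  proof (rule insert.IH)
    show "smooth_on S (G' x y)" if "x \<in> E" "y \<in> E" for x y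
      unfolding G'_def using that g S insert.prems(1)
      by (intro smooth_on_diff smooth_on_divide smooth_on_mult) auto
    show "smooth_on S (b' y)" if "y \<in> E" for y
      unfolding b'_def using that g S insert.prems(1,4)
      by (intro smooth_on_diff smooth_on_divide smooth_on_mult) auto
    show "G' y x s = cnj (G' x y s)" if "x \<in> E" "y \<in> E" "s \<in> S" for x y s
      using insert.prems(2)[of x y s] insert.prems(2)[of p x s] insert.prems(2)[of p y s]
        insert.prems(2)[of x p s] insert.prems(2)[of y p s] that greal[of s] by (simp add: G'_def)
    show "0 < Re (\<Sum>x\<in>E. \<Sum>y\<in>E. c x * cnj (c y) * G' x y s)" if s: "s \<in> S" and c: "\<exists>x\<in>E. c x \<noteq> 0" for s c
    proof -
      define q where "q = (\<Sum>x\<in>E. c x * G x p s)"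
      \<comment> \<open>The value that minimises the quadratic form over the coefficient at
        \<open>p\<close>; completing the square leaves exactly the form of \<open>G'\<close> in
        \<open>c\<close>.\<close>
      define a where "a = - q / G p p s"
      define d where "d x = (if x = p then a else c x)" for x
      have dE: "d x = c x" if "x \<in> E" for x using that insert.hyps by (auto simp: d_def)
      have q': "(\<Sum>y\<in>E. cnj (c y) * G p y s) = cnj q"
        unfolding q_def cnj_sum by (rule sum.cong[OF refl]) (use insert.prems(2)[of _ p s] s in simp)
      have "0 < Re (\<Sum>x\<in>insert p E. \<Sum>y\<in>insert p E. d x * cnj (d y) * G x y s)"
        by (rule insert.prems(3)[OF s]) (use c dE in auto)
      also have "(\<Sum>x\<in>insert p E. \<Sum>y\<in>insert p E. d x * cnj (d y) * G x y s)
         = a * cnj a * G p p s + a * (\<Sum>y\<in>E. cnj (c y) * G p y s) + cnj a * q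
           + (\<Sum>x\<in>E. \<Sum>y\<in>E. c x * cnj (c y) * G x y s)"
      proof -
        define f where "f x = (\<Sum>y\<in>insert p E. d x * cnj (d y) * G x y s)" for x
        have "f x = cnj a * (c x * G x p s) + (\<Sum>y\<in>E. c x * cnj (c y) * G x y s)" if "x \<in> E" for x
          unfolding f_def using insert.hyps that by (simp add: dE cong: sum.cong) (simp add: d_def)
        then have "(\<Sum>x\<in>E. f x) = cnj a * q + (\<Sum>x\<in>E. \<Sum>y\<in>E. c x * cnj (c y) * G x y s)"
          by (simp add: sum.distrib q_def sum_distrib_left)
        moreover have "f p = a * cnj a * G p p s + a * (\<Sum>y\<in>E. cnj (c y) * G p y s)"
          unfolding f_def using insert.hyps
          by (simp add: dE sum_distrib_left mult.assoc cong: sum.cong) (simp add: d_def mult_ac)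
        moreover have "(\<Sum>x\<in>insert p E. f x) = f p + (\<Sum>x\<in>E. f x)" by (rule sum.insert[OF insert.hyps])
        ultimately show ?thesis unfolding f_def by simp
      qed
      also have "\<dots> = (\<Sum>x\<in>E. \<Sum>y\<in>E. c x * cnj (c y) * G x y s) - q * cnj q / G p p s"
        using g[OF s] greal[OF s] unfolding q' a_def by (simp add: field_simps)
      also have "\<dots> = (\<Sum>x\<in>E. \<Sum>y\<in>E. c x * cnj (c y) * G' x y s)"
      proof -
        have "q * cnj q = (\<Sum>x\<in>E. \<Sum>y\<in>E. c x * cnj (c y) * (G x p s * G p y s))"
        proof -
          have "q * (\<Sum>y\<in>E. cnj (c y) * G p y s) = (\<Sum>x\<in>E. \<Sum>y\<in>E. c x * cnj (c y) * (G x p s * G p y s))"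
            unfolding q_def sum_product by (simp only: mult_ac)
          then show ?thesis by (simp only: q')
        qed
        then show ?thesis
          by (simp add: G'_def right_diff_distrib sum_subtractf sum_divide_distrib)
      qed
      finally show ?thesis .
    qed
  qed
  then obtain c where c: "\<And>x. x \<in> E \<Longrightarrow> smooth_on S (c x)"
    "\<And>s y. s \<in> S \<Longrightarrow> y \<in> E \<Longrightarrow> (\<Sum>x\<in>E. c x s * G' x y s) = b' y s" by blast
  \<comment> \<open>Back substitution: the equation at \<open>p\<close> determines the eliminated
    unknown.\<close>
  define d where "d x = (if x = p then (\<lambda>s. (b p s - (\<Sum>x\<in>E. c x s * G x p s)) / G p p s) else c x)" for x
  have dE: "d x = c x" if "x \<in> E" for x using that insert.hyps by (auto simp: d_def)
  have dp: "d p s * G p p s = b p s - (\<Sum>x\<in>E. c x s * G x p s)" if "s \<in> S" for s using g[OF that] by (simp add: d_def)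
  have "smooth_on S (d x)" if "x \<in> insert p E" for x
  proof (cases "x = p")
    case True
    then show ?thesis unfolding d_def using g S insert.prems(1,4) c(1)
      by simp (intro smooth_on_divide smooth_on_diff smooth_on_sum smooth_on_mult, auto)
  qed (use that c dE in auto)
  moreover have "(\<Sum>x\<in>insert p E. d x s * G x y s) = b y s" if s: "s \<in> S" and y: "y \<in> insert p E" for s y
  proof -
    have sum: "(\<Sum>x\<in>insert p E. d x s * G x y s) = d p s * G p y s + (\<Sum>x\<in>E. c x s * G x y s)"
      using insert.hyps by (simp add: dE cong: sum.cong)
    show ?thesis
    proof (cases "y = p")
      case True
      then show ?thesis unfolding sum using dp[OF s] by simp
    next
      case False
      then have yE: "y \<in> E" using y by simp
      have "(\<Sum>x\<in>E. c x s * G' x y s) = (\<Sum>x\<in>E. c x s * G x y s) - (\<Sum>x\<in>E. c x s * G x p s) * G p y s / G p p s"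
        by (simp add: G'_def right_diff_distrib sum_subtractf sum_divide_distrib sum_distrib_right mult.assoc)
      then have "(\<Sum>x\<in>E. c x s * G x y s) = b' y s + (\<Sum>x\<in>E. c x s * G x p s) * G p y s / G p p s"
        using c(2)[OF s yE] by simp
      moreover have "d p s = (b p s - (\<Sum>x\<in>E. c x s * G x p s)) / G p p s" by (simp add: d_def)
      ultimately show ?thesis unfolding sum b'_def by (simp add: diff_divide_distrib left_diff_distrib)
    qed
  qed
  ultimately show ?case by blast
qed

section \<open>A smooth bump function\<close>

definition bump :: "real \<Rightarrow> real" where "bump x = (if x > 0 then exp (- inverse x) else 0)"

lemma tendsto_poly_exp_0: "((\<lambda>u. poly p u * exp (- u)) \<longlongrightarrow> (0::real)) at_top"
proof -
  have "((\<lambda>u. \<Sum>i\<le>degree p. coeff p i * (u ^ i / exp u)) \<longlongrightarrow> (\<Sum>i\<le>degree p. coeff p i * 0)) at_top"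
    by (intro tendsto_intros tendsto_power_div_exp_0)
  moreover have "(\<lambda>u. \<Sum>i\<le>degree p. coeff p i * (u ^ i / exp u)) = (\<lambda>u. poly p u * exp (- u))"
    by (simp add: fun_eq_iff poly_altdef sum_distrib_left exp_minus divide_inverse mult_ac)
  ultimately show ?thesis by simp
qed

text \<open>For positive \<open>x\<close> all derivatives have the form
  \<open>p (1/x) * exp (- 1/x)\<close> with a polynomial \<open>p\<close>, and one more derivative
  replaces \<open>p\<close> by \<open>d p\<close>, that is, \<open>X^2 * (p - p')\<close>. At 0 the
  difference quotient tends to 0 by \<open>tendsto_poly_exp_0\<close>.\<close>

lemma smooth_on_bump: "smooth_on UNIV bump"
proof -
  define F where "F p x = (if x > 0 then poly p (inverse x) * exp (- inverse x) else 0)" for p :: "real poly" and x :: real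
  define d where "d p = [:0, 0, 1:] * (p - pderiv p)" for p :: "real poly"
  have F: "(F p has_field_derivative F (d p) x) (at x)" for p x
  proof -
    consider "x > 0" | "x < 0" | "x = 0" by linarith
    then show ?thesis
    proof cases
      case 1
      have "((\<lambda>x. poly p (inverse x) * exp (- inverse x)) has_field_derivative
          poly (d p) (inverse x) * exp (- inverse x)) (at x)"
        using 1 by (auto intro!: derivative_eq_intros simp: d_def algebra_simps power2_eq_square)
      moreover have "F (d p) x = poly (d p) (inverse x) * exp (- inverse x)" using 1 by (simp add: F_def)
      ultimately have "((\<lambda>x. poly p (inverse x) * exp (- inverse x)) has_field_derivative F (d p) x) (at x)" by simp
      then show ?thesis
        by (rule has_field_derivative_transform_within_open[where S = "{0<..}"]) (use 1 in \<open>auto simp: F_def\<close>)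
    next
      case 2
      have "((\<lambda>_. 0) has_field_derivative F (d p) x) (at x)" using 2 by (simp add: F_def)
      then show ?thesis
        by (rule has_field_derivative_transform_within_open[where S = "{..<0}"]) (use 2 in \<open>auto simp: F_def\<close>)
    next
      case 3
      have "((\<lambda>h. F p h / h) \<longlongrightarrow> 0) (at_left 0)"
        by (rule tendsto_eventually) (auto simp: F_def eventually_at_left_field intro!: exI[of _ "-1"])
      moreover have "((\<lambda>h. F p h / h) \<longlongrightarrow> 0) (at_right 0)"
        unfolding filterlim_at_right_to_top
      \<comment> \<open>With \<open>u = 1 / h\<close>, dividing by \<open>h\<close> multiplies the
        polynomial by \<open>u\<close>.\<close>
      proof (rule Lim_transform_eventually[OF tendsto_poly_exp_0[of "[:0, 1:] * p"]])
        show "\<forall>\<^sub>F u in at_top. poly ([:0, 1:] * p) u * exp (- u) = F p (inverse u) / inverse u"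
          using eventually_gt_at_top[of 0] by eventually_elim (simp add: F_def field_simps)
      qed
      ultimately have "((\<lambda>h. F p h / h) \<longlongrightarrow> 0) (at 0)" by (rule filterlim_split_at)
      then show ?thesis using 3 by (simp add: has_field_derivative_iff F_def)
    qed
  qed
  have "smooth_on UNIV (F [:1:])"
  proof (rule smooth_on_coinduct[of "\<lambda>f. \<exists>p. f = F p"])
    fix f assume "\<exists>p. f = F p"
    then obtain p where f: "f = F p" by blast
    have der: "(f has_derivative (*) (F (d p) x)) (at x)" for x using F[of p x] by (simp add: f has_field_derivative_def)
    then have "f differentiable_on UNIV" by (meson differentiableI differentiable_at_imp_differentiable_on)
    moreover have "(\<lambda>x. fderiv f x v) = F (smult v (d p))" for v
      unfolding fderiv_eqI[OF der] by (simp add: F_def fun_eq_iff)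
    ultimately show "f differentiable_on UNIV \<and> (\<forall>v. \<exists>p. (\<lambda>x. fderiv f x v) = F p)" by blast
  qed blast
  moreover have "F [:1:] = bump" by (simp add: fun_eq_iff F_def bump_def)
  ultimately show ?thesis by simp
qed

section \<open>Change of variables\<close>

lemma std_frame_eq_adapted_frame:
  "(std_frame :: nat \<Rightarrow> complex^'n::finite) = adapted_frame J_vec (\<lambda>i. axis (from_nat_into UNIV i) 1)"
  by (simp add: fun_eq_iff std_frame_def adapted_frame_def Let_def)

lemma bij_betw_std_frame:
  "bij_betw (std_frame :: nat \<Rightarrow> complex^'n::finite) {..<2 * CARD('n)} Basis"
proof -
  let ?i = "from_nat_into (UNIV::'n set)"
  have b: "bij_betw ?i {..<CARD('n)} UNIV" by (rule bij_betw_from_nat_into_finite) simp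
  have J: "J_vec (axis a 1) = axis a \<i>" for a :: 'n by (simp add: J_vec_def vec_eq_iff axis_def)
  have s: "(std_frame k :: complex^'n) = axis (?i (k div 2)) (if even k then 1 else \<i>)" for k
    by (simp add: std_frame_def Let_def J)
  show ?thesis
  proof (rule bij_betw_imageI)
    show "inj_on (std_frame :: nat \<Rightarrow> complex^'n) {..<2 * CARD('n)}"
    proof (rule inj_onI)
      fix k l assume kl: "k \<in> {..<2 * CARD('n)}" "l \<in> {..<2 * CARD('n)}" "(std_frame k :: complex^'n) = std_frame l"
      have e: "even k \<longleftrightarrow> even l" and i: "?i (k div 2) = ?i (l div 2)"
        using kl(3) unfolding s axis_eq_axis by (auto simp: complex_eq_iff split: if_splits)
      have "k div 2 = l div 2"
        using i b kl(1,2) by (auto simp: bij_betw_def dest!: inj_onD)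
      then show "k = l" using e by (metis div_mult_mod_eq even_iff_mod_2_eq_zero odd_iff_mod_2_eq_one)
    qed
    have "axis a u \<in> (std_frame :: nat \<Rightarrow> complex^'n) ` {..<2 * CARD('n)}" if u: "u \<in> {1, \<i>}" for a u
    proof -
      obtain k where k: "k < CARD('n)" "a = ?i k" using b by (auto simp: bij_betw_def)
      show ?thesis
      proof (cases "u = 1")
        case True
        then have "axis a u = (std_frame (2 * k) :: complex^'n)" by (simp add: s k)
        then show ?thesis using k by auto
      next
        case False
        then have "axis a u = (std_frame (2 * k + 1) :: complex^'n)" using u by (simp add: s k)
        then show ?thesis using k by auto
      qed
    qed
    then show "(std_frame :: nat \<Rightarrow> complex^'n) ` {..<2 * CARD('n)} = Basis"
      by (auto simp: Basis_vec_def Basis_complex_def s)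
  qed
qed

lemma sum_std_frame: "(\<Sum>k<2 * CARD('n). f (std_frame k)) = (\<Sum>b\<in>(Basis::(complex^'n::finite) set). f b)"
  by (rule sum.reindex_bij_betw[OF bij_betw_std_frame])

lemma std_frame_representation: "(\<Sum>k<2 * CARD('n). (v \<bullet> std_frame k) *\<^sub>R std_frame k) = (v :: complex^'n::finite)"
  using sum_std_frame[of "\<lambda>b. (v \<bullet> b) *\<^sub>R b"] by (simp add: euclidean_representation)

lemma std_frame_inner:
  "k < 2 * CARD('n) \<Longrightarrow> l < 2 * CARD('n) \<Longrightarrow>
    (std_frame k :: complex^'n::finite) \<bullet> std_frame l = (if k = l then 1 else 0)"
  using bij_betwE[OF bij_betw_std_frame[where 'n = 'n]]
    inj_on_eq_iff[OF bij_betw_imp_inj_on[OF bij_betw_std_frame[where 'n = 'n]], of k l]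
  by (simp add: inner_Basis)

text \<open>The determinant of the real linear map \<open>f\<close> in the orthonormal frame
  \<open>std_frame\<close>, written as the permutation sum that \<open>pf_sum_linear_image\<close>
  produces.\<close>

definition std_det :: "(complex^'n::finite \<Rightarrow> complex^'n) \<Rightarrow> real"
  where "std_det f = (\<Sum>\<sigma> | \<sigma> permutes {..<2 * CARD('n)}.
    of_int (sign \<sigma>) * (\<Prod>m<2 * CARD('n). f (std_frame m) \<bullet> std_frame (\<sigma> m)))"

lemma pf_sum_std_frame_image:
  assumes "bilinear B"
  shows "pf_sum B CARD('n) (\<lambda>m. f (std_frame m)) = std_det f * pf_sum B CARD('n) (std_frame :: nat \<Rightarrow> complex^'n::finite)"
proof -
  have "(\<lambda>m. f (std_frame m)) = (\<lambda>m. \<Sum>b<2 * CARD('n). (f (std_frame m) \<bullet> std_frame b) *\<^sub>R std_frame b)"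
    by (simp add: std_frame_representation)
  then show ?thesis unfolding std_det_def
    using pf_sum_linear_image[OF assms, of "CARD('n)" "\<lambda>m b. f (std_frame m) \<bullet> std_frame b" std_frame] by simp
qed

text \<open>The change of variables theorem of the library is stated for \<open>real ^ 'm\<close> with a well-ordered
  index type; \<open>'n bit0\<close> is such a type with \<open>2 * CARD('n)\<close> elements.\<close>

lemma set_integral_change_of_variables:
  fixes g :: "complex^'n::finite \<Rightarrow> complex^'n" and F :: "complex^'n \<Rightarrow> real"
  assumes S: "open S" and gS: "g ` S \<in> sets borel"
    and der: "\<And>y. y \<in> S \<Longrightarrow> (g has_derivative g' y) (at y)" and inj: "inj_on g S"
    and int1: "set_integrable lborel S (\<lambda>y. \<bar>std_det (g' y)\<bar> * F (g y))"
    and int2: "set_integrable lborel (g ` S) F"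
  shows "(LINT y:S|lborel. \<bar>std_det (g' y)\<bar> * F (g y)) = (LINT y:g ` S|lborel. F y)"
proof -
  let ?N = "{..<2 * CARD('n)}"
  have "card ?N = card (UNIV :: 'n bit0 set)" by simp
  then obtain h where h: "bij_betw h ?N (UNIV :: 'n bit0 set)"
    by (metis finite_lessThan finite_class.finite_UNIV finite_same_card_bij)
  define hi where "hi = inv_into ?N h"
  have hi: "h (hi j) = j" "hi j \<in> ?N" "k \<in> ?N \<Longrightarrow> hi (h k) = k" for j k
    using h by (auto simp: hi_def bij_betw_def f_inv_into_f inv_into_into)
      (metis UNIV_I inv_into_into lessThan_iff)
  define L :: "complex^'n \<Rightarrow> real^('n bit0)" where "L y = (\<chi> j. y \<bullet> std_frame (hi j))" for y
  define M :: "real^('n bit0) \<Rightarrow> complex^'n" where "M x = (\<Sum>k\<in>?N. (x $ h k) *\<^sub>R std_frame k)" for x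
  have linL: "linear L" by (rule linearI) (simp_all add: L_def vec_eq_iff inner_add_left)
  have linM: "linear M" by (rule linearI) (simp_all add: M_def sum.distrib scaleR_add_left scaleR_sum_right)
  have blL: "bounded_linear L" and blM: "bounded_linear M" using linL linM by (auto simp: linear_conv_bounded_linear)
  have M_L: "M (L y) = y" for y
    unfolding M_def L_def using std_frame_representation[of y] hi by (auto intro!: sum.cong simp: vec_lambda_beta)
  have Mi: "M x \<bullet> std_frame k = x $ h k" if "k \<in> ?N" for x k
    using that by (simp add: M_def inner_sum_left std_frame_inner sum.delta if_distrib[of "\<lambda>c. _ * c"] cong: if_cong)
  have L_M: "L (M x) = x" for x by (simp add: L_def vec_eq_iff Mi[OF hi(2)] hi(1))
  have meas: "L \<in> borel_measurable borel" "M \<in> borel_measurable borel"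
    using blL blM by (auto intro!: borel_measurable_continuous_onI linear_continuous_on)
  \<comment> \<open>\<open>L\<close> only renames the coordinates, so boxes correspond to boxes with
    the same side lengths; this characterises Lebesgue measure.\<close>
  have lb: "(lborel :: (real^('n bit0)) measure) = distr lborel borel L"
  proof (rule lborel_eqI)
    fix l u :: "real^('n bit0)" assume lu: "\<And>b. b \<in> Basis \<Longrightarrow> l \<bullet> b \<le> u \<bullet> b"
    have lu': "l $ j \<le> u $ j" for j using lu[of "axis j 1"] by (simp add: inner_axis)
    have "L -` box l u = box (M l) (M u)"
    proof (rule set_eqI)
      fix y :: "complex^'n"
      have "y \<in> box (M l) (M u) \<longleftrightarrow> (\<forall>k\<in>?N. M l \<bullet> std_frame k < y \<bullet> std_frame k \<and> y \<bullet> std_frame k < M u \<bullet> std_frame k)"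
        unfolding mem_box bij_betw_imp_surj_on[OF bij_betw_std_frame[where 'n = 'n], symmetric] by blast
      also have "\<dots> \<longleftrightarrow> (\<forall>k\<in>?N. l $ h k < L y $ h k \<and> L y $ h k < u $ h k)"
        using Mi hi by (auto simp: L_def)
      also have "\<dots> \<longleftrightarrow> (\<forall>j. l $ j < L y $ j \<and> L y $ j < u $ j)"
        using hi by metis
      finally show "y \<in> L -` box l u \<longleftrightarrow> y \<in> box (M l) (M u)" by (simp add: mem_box_cart)
    qed
    then have "emeasure (distr lborel borel L) (box l u) = emeasure lborel (box (M l) (M u))"
      using meas by (subst emeasure_distr) auto
    also have "\<dots> = ennreal (\<Prod>b\<in>Basis. (M u - M l) \<bullet> b)"
    proof (rule emeasure_lborel_box)
      fix b :: "complex^'n" assume "b \<in> Basis"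
      then obtain k where "k \<in> ?N" "b = std_frame k" using bij_betw_std_frame[where 'n = 'n] by (auto simp: bij_betw_def)
      then show "M l \<bullet> b \<le> M u \<bullet> b" using Mi lu' by simp
    qed
    also have "(\<Prod>b\<in>(Basis :: (complex^'n) set). (M u - M l) \<bullet> b) = (\<Prod>k\<in>?N. (M u - M l) \<bullet> std_frame k)"
      by (rule prod.reindex_bij_betw[OF bij_betw_std_frame, symmetric])
    also have "\<dots> = (\<Prod>k\<in>?N. u $ h k - l $ h k)" using Mi by (simp add: inner_diff_left)
    also have "\<dots> = (\<Prod>j\<in>UNIV. u $ j - l $ j)" by (rule prod.reindex_bij_betw[OF h])
    also have "\<dots> = (\<Prod>b\<in>Basis. (u - l) \<bullet> b)"
    proof -
      have "inj (\<lambda>j. axis j (1::real) :: real^('n bit0))" by (auto intro!: injI simp: axis_eq_axis)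
      then have "(\<Prod>b\<in>range (\<lambda>j. axis j (1::real) :: real^('n bit0)). (u - l) \<bullet> b) = (\<Prod>j\<in>UNIV. u $ j - l $ j)"
        by (subst prod.reindex) (auto simp: inner_axis)
      moreover have "range (\<lambda>j. axis j (1::real) :: real^('n bit0)) = Basis" by (auto simp: Basis_vec_def)
      ultimately show ?thesis by simp
    qed
    finally show "emeasure (distr lborel borel L) (box l u) = ennreal (\<Prod>b\<in>Basis. (u - l) \<bullet> b)" .
  qed simp
  have transfer: "set_integrable lborel (L ` X) (\<lambda>x. f (M x)) \<and>
      (LINT x:L ` X|lborel. f (M x)) = (LINT y:X|lborel. f y)"
    if X: "X \<in> sets borel" and f: "set_integrable lborel X f" for X and f :: "complex^'n \<Rightarrow> real"
  proof -
    have ind: "indicator (L ` X) x = (indicator X (M x) :: real)" for x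
      using L_M M_L by (auto simp: indicator_def image_iff) (metis L_M)
    define q where "q y = indicator X y *\<^sub>R f y" for y
    have q: "integrable lborel q" using f by (simp add: q_def[abs_def] set_integrable_def)
    have qM: "(\<lambda>x. q (M x)) \<in> borel_measurable borel"
      using measurable_compose[OF meas(2) borel_measurable_integrable[OF q, simplified]] by simp
    have "integrable (distr lborel borel L) (\<lambda>x. q (M x))"
      using q qM meas by (subst integrable_distr_eq) (auto simp: M_L)
    moreover have "integral\<^sup>L (distr lborel borel L) (\<lambda>x. q (M x)) = integral\<^sup>L lborel q"
      using qM meas by (subst integral_distr) (auto simp: M_L)
    ultimately show ?thesis unfolding set_integrable_def set_lebesgue_integral_def ind lb q_def by simp
  qed
  define G where "G x = L (g (M x))" for x
  define G' where "G' x v = L (g' (M x) (M v))" for x v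
  have derG: "(G has_derivative G' x) (at x within L ` S)" if x: "x \<in> L ` S" for x
  proof -
    have "M x \<in> S" using x M_L by auto
    have "(M has_derivative M) (at x)" using blM by (rule bounded_linear_imp_has_derivative)
    from has_derivative_compose[OF this der[OF \<open>M x \<in> S\<close>]]
    have "((\<lambda>x. g (M x)) has_derivative (\<lambda>v. g' (M x) (M v))) (at x)" .
    from bounded_linear.has_derivative[OF blL this]
    show ?thesis unfolding G_def G'_def by (rule has_derivative_at_withinI)
  qed
  have injG: "inj_on G (L ` S)"
    unfolding G_def by (rule inj_onI) (metis (no_types, lifting) M_L imageE inj inj_on_def)
  have GLS: "G ` L ` S = L ` g ` S" unfolding G_def by (auto simp: image_image M_L)
  have detG: "det (matrix (G' x)) = std_det (g' (M x))" for x
  proof -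
    \<comment> \<open>Transposing puts the permuted index on the second vector of the inner product,
      as in \<open>std_det\<close>; conjugating permutations by the enumeration \<open>hi\<close>
      then matches the two sums.\<close>
    have "det (matrix (G' x)) = det (Finite_Cartesian_Product.transpose (matrix (G' x)))" by simp
    also have "\<dots> = (\<Sum>p | p permutes (UNIV :: 'n bit0 set). of_int (sign p) *
        (\<Prod>j\<in>UNIV. g' (M x) (std_frame (hi j)) \<bullet> std_frame (hi (p j))))"
    proof -
      have "M (axis j 1) = std_frame (hi j)" for j
      proof -
        have "M (axis j 1) = (\<Sum>k\<in>?N. (if k = hi j then 1 else 0) *\<^sub>R std_frame k)"
          unfolding M_def using hi by (intro sum.cong) (auto simp: axis_def)
        also have "\<dots> = (\<Sum>k\<in>?N. if k = hi j then std_frame k else 0)" by (rule sum.cong) auto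
        finally show ?thesis using hi(2)[of j] by (simp add: sum.delta)
      qed
      then have "Finite_Cartesian_Product.transpose (matrix (G' x)) $ j $ i = g' (M x) (std_frame (hi j)) \<bullet> std_frame (hi i)" for i j
        by (simp add: Finite_Cartesian_Product.transpose_def matrix_def G'_def L_def)
      then show ?thesis by (simp add: det_def)
    qed
    also have "\<dots> = std_det (g' (M x))"
      unfolding std_det_def
    proof (rule sum.reindex_bij_witness[where i = "map_permutation ?N h" and j = "map_permutation UNIV hi"])
      have bi: "bij_betw hi UNIV ?N" unfolding hi_def by (rule bij_betw_inv_into[OF h])
      fix p assume "p \<in> {p. p permutes (UNIV :: 'n bit0 set)}"
      then have p: "p permutes UNIV" by simp
      show "map_permutation ?N h (map_permutation UNIV hi p) = p"
        by (rule map_permutation_compose_inv[OF bi p]) (simp add: hi)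
      show "map_permutation UNIV hi p \<in> {\<sigma>. \<sigma> permutes ?N}" using map_permutation_permutes[OF bi p] by simp
      have inj: "inj_on hi UNIV" using bi by (simp add: bij_betw_def)
      have "(\<Prod>m\<in>?N. g' (M x) (std_frame m) \<bullet> std_frame (map_permutation UNIV hi p m))
        = (\<Prod>j\<in>UNIV. g' (M x) (std_frame (hi j)) \<bullet> std_frame (map_permutation UNIV hi p (hi j)))"
        by (rule prod.reindex_bij_betw[OF bi, symmetric])
      also have "\<dots> = (\<Prod>j\<in>UNIV. g' (M x) (std_frame (hi j)) \<bullet> std_frame (hi (p j)))"
        by (simp add: map_permutation_apply[OF inj])
      finally show "of_int (sign (map_permutation UNIV hi p)) *
          (\<Prod>m\<in>?N. g' (M x) (std_frame m) \<bullet> std_frame (map_permutation UNIV hi p m))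
        = of_int (sign p) * (\<Prod>j\<in>UNIV. g' (M x) (std_frame (hi j)) \<bullet> std_frame (hi (p j)))"
        using sign_map_permutation[OF inj p] by simp
    next
      fix \<sigma> assume "\<sigma> \<in> {\<sigma>. \<sigma> permutes ?N}"
      then have \<sigma>: "\<sigma> permutes ?N" by simp
      show "map_permutation UNIV hi (map_permutation ?N h \<sigma>) = \<sigma>"
        by (rule map_permutation_compose_inv[OF h \<sigma>]) (simp add: hi)
      show "map_permutation ?N h \<sigma> \<in> {p. p permutes (UNIV :: 'n bit0 set)}" using map_permutation_permutes[OF h \<sigma>] by simp
    qed
    finally show ?thesis .
  qed
  \<comment> \<open>The change of variables theorem concerns vector-valued functions, so
    \<open>F\<close> is regarded as a function into \<open>real^1\<close>.\<close>
  have hk: "(\<lambda>x. vec (f x) :: real^1) absolutely_integrable_on X \<and> integral X (\<lambda>x. vec (f x) :: real^1) = vec (LINT x:X|lborel. f x)"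
    if f: "set_integrable lborel X f" for X and f :: "real^('n bit0) \<Rightarrow> real"
  proof -
    have bl: "bounded_linear (vec :: real \<Rightarrow> real^1)"
      by (intro linear_conv_bounded_linear[THEN iffD1] linearI) (simp_all add: vec_eq_iff)
    have v: "set_integrable lborel X (\<lambda>x. vec (f x) :: real^1)"
    proof -
      have "(\<lambda>x. indicator X x *\<^sub>R (vec (f x) :: real^1)) = (\<lambda>x. vec (indicator X x *\<^sub>R f x))"
        by (simp add: fun_eq_iff vec_eq_iff)
      then show ?thesis using integrable_bounded_linear[OF bl f[unfolded set_integrable_def]]
        by (simp add: set_integrable_def)
    qed
    have "(\<lambda>x. vec (f x) :: real^1) absolutely_integrable_on X"
      using v integrable_completion[of "\<lambda>x. indicator X x *\<^sub>R (vec (f x) :: real^1)" lborel] borel_measurable_integrable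
      unfolding set_integrable_def by blast
    moreover have "integral X (\<lambda>x. vec (f x) :: real^1) = vec (integral X f)"
      using integral_linear[OF set_borel_integral_eq_integral(1)[OF f] bl] by (simp add: o_def)
    ultimately show ?thesis using set_borel_integral_eq_integral(2)[OF f] by simp
  qed
  have SB: "S \<in> sets borel" using S by simp
  note t1 = transfer[OF SB int1] and t2 = transfer[OF gS int2]
  have "L ` S = M -` S" using L_M M_L by (auto simp: image_iff) (metis L_M)
  moreover have "M -` S \<inter> space borel \<in> sets borel" by (rule measurable_sets[OF meas(2) SB])
  ultimately have LS: "L ` S \<in> sets lebesgue" by simp
  have FM: "\<bar>std_det (g' (M x))\<bar> * F (g (M x)) = \<bar>det (matrix (G' x))\<bar> * F (M (G x))" for x
    by (simp add: detG G_def M_L)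
  have "integral (L ` S) (\<lambda>x. \<bar>det (matrix (G' x))\<bar> *\<^sub>R (vec (F (M (G x))) :: real^1)) = vec (LINT y:S|lborel. \<bar>std_det (g' y)\<bar> * F (g y))
     \<and> (\<lambda>x. \<bar>det (matrix (G' x))\<bar> *\<^sub>R (vec (F (M (G x))) :: real^1)) absolutely_integrable_on L ` S"
  proof -
    have e: "(\<lambda>x. \<bar>det (matrix (G' x))\<bar> *\<^sub>R (vec (F (M (G x))) :: real^1)) = (\<lambda>x. vec (\<bar>std_det (g' (M x))\<bar> * F (g (M x))))"
      unfolding FM by (simp add: fun_eq_iff vec_eq_iff)
    show ?thesis unfolding e using hk[OF conjunct1[OF t1]] t1 by simp
  qed
  then have "integral (G ` L ` S) (\<lambda>x. vec (F (M x)) :: real^1) = vec (LINT y:S|lborel. \<bar>std_det (g' y)\<bar> * F (g y))"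
    using has_absolute_integral_change_of_variables[OF LS derG injG, of "\<lambda>x. vec (F (M x)) :: real^1"] by blast
  moreover have "integral (G ` L ` S) (\<lambda>x. vec (F (M x)) :: real^1) = vec (LINT y:g ` S|lborel. F y)"
    unfolding GLS using hk[OF conjunct1[OF t2]] t2 by simp
  ultimately have "(vec (LINT y:S|lborel. \<bar>std_det (g' y)\<bar> * F (g y)) :: real^1) = vec (LINT y:g ` S|lborel. F y)" by simp
  then show ?thesis by (simp add: vec_eq_iff)
qed

section \<open>Compact complex manifolds\<close>

definition transition :: "('z, 'n) chart \<Rightarrow> ('z, 'n) chart \<Rightarrow> complex^'n \<Rightarrow> complex^'n"
  where "transition c d y = snd d (chart_inv c y)"

locale compact_mfd =
  fixes A :: "('z::t2_space, 'n::finite) chart set"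
  assumes mfd: "compact_complex_manifold A"
begin

lemma chart_homeomorphism:
  assumes "c \<in> A"
  shows "homeomorphism (fst c) (snd c ` fst c) (snd c) (chart_inv c)"
  using mfd assms unfolding compact_complex_manifold_def by blast

lemma open_chart_dom: "c \<in> A \<Longrightarrow> open (fst c)"
  and open_chart_img: "c \<in> A \<Longrightarrow> open (snd c ` fst c)"
  using mfd unfolding compact_complex_manifold_def by blast+

lemma compact_space: "compact (UNIV :: 'z set)"
  using mfd unfolding compact_complex_manifold_def by blast

lemma chart_at: obtains c where "c \<in> A" "z \<in> fst c"
  using mfd unfolding compact_complex_manifold_def by blast

lemma chart_inv_mem [intro]:
  assumes "c \<in> A" "y \<in> snd c ` fst c"
  shows "chart_inv c y \<in> fst c"
  using chart_homeomorphism[OF assms(1)] assms(2) unfolding homeomorphism_def by blast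

lemma chart_chart_inv:
  assumes "c \<in> A" "y \<in> snd c ` fst c"
  shows "snd c (chart_inv c y) = y"
  using chart_homeomorphism[OF assms(1)] assms(2) unfolding homeomorphism_def by blast

lemma chart_inv_chart:
  assumes "c \<in> A" "z \<in> fst c"
  shows "chart_inv c (snd c z) = z"
  using chart_homeomorphism[OF assms(1)] assms(2) unfolding homeomorphism_def by blast

lemma continuous_on_chart_inv: "c \<in> A \<Longrightarrow> continuous_on (snd c ` fst c) (chart_inv c)"
  and continuous_on_chart: "c \<in> A \<Longrightarrow> continuous_on (fst c) (snd c)"
  using chart_homeomorphism unfolding homeomorphism_def by blast+

lemma chart_image_Int:
  assumes "c \<in> A"
  shows "snd c ` (fst c \<inter> W) = {y \<in> snd c ` fst c. chart_inv c y \<in> W}"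
  using chart_inv_chart[OF assms] by auto

lemma open_chart_image:
  assumes "c \<in> A" "open W"
  shows "open (snd c ` (fst c \<inter> W))"
proof -
  have "open (snd c ` fst c \<inter> chart_inv c -` W)"
    by (rule continuous_open_preimage[OF continuous_on_chart_inv open_chart_img]) (use assms in auto)
  moreover have "snd c ` (fst c \<inter> W) = snd c ` fst c \<inter> chart_inv c -` W"
    using chart_image_Int[OF assms(1), of W] by auto
  ultimately show ?thesis by simp
qed

lemma transition_mem:
  assumes "c \<in> A" "d \<in> A" "y \<in> snd c ` (fst c \<inter> (fst d \<inter> W))"
  shows "transition c d y \<in> snd d ` (fst d \<inter> (fst c \<inter> W))"
    and "chart_inv d (transition c d y) = chart_inv c y"
    and "transition d c (transition c d y) = y"
proof -
  obtain x where x: "x \<in> fst c" "x \<in> fst d" "x \<in> W" "y = snd c x" using assms(3) by auto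
  have "chart_inv c y = x" "chart_inv d (snd d x) = x" using x chart_inv_chart assms by auto
  then show "transition c d y \<in> snd d ` (fst d \<inter> (fst c \<inter> W))"
    "chart_inv d (transition c d y) = chart_inv c y" "transition d c (transition c d y) = y"
    using x by (auto simp: transition_def)
qed

lemma transition_image:
  assumes "c \<in> A" "d \<in> A"
  shows "transition c d ` (snd c ` (fst c \<inter> fst d)) = snd d ` (fst d \<inter> fst c)"
  using chart_inv_chart[OF assms(1)] by (auto simp: transition_def image_iff)

lemma holo_transition:
  assumes "c \<in> A" "d \<in> A"
  shows "holo_on (snd c ` (fst c \<inter> fst d)) (\<lambda>y. transition c d y $ a)"
  using mfd assms unfolding compact_complex_manifold_def transition_def by blast

lemma smooth_transition:
  assumes "c \<in> A" "d \<in> A"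
  shows "smooth_on (snd c ` (fst c \<inter> fst d)) (transition c d)"
proof (rule smooth_on_euclidean)
  show o: "open (snd c ` (fst c \<inter> fst d))" using open_chart_image open_chart_dom assms by blast
  fix b :: "complex^'n" assume "b \<in> Basis"
  then obtain a u where b: "b = axis a u" by (auto simp: Basis_vec_def)
  have "smooth_on (snd c ` (fst c \<inter> fst d)) (\<lambda>y. transition c d y $ a \<bullet> u)"
    by (intro smooth_on_inner[OF o] smooth_on_const[OF o] holo_on_smooth_on[OF o] holo_transition assms)
  then show "smooth_on (snd c ` (fst c \<inter> fst d)) (\<lambda>y. transition c d y \<bullet> b)"
    by (simp add: b inner_axis)
qed

lemma fderiv_transition_J:
  assumes "c \<in> A" "d \<in> A" "y \<in> snd c ` (fst c \<inter> fst d)"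
  shows "fderiv (transition c d) y (k *s v) = k *s fderiv (transition c d) y v"
proof -
  have o: "open (snd c ` (fst c \<inter> fst d))" using open_chart_image open_chart_dom assms by blast
  have "fderiv (transition c d) y v $ a = fderiv (\<lambda>y. transition c d y $ a) y v" for a v
    using fderiv_eqI[OF bounded_linear.has_derivative[OF bounded_linear_vec_nth
        smooth_on_has_derivative[OF o smooth_transition[OF assms(1,2)] assms(3)]]] by simp
  then show ?thesis
    using holo_on_fderiv_scale[OF holo_transition[OF assms(1,2)] assms(3)] by (simp add: vec_eq_iff)
qed

lemma smooth_chart_change:
  assumes c: "c \<in> A" and d: "d \<in> A" and W: "open W"
    and f: "smooth_on (snd d ` (fst d \<inter> W)) (\<lambda>y. f (chart_inv d y))"
  shows "smooth_on (snd c ` (fst c \<inter> (fst d \<inter> W))) (\<lambda>y. f (chart_inv c y))"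
proof -
  have o: "open (snd c ` (fst c \<inter> (fst d \<inter> W)))" "open (snd d ` (fst d \<inter> W))"
    using open_chart_image open_chart_dom c d W by blast+
  have "smooth_on (snd c ` (fst c \<inter> (fst d \<inter> W))) (\<lambda>y. f (chart_inv d (transition c d y)))"
    by (rule smooth_on_compose[OF o smooth_on_subset[OF smooth_transition[OF c d]] f])
      (use transition_mem(1)[OF c d] in auto)
  then show ?thesis
    by (rule smooth_on_cong[OF o(1), THEN iffD1, rotated]) (use transition_mem(2)[OF c d] in auto)
qed

lemma smooth_fst_snd:
  "smooth_on UNIV (fst :: 'p::euclidean_space \<times> 'q::euclidean_space \<Rightarrow> 'p)"
  "smooth_on UNIV (snd :: 'p::euclidean_space \<times> 'q::euclidean_space \<Rightarrow> 'q)"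
  by (auto intro!: smooth_on_bounded_linear bounded_linear_fst bounded_linear_snd)

lemma smooth_on_prod_transition:
  assumes c: "c \<in> A" and d: "d \<in> A" and U: "open U"
  shows "smooth_on (U \<times> snd c ` (fst c \<inter> fst d)) (\<lambda>p. (fst p :: 'p::euclidean_space, transition c d (snd p)))"
proof -
  have o: "open (snd c ` (fst c \<inter> fst d))" using open_chart_image open_chart_dom c d by blast
  have oU: "open (U \<times> snd c ` (fst c \<inter> fst d))" using o U by (rule open_Times[rotated])
  show ?thesis
    by (intro smooth_on_Pair[OF oU] smooth_on_subset[OF smooth_fst_snd(1)]
        smooth_on_compose[OF oU o smooth_on_subset[OF smooth_fst_snd(2)] smooth_transition[OF c d]]) auto
qed

section \<open>Bump functions and partitions of unity on the manifold\<close>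

lemma smooth_bump_at:
  assumes c: "c \<in> A" and z: "z \<in> fst c"
  obtains b K where "smooth_fun_on A UNIV b" "\<And>z. 0 \<le> b z" "b z > 0" "compact K" "K \<subseteq> fst c"
    "{z. b z \<noteq> 0} \<subseteq> K" "open {z. b z > 0}"
proof -
  obtain r where r: "r > 0" "cball (snd c z) r \<subseteq> snd c ` fst c"
    using open_chart_img[OF c] z by (meson imageI open_contains_cball)
  define h where "h y = r\<^sup>2 - (y - snd c z) \<bullet> (y - snd c z)" for y
  define b where "b z' = (if z' \<in> fst c then bump (h (snd c z')) else 0)" for z'
  define K where "K = chart_inv c ` cball (snd c z) r"
  have h: "smooth_on UNIV h" unfolding h_def
    by (intro smooth_on_diff smooth_on_inner smooth_on_const smooth_on_bounded_linear[OF _ bounded_linear_ident]) auto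
  have sb: "smooth_on S (\<lambda>y. bump (h y))" for S
    by (rule smooth_on_subset[OF smooth_on_compose[OF open_UNIV open_UNIV h smooth_on_bump]]) auto
  have K: "compact K" "K \<subseteq> fst c"
    unfolding K_def using r c chart_inv_mem
    by (auto intro!: compact_continuous_image continuous_on_subset[OF continuous_on_chart_inv])
  have supp: "z' \<in> K" if "b z' \<noteq> 0" for z'
  proof -
    have z': "z' \<in> fst c" "h (snd c z') > 0" using that by (auto simp: b_def bump_def split: if_splits)
    then have "norm (snd c z' - snd c z) ^ 2 < r\<^sup>2" by (simp add: h_def power2_norm_eq_inner)
    then have "norm (snd c z' - snd c z) < r" using r(1) by (simp add: power_less_imp_less_base)
    then have "snd c z' \<in> cball (snd c z) r" by (simp add: dist_norm norm_minus_commute)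
    then show ?thesis unfolding K_def using chart_inv_chart[OF c z'(1)] by (metis imageI)
  qed
  have clK: "closed K" using K(1) by (rule compact_imp_closed)
  have nonneg: "b z' \<ge> 0" for z' by (simp add: b_def bump_def)
  have "smooth_fun_on A UNIV b"
    unfolding smooth_fun_on_def
  proof
    fix d assume d: "d \<in> A"
    show "smooth_on (snd d ` (fst d \<inter> UNIV)) (\<lambda>y. b (chart_inv d y))"
    proof (rule smooth_on_local)
      fix y assume "y \<in> snd d ` (fst d \<inter> UNIV)"
      then have y: "y \<in> snd d ` fst d" by simp
      show "\<exists>N. open N \<and> y \<in> N \<and> smooth_on N (\<lambda>y. b (chart_inv d y))"
      \<comment> \<open>Near \<open>K\<close> the function is a smooth expression in the chart
        \<open>c\<close>; away from \<open>K\<close> it is zero.\<close>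
      proof (cases "chart_inv d y \<in> K")
        case True
        have "smooth_on (snd c ` (fst c \<inter> UNIV)) (\<lambda>y. b (chart_inv c y))"
          by (rule smooth_on_cong[THEN iffD1, OF _ _ sb])
            (use open_chart_img[OF c] chart_chart_inv[OF c] chart_inv_mem[OF c] in \<open>auto simp: b_def\<close>)
        from smooth_chart_change[OF d c open_UNIV this]
        have "smooth_on (snd d ` (fst d \<inter> fst c)) (\<lambda>y. b (chart_inv d y))" by simp
        moreover have "y \<in> snd d ` (fst d \<inter> fst c)" using True K y chart_image_Int[OF d] by auto
        ultimately show ?thesis using open_chart_image[OF d open_chart_dom[OF c]] by blast
      next
        case False
        let ?N = "snd d ` (fst d \<inter> - K)"
        have o: "open ?N" using open_chart_image[OF d] clK by auto
        have "smooth_on ?N (\<lambda>y. b (chart_inv d y))"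
          by (rule smooth_on_cong[THEN iffD1, OF o _ smooth_on_const[OF o, of 0]])
            (use supp chart_image_Int[OF d, of "- K"] in auto)
        moreover have "y \<in> ?N" using False y chart_image_Int[OF d, of "- K"] by auto
        ultimately show ?thesis using o by blast
      qed
    qed
  qed
  moreover have "b z > 0" using z r by (simp add: b_def h_def bump_def)
  moreover have "open {z. b z > 0}"
  proof -
    have "continuous_on (fst c) (\<lambda>z. h (snd c z))"
      by (rule continuous_on_compose2[OF smooth_on_imp_continuous_on[OF h] continuous_on_chart[OF c]]) auto
    then have "open (fst c \<inter> (\<lambda>z. h (snd c z)) -` {0<..})"
      by (rule continuous_open_preimage[OF _ open_chart_dom[OF c]]) auto
    moreover have "fst c \<inter> (\<lambda>z. h (snd c z)) -` {0<..} = {z. b z > 0}" by (auto simp: b_def bump_def)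
    ultimately show ?thesis by simp
  qed
  ultimately show ?thesis using that[of b K] K supp nonneg by blast
qed

text \<open>By compactness the positivity sets of finitely many bumps cover the manifold, so their
  sum \<open>s\<close> is positive and each bump may be divided by it.\<close>

lemma ex_partition_of_unity: "\<exists>P. partition_of_unity A P"
proof -
  have "\<exists>p. fst p \<in> A \<and> smooth_fun_on A UNIV (snd p) \<and> (\<forall>z. 0 \<le> snd p z) \<and> snd p z > 0 \<and>
      open {z. snd p z > 0} \<and> (\<exists>K. compact K \<and> K \<subseteq> fst (fst p) \<and> {z. snd p z \<noteq> 0} \<subseteq> K)" for z
  proof -
    obtain c where c: "c \<in> A" "z \<in> fst c" by (rule chart_at)
    obtain b K where "smooth_fun_on A UNIV b" "\<And>z. 0 \<le> b z" "b z > 0" "compact K" "K \<subseteq> fst c"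
      "{z. b z \<noteq> 0} \<subseteq> K" "open {z. b z > 0}" by (rule smooth_bump_at[OF c]) blast
    then show ?thesis using c by (intro exI[of _ "(c, b)"]) auto
  qed
  then obtain p where p: "\<And>z. fst (p z) \<in> A" "\<And>z. smooth_fun_on A UNIV (snd (p z))" "\<And>z w. 0 \<le> snd (p z) w"
    "\<And>z. snd (p z) z > 0" "\<And>z. open {w. snd (p z) w > 0}"
    "\<And>z. \<exists>K. compact K \<and> K \<subseteq> fst (fst (p z)) \<and> {w. snd (p z) w \<noteq> 0} \<subseteq> K" by metis
  obtain Z where Z: "finite Z" "UNIV \<subseteq> (\<Union>z\<in>Z. {w. snd (p z) w > 0})"
    by (rule compactE_image[OF compact_space, of UNIV "\<lambda>z. {w. snd (p z) w > 0}"]) (use p in auto)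
  define P where "P = p ` Z"
  define s where "s w = (\<Sum>q\<in>P. snd q w)" for w
  have finP: "finite P" using Z by (simp add: P_def)
  have s: "s w > 0" for w
  proof -
    obtain z where z: "z \<in> Z" "snd (p z) w > 0" using Z(2) by blast
    have "snd (p z) w \<le> s w"
      unfolding s_def by (rule member_le_sum) (use z p finP in \<open>auto simp: P_def\<close>)
    then show ?thesis using z by linarith
  qed
  define Q where "Q = (\<lambda>(c, b). (c, \<lambda>w. b w / s w)) ` P"
  \<comment> \<open>A partition is a set of pairs, so dividing by \<open>s\<close> must not identify
    two of them when sums are reindexed.\<close>
  have inj: "inj_on (\<lambda>(c, b). (c, \<lambda>w. b w / s w)) P"
  proof (rule inj_onI)
    fix p q :: "('z, 'n) chart \<times> ('z \<Rightarrow> real)"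
    assume "(\<lambda>(c, b). (c, \<lambda>w. b w / s w)) p = (\<lambda>(c, b). (c, \<lambda>w. b w / s w)) q"
    then have 1: "fst p = fst q" and 2: "(\<lambda>w. snd p w / s w) = (\<lambda>w. snd q w / s w)"
      by (auto simp: case_prod_unfold)
    have "snd p w = snd q w" for w using fun_cong[OF 2, of w] s[of w] by simp
    then show "p = q" using 1 by (simp add: prod_eq_iff fun_eq_iff)
  qed
  have "partition_of_unity A Q"
    unfolding partition_of_unity_def case_prod_unfold
  proof (intro conjI ballI allI)
    show "finite Q" using finP by (simp add: Q_def)
    show "(\<Sum>q\<in>Q. snd q z) = 1" for z
    proof -
      have "(\<Sum>q\<in>Q. snd q z) = (\<Sum>q\<in>P. snd q z / s z)"
        unfolding Q_def by (subst sum.reindex[OF inj]) (simp add: case_prod_unfold)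
      also have "\<dots> = s z / s z" unfolding sum_divide_distrib[symmetric] by (simp add: s_def)
      finally show ?thesis using s[of z] by simp
    qed
    fix q assume "q \<in> Q"
    then obtain z where z: "z \<in> Z" "q = (fst (p z), \<lambda>w. snd (p z) w / s w)"
      by (auto simp: Q_def P_def case_prod_unfold)
    show "fst q \<in> A" "0 \<le> snd q w" for w using z p s[of w] by (auto intro!: divide_nonneg_pos)
    show "smooth_fun_on A UNIV (snd q)"
      unfolding smooth_fun_on_def
    proof
      fix d assume d: "d \<in> A"
      have o: "open (snd d ` (fst d \<inter> UNIV))" using open_chart_img[OF d] by simp
      have sm: "smooth_on (snd d ` (fst d \<inter> UNIV)) (\<lambda>y. snd (p z) (chart_inv d y))" for z
        using p(2) d unfolding smooth_fun_on_def by blast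
      have "smooth_on (snd d ` (fst d \<inter> UNIV)) (\<lambda>y. s (chart_inv d y))"
        unfolding s_def using sm by (intro smooth_on_sum[OF o]) (auto simp: P_def)
      then show "smooth_on (snd d ` (fst d \<inter> UNIV)) (\<lambda>y. snd q (chart_inv d y))"
        unfolding z using smooth_on_divide[OF o sm] s by (simp add: less_imp_neq[symmetric])
    qed
    obtain K where K: "compact K" "K \<subseteq> fst (fst (p z))" "{w. snd (p z) w \<noteq> 0} \<subseteq> K" using p(6) by blast
    have "closure {w. snd q w \<noteq> 0} \<subseteq> K"
      by (rule closure_minimal) (use K z in \<open>auto intro: compact_imp_closed\<close>)
    then show "closure {w. snd q w \<noteq> 0} \<subseteq> fst (fst q)" using K z by auto
  qed
  then show ?thesis by blast
qed

text \<open>The same choice as the \<open>SOME\<close> in \<open>form_integral\<close>, so that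
  fibre integrals can be compared with \<open>L2_inner\<close> without a change of
  partition.\<close>

definition pou :: "(('z, 'n) chart \<times> ('z \<Rightarrow> real)) set"
  where "pou = (SOME P. partition_of_unity A P)"

lemma partition_of_unity_pou: "partition_of_unity A pou"
  unfolding pou_def using ex_partition_of_unity by (rule someI_ex)

lemma finite_pou: "finite pou"
  and pou_sum: "(\<Sum>q\<in>pou. snd q z) = 1"
  using partition_of_unity_pou by (auto simp: partition_of_unity_def case_prod_unfold)

lemma pou_chart: "q \<in> pou \<Longrightarrow> fst q \<in> A"
  and pou_smooth: "q \<in> pou \<Longrightarrow> d \<in> A \<Longrightarrow> smooth_on (snd d ` fst d) (\<lambda>y. snd q (chart_inv d y))"
  and pou_nonneg: "q \<in> pou \<Longrightarrow> 0 \<le> snd q z"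
  and pou_supp: "q \<in> pou \<Longrightarrow> closure {z. snd q z \<noteq> 0} \<subseteq> fst (fst q)"
  using partition_of_unity_pou by (auto simp: partition_of_unity_def case_prod_unfold smooth_fun_on_def)

lemma closed_compact: "closed C \<Longrightarrow> compact (C :: 'z set)"
  using compact_space compact_Int_closed[of UNIV C] by simp

lemma compact_chart_image:
  assumes "c \<in> A" "closed C" "C \<subseteq> fst c"
  shows "compact (snd c ` C)"
  using continuous_on_subset[OF continuous_on_chart[OF assms(1)] assms(3)] closed_compact[OF assms(2)]
  by (rule compact_continuous_image)

definition chart_cont :: "('z \<Rightarrow> 'b::topological_space) \<Rightarrow> bool"
  where "chart_cont f \<longleftrightarrow> (\<forall>c\<in>A. continuous_on (snd c ` fst c) (\<lambda>y. f (chart_inv c y)))"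

end

section \<open>Integration against a smooth positive density\<close>

lemma set_integral_Re:
  "set_integrable M S h \<Longrightarrow> Re (LINT x:S|M. h x) = (LINT x:S|M. Re (h x))"
  and set_integral_Im:
  "set_integrable M S h \<Longrightarrow> Im (LINT x:S|M. h x) = (LINT x:S|M. Im (h x))"
  unfolding set_lebesgue_integral_def set_integrable_def
  using integral_Re[of M "\<lambda>x. indicator S x *\<^sub>R h x"] integral_Im[of M "\<lambda>x. indicator S x *\<^sub>R h x"] by auto

locale mfd_density = compact_mfd A for A :: "('z::t2_space, 'n::finite) chart set" +
  fixes \<kappa> :: "('z, 'n) chart \<Rightarrow> complex^'n \<Rightarrow> real"
  assumes \<kappa>_smooth: "c \<in> A \<Longrightarrow> smooth_on (snd c ` fst c) (\<kappa> c)"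
    and \<kappa>_pos: "c \<in> A \<Longrightarrow> y \<in> snd c ` fst c \<Longrightarrow> \<kappa> c y > 0"
    and \<kappa>_change: "c \<in> A \<Longrightarrow> d \<in> A \<Longrightarrow> y \<in> snd c ` (fst c \<inter> fst d) \<Longrightarrow>
      \<kappa> c y = \<bar>std_det (fderiv (transition c d) y)\<bar> * \<kappa> d (transition c d y)"
begin

lemma \<kappa>_cont: "c \<in> A \<Longrightarrow> continuous_on (snd c ` fst c) (\<kappa> c)"
  by (rule smooth_on_imp_continuous_on[OF \<kappa>_smooth])

text \<open>The function lives on a closed, hence compact, subset of the overlap of the two charts,
  where the factor in \<open>\<kappa>_change\<close> is the one of the change of variables formula.
  Compactness also provides the integrability.\<close>

lemma chart_integral_change_real:
  fixes f :: "'z \<Rightarrow> real"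
  assumes c: "c \<in> A" and d: "d \<in> A" and C: "closed C" "C \<subseteq> fst c \<inter> fst d"
    and f0: "\<And>z. z \<notin> C \<Longrightarrow> f z = 0" and f: "chart_cont f"
  shows "(LINT y:snd c ` fst c|lborel. f (chart_inv c y) * \<kappa> c y) = (LINT y:snd d ` fst d|lborel. f (chart_inv d y) * \<kappa> d y)"
proof -
  let ?O = "snd c ` (fst c \<inter> fst d)" and ?g = "transition c d"
  have fc: "continuous_on (snd c ` fst c) (\<lambda>y. f (chart_inv c y))" if "c \<in> A" for c
    using f that by (simp add: chart_cont_def)
  have op: "open ?O" using open_chart_image open_chart_dom c d by blast
  have cpt: "compact (snd c ` C)" "compact (snd d ` C)" using C c d by (auto intro!: compact_chart_image)
  have img: "?g ` ?O = snd d ` (fst d \<inter> fst c)" by (rule transition_image[OF c d])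
  have off: "f (chart_inv e y) = 0" if "e \<in> A" "y \<in> snd e ` fst e - snd e ` C" for e y
    using that f0 chart_chart_inv[OF that(1)] by (metis DiffD1 DiffD2 image_eqI)
  have sub: "snd c ` C \<subseteq> ?O" "snd d ` C \<subseteq> snd d ` (fst d \<inter> fst c)" using C by auto
  have int: "set_integrable lborel (snd e ` C) (\<lambda>y. f (chart_inv e y) * \<kappa> e y)" if "e = c \<or> e = d" for e
    by (rule set_integrable_compact)
      (use that cpt C c d in \<open>auto intro!: continuous_intros continuous_on_subset[OF fc] continuous_on_subset[OF \<kappa>_cont]\<close>)
  have eq: "\<bar>std_det (fderiv ?g y)\<bar> * (f (chart_inv d (?g y)) * \<kappa> d (?g y)) = f (chart_inv c y) * \<kappa> c y" if "y \<in> ?O" for y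
    using \<kappa>_change[OF c d that] transition_mem(2)[OF c d, of y UNIV] that by simp
  have "(LINT y:snd c ` fst c|lborel. f (chart_inv c y) * \<kappa> c y) = (LINT y:snd c ` C|lborel. f (chart_inv c y) * \<kappa> c y)"
    by (rule set_integral_cong_support) (use C off[OF c] in auto)
  also have "\<dots> = (LINT y:?O|lborel. f (chart_inv c y) * \<kappa> c y)"
    by (rule set_integral_cong_support[symmetric]) (use sub off[OF c] in auto)
  also have "\<dots> = (LINT y:?O|lborel. \<bar>std_det (fderiv ?g y)\<bar> * (f (chart_inv d (?g y)) * \<kappa> d (?g y)))"
    by (rule set_lebesgue_integral_cong) (use op eq in auto)
  also have "\<dots> = (LINT y:?g ` ?O|lborel. f (chart_inv d y) * \<kappa> d y)"
  proof (rule set_integral_change_of_variables[OF op])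
    show "?g ` ?O \<in> sets borel" unfolding img using open_chart_image open_chart_dom c d by auto
    show "(?g has_derivative fderiv ?g y) (at y)" if "y \<in> ?O" for y
      by (rule smooth_on_has_derivative[OF op smooth_transition[OF c d] that])
    show "inj_on ?g ?O" by (rule inj_on_inverseI[of _ "transition d c"]) (use transition_mem(3)[OF c d, of _ UNIV] in auto)
    show "set_integrable lborel (?g ` ?O) (\<lambda>y. f (chart_inv d y) * \<kappa> d y)"
      unfolding img using int[of d] set_integrable_cong_support[OF sub(2), of "\<lambda>y. f (chart_inv d y) * \<kappa> d y"] off[OF d] by auto
    have "set_integrable lborel ?O (\<lambda>y. f (chart_inv c y) * \<kappa> c y)"
      using int[of c] set_integrable_cong_support[OF sub(1), of "\<lambda>y. f (chart_inv c y) * \<kappa> c y"] off[OF c] by auto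
    then show "set_integrable lborel ?O (\<lambda>y. \<bar>std_det (fderiv ?g y)\<bar> * (f (chart_inv d (?g y)) * \<kappa> d (?g y)))"
      by (rule set_integrable_cong[THEN iffD1, rotated -1]) (use eq in auto)
  qed
  also have "\<dots> = (LINT y:snd d ` C|lborel. f (chart_inv d y) * \<kappa> d y)"
    unfolding img by (rule set_integral_cong_support) (use sub off[OF d] in auto)
  also have "\<dots> = (LINT y:snd d ` fst d|lborel. f (chart_inv d y) * \<kappa> d y)"
    by (rule set_integral_cong_support[symmetric]) (use C off[OF d] in auto)
  finally show ?thesis .
qed

lemma chart_set_integrable:
  fixes f :: "'z \<Rightarrow> complex"
  assumes c: "c \<in> A" and C: "closed C" "C \<subseteq> fst c"
    and f0: "\<And>z. z \<notin> C \<Longrightarrow> f z = 0" and f: "chart_cont f"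
  shows "set_integrable lborel (snd c ` fst c) (\<lambda>y. f (chart_inv c y) * of_real (\<kappa> c y))"
proof -
  have off: "f (chart_inv c y) = 0" if "y \<in> snd c ` fst c - snd c ` C" for y
    using that f0 chart_chart_inv[OF c] by (metis DiffD1 DiffD2 image_eqI)
  have fc: "continuous_on (snd c ` fst c) (\<lambda>y. f (chart_inv c y))" using f c by (simp add: chart_cont_def)
  have "set_integrable lborel (snd c ` C) (\<lambda>y. f (chart_inv c y) * of_real (\<kappa> c y))"
    by (rule set_integrable_compact)
      (use C c compact_chart_image in \<open>auto intro!: continuous_intros continuous_on_subset[OF fc] continuous_on_subset[OF \<kappa>_cont]\<close>)
  then show ?thesis
    by (subst set_integrable_cong_support[of "snd c ` C"]) (use off C in auto)
qed

lemma chart_integral_change: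
  fixes f :: "'z \<Rightarrow> complex"
  assumes c: "c \<in> A" and d: "d \<in> A" and C: "closed C" "C \<subseteq> fst c \<inter> fst d"
    and f0: "\<And>z. z \<notin> C \<Longrightarrow> f z = 0" and f: "chart_cont f"
  shows "(LINT y:snd c ` fst c|lborel. f (chart_inv c y) * of_real (\<kappa> c y))
    = (LINT y:snd d ` fst d|lborel. f (chart_inv d y) * of_real (\<kappa> d y))"
proof -
  have cont: "chart_cont (\<lambda>z. Re (f z))" "chart_cont (\<lambda>z. Im (f z))"
    using f by (auto simp: chart_cont_def intro!: continuous_intros)
  have int: "set_integrable lborel (snd c ` fst c) (\<lambda>y. f (chart_inv c y) * of_real (\<kappa> c y))"
     "set_integrable lborel (snd d ` fst d) (\<lambda>y. f (chart_inv d y) * of_real (\<kappa> d y))"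
    using chart_set_integrable[OF c C(1) _ f0 f] chart_set_integrable[OF d C(1) _ f0 f] C(2) by auto
  show ?thesis
  proof (rule complex_eqI)
    show "Re (LINT y:snd c ` fst c|lborel. f (chart_inv c y) * of_real (\<kappa> c y))
      = Re (LINT y:snd d ` fst d|lborel. f (chart_inv d y) * of_real (\<kappa> d y))"
      using chart_integral_change_real[OF c d C _ cont(1)] f0 by (simp add: set_integral_Re[OF int(1)] set_integral_Re[OF int(2)])
    show "Im (LINT y:snd c ` fst c|lborel. f (chart_inv c y) * of_real (\<kappa> c y))
      = Im (LINT y:snd d ` fst d|lborel. f (chart_inv d y) * of_real (\<kappa> d y))"
      using chart_integral_change_real[OF c d C _ cont(2)] f0 by (simp add: set_integral_Im[OF int(1)] set_integral_Im[OF int(2)])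
  qed
qed

end

context compact_mfd
begin

lemma pou_cont: "q \<in> pou \<Longrightarrow> chart_cont (snd q)"
  unfolding chart_cont_def using pou_smooth smooth_on_imp_continuous_on by blast

lemma chart_cont_mult:
  fixes f g :: "'z \<Rightarrow> 'b::real_normed_algebra"
  shows "chart_cont f \<Longrightarrow> chart_cont g \<Longrightarrow> chart_cont (\<lambda>z. f z * g z)"
  by (auto simp: chart_cont_def intro!: continuous_intros)

lemma chart_cont_add:
  fixes f g :: "'z \<Rightarrow> 'b::real_normed_vector"
  shows "chart_cont f \<Longrightarrow> chart_cont g \<Longrightarrow> chart_cont (\<lambda>z. f z + g z)"
  by (auto simp: chart_cont_def intro!: continuous_intros)

lemma chart_cont_of_real: "chart_cont f \<Longrightarrow> chart_cont (\<lambda>z. complex_of_real (f z))"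
  by (auto simp: chart_cont_def intro!: continuous_intros)

definition pou_support :: "('z, 'n) chart \<times> ('z \<Rightarrow> real) \<Rightarrow> 'z set"
  where "pou_support q = closure {z. snd q z \<noteq> 0}"

lemma closed_pou_support: "closed (pou_support q)"
  by (simp add: pou_support_def)

lemma pou_support_chart: "q \<in> pou \<Longrightarrow> pou_support q \<subseteq> fst (fst q)"
  unfolding pou_support_def by (rule pou_supp)

lemma pou_zero: "z \<notin> pou_support q \<Longrightarrow> snd q z = 0"
  using subsetD[OF closure_subset, of z "{z. snd q z \<noteq> 0}"] by (auto simp: pou_support_def)

definition vderiv :: "(('z, 'n) chart \<Rightarrow> complex^'n \<Rightarrow> complex^'n) \<Rightarrow> ('z \<Rightarrow> 'b::real_normed_vector) \<Rightarrow> 'z \<Rightarrow> 'b"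
  where "vderiv X f z = (let c = SOME c. c \<in> A \<and> z \<in> fst c
    in fderiv (\<lambda>y. f (chart_inv c y)) (snd c z) (X c (snd c z)))"

definition vector_field :: "(('z, 'n) chart \<Rightarrow> complex^'n \<Rightarrow> complex^'n) \<Rightarrow> bool"
  where "vector_field X \<longleftrightarrow> (\<forall>c\<in>A. smooth_on (snd c ` fst c) (X c)) \<and>
    (\<forall>c\<in>A. \<forall>d\<in>A. \<forall>y\<in>snd c ` (fst c \<inter> fst d). X d (transition c d y) = fderiv (transition c d) y (X c y))"

text \<open>By the chain rule and the transformation law of \<open>X\<close>, the chart chosen in
  \<open>vderiv\<close> does not matter.\<close>

lemma vderiv_chart:
  assumes X: "vector_field X" and f: "\<And>c. c \<in> A \<Longrightarrow> smooth_on (snd c ` fst c) (\<lambda>y. f (chart_inv c y))"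
    and c: "c \<in> A" and z: "z \<in> fst c"
  shows "vderiv X f z = fderiv (\<lambda>y. f (chart_inv c y)) (snd c z) (X c (snd c z))"
proof -
  define d where "d = (SOME c. c \<in> A \<and> z \<in> fst c)"
  have d: "d \<in> A" "z \<in> fst d" unfolding d_def using someI[of "\<lambda>c. c \<in> A \<and> z \<in> fst c" c] c z by auto
  have o: "open (snd c ` (fst c \<inter> fst d))" using open_chart_image open_chart_dom c d by blast
  have y: "snd c z \<in> snd c ` (fst c \<inter> fst d)" using z d by auto
  have T: "transition c d (snd c z) = snd d z" by (simp add: transition_def chart_inv_chart[OF c z])
  have "fderiv (\<lambda>y. f (chart_inv c y)) (snd c z) = fderiv (\<lambda>y. f (chart_inv d (transition c d y))) (snd c z)"
    by (rule fderiv_cong[OF o y]) (use transition_mem(2)[OF c d(1), of _ UNIV] in auto)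
  also have "\<dots> = (\<lambda>v. fderiv (\<lambda>y. f (chart_inv d y)) (snd d z) (fderiv (transition c d) (snd c z) v))"
  proof (rule fderiv_eqI)
    have "((\<lambda>y. f (chart_inv d y)) has_derivative fderiv (\<lambda>y. f (chart_inv d y)) (snd d z)) (at (snd d z))"
      by (rule smooth_on_has_derivative[OF open_chart_img[OF d(1)] f[OF d(1)]]) (use d in auto)
    then show "((\<lambda>y. f (chart_inv d (transition c d y))) has_derivative
        (\<lambda>v. fderiv (\<lambda>y. f (chart_inv d y)) (snd d z) (fderiv (transition c d) (snd c z) v))) (at (snd c z))"
      using has_derivative_compose[OF smooth_on_has_derivative[OF o smooth_transition[OF c d(1)] y]] T by auto
  qed
  finally have "fderiv (\<lambda>y. f (chart_inv c y)) (snd c z) (X c (snd c z))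
    = fderiv (\<lambda>y. f (chart_inv d y)) (snd d z) (fderiv (transition c d) (snd c z) (X c (snd c z)))" by simp
  also have "fderiv (transition c d) (snd c z) (X c (snd c z)) = X d (snd d z)"
    using X c d(1) y unfolding vector_field_def by (metis T)
  finally show ?thesis unfolding vderiv_def Let_def d_def[symmetric] by simp
qed

end

context mfd_density
begin

definition dens_integral :: "('z \<Rightarrow> complex) \<Rightarrow> complex"
  where "dens_integral f = (\<Sum>q\<in>pou. LINT y:snd (fst q) ` fst (fst q)|lborel.
    of_real (snd q (chart_inv (fst q) y)) * f (chart_inv (fst q) y) * of_real (\<kappa> (fst q) y))"

lemma dens_integrable:
  fixes f :: "'z \<Rightarrow> complex"
  assumes "chart_cont f" "q \<in> pou"
  shows "set_integrable lborel (snd (fst q) ` fst (fst q))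
    (\<lambda>y. of_real (snd q (chart_inv (fst q) y)) * f (chart_inv (fst q) y) * of_real (\<kappa> (fst q) y))"
proof (rule chart_set_integrable[of _ "pou_support q" "\<lambda>z. of_real (snd q z) * f z"])
  show "chart_cont (\<lambda>z. of_real (snd q z) * f z)"
    by (intro chart_cont_mult chart_cont_of_real pou_cont assms)
qed (use pou_chart[OF assms(2)] pou_support_chart[OF assms(2)] pou_zero closed_pou_support in auto)

lemma dens_integral_add:
  assumes "chart_cont f" "chart_cont g"
  shows "dens_integral (\<lambda>z. f z + g z) = dens_integral f + dens_integral g"
  unfolding dens_integral_def sum.distrib[symmetric]
  using dens_integrable[OF assms(1)] dens_integrable[OF assms(2)]
  by (intro sum.cong refl) (simp add: distrib_left distrib_right set_integral_add)

lemma dens_integral_mult: "dens_integral (\<lambda>z. k * f z) = k * dens_integral f"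
proof -
  have "(LINT y:S|lborel. of_real (r y) * (k * h y) * of_real (m y)) = k * (LINT y:S|lborel. of_real (r y) * h y * of_real (m y))"
    for S :: "(complex^'n) set" and r m h
    by (subst set_integral_mult_right[symmetric]) (simp only: mult_ac)
  then show ?thesis by (simp add: dens_integral_def sum_distrib_left)
qed

lemma dens_integral_cnj: "dens_integral (\<lambda>z. cnj (f z)) = cnj (dens_integral f)"
proof -
  have "(LINT y:S|lborel. of_real (r y) * cnj (h y) * of_real (m y)) = cnj (LINT y:S|lborel. of_real (r y) * h y * of_real (m y))"
    for S :: "(complex^'n) set" and r m h
    unfolding set_lebesgue_integral_def
    using integral_bounded_linear'[OF bounded_linear_cnj bounded_linear_cnj, of lborel
        "\<lambda>y. indicator S y *\<^sub>R (of_real (r y) * h y * of_real (m y))"] by simp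
  then show ?thesis by (simp add: dens_integral_def)
qed

text \<open>For the last claim: if a sum of nonnegative integrals vanishes, each integrand is zero
  almost everywhere, and being continuous it is zero everywhere, because balls have positive
  measure. Adding up the partition of unity recovers \<open>h\<close>.\<close>

lemma dens_integral_real:
  assumes f: "chart_cont f" and real: "\<And>z. f z = complex_of_real (h z)" and h: "\<And>z. h z \<ge> 0"
  shows "Im (dens_integral f) = 0" "Re (dens_integral f) \<ge> 0"
    and "Re (dens_integral f) = 0 \<Longrightarrow> h z = 0"
proof -
  define J where "J q = (LINT y:snd (fst q) ` fst (fst q)|lborel.
    snd q (chart_inv (fst q) y) * h (chart_inv (fst q) y) * \<kappa> (fst q) y)" for q
  have eq: "dens_integral f = complex_of_real (\<Sum>q\<in>pou. J q)"
  proof -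
    have "dens_integral f = (\<Sum>q\<in>pou. LINT y:snd (fst q) ` fst (fst q)|lborel.
      complex_of_real (snd q (chart_inv (fst q) y) * h (chart_inv (fst q) y) * \<kappa> (fst q) y))"
      unfolding dens_integral_def real by simp
    then show ?thesis unfolding J_def by (simp only: set_integral_complex_of_real of_real_sum)
  qed
  have nn: "snd q (chart_inv (fst q) y) * h (chart_inv (fst q) y) * \<kappa> (fst q) y \<ge> 0"
    if "q \<in> pou" "y \<in> snd (fst q) ` fst (fst q)" for q y
    using h pou_nonneg[OF that(1)] \<kappa>_pos[OF pou_chart[OF that(1)] that(2)]
    by (intro mult_nonneg_nonneg) (auto intro: less_imp_le)
  have J: "J q \<ge> 0" if "q \<in> pou" for q
    unfolding J_def set_lebesgue_integral_def
    by (rule Bochner_Integration.integral_nonneg) (use nn[OF that] in \<open>auto simp: indicator_def\<close>)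
  show "Im (dens_integral f) = 0" "Re (dens_integral f) \<ge> 0" using J by (auto simp: eq sum_nonneg)
  assume "Re (dens_integral f) = 0"
  then have J0: "J q = 0" if "q \<in> pou" for q
    using sum_nonneg_eq_0_iff[OF finite_pou, of J] J that by (simp add: eq)
  have hc: "chart_cont h"
  proof -
    have "h = (\<lambda>z. Re (f z))" using real by auto
    then show ?thesis using f by (auto simp: chart_cont_def intro!: continuous_intros)
  qed
  have zero: "snd q z * h z = 0" if q: "q \<in> pou" for q
  proof (cases "z \<in> fst (fst q)")
    case False
    then have "snd q z = 0" using pou_zero[of z q] pou_support_chart[OF q] by auto
    then show ?thesis by simp
  next
    case True
    let ?c = "fst q" let ?S = "snd ?c ` fst ?c"
    let ?F = "\<lambda>y. snd q (chart_inv ?c y) * h (chart_inv ?c y) * \<kappa> ?c y"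
    have c: "?c \<in> A" using q by (rule pou_chart)
    have F: "continuous_on ?S ?F"
      using hc pou_cont[OF q] \<kappa>_cont[OF c] c by (auto simp: chart_cont_def intro!: continuous_intros)
    have int: "set_integrable lborel ?S ?F"
    proof -
      have "set_integrable lborel ?S (\<lambda>y. complex_of_real (?F y))"
        using dens_integrable[OF f q] unfolding real by simp
      then show ?thesis unfolding set_integrable_def
        using integrable_Re[of lborel "\<lambda>y. indicator ?S y *\<^sub>R complex_of_real (?F y)"] by simp
    qed
    have "AE y in lborel. indicator ?S y *\<^sub>R ?F y = 0"
    proof (rule integral_nonneg_eq_0_iff_AE[THEN iffD1])
      show "integral\<^sup>L lborel (\<lambda>y. indicator ?S y *\<^sub>R ?F y) = 0"
        using J0[OF q] by (simp add: J_def set_lebesgue_integral_def)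
    qed (use int nn[OF q] in \<open>auto simp: set_integrable_def indicator_def\<close>)
    then have ae: "AE y in lborel. y \<in> ?S \<longrightarrow> ?F y = 0" by eventually_elim (auto simp: indicator_def)
    have "?F (snd ?c z) = 0"
    proof (rule ccontr)
      assume nz: "?F (snd ?c z) \<noteq> 0"
      have "open (?S \<inter> ?F -` (- {0}))"
        by (rule continuous_open_preimage[OF F open_chart_img[OF c]]) auto
      then obtain e where e: "e > 0" "ball (snd ?c z) e \<subseteq> ?S \<inter> ?F -` (- {0})"
        using nz True by (metis (no_types, lifting) ComplI IntI imageI openE singletonD vimageI)
      have "AE y in lborel. y \<notin> ball (snd ?c z) e" using ae by eventually_elim (use e in auto)
      then have "emeasure lborel (ball (snd ?c z) e) = 0"
        by (subst (asm) AE_iff_measurable[OF _ refl]) (auto simp: ball_def)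
      moreover have "emeasure lborel (ball (snd ?c z) e) \<noteq> 0"
        using content_ball_pos[OF e(1), of "snd ?c z"] by (auto simp: measure_def)
      ultimately show False by simp
    qed
    then show ?thesis using \<kappa>_pos[OF c, of "snd ?c z"] True by (simp add: chart_inv_chart[OF c True])
  qed
  have "(\<Sum>q\<in>pou. snd q z) * h z = (\<Sum>q\<in>pou. snd q z * h z)" by (rule sum_distrib_right)
  also have "\<dots> = 0" by (rule sum.neutral) (use zero in auto)
  finally show "h z = 0" by (simp add: pou_sum)
qed

text \<open>Integration by parts in each chart moves the derivative to the partition functions,
  whose derivatives add up to zero because the functions add up to 1. The obstacle is that the terms
  are integrated in different charts; a second copy of the partition of unity brings them to common
  integrals.\<close>

lemma divergence_theorem:
  fixes F :: "'z \<Rightarrow> complex"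
  assumes X: "vector_field X" and F: "\<And>c. c \<in> A \<Longrightarrow> smooth_on (snd c ` fst c) (\<lambda>y. F (chart_inv c y))"
  shows "(\<Sum>q\<in>pou. LINT y:snd (fst q) ` fst (fst q)|lborel. of_real (snd q (chart_inv (fst q) y)) *
     (\<Sum>b\<in>Basis. fderiv (\<lambda>y. (X (fst q) y \<bullet> b) *\<^sub>R (F (chart_inv (fst q) y) * of_real (\<kappa> (fst q) y))) y b)) = 0"
proof -
  define E where "E q = vderiv X (snd q)" for q :: "('z, 'n) chart \<times> ('z \<Rightarrow> real)"
  have E: "E q (chart_inv c y) = fderiv (\<lambda>y. snd q (chart_inv c y)) y (X c y)"
    if "q \<in> pou" "c \<in> A" "y \<in> snd c ` fst c" for q c y
    unfolding E_def using vderiv_chart[OF X pou_smooth[OF that(1)] that(2) chart_inv_mem[OF that(2,3)]]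
    by (simp add: chart_chart_inv[OF that(2,3)])
  have Xs: "smooth_on (snd c ` fst c) (X c)" if "c \<in> A" for c using X that by (simp add: vector_field_def)
  have Ec: "chart_cont (E q)" if q: "q \<in> pou" for q
    unfolding chart_cont_def
  proof
    fix c assume c: "c \<in> A"
    let ?S = "snd c ` fst c" and ?r = "\<lambda>y. snd q (chart_inv c y)"
    have o: "open ?S" using open_chart_img[OF c] .
    have "continuous_on ?S (\<lambda>y. \<Sum>b\<in>Basis. (X c y \<bullet> b) *\<^sub>R fderiv ?r y b)"
      by (intro continuous_intros smooth_on_imp_continuous_on[OF Xs[OF c]]
          smooth_on_imp_continuous_on[OF smooth_on_fderiv[OF pou_smooth[OF q c]]])
    then show "continuous_on ?S (\<lambda>y. E q (chart_inv c y))"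
    proof (rule continuous_on_eq)
      fix y assume y: "y \<in> ?S"
      show "(\<Sum>b\<in>Basis. (X c y \<bullet> b) *\<^sub>R fderiv ?r y b) = E q (chart_inv c y)"
        unfolding E[OF q c y]
        by (rule fderiv_eval_basis[OF smooth_on_differentiable[OF o pou_smooth[OF q c] y], symmetric])
    qed
  qed
  have E0: "E q z = 0" if q: "q \<in> pou" and z: "z \<notin> pou_support q" for q z
  proof -
    obtain c where c: "c \<in> A" "z \<in> fst c" by (rule chart_at)
    let ?N = "snd c ` (fst c \<inter> - pou_support q)"
    have "fderiv (\<lambda>y. snd q (chart_inv c y)) (snd c z) = fderiv (\<lambda>_. 0) (snd c z)"
    proof (rule fderiv_cong[of ?N])
      show "open ?N" using open_chart_image[OF c(1), of "- pou_support q"] closed_pou_support[of q] by auto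
      show "snd c z \<in> ?N" using c z by auto
      show "snd q (chart_inv c y) = 0" if y: "y \<in> ?N" for y
      proof -
        obtain x where "x \<in> fst c" "x \<notin> pou_support q" "y = snd c x" using y by blast
        then show ?thesis using pou_zero[of x] chart_inv_chart[OF c(1), of x] by simp
      qed
    qed
    then show ?thesis using E[OF q c(1) imageI[OF c(2)]] chart_inv_chart[OF c] by (simp add: frechet_derivative_const)
  qed
  have Fc: "chart_cont F" unfolding chart_cont_def using F smooth_on_imp_continuous_on by blast
  have step: "(LINT y:snd (fst q) ` fst (fst q)|lborel. of_real (snd q (chart_inv (fst q) y)) *
     (\<Sum>b\<in>Basis. fderiv (\<lambda>y. (X (fst q) y \<bullet> b) *\<^sub>R (F (chart_inv (fst q) y) * of_real (\<kappa> (fst q) y))) y b))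
     = - (LINT y:snd (fst q) ` fst (fst q)|lborel. of_real (E q (chart_inv (fst q) y)) * F (chart_inv (fst q) y) * of_real (\<kappa> (fst q) y))"
    if q: "q \<in> pou" for q
  proof -
    let ?c = "fst q" let ?S = "snd ?c ` fst ?c"
    let ?r = "\<lambda>y. snd q (chart_inv ?c y)" and ?G = "\<lambda>b y. (X ?c y \<bullet> b) *\<^sub>R (F (chart_inv ?c y) * complex_of_real (\<kappa> ?c y))"
    let ?K = "snd ?c ` pou_support q"
    have c: "?c \<in> A" using q by (rule pou_chart)
    have o: "open ?S" using open_chart_img[OF c] .
    have r: "smooth_on ?S ?r" by (rule pou_smooth[OF q c])
    have G: "smooth_on ?S (?G b)" for b
      by (intro smooth_on_scaleR smooth_on_inner smooth_on_mult smooth_on_of_real smooth_on_const Xs F \<kappa>_smooth o c)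
    have K: "compact ?K" "?K \<subseteq> ?S" using compact_chart_image[OF c closed_pou_support pou_support_chart[OF q]] pou_support_chart[OF q] by auto
    have r0: "?r y = 0" if "y \<in> ?S - ?K" for y
      using that pou_zero chart_chart_inv[OF c] by (metis DiffD1 DiffD2 image_eqI)
    have int0: "(LINT y:?S|lborel. fderiv (\<lambda>y. ?r y *\<^sub>R ?G b y) y b) = 0" for b
      by (rule integral_fderiv_compact_support[OF o smooth_on_scaleR[OF o r G] K]) (use r0 in auto)
    have der: "fderiv (\<lambda>y. ?r y *\<^sub>R ?G b y) y b = ?r y *\<^sub>R fderiv (?G b) y b + fderiv ?r y b *\<^sub>R ?G b y" if "y \<in> ?S" for b y
      using fderiv_eqI[OF has_derivative_scaleR[OF smooth_on_has_derivative[OF o r that] smooth_on_has_derivative[OF o G that]]] by simp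
    have sup0: "fderiv (\<lambda>y. ?r y *\<^sub>R ?G b y) y b = 0" if "y \<in> ?S - ?K" for b y
    proof -
      have "fderiv (\<lambda>y. ?r y *\<^sub>R ?G b y) y = fderiv (\<lambda>_. 0) y"
        by (rule fderiv_cong[of "?S - ?K"])
          (use that o K r0 in \<open>auto intro!: open_Diff compact_imp_closed\<close>)
      then show ?thesis by (simp add: frechet_derivative_const)
    qed
    have int: "set_integrable lborel ?S (\<lambda>y. fderiv (\<lambda>y. ?r y *\<^sub>R ?G b y) y b)" for b
    proof -
      have "set_integrable lborel ?K (\<lambda>y. fderiv (\<lambda>y. ?r y *\<^sub>R ?G b y) y b)"
        by (rule set_integrable_compact[OF K(1)], rule continuous_on_subset[OF _ K(2)])
          (rule smooth_on_imp_continuous_on[OF smooth_on_fderiv[OF smooth_on_scaleR[OF o r G]]])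
      then show ?thesis by (subst set_integrable_cong_support[OF K(2)]) (use sup0 in auto)
    qed
    have intE: "set_integrable lborel ?S (\<lambda>y. of_real (E q (chart_inv ?c y)) * F (chart_inv ?c y) * of_real (\<kappa> ?c y))"
      by (rule chart_set_integrable[OF c, of "pou_support q" "\<lambda>z. of_real (E q z) * F z"])
        (use closed_pou_support pou_support_chart[OF q] E0[OF q] Ec[OF q] Fc in \<open>auto intro!: chart_cont_mult chart_cont_of_real\<close>)
    have sumE: "(\<Sum>b\<in>Basis. fderiv ?r y b *\<^sub>R ?G b y) = of_real (E q (chart_inv ?c y)) * F (chart_inv ?c y) * of_real (\<kappa> ?c y)"
      if y: "y \<in> ?S" for y
    proof -
      have "E q (chart_inv ?c y) = (\<Sum>b\<in>Basis. (X ?c y \<bullet> b) *\<^sub>R fderiv ?r y b)"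
        unfolding E[OF q c y] by (rule fderiv_eval_basis[OF smooth_on_differentiable[OF o r y]])
      then show ?thesis by (simp add: sum_distrib_left scaleR_conv_of_real mult_ac)
    qed
    have "(LINT y:?S|lborel. of_real (?r y) * (\<Sum>b\<in>Basis. fderiv (?G b) y b))
      = (LINT y:?S|lborel. (\<Sum>b\<in>Basis. fderiv (\<lambda>y. ?r y *\<^sub>R ?G b y) y b)
          - of_real (E q (chart_inv ?c y)) * F (chart_inv ?c y) * of_real (\<kappa> ?c y))"
    proof (rule set_lebesgue_integral_cong, goal_cases)
      case 2
      show ?case
      proof (intro allI impI)
        fix y assume y: "y \<in> ?S"
        have "(\<Sum>b\<in>Basis. fderiv (\<lambda>y. ?r y *\<^sub>R ?G b y) y b) = (\<Sum>b\<in>Basis. ?r y *\<^sub>R fderiv (?G b) y b) + (\<Sum>b\<in>Basis. fderiv ?r y b *\<^sub>R ?G b y)"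
          unfolding der[OF y] sum.distrib ..
        then show "of_real (?r y) * (\<Sum>b\<in>Basis. fderiv (?G b) y b) = (\<Sum>b\<in>Basis. fderiv (\<lambda>y. ?r y *\<^sub>R ?G b y) y b)
          - of_real (E q (chart_inv ?c y)) * F (chart_inv ?c y) * of_real (\<kappa> ?c y)"
          unfolding sumE[OF y] by (simp add: scaleR_conv_of_real sum_distrib_left)
      qed
    qed (use o in auto)
    also have "\<dots> = (LINT y:?S|lborel. (\<Sum>b\<in>Basis. fderiv (\<lambda>y. ?r y *\<^sub>R ?G b y) y b))
        - (LINT y:?S|lborel. of_real (E q (chart_inv ?c y)) * F (chart_inv ?c y) * of_real (\<kappa> ?c y))"
    proof (rule set_integral_diff(2)[OF _ intE])
      show "set_integrable lborel ?S (\<lambda>y. \<Sum>b\<in>Basis. fderiv (\<lambda>y. ?r y *\<^sub>R ?G b y) y b)"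
        using int unfolding set_integrable_def scaleR_sum_right by (intro Bochner_Integration.integrable_sum)
    qed
    also have "(LINT y:?S|lborel. (\<Sum>b\<in>Basis. fderiv (\<lambda>y. ?r y *\<^sub>R ?G b y) y b)) = (\<Sum>b\<in>Basis. LINT y:?S|lborel. fderiv (\<lambda>y. ?r y *\<^sub>R ?G b y) y b)"
      using int unfolding set_integrable_def set_lebesgue_integral_def scaleR_sum_right by (intro Bochner_Integration.integral_sum)
    finally show ?thesis unfolding int0 by simp
  qed
  have sumE0: "(\<Sum>q\<in>pou. E q z) = 0" for z
  proof -
    obtain c where c: "c \<in> A" "z \<in> fst c" by (rule chart_at)
    have o: "open (snd c ` fst c)" using open_chart_img[OF c(1)] .
    have "(\<Sum>q\<in>pou. E q z) = (\<Sum>q\<in>pou. fderiv (\<lambda>y. snd q (chart_inv c y)) (snd c z) (X c (snd c z)))"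
      by (rule sum.cong[OF refl]) (use E[OF _ c(1) imageI[OF c(2)]] chart_inv_chart[OF c] in simp)
    also have "\<dots> = fderiv (\<lambda>y. \<Sum>q\<in>pou. snd q (chart_inv c y)) (snd c z) (X c (snd c z))"
      using fderiv_eqI[OF has_derivative_sum[of pou, OF smooth_on_has_derivative[OF o pou_smooth[OF _ c(1)] imageI[OF c(2)]]]] by simp
    also have "\<dots> = 0" by (simp add: pou_sum frechet_derivative_const)
    finally show ?thesis .
  qed
  \<comment> \<open>Inserting \<open>(\<Sum>p\<in>pou. snd p z) = 1\<close> splits the integrand
    into pieces supported in two charts, each of which may be integrated in the chart of
    \<open>p\<close> instead; that way the integral becomes a \<open>dens_integral\<close>.\<close>
  have move: "(LINT y:snd (fst q) ` fst (fst q)|lborel. of_real (E q (chart_inv (fst q) y)) * F (chart_inv (fst q) y) * of_real (\<kappa> (fst q) y))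
    = (\<Sum>p\<in>pou. LINT y:snd (fst p) ` fst (fst p)|lborel. of_real (snd p (chart_inv (fst p) y)) *
        (of_real (E q (chart_inv (fst p) y)) * F (chart_inv (fst p) y)) * of_real (\<kappa> (fst p) y))" if q: "q \<in> pou" for q
  proof -
    let ?c = "fst q" let ?S = "snd ?c ` fst ?c"
    let ?f = "\<lambda>p z. complex_of_real (snd p z) * (of_real (E q z) * F z)"
    have c: "?c \<in> A" using q by (rule pou_chart)
    have cc: "chart_cont (?f p)" if "p \<in> pou" for p
      by (intro chart_cont_mult chart_cont_of_real pou_cont[OF that] Ec[OF q] Fc)
    have cq: "pou_support q \<subseteq> fst ?c" by (rule pou_support_chart[OF q])
    have z0: "?f p z = 0" if "p \<in> pou" "z \<notin> pou_support q \<inter> pou_support p" for p z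
      using that(2) E0[OF q, of z] pou_zero[of z p] by auto
    have int: "set_integrable lborel ?S (\<lambda>y. ?f p (chart_inv ?c y) * of_real (\<kappa> ?c y))" if "p \<in> pou" for p
      by (rule chart_set_integrable[OF c, of "pou_support q" "?f p"])
        (use closed_pou_support cq E0[OF q] cc[OF that] in auto)
    have "(LINT y:?S|lborel. of_real (E q (chart_inv ?c y)) * F (chart_inv ?c y) * of_real (\<kappa> ?c y))
      = (LINT y:?S|lborel. \<Sum>p\<in>pou. ?f p (chart_inv ?c y) * of_real (\<kappa> ?c y))"
    proof -
      have "(\<Sum>p\<in>pou. ?f p z * m) = of_real (E q z) * F z * m" for z m
      proof -
        have "(\<Sum>p\<in>pou. ?f p z * m) = of_real (\<Sum>p\<in>pou. snd p z) * (of_real (E q z) * F z * m)"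
          by (simp add: sum_distrib_right mult.assoc)
        then show ?thesis by (simp add: pou_sum)
      qed
      then show ?thesis by simp
    qed
    also have "\<dots> = (\<Sum>p\<in>pou. LINT y:?S|lborel. ?f p (chart_inv ?c y) * of_real (\<kappa> ?c y))"
      using int unfolding set_integrable_def set_lebesgue_integral_def scaleR_sum_right by (intro Bochner_Integration.integral_sum)
    also have "\<dots> = (\<Sum>p\<in>pou. LINT y:snd (fst p) ` fst (fst p)|lborel. ?f p (chart_inv (fst p) y) * of_real (\<kappa> (fst p) y))"
    proof (rule sum.cong[OF refl])
      fix p assume p: "p \<in> pou"
      show "(LINT y:?S|lborel. ?f p (chart_inv ?c y) * of_real (\<kappa> ?c y)) =
        (LINT y:snd (fst p) ` fst (fst p)|lborel. ?f p (chart_inv (fst p) y) * of_real (\<kappa> (fst p) y))"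
        by (rule chart_integral_change[OF c pou_chart[OF p], of "pou_support q \<inter> pou_support p" "?f p"])
          (use cq pou_support_chart[OF p] z0[OF p] cc[OF p] in \<open>auto intro!: closed_Int closed_pou_support\<close>)
    qed
    finally show ?thesis .
  qed
  have "(\<Sum>q\<in>pou. LINT y:snd (fst q) ` fst (fst q)|lborel. of_real (E q (chart_inv (fst q) y)) * F (chart_inv (fst q) y) * of_real (\<kappa> (fst q) y))
    = (\<Sum>q\<in>pou. dens_integral (\<lambda>z. of_real (E q z) * F z))"
    unfolding dens_integral_def by (rule sum.cong[OF refl]) (rule move)
  also have "\<dots> = dens_integral (\<lambda>z. \<Sum>q\<in>pou. of_real (E q z) * F z)"
  proof -
    have "finite Q \<Longrightarrow> Q \<subseteq> pou \<Longrightarrow> chart_cont (\<lambda>z. \<Sum>q\<in>Q. of_real (E q z) * F z) \<and>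
       (\<Sum>q\<in>Q. dens_integral (\<lambda>z. of_real (E q z) * F z)) = dens_integral (\<lambda>z. \<Sum>q\<in>Q. of_real (E q z) * F z)" for Q
    proof (induction Q rule: finite_induct)
      case empty
      then show ?case using dens_integral_mult[of 0 "\<lambda>z. 0"] by (simp add: chart_cont_def)
    next
      case (insert q Q)
      have "chart_cont (\<lambda>z. of_real (E q z) * F z)"
        using insert.prems by (intro chart_cont_mult chart_cont_of_real Ec Fc) auto
      then show ?case using insert by (simp add: dens_integral_add chart_cont_add)
    qed
    from this[OF finite_pou subset_refl] show ?thesis by simp
  qed
  also have "\<dots> = 0"
  proof -
    have "(\<Sum>q\<in>pou. of_real (E q z) * F z) = 0" for z
      unfolding sum_distrib_right[symmetric] of_real_sum[symmetric] sumE0 by simp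
    then show ?thesis using dens_integral_mult[of 0 "\<lambda>z. 0"] by simp
  qed
  finally show ?thesis by (simp add: step sum_negf)
qed

end

section \<open>The geometry of a fibrewise positive metric\<close>

locale fibration = compact_mfd A for A :: "('z::t2_space, 'n::finite) chart set" +
  fixes V :: "'j \<Rightarrow> 'z set" and g :: "'j \<Rightarrow> 'j \<Rightarrow> 'z \<Rightarrow> complex"
    and U :: "complex set" and \<phi> :: "'j \<Rightarrow> complex \<Rightarrow> 'z \<Rightarrow> real"
  assumes lb: "line_bundle A V g" and U: "open U"
    and sm: "smooth_metric_pullback A V g U \<phi>"
    and pm: "\<forall>t\<in>U. positive_metric A V (\<lambda>j. \<phi> j t)"
begin

definition weight :: "('z, 'n) chart \<Rightarrow> 'j \<Rightarrow> complex \<times> (complex^'n) \<Rightarrow> real"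
  where "weight c j = (\<lambda>(t, y). \<phi> j t (chart_inv c y))"

definition fdom :: "('z, 'n) chart \<Rightarrow> 'j \<Rightarrow> (complex \<times> (complex^'n)) set"
  where "fdom c j = U \<times> snd c ` (fst c \<inter> V j)"

definition cdom :: "('z, 'n) chart \<Rightarrow> (complex \<times> (complex^'n)) set"
  where "cdom c = U \<times> snd c ` fst c"

definition frame :: "('z, 'n) chart \<Rightarrow> complex \<times> (complex^'n) \<Rightarrow> 'j"
  where "frame c p = frame_at V (chart_inv c (snd p))"

definition Omega :: "('z, 'n) chart \<Rightarrow> complex \<times> (complex^'n) \<Rightarrow> complex \<times> (complex^'n) \<Rightarrow> complex \<times> (complex^'n) \<Rightarrow> real"
  where "Omega c p = levi J_prod (weight c (frame c p)) p"

lemma open_V: "open (V j)" and V_cover: "(\<Union>j. V j) = UNIV"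
  using lb unfolding line_bundle_def by blast+

lemma frame_at_mem: "z \<in> V (frame_at V z)"
  unfolding frame_at_def using V_cover by (intro someI_ex[of "\<lambda>j. z \<in> V j"]) auto

lemma open_fdom: "c \<in> A \<Longrightarrow> open (fdom c j)"
  unfolding fdom_def by (intro open_Times U open_chart_image open_V)

lemma open_cdom: "c \<in> A \<Longrightarrow> open (cdom c)"
  unfolding cdom_def by (intro open_Times U open_chart_img)

lemma fdom_iff: "c \<in> A \<Longrightarrow> p \<in> fdom c j \<longleftrightarrow> p \<in> cdom c \<and> chart_inv c (snd p) \<in> V j"
  unfolding fdom_def cdom_def using chart_image_Int[of c "V j"] by (auto simp: mem_Times_iff)

lemma fdom_frame: "c \<in> A \<Longrightarrow> p \<in> cdom c \<Longrightarrow> p \<in> fdom c (frame c p)"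
  by (simp add: fdom_iff frame_def frame_at_mem)

lemma smooth_weight: "c \<in> A \<Longrightarrow> smooth_on (fdom c j) (weight c j)"
  using sm unfolding smooth_metric_pullback_def fdom_def weight_def by blast

lemma weight_diff:
  assumes "c \<in> A" "p \<in> fdom c j" "p \<in> fdom c k"
  shows "weight c j p - weight c k p = ln ((cmod (g j k (chart_inv c (snd p))))\<^sup>2)"
  using sm assms unfolding smooth_metric_pullback_def weight_def
  by (auto simp: fdom_iff cdom_def mem_Times_iff case_prod_unfold)

lemma holo_on_comp_snd:
  assumes S: "open S" and h: "holo_on S h"
  shows "smooth_on (UNIV \<times> S) (\<lambda>p::complex \<times> (complex^'n). h (snd p))"
    and "p \<in> UNIV \<times> S \<Longrightarrow> fderiv (\<lambda>p::complex \<times> (complex^'n). h (snd p)) p v = fderiv h (snd p) (snd v)"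
proof -
  have o: "open (UNIV \<times> S :: (complex \<times> (complex^'n)) set)" using S by (intro open_Times) auto
  show "smooth_on (UNIV \<times> S) (\<lambda>p::complex \<times> (complex^'n). h (snd p))"
    by (rule smooth_on_compose[OF o S smooth_on_subset[OF smooth_fst_snd(2)] holo_on_smooth_on[OF S h]]) auto
  assume "p \<in> UNIV \<times> S"
  then have "snd p \<in> S" by auto
  from has_derivative_compose[OF bounded_linear_imp_has_derivative[OF bounded_linear_snd] holo_on_has_derivative[OF h this]]
  have "((\<lambda>p::complex \<times> (complex^'n). h (snd p)) has_derivative (\<lambda>v. fderiv h (snd p) (snd v))) (at p)" .
  from fderiv_eqI[OF this] show "fderiv (\<lambda>p::complex \<times> (complex^'n). h (snd p)) p v = fderiv h (snd p) (snd v)" by simp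
qed

text \<open>Two weights differ by \<open>ln |g|^2\<close> with a holomorphic \<open>g\<close>
  without zeros, and this function is pluriharmonic. On all of \<open>fdom c j\<close> the form thus
  has a single smooth potential, although \<open>Omega\<close> chooses its frame point by point;
  smoothness and closedness follow.\<close>

lemma Omega_eq:
  assumes c: "c \<in> A" and p: "p \<in> fdom c j"
  shows "Omega c p = levi J_prod (weight c j) p"
proof (intro ext)
  fix v w
  define k where "k = frame c p"
  let ?N = "fdom c k \<inter> fdom c j" and ?W = "snd c ` (fst c \<inter> (V k \<inter> V j))"
  let ?T = "\<lambda>p::complex \<times> (complex^'n). g k j (chart_inv c (snd p))"
  have pk: "p \<in> fdom c k" unfolding k_def using p fdom_iff[OF c] fdom_frame[OF c] by blast
  have o: "open ?N" "open ?W" using open_fdom[OF c] open_chart_image[OF c open_Int[OF open_V open_V]] by auto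
  have h: "holo_on ?W (\<lambda>y. g k j (chart_inv c y))"
    using lb c unfolding line_bundle_def holo_fun_on_def by blast
  have sub: "?N \<subseteq> UNIV \<times> ?W"
    using chart_image_Int[OF c] by (auto simp: fdom_iff[OF c] cdom_def)
  have T: "smooth_on ?N ?T" by (rule smooth_on_subset[OF holo_on_comp_snd(1)[OF o(2) h] sub])
  have "levi J_prod (weight c k) p v w - levi J_prod (weight c j) p v w
     = levi J_prod (\<lambda>q. weight c k q - weight c j q) p v w"
    by (rule levi_diff[OF o(1), symmetric])
      (use smooth_on_subset[OF smooth_weight[OF c]] pk p in auto)
  also have "\<dots> = levi J_prod (\<lambda>q. ln ((cmod (?T q))\<^sup>2)) p v w"
    by (rule fun_cong[OF fun_cong[OF levi_cong[OF o(1)]]]) (use weight_diff[OF c] pk p in auto)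
  also have "\<dots> = levi ((*) \<i>) (\<lambda>z. ln ((cmod z)\<^sup>2)) (?T p) (fderiv ?T p v) (fderiv ?T p w)"
  proof (rule levi_pullback[OF o(1) _ T _ smooth_on_ln_cmod])
    show "?T ` ?N \<subseteq> - {0}"
      using lb unfolding line_bundle_def by (auto simp: fdom_iff[OF c])
    show "linear ((*) \<i>)" by (intro linearI) (auto simp: algebra_simps)
    show "fderiv ?T q (J_prod v) = \<i> * fderiv ?T q v" if "q \<in> ?N" for q v
    proof -
      have q: "q \<in> UNIV \<times> ?W" using that sub by blast
      then have "snd q \<in> ?W" by auto
      from holo_on_fderiv_scale[OF h this, of \<i> "snd v"]
      show ?thesis unfolding holo_on_comp_snd(2)[OF o(2) h q] by (simp add: J_prod_def)
    qed
  qed (use pk p in auto)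
  also have "\<dots> = 0"
    using lb p pk unfolding line_bundle_def by (intro levi_ln_cmod) (auto simp: fdom_iff[OF c])
  finally show "Omega c p v w = levi J_prod (weight c j) p v w" by (simp add: Omega_def k_def)
qed

context
  fixes c assumes c: "c \<in> A"
begin

lemma bilinear_Omega: "p \<in> cdom c \<Longrightarrow> bilinear (Omega c p)"
  unfolding Omega_eq[OF c fdom_frame[OF c]]
  by (intro levi_bilinear[OF open_fdom[OF c] smooth_weight[OF c] fdom_frame[OF c]] linear_J_prod)

lemma Omega_antisym: "p \<in> cdom c \<Longrightarrow> Omega c p v w = - Omega c p w v"
  unfolding Omega_eq[OF c fdom_frame[OF c]]
  by (rule levi_antisym[OF open_fdom[OF c] smooth_weight[OF c] fdom_frame[OF c]])

lemma Omega_J_J: "p \<in> cdom c \<Longrightarrow> Omega c p (J_prod v) (J_prod w) = Omega c p v w"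
  unfolding Omega_eq[OF c fdom_frame[OF c]]
  by (rule levi_J_J[OF open_fdom[OF c] smooth_weight[OF c] fdom_frame[OF c]]) auto

lemma Omega_J:
  assumes "p \<in> cdom c"
  shows "Omega c p (J_prod v) w = - Omega c p v (J_prod w)"
  using Omega_J_J[OF assms, of v "J_prod w"] bilinear_rneg[OF bilinear_Omega[OF assms]] by simp

lemma smooth_Omega: "smooth_on (cdom c) (\<lambda>p. Omega c p v w)"
proof (rule smooth_on_local)
  fix p assume p: "p \<in> cdom c"
  let ?j = "frame c p"
  have "smooth_on (fdom c ?j) (\<lambda>p. Omega c p v w)"
    by (rule smooth_on_cong[THEN iffD1, OF open_fdom[OF c] _ smooth_on_levi[OF open_fdom[OF c] smooth_weight[OF c]]])
      (simp add: Omega_eq[OF c])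
  then show "\<exists>N. open N \<and> p \<in> N \<and> smooth_on N (\<lambda>p. Omega c p v w)"
    using open_fdom[OF c] fdom_frame[OF c p] by blast
qed

lemma Omega_closed:
  assumes p: "p \<in> cdom c"
  shows "fderiv (\<lambda>q. Omega c q b w) p a + fderiv (\<lambda>q. Omega c q w a) p b + fderiv (\<lambda>q. Omega c q a b) p w = 0"
proof -
  let ?j = "frame c p"
  note pj = fdom_frame[OF c p]
  have "fderiv (\<lambda>q. Omega c q x y) p = fderiv (\<lambda>q. levi J_prod (weight c ?j) q x y) p" for x y
    by (rule fderiv_cong[OF open_fdom[OF c] pj]) (simp add: Omega_eq[OF c])
  then show ?thesis using levi_closed[OF open_fdom[OF c] smooth_weight[OF c] pj] by simp
qed

lemma curvature_form_pullback_eq: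
  assumes p: "p \<in> cdom c"
  shows "curvature_form_pullback V \<phi> c p w = of_real (Omega c p (w 0) (w 1))"
  using i_ddbar_eq_levi[OF open_fdom[OF c] smooth_weight[OF c] fdom_frame[OF c p], of J_prod w]
  unfolding curvature_form_pullback_def Omega_def weight_def frame_def by simp

text \<open>The fibre form is the pullback of the total one under the holomorphic inclusion of the
  slice at \<open>t\<close>.\<close>

lemma curvature_form_eq:
  assumes p: "(t, y) \<in> cdom c"
  shows "curvature_form V (\<lambda>j. \<phi> j t) c y w = of_real (Omega c (t, y) (0, w 0) (0, w 1))"
proof -
  let ?j = "frame c (t, y)"
  let ?S = "snd c ` (fst c \<inter> V ?j)" and ?T = "\<lambda>y. (t, y)"
  have o: "open ?S" using open_chart_image[OF c open_V] .
  have tU: "t \<in> U" and y: "y \<in> ?S" using fdom_frame[OF c p] by (auto simp: fdom_def)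
  have T: "smooth_on ?S ?T"
    by (intro smooth_on_Pair o smooth_on_const smooth_on_bounded_linear bounded_linear_ident)
  have dT: "fderiv ?T y v = (0, v)" for y v
  proof -
    have "(?T has_derivative (\<lambda>v. (0, v))) (at y)" by (auto intro!: derivative_eq_intros)
    from fderiv_eqI[OF this] show ?thesis by simp
  qed
  have sub: "?T ` ?S \<subseteq> fdom c ?j" using tU by (auto simp: fdom_def)
  have "curvature_form V (\<lambda>j. \<phi> j t) c y w = i_ddbar J_vec (\<lambda>y. weight c ?j (?T y)) y w"
    by (simp add: curvature_form_def weight_def frame_def)
  also have "\<dots> = of_real (levi J_vec (\<lambda>y. weight c ?j (?T y)) y (w 0) (w 1))"
    by (rule i_ddbar_eq_levi[OF o smooth_on_compose[OF o open_fdom[OF c] T smooth_weight[OF c] sub] y])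
  also have "levi J_vec (\<lambda>y. weight c ?j (?T y)) y (w 0) (w 1)
      = levi J_prod (weight c ?j) (t, y) (fderiv ?T y (w 0)) (fderiv ?T y (w 1))"
    by (rule levi_pullback[OF o open_fdom[OF c] T sub smooth_weight[OF c] y linear_J_prod])
      (simp add: dT J_prod_def J_vec_def)
  finally show ?thesis by (simp add: dT Omega_def)
qed

lemma Omega_fibre_pos:
  assumes p: "p \<in> cdom c" and v: "v \<noteq> 0"
  shows "Omega c p (0, v) (0, J_vec v) > 0"
proof -
  obtain t y where ty: "p = (t, y)" by (cases p)
  have "t \<in> U" "y \<in> snd c ` fst c" using p by (auto simp: cdom_def ty)
  then have "positive_form J_vec (curvature_form V (\<lambda>j. \<phi> j t) c y)"
    using pm c unfolding positive_metric_def by blast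
  from this[unfolded positive_form_def, rule_format, OF v]
  show ?thesis using curvature_form_eq[of t y] p by (simp add: ty)
qed

text \<open>The Hermitian form belonging to \<open>Omega\<close>, complex linear in a vertical
  \<open>X\<close> and antilinear in \<open>y\<close>. The first argument may be any vector of the
  total space, so that the mixed coefficients \<open>Hform p (1, 0) y\<close> are covered, which up
  to sign are the right-hand side of the system for the lift.\<close>

definition Hform :: "complex \<times> (complex^'n) \<Rightarrow> complex \<times> (complex^'n) \<Rightarrow> complex^'n \<Rightarrow> complex"
  where "Hform p X y = of_real (Omega c p X (0, J_vec y)) - \<i> * of_real (Omega c p X (0, y))"

lemma Hform_scale:
  assumes p: "p \<in> cdom c"
  shows "Hform p (0, k *s x) y = k * Hform p (0, x) y"
proof -
  note B = bilinear_Omega[OF p]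
  have J: "J_prod (0, x) = (0, J_vec x)" "J_prod (0, y) = (0, J_vec y)" by (auto simp: J_prod_def J_vec_def)
  have x: "(0, k *s x) = Re k *\<^sub>R (0, x) + Im k *\<^sub>R (0 :: complex, J_vec x)"
    using vector_scalar_mult_Complex[of k x] by (simp add: J_vec_def)
  have 1: "Omega c p (0, J_vec x) (0, J_vec y) = Omega c p (0, x) (0, y)"
    using Omega_J_J[OF p, of "(0, x)" "(0, y)"] by (simp add: J)
  have 2: "Omega c p (0, J_vec x) (0, y) = - Omega c p (0, x) (0, J_vec y)"
    using Omega_J[OF p, of "(0, x)" "(0, y)"] by (simp add: J)
  show ?thesis
    unfolding Hform_def x bilinear_ladd[OF B] bilinear_lmul[OF B] 1 2
    by (simp add: complex_eq_iff algebra_simps)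
qed

lemma Hform_add:
  assumes p: "p \<in> cdom c"
  shows "Hform p (X + Y) y = Hform p X y + Hform p Y y" "Hform p X (y + y') = Hform p X y + Hform p X y'"
proof -
  note B = bilinear_Omega[OF p]
  show "Hform p (X + Y) y = Hform p X y + Hform p Y y" unfolding Hform_def bilinear_ladd[OF B] by (simp add: algebra_simps)
  have e: "(0 :: complex, y + y') = (0, y) + (0, y')" "(0 :: complex, J_vec (y + y')) = (0, J_vec y) + (0, J_vec y')"
    using linear_add[OF linear_J_vec] by auto
  show "Hform p X (y + y') = Hform p X y + Hform p X y'"
    unfolding Hform_def e bilinear_radd[OF B] by (simp add: algebra_simps)
qed

lemma Hform_sum:
  assumes p: "p \<in> cdom c"
  shows "Hform p (0, \<Sum>i\<in>I. k i *s x i) y = (\<Sum>i\<in>I. k i * Hform p (0, x i) y)"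
proof (induction I rule: infinite_finite_induct)
  case (insert i I)
  have e: "(0, \<Sum>i\<in>insert i I. k i *s x i) = (0 :: complex, k i *s x i) + (0, \<Sum>i\<in>I. k i *s x i)"
    using insert.hyps by simp
  show ?case unfolding e Hform_add[OF p] Hform_scale[OF p] insert.IH using insert.hyps by simp
next
  case empty
  show ?case using Hform_scale[OF p, of 0 0] by simp
next
  case (infinite I)
  then show ?case using Hform_scale[OF p, of 0 0] by simp
qed

lemma Hform_herm:
  assumes p: "p \<in> cdom c"
  shows "Hform p (0, y) x = cnj (Hform p (0, x) y)"
proof -
  have J: "J_prod (0, x) = (0, J_vec x)" "J_prod (0, y) = (0, J_vec y)" by (auto simp: J_prod_def J_vec_def)
  have "Omega c p (0, y) (0, J_vec x) = Omega c p (0, x) (0, J_vec y)"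
    using Omega_J[OF p, of "(0, x)" "(0, y)"] Omega_antisym[OF p, of "(0, y)" "(0, J_vec x)"] by (simp add: J)
  then show ?thesis unfolding Hform_def using Omega_antisym[OF p, of "(0, y)" "(0, x)"] by (simp add: complex_eq_iff)
qed

lemma Hform_sum_right:
  assumes p: "p \<in> cdom c"
  shows "Hform p (0, x) (\<Sum>i\<in>I. k i *s y i) = (\<Sum>i\<in>I. cnj (k i) * Hform p (0, x) (y i))"
  unfolding Hform_herm[OF p, of x] Hform_sum[OF p] by simp

text \<open>The coefficients of the vertical correction of \<open>(1, 0)\<close> solve a linear
  system whose matrix, \<open>Hform\<close> on the fibre, is positive definite; by
  \<open>smooth_positive_definite_system\<close> they depend smoothly on the point.\<close>

lemma ex_horizontal_lift:
  "\<exists>\<xi>. smooth_on (cdom c) \<xi> \<and> (\<forall>p\<in>cdom c. \<forall>b. Omega c p (1, \<xi> p) (0, b) = 0)"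
proof -
  let ?e = "\<lambda>i. axis i 1 :: complex^'n"
  have rep: "(\<Sum>i\<in>UNIV. k i *s ?e i) = (\<chi> i. k i)" for k
    by (simp add: vec_eq_iff axis_def if_distrib[of "\<lambda>x. _ * x"] cong: if_cong)
  have o: "open (cdom c)" by (rule open_cdom[OF c])
  have sH: "smooth_on (cdom c) (\<lambda>p. Hform p X y)" for X y
    unfolding Hform_def by (intro smooth_on_diff smooth_on_mult smooth_on_of_real smooth_on_const smooth_Omega o)
  have "\<exists>k. (\<forall>i\<in>UNIV. smooth_on (cdom c) (k i)) \<and>
     (\<forall>p\<in>cdom c. \<forall>j\<in>UNIV. (\<Sum>i\<in>UNIV. k i p * Hform p (0, ?e i) (?e j)) = - Hform p (1, 0) (?e j))"
  proof (rule smooth_positive_definite_system[OF _ o])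
    show "Hform p (0, ?e j) (?e i) = cnj (Hform p (0, ?e i) (?e j))" if "p \<in> cdom c" for i j p
      by (rule Hform_herm[OF that])
    fix p and k :: "'n \<Rightarrow> complex" assume p: "p \<in> cdom c" and k: "\<exists>x\<in>UNIV. k x \<noteq> 0"
    have "(\<Sum>i\<in>UNIV. \<Sum>j\<in>UNIV. k i * cnj (k j) * Hform p (0, ?e i) (?e j)) = Hform p (0, \<chi> i. k i) (\<chi> i. k i)"
      unfolding rep[symmetric, of k] Hform_sum[OF p] Hform_sum_right[OF p]
      by (simp add: sum_distrib_left mult_ac) (rule sum.swap)
    moreover have "(\<chi> i. k i) \<noteq> 0" using k by (auto simp: vec_eq_iff)
    ultimately show "0 < Re (\<Sum>i\<in>UNIV. \<Sum>j\<in>UNIV. k i * cnj (k j) * Hform p (0, ?e i) (?e j))"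
      using Omega_fibre_pos[OF p, of "\<chi> i. k i"] by (simp add: Hform_def)
  qed (auto intro!: sH smooth_on_uminus o)
  then obtain k where k: "\<And>i. smooth_on (cdom c) (k i)"
    "\<And>p j. p \<in> cdom c \<Longrightarrow> (\<Sum>i\<in>UNIV. k i p * Hform p (0, ?e i) (?e j)) = - Hform p (1, 0) (?e j)" by auto
  define \<xi> where "\<xi> p = (\<chi> i. k i p)" for p
  have "smooth_on (cdom c) \<xi>"
  proof (rule smooth_on_euclidean[OF o])
    fix b :: "complex^'n" assume "b \<in> Basis"
    then obtain a u where b: "b = axis a u" by (auto simp: Basis_vec_def)
    show "smooth_on (cdom c) (\<lambda>p. \<xi> p \<bullet> b)"
      unfolding b inner_axis \<xi>_def using k by (simp add: smooth_on_inner o smooth_on_const)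
  qed
  moreover have "Omega c p (1, \<xi> p) (0, b) = 0" if p: "p \<in> cdom c" for p b
  proof -
    \<comment> \<open>Real and imaginary part of this equation are the orthogonality to
      \<open>J_vec (?e j)\<close> and to \<open>?e j\<close>, and these vectors span the fibre over
      the reals.\<close>
    have "Hform p (1, \<xi> p) (?e j) = 0" for j
    proof -
      have "(1 :: complex, \<xi> p) = (1, 0) + (0, \<Sum>i\<in>UNIV. k i p *s ?e i)" by (simp add: rep \<xi>_def)
      then show ?thesis using k(2)[OF p, of j] by (simp only: Hform_add[OF p] Hform_sum[OF p]) simp
    qed
    then have e: "Omega c p (1, \<xi> p) (0, ?e j) = 0" "Omega c p (1, \<xi> p) (0, J_vec (?e j)) = 0" for j
      unfolding Hform_def by (auto simp: complex_eq_iff)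
    note B = bilinear_Omega[OF p]
    have lin: "linear (\<lambda>b. Omega c p (1, \<xi> p) (0, b))"
    proof (rule linearI)
      fix x y :: "complex^'n" and r :: real
      have "(0 :: complex, x + y) = (0, x) + (0, y)" "(0 :: complex, r *\<^sub>R x) = r *\<^sub>R (0, x)" by auto
      then show "Omega c p (1, \<xi> p) (0, x + y) = Omega c p (1, \<xi> p) (0, x) + Omega c p (1, \<xi> p) (0, y)"
        "Omega c p (1, \<xi> p) (0, r *\<^sub>R x) = r *\<^sub>R Omega c p (1, \<xi> p) (0, x)"
        by (simp_all only: bilinear_radd[OF B] bilinear_rmul[OF B] real_scaleR_def)
    qed
    have "b = (\<Sum>j\<in>UNIV. Re (b $ j) *\<^sub>R ?e j + Im (b $ j) *\<^sub>R J_vec (?e j))"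
    proof -
      have "b = (\<Sum>j\<in>UNIV. b $ j *s ?e j)" unfolding rep by (simp add: vec_eq_iff)
      then show ?thesis by (subst (asm) vector_scalar_mult_Complex) (simp add: J_vec_def)
    qed
    then have "Omega c p (1, \<xi> p) (0, b) = Omega c p (1, \<xi> p) (0, \<Sum>j\<in>UNIV. Re (b $ j) *\<^sub>R ?e j + Im (b $ j) *\<^sub>R J_vec (?e j))"
      by simp
    also have "\<dots> = 0"
      by (simp only: linear_sum[OF lin] linear_add[OF lin] linear_scale[OF lin] e) simp
    finally show ?thesis .
  qed
  ultimately show ?thesis by blast
qed

end

definition lift :: "('z, 'n) chart \<Rightarrow> complex \<times> (complex^'n) \<Rightarrow> complex^'n"
  where "lift c = (SOME \<xi>. smooth_on (cdom c) \<xi> \<and> (\<forall>p\<in>cdom c. \<forall>b. Omega c p (1, \<xi> p) (0, b) = 0))"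

lemma smooth_lift: "c \<in> A \<Longrightarrow> smooth_on (cdom c) (lift c)"
  and Omega_lift: "c \<in> A \<Longrightarrow> p \<in> cdom c \<Longrightarrow> Omega c p (1, lift c p) (0, b) = 0"
  using someI_ex[OF ex_horizontal_lift[of c]] unfolding lift_def by blast+

text \<open>The lift of the constant real vector field \<open>\<tau>\<close> on \<open>U\<close>;
  \<open>hlift c 1\<close> and \<open>hlift c \<i>\<close> lift the two coordinate fields, and
  \<open>J_prod\<close> carries the former to the latter.\<close>

definition hlift :: "('z, 'n) chart \<Rightarrow> complex \<Rightarrow> complex \<times> (complex^'n) \<Rightarrow> complex \<times> (complex^'n)"
  where "hlift c \<tau> p = (\<tau>, \<tau> *s lift c p)"

lemma hlift_eq: "hlift c \<tau> p = Re \<tau> *\<^sub>R (1, lift c p) + Im \<tau> *\<^sub>R J_prod (1, lift c p)"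
  using vector_scalar_mult_Complex[of \<tau> "lift c p"] by (simp add: hlift_def J_prod_def complex_eq_iff)

lemma Omega_hlift:
  assumes c: "c \<in> A" and p: "p \<in> cdom c"
  shows "Omega c p (hlift c \<tau> p) (0, b) = 0"
proof -
  note B = bilinear_Omega[OF c p]
  have "J_prod (0, b) = (0, J_vec b)" by (simp add: J_prod_def J_vec_def)
  then have "Omega c p (J_prod (1, lift c p)) (0, b) = 0" using Omega_J[OF c p] Omega_lift[OF c p] by simp
  then show ?thesis
    unfolding hlift_eq bilinear_ladd[OF B] bilinear_lmul[OF B] using Omega_lift[OF c p] by simp
qed

text \<open>The change of charts is holomorphic on the total space and leaves \<open>t\<close>
  alone; it carries the local potential in one chart to that in the other, so
  \<open>levi_pullback\<close> applies.\<close>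

lemma Omega_change:
  assumes c: "c \<in> A" and d: "d \<in> A" and p: "p \<in> U \<times> snd c ` (fst c \<inter> fst d)"
  shows "Omega c p X Y = Omega d (fst p, transition c d (snd p))
     (fst X, fderiv (transition c d) (snd p) (snd X)) (fst Y, fderiv (transition c d) (snd p) (snd Y))"
proof -
  define j where "j = frame c p"
  let ?T = "\<lambda>p::complex \<times> (complex^'n). (fst p, transition c d (snd p))"
  let ?N = "U \<times> snd c ` (fst c \<inter> (fst d \<inter> V j))"
  have pc: "p \<in> cdom c" using p by (auto simp: cdom_def)
  have pj: "p \<in> ?N"
    using p fdom_frame[OF c pc] chart_image_Int[OF c] by (auto simp: j_def fdom_iff[OF c] mem_Times_iff)
  have o: "open ?N" by (intro open_Times U open_chart_image c open_Int open_chart_dom d open_V)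
  have sub: "?N \<subseteq> U \<times> snd c ` (fst c \<inter> fst d)" by auto
  have T: "smooth_on ?N ?T" by (rule smooth_on_subset[OF smooth_on_prod_transition[OF c d U] sub])
  have im: "?T ` ?N \<subseteq> fdom d j"
  proof (rule image_subsetI)
    fix q assume q: "q \<in> ?N"
    then have "snd q \<in> snd c ` (fst c \<inter> (fst d \<inter> V j))" by (simp add: mem_Times_iff)
    from transition_mem(1)[OF c d this] show "?T q \<in> fdom d j" using q by (auto simp: fdom_def)
  qed
  have dT: "fderiv ?T q v = (fst v, fderiv (transition c d) (snd q) (snd v))" if "q \<in> ?N" for q v
  proof -
    have o': "open (snd c ` (fst c \<inter> fst d))" using open_chart_image[OF c] open_chart_dom[OF d] by auto
    have "snd q \<in> snd c ` (fst c \<inter> fst d)" using that by auto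
    from has_derivative_compose[OF bounded_linear_imp_has_derivative[OF bounded_linear_snd]
        smooth_on_has_derivative[OF o' smooth_transition[OF c d] this]]
    have "(?T has_derivative (\<lambda>v. (fst v, fderiv (transition c d) (snd q) (snd v)))) (at q)"
      by (intro has_derivative_Pair bounded_linear_imp_has_derivative[OF bounded_linear_fst])
    from fderiv_eqI[OF this] show ?thesis by simp
  qed
  have "Omega c p X Y = levi J_prod (weight c j) p X Y" by (simp add: Omega_def j_def)
  also have "\<dots> = levi J_prod (\<lambda>q. weight d j (?T q)) p X Y"
  proof (rule fun_cong[OF fun_cong[OF levi_cong[OF o pj]]])
    fix q assume "q \<in> ?N"
    then have "snd q \<in> snd c ` (fst c \<inter> (fst d \<inter> V j))" by (simp add: mem_Times_iff)
    from transition_mem(2)[OF c d this] show "weight c j q = weight d j (?T q)"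
      by (simp add: weight_def case_prod_unfold)
  qed
  also have "\<dots> = levi J_prod (weight d j) (?T p) (fderiv ?T p X) (fderiv ?T p Y)"
  proof (rule levi_pullback[OF o open_fdom[OF d] T im smooth_weight[OF d] pj linear_J_prod])
    fix q v assume q: "q \<in> ?N"
    have "snd q \<in> snd c ` (fst c \<inter> fst d)" using q by auto
    from fderiv_transition_J[OF c d this, of \<i>] show "fderiv ?T q (J_prod v) = J_prod (fderiv ?T q v)"
      unfolding dT[OF q] by (simp add: J_prod_def)
  qed
  also have "\<dots> = Omega d (?T p) (fderiv ?T p X) (fderiv ?T p Y)"
    unfolding Omega_eq[OF d subsetD[OF im imageI[OF pj]]] ..
  finally show ?thesis by (simp add: dT[OF pj])
qed

lemma fderiv_transition_inverse:
  assumes c: "c \<in> A" and d: "d \<in> A" and y: "y \<in> snd c ` (fst c \<inter> fst d)"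
  shows "fderiv (transition c d) y (fderiv (transition d c) (transition c d y) b) = b"
proof -
  let ?S = "snd c ` (fst c \<inter> fst d)" and ?S' = "snd d ` (fst d \<inter> fst c)"
  have o: "open ?S" "open ?S'" using open_chart_image open_chart_dom c d by blast+
  have y': "transition c d y \<in> ?S'" and bk: "transition d c (transition c d y) = y"
    using transition_mem[OF c d, of y UNIV] y by auto
  have "((\<lambda>x. transition c d (transition d c x)) has_derivative
      (\<lambda>b. fderiv (transition c d) y (fderiv (transition d c) (transition c d y) b))) (at (transition c d y))"
    using has_derivative_compose[OF smooth_on_has_derivative[OF o(2) smooth_transition[OF d c] y'],
        of "transition c d"] smooth_on_has_derivative[OF o(1) smooth_transition[OF c d] y] unfolding bk by blast
  moreover have "((\<lambda>x. transition c d (transition d c x)) has_derivative (\<lambda>b. b)) (at (transition c d y))"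
    by (rule has_derivative_transform_within_open[OF has_derivative_ident o(2) y'])
      (use transition_mem(3)[OF d c, of _ UNIV] in auto)
  ultimately show ?thesis by (metis has_derivative_unique)
qed

text \<open>Both sides are vertical parts of horizontal lifts of the same vector; their difference
  is vertical and orthogonal to all vertical vectors, hence zero by positivity on the fibre.\<close>

lemma lift_change:
  assumes c: "c \<in> A" and d: "d \<in> A" and t: "t \<in> U" and y: "y \<in> snd c ` (fst c \<inter> fst d)"
  shows "lift d (t, transition c d y) = fderiv (transition c d) y (lift c (t, y))"
proof -
  let ?q = "(t, transition c d y)"
  define x where "x = fderiv (transition c d) y (lift c (t, y))"
  have p: "(t, y) \<in> cdom c" "(t, y) \<in> U \<times> snd c ` (fst c \<inter> fst d)" using t y by (auto simp: cdom_def)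
  have q: "?q \<in> cdom d" using transition_mem(1)[OF c d, of y UNIV] y t by (auto simp: cdom_def)
  note B = bilinear_Omega[OF d q]
  have x: "Omega d ?q (1, x) (0, b) = 0" for b
    using Omega_change[OF c d p(2), of "(1, lift c (t, y))" "(0, fderiv (transition d c) (transition c d y) b)"]
      Omega_lift[OF c p(1)] fderiv_transition_inverse[OF c d y, of b] by (simp add: x_def)
  have "(0 :: complex, lift d ?q - x) = (1, lift d ?q) - (1, x)" by simp
  then have "Omega d ?q (0, lift d ?q - x) (0, J_vec (lift d ?q - x)) = 0"
    by (simp only: bilinear_lsub[OF B] x Omega_lift[OF d q])
  then show ?thesis using Omega_fibre_pos[OF d q, of "lift d ?q - x"] by (auto simp: x_def)
qed

text \<open>The denominator turns \<open>pf_sum\<close> into the Pfaffian of the fibre form in the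
  standard frame; by \<open>divided_power_eq_vol\<close> this is the density of the fibre volume in
  the chart \<open>c\<close>.\<close>

definition vol :: "('z, 'n) chart \<Rightarrow> complex \<times> (complex^'n) \<Rightarrow> real"
  where "vol c p = pf_sum (\<lambda>a b. Omega c p (0, a) (0, b)) CARD('n) (std_frame :: nat \<Rightarrow> complex^'n)
    / (2 ^ CARD('n) * fact CARD('n))"

lemma divided_power_eq_vol:
  assumes c: "c \<in> A" and p: "(t, y) \<in> cdom c"
  shows "divided_power (curvature_form V (\<lambda>j. \<phi> j t) c y) CARD('n) std_frame = of_real (vol c (t, y))"
  unfolding divided_power_def vol_def
  using form_power_eq_pf_sum[of "curvature_form V (\<lambda>j. \<phi> j t) c y" "\<lambda>a b. Omega c (t, y) (0, a) (0, b)" "CARD('n)" std_frame]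
    curvature_form_eq[OF c p] by simp

lemma bilinear_fibre:
  assumes "c \<in> A" "p \<in> cdom c"
  shows "bilinear (\<lambda>a b. Omega c p (0, a) (0, b))"
proof -
  note B = bilinear_Omega[OF assms]
  have e: "(0 :: complex, x + y) = (0, x) + (0, y)" "(0 :: complex, r *\<^sub>R x) = r *\<^sub>R (0, x)" for x y :: "complex^'n" and r :: real
    by auto
  show ?thesis unfolding bilinear_def
    by (intro conjI allI linearI)
      (simp_all only: e bilinear_radd[OF B] bilinear_rmul[OF B] bilinear_ladd[OF B] bilinear_lmul[OF B] real_scaleR_def)
qed

lemma smooth_vol:
  assumes c: "c \<in> A"
  shows "smooth_on (cdom c) (vol c)"
  unfolding vol_def[abs_def] pf_sum_def pf_term_def
  by (intro smooth_on_divide smooth_on_sum smooth_on_mult smooth_on_prod smooth_on_const smooth_Omega[OF c] open_cdom[OF c]) auto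

lemma vol_pos:
  assumes c: "c \<in> A" and p: "p \<in> cdom c"
  shows "vol c p > 0"
proof -
  let ?i = "from_nat_into (UNIV::'n set)"
  have b: "bij_betw ?i {..<CARD('n)} UNIV" by (rule bij_betw_from_nat_into_finite) simp
  have "pf_sum (\<lambda>a b. Omega c p (0, a) (0, b)) CARD('n) (adapted_frame J_vec (\<lambda>i. axis (?i i) 1)) > 0"
  proof (rule pf_sum_pos[OF linear_J_vec _ bilinear_fibre[OF c p]])
    show "Omega c p (0, x) (0, y) = - Omega c p (0, y) (0, x)" for x y by (rule Omega_antisym[OF c p])
    show "Omega c p (0, J_vec x) (0, J_vec y) = Omega c p (0, x) (0, y)" for x y
      using Omega_J_J[OF c p, of "(0, x)" "(0, y)"] by (simp add: J_prod_def J_vec_def)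
    fix k :: "nat \<Rightarrow> complex" assume "\<exists>i<CARD('n). k i \<noteq> 0"
    then obtain l where l: "l < CARD('n)" "k l \<noteq> 0" by blast
    let ?x = "\<Sum>i<CARD('n). Re (k i) *\<^sub>R axis (?i i) 1 + Im (k i) *\<^sub>R J_vec (axis (?i i) (1::complex))"
    have "?x $ ?i l = (\<Sum>i<CARD('n). if i = l then k i else 0)"
      unfolding sum_component
    proof (rule sum.cong[OF refl])
      fix i assume i: "i \<in> {..<CARD('n)}"
      have "?i i = ?i l \<longleftrightarrow> i = l" using b l(1) i by (auto simp: bij_betw_def dest: inj_onD)
      then show "(Re (k i) *\<^sub>R axis (?i i) 1 + Im (k i) *\<^sub>R J_vec (axis (?i i) (1::complex))) $ ?i l = (if i = l then k i else 0)"
        by (auto simp: J_vec_def axis_def complex_eq_iff)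
    qed
    then have xl: "?x $ ?i l = k l" using l by simp
    have "?x \<noteq> 0"
    proof
      assume "?x = 0"
      then have "?x $ ?i l = 0" by (simp only: zero_index)
      then show False using xl l by simp
    qed
    then show "Omega c p (0, ?x) (0, J_vec ?x) > 0" by (rule Omega_fibre_pos[OF c p])
  qed auto
  then show ?thesis by (simp add: vol_def std_frame_eq_adapted_frame)
qed

lemma mfd_density_vol:
  assumes t: "t \<in> U"
  shows "mfd_density A (\<lambda>c y. vol c (t, y))"
proof unfold_locales
  have mem: "(t, y) \<in> cdom c" if "y \<in> snd c ` fst c" for c y using t that by (simp add: cdom_def)
  show "smooth_on (snd c ` fst c) (\<lambda>y. vol c (t, y))" if c: "c \<in> A" for c
  proof (rule smooth_on_compose[OF open_chart_img[OF c] open_cdom[OF c] _ smooth_vol[OF c]])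
    show "smooth_on (snd c ` fst c) (\<lambda>y. (t, y))"
      by (intro smooth_on_Pair smooth_on_const smooth_on_bounded_linear bounded_linear_ident open_chart_img[OF c])
    show "(\<lambda>y. (t, y)) ` (snd c ` fst c) \<subseteq> cdom c" using mem by (rule image_subsetI)
  qed
  show pos: "vol c (t, y) > 0" if "c \<in> A" "y \<in> snd c ` fst c" for c y using vol_pos[OF that(1) mem[OF that(2)]] .
  show "vol c (t, y) = \<bar>std_det (fderiv (transition c d) y)\<bar> * vol d (t, transition c d y)"
    if c: "c \<in> A" and d: "d \<in> A" and y: "y \<in> snd c ` (fst c \<inter> fst d)" for c d y
  proof -
    let ?y = "transition c d y"
    have y': "?y \<in> snd d ` fst d" and yc: "y \<in> snd c ` fst c" using transition_mem(1)[OF c d, of y UNIV] y by auto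
    have "(\<lambda>a b. Omega c (t, y) (0, a) (0, b)) =
        (\<lambda>a b. Omega d (t, ?y) (0, fderiv (transition c d) y a) (0, fderiv (transition c d) y b))"
      using Omega_change[OF c d, of "(t, y)"] t y by (simp add: fun_eq_iff)
    then have "pf_sum (\<lambda>a b. Omega c (t, y) (0, a) (0, b)) CARD('n) (std_frame :: nat \<Rightarrow> complex^'n)
      = pf_sum (\<lambda>a b. Omega d (t, ?y) (0, a) (0, b)) CARD('n) (\<lambda>m. fderiv (transition c d) y (std_frame m))"
      by (simp add: pf_sum_def pf_term_def)
    also have "\<dots> = std_det (fderiv (transition c d) y) * pf_sum (\<lambda>a b. Omega d (t, ?y) (0, a) (0, b)) CARD('n) (std_frame :: nat \<Rightarrow> complex^'n)"
      by (rule pf_sum_std_frame_image[OF bilinear_fibre[OF d mem[OF y']]])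
    finally have eq: "vol c (t, y) = std_det (fderiv (transition c d) y) * vol d (t, ?y)" by (simp add: vol_def)
    \<comment> \<open>Both volumes are positive, so the transition map preserves orientation and the
      absolute value in the density law changes nothing.\<close>
    then have "std_det (fderiv (transition c d) y) > 0"
      using pos[OF c yc] pos[OF d y'] by (simp add: zero_less_mult_iff)
    then show ?thesis using eq by simp
  qed
qed

end

section \<open>Derivatives of fibre integrals\<close>

context fibration
begin

lemma has_derivative_hlift:
  assumes c: "c \<in> A" and p: "p \<in> cdom c"
  shows "(hlift c \<tau> has_derivative (\<lambda>d. (0, \<tau> *s fderiv (lift c) p d))) (at p)"
  unfolding hlift_def[abs_def]
  by (intro has_derivative_Pair has_derivative_const
      bounded_linear.has_derivative[OF bounded_linear_scalar_mult_right]
      smooth_on_has_derivative[OF open_cdom[OF c] smooth_lift[OF c] p])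

lemma smooth_hlift: "c \<in> A \<Longrightarrow> smooth_on (cdom c) (hlift c \<tau>)"
  unfolding hlift_def[abs_def]
  by (intro smooth_on_Pair open_cdom smooth_on_const
      smooth_on_bounded_linear_comp[OF bounded_linear_scalar_mult_right] smooth_lift)

text \<open>By the product rule, the variation of the form with its first argument held fixed is
  minus the contribution of the moving lift. This is how derivatives of \<open>lift\<close> enter
  the closedness identity; \<open>Y\<close> is vertical in \<open>lie_Omega\<close> and arbitrary
  once the lift is known to span the kernel.\<close>

lemma fderiv_Omega_frozen:
  assumes c: "c \<in> A" and p: "p \<in> cdom c" and zero: "\<And>q. q \<in> cdom c \<Longrightarrow> Omega c q (hlift c \<tau> q) Y = 0"
  shows "fderiv (\<lambda>q. Omega c q (hlift c \<tau> p) Y) p d = - Omega c p (0, \<tau> *s fderiv (lift c) p d) Y"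
proof -
  note o = open_cdom[OF c]
  have "((\<lambda>q. Omega c q (hlift c \<tau> q) Y) has_derivative
     (\<lambda>d. fderiv (\<lambda>q. Omega c q (hlift c \<tau> p) Y) p d + Omega c p (0, \<tau> *s fderiv (lift c) p d) Y + Omega c p (hlift c \<tau> p) 0)) (at p)"
    by (rule bilinear_field_has_derivative[OF o p bilinear_Omega[OF c] smooth_Omega[OF c] has_derivative_hlift[OF c p] has_derivative_const])
  moreover have "((\<lambda>q. Omega c q (hlift c \<tau> q) Y) has_derivative (\<lambda>_. 0)) (at p)"
    by (rule has_derivative_transform_within_open[OF has_derivative_const o p]) (simp add: zero)
  ultimately have "(\<lambda>d. fderiv (\<lambda>q. Omega c q (hlift c \<tau> p) Y) p d + Omega c p (0, \<tau> *s fderiv (lift c) p d) Y + Omega c p (hlift c \<tau> p) 0) = (\<lambda>_. 0)"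
    by (rule has_derivative_unique)
  from fun_cong[OF this, of d] show ?thesis using bilinear_rzero[OF bilinear_Omega[OF c p]] by simp
qed

lemma fderiv_Omega_swap:
  assumes c: "c \<in> A" and p: "p \<in> cdom c"
  shows "fderiv (\<lambda>q. Omega c q X Y) p d = - fderiv (\<lambda>q. Omega c q Y X) p d"
proof -
  have "fderiv (\<lambda>q. Omega c q X Y) p = fderiv (\<lambda>q. - Omega c q Y X) p"
    by (rule fderiv_cong[OF open_cdom[OF c] p]) (rule Omega_antisym[OF c])
  also have "\<dots> = (\<lambda>d. - fderiv (\<lambda>q. Omega c q Y X) p d)"
    by (intro fderiv_eqI has_derivative_minus smooth_on_has_derivative[OF open_cdom[OF c] smooth_Omega[OF c] p])
  finally show ?thesis by simp
qed

text \<open>The Lie derivative of the fibre metric along a horizontal lift vanishes on vertical vectors.\<close>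

lemma lie_Omega:
  assumes c: "c \<in> A" and p: "p \<in> cdom c"
  shows "fderiv (\<lambda>q. Omega c q (0, a) (0, b)) p (hlift c \<tau> p) =
    - (Omega c p (0, \<tau> *s fderiv (lift c) p (0, a)) (0, b) + Omega c p (0, a) (0, \<tau> *s fderiv (lift c) p (0, b)))"
proof -
  have "fderiv (\<lambda>q. Omega c q (hlift c \<tau> p) (0, x)) p d = - Omega c p (0, \<tau> *s fderiv (lift c) p d) (0, x)" for x d
    by (rule fderiv_Omega_frozen[OF c p Omega_hlift[OF c]])
  from this[of a "(0, b)"] this[of b "(0, a)"] show ?thesis
    using Omega_closed[OF c p, of "(0, a)" "(0, b)" "hlift c \<tau> p"]
      fderiv_Omega_swap[OF c p, of "(0, b)" "hlift c \<tau> p"]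
      Omega_antisym[OF c p, of "(0, \<tau> *s fderiv (lift c) p (0, b))" "(0, a)"] by simp
qed

text \<open>Jacobi's formula: by \<open>lie_Omega\<close> the fibre form changes by the derivation
  that the vertical derivative of the lift induces, and on the top power this acts by its trace. The
  trace is the divergence of the lift, so the fibre volume has vanishing Lie derivative along the
  lift.\<close>

lemma fderiv_vol_hlift:
  assumes c: "c \<in> A" and p: "p \<in> cdom c"
  shows "fderiv (vol c) p (hlift c \<tau> p) = - (\<Sum>b\<in>Basis. (\<tau> *s fderiv (lift c) p (0, b)) \<bullet> b) * vol c p"
proof -
  let ?v = "std_frame :: nat \<Rightarrow> complex^'n" and ?n = "CARD('n)"
  let ?B = "\<lambda>q a b. Omega c q (0, a) (0, b)"
  define M where "M m = \<tau> *s fderiv (lift c) p (0, ?v m)" for m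
  have "((\<lambda>q. pf_sum (?B q) ?n ?v) has_derivative
     (\<lambda>d. \<Sum>\<sigma> | \<sigma> permutes {..<2*?n}. of_int (sign \<sigma>) *
        (\<Sum>i<?n. (\<lambda>a b. fderiv (\<lambda>q. ?B q (?v a) (?v b)) p) (\<sigma> (2*i)) (\<sigma> (2*i+1)) d *
          (\<Prod>j\<in>{..<?n}-{i}. ?B p (?v (\<sigma> (2*j))) (?v (\<sigma> (2*j+1))))))) (at p)"
    by (rule has_derivative_pf_sum) (rule smooth_on_has_derivative[OF open_cdom[OF c] smooth_Omega[OF c] p])
  from fun_cong[OF fderiv_eqI[OF this], of "hlift c \<tau> p"]
  have "fderiv (\<lambda>q. pf_sum (?B q) ?n ?v) p (hlift c \<tau> p) = - (\<Sum>m<2*?n. pf_sum (?B p) ?n (?v(m := M m)))"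
    using pf_sum_derivation[of ?n "\<lambda>a b. fderiv (\<lambda>q. ?B q (?v a) (?v b)) p (hlift c \<tau> p)" "?B p" M ?v]
      lie_Omega[OF c p] by (simp add: M_def)
  also have "(\<Sum>m<2*?n. pf_sum (?B p) ?n (?v(m := M m))) = (\<Sum>m<2*?n. (M m \<bullet> ?v m) * pf_sum (?B p) ?n ?v)"
  proof (rule sum.cong[OF refl])
    fix m assume "m \<in> {..<2*?n}"
    then show "pf_sum (?B p) ?n (?v(m := M m)) = (M m \<bullet> ?v m) * pf_sum (?B p) ?n ?v"
      using pf_sum_upd_combination[OF bilinear_fibre[OF c p], of m ?n ?v "\<lambda>b. M m \<bullet> ?v b"]
      by (simp add: std_frame_representation)
  qed
  also have "\<dots> = (\<Sum>b\<in>Basis. (\<tau> *s fderiv (lift c) p (0, b)) \<bullet> b) * pf_sum (?B p) ?n ?v"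
    unfolding M_def sum_distrib_right[symmetric] by (simp only: sum_std_frame[of "\<lambda>b. (\<tau> *s fderiv (lift c) p (0, b)) \<bullet> b"])
  finally have 1: "fderiv (\<lambda>q. pf_sum (?B q) ?n ?v) p (hlift c \<tau> p)
     = - (\<Sum>b\<in>Basis. (\<tau> *s fderiv (lift c) p (0, b)) \<bullet> b) * pf_sum (?B p) ?n ?v" by simp
  have "smooth_on (cdom c) (\<lambda>q. pf_sum (?B q) ?n ?v)"
    unfolding pf_sum_def pf_term_def
    by (intro smooth_on_sum smooth_on_mult smooth_on_prod smooth_on_const smooth_Omega[OF c] open_cdom[OF c])
  from fderiv_eqI[OF bounded_linear.has_derivative[OF bounded_linear_divide
        smooth_on_has_derivative[OF open_cdom[OF c] this p], of "2 ^ ?n * fact ?n"]]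
  have "fderiv (vol c) p (hlift c \<tau> p) = fderiv (\<lambda>q. pf_sum (?B q) ?n ?v) p (hlift c \<tau> p) / (2 ^ ?n * fact ?n)"
    unfolding vol_def[abs_def] by simp
  then show ?thesis unfolding 1 by (simp add: vol_def)
qed

definition rep :: "(complex \<Rightarrow> 'z \<Rightarrow> 'b) \<Rightarrow> ('z, 'n) chart \<Rightarrow> complex \<times> (complex^'n) \<Rightarrow> 'b"
  where "rep F c p = F (fst p) (chart_inv c (snd p))"

definition fsmooth :: "(complex \<Rightarrow> 'z \<Rightarrow> 'b::real_normed_vector) \<Rightarrow> bool"
  where "fsmooth F \<longleftrightarrow> (\<forall>c\<in>A. smooth_on (cdom c) (rep F c))"

definition hderiv :: "complex \<Rightarrow> (complex \<Rightarrow> 'z \<Rightarrow> 'b::real_normed_vector) \<Rightarrow> complex \<Rightarrow> 'z \<Rightarrow> 'b"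
  where "hderiv \<tau> F t z = (let c = SOME c. c \<in> A \<and> z \<in> fst c
    in fderiv (rep F c) (t, snd c z) (hlift c \<tau> (t, snd c z)))"

lemma fsmoothD: "fsmooth F \<Longrightarrow> c \<in> A \<Longrightarrow> smooth_on (cdom c) (rep F c)"
  by (simp add: fsmooth_def)

text \<open>The lifts in two charts correspond by \<open>lift_change\<close>, so the chart selected
  in \<open>hderiv\<close> does not matter.\<close>

lemma rep_hderiv:
  assumes F: "fsmooth F" and c: "c \<in> A" and p: "p \<in> cdom c"
  shows "rep (hderiv \<tau> F) c p = fderiv (rep F c) p (hlift c \<tau> p)"
proof -
  obtain t y where ty: "p = (t, y)" by (cases p)
  have t: "t \<in> U" and y: "y \<in> snd c ` fst c" using p by (auto simp: ty cdom_def)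
  define z where "z = chart_inv c y"
  have z: "z \<in> fst c" "snd c z = y" using chart_inv_mem[OF c y] chart_chart_inv[OF c y] by (auto simp: z_def)
  define d where "d = (SOME c. c \<in> A \<and> z \<in> fst c)"
  have d: "d \<in> A" "z \<in> fst d" unfolding d_def using someI[of "\<lambda>c. c \<in> A \<and> z \<in> fst c" c] c z by auto
  let ?N = "U \<times> snd c ` (fst c \<inter> fst d)"
  let ?T = "\<lambda>p::complex \<times> (complex^'n). (fst p, transition c d (snd p))"
  have oy: "open (snd c ` (fst c \<inter> fst d))" using open_chart_image[OF c open_chart_dom[OF d(1)]] .
  have o: "open ?N" by (intro open_Times U oy)
  have yN: "y \<in> snd c ` (fst c \<inter> fst d)" using z d by auto
  have pN: "p \<in> ?N" using t yN by (simp add: ty)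
  have Ty: "transition c d y = snd d z" by (simp add: transition_def z_def)
  have q: "(t, snd d z) \<in> cdom d" using t d by (simp add: cdom_def)
  have "fderiv (rep F c) p = fderiv (\<lambda>p. rep F d (?T p)) p"
  proof (rule fderiv_cong[OF o pN])
    fix q assume "q \<in> ?N"
    then have "snd q \<in> snd c ` (fst c \<inter> (fst d \<inter> UNIV))" by (simp add: mem_Times_iff)
    from transition_mem(2)[OF c d(1) this] show "rep F c q = rep F d (?T q)" by (simp add: rep_def)
  qed
  also have "\<dots> = (\<lambda>v. fderiv (rep F d) (t, snd d z) (fst v, fderiv (transition c d) y (snd v)))"
  proof (rule fderiv_eqI)
    have yp: "snd p \<in> snd c ` (fst c \<inter> fst d)" using yN by (simp add: ty)
    have "(?T has_derivative (\<lambda>v. (fst v, fderiv (transition c d) (snd p) (snd v)))) (at p)"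
      by (intro has_derivative_Pair bounded_linear_imp_has_derivative[OF bounded_linear_fst]
          has_derivative_compose[OF bounded_linear_imp_has_derivative[OF bounded_linear_snd]
            smooth_on_has_derivative[OF oy smooth_transition[OF c d(1)] yp]])
    from has_derivative_compose[OF this, of "rep F d"]
    show "((\<lambda>p. rep F d (?T p)) has_derivative
        (\<lambda>v. fderiv (rep F d) (t, snd d z) (fst v, fderiv (transition c d) y (snd v)))) (at p)"
      using smooth_on_has_derivative[OF open_cdom[OF d(1)] fsmoothD[OF F d(1)] q] by (simp add: ty Ty)
  qed
  finally have "fderiv (rep F c) p (hlift c \<tau> p)
     = fderiv (rep F d) (t, snd d z) (\<tau>, fderiv (transition c d) y (\<tau> *s lift c p))"
    by (simp add: hlift_def)
  also have "(\<tau>, fderiv (transition c d) y (\<tau> *s lift c p)) = hlift d \<tau> (t, snd d z)"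
    using lift_change[OF c d(1) t yN] fderiv_transition_J[OF c d(1) yN] by (simp add: hlift_def Ty ty)
  finally show ?thesis unfolding rep_def[of "hderiv \<tau> F"] hderiv_def Let_def
    by (simp add: ty z_def[symmetric] d_def[symmetric])
qed

lemma fsmooth_hderiv:
  assumes F: "fsmooth F"
  shows "fsmooth (hderiv \<tau> F)"
  unfolding fsmooth_def
proof
  fix c assume c: "c \<in> A"
  note o = open_cdom[OF c]
  have "smooth_on (cdom c) (\<lambda>p. \<Sum>b\<in>Basis. (hlift c \<tau> p \<bullet> b) *\<^sub>R fderiv (rep F c) p b)"
    by (intro smooth_on_sum smooth_on_scaleR smooth_on_inner smooth_on_const smooth_hlift[OF c]
        smooth_on_fderiv fsmoothD[OF F c] o)
  then show "smooth_on (cdom c) (rep (hderiv \<tau> F) c)"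
  proof (rule smooth_on_cong[OF o, THEN iffD1, rotated])
    fix p assume p: "p \<in> cdom c"
    show "(\<Sum>b\<in>Basis. (hlift c \<tau> p \<bullet> b) *\<^sub>R fderiv (rep F c) p b) = rep (hderiv \<tau> F) c p"
      unfolding rep_hderiv[OF F c p]
      by (rule fderiv_eval_basis[OF smooth_on_differentiable[OF o fsmoothD[OF F c] p], symmetric])
  qed
qed

lemma smooth_slice:
  assumes F: "fsmooth F" and t: "t \<in> U" and c: "c \<in> A"
  shows "smooth_on (snd c ` fst c) (\<lambda>y. F t (chart_inv c y))"
proof -
  have s: "smooth_on (snd c ` fst c) (\<lambda>y. (t, y))"
    by (intro smooth_on_Pair smooth_on_const smooth_on_bounded_linear bounded_linear_ident open_chart_img[OF c])
  have "smooth_on (snd c ` fst c) (\<lambda>y. rep F c (t, y))"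
    by (rule smooth_on_compose[OF open_chart_img[OF c] open_cdom[OF c] s fsmoothD[OF F c]])
      (use t in \<open>auto simp: cdom_def\<close>)
  then show ?thesis by (simp add: rep_def)
qed

lemma chart_cont_slice: "fsmooth F \<Longrightarrow> t \<in> U \<Longrightarrow> chart_cont (F t)"
  unfolding chart_cont_def using smooth_slice smooth_on_imp_continuous_on by blast

definition fint :: "(complex \<Rightarrow> 'z \<Rightarrow> complex) \<Rightarrow> complex \<Rightarrow> complex"
  where "fint F t = mfd_density.dens_integral A (\<lambda>c y. vol c (t, y)) (F t)"

lemma fint_eq: "t \<in> U \<Longrightarrow> fint F t = (\<Sum>q\<in>pou. LINT y:snd (fst q) ` fst (fst q)|lborel.
    of_real (snd q (chart_inv (fst q) y)) * F t (chart_inv (fst q) y) * of_real (vol (fst q) (t, y)))"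
  unfolding fint_def using mfd_density.dens_integral_def[OF mfd_density_vol] by simp

lemma vector_field_lift:
  assumes t: "t \<in> U"
  shows "vector_field (\<lambda>c y. \<tau> *s lift c (t, y))"
  unfolding vector_field_def
proof (intro conjI ballI)
  fix c assume c: "c \<in> A"
  have s: "smooth_on (snd c ` fst c) (\<lambda>y. (t, y))"
    by (intro smooth_on_Pair smooth_on_const smooth_on_bounded_linear bounded_linear_ident open_chart_img[OF c])
  have "smooth_on (snd c ` fst c) (\<lambda>y. lift c (t, y))"
    by (rule smooth_on_compose[OF open_chart_img[OF c] open_cdom[OF c] s smooth_lift[OF c]])
      (use t in \<open>auto simp: cdom_def\<close>)
  then show "smooth_on (snd c ` fst c) (\<lambda>y. \<tau> *s lift c (t, y))"
    by (rule smooth_on_bounded_linear_comp[OF bounded_linear_scalar_mult_right open_chart_img[OF c]])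
  fix d y assume d: "d \<in> A" and y: "y \<in> snd c ` (fst c \<inter> fst d)"
  show "\<tau> *s lift d (t, transition c d y) = fderiv (transition c d) y (\<tau> *s lift c (t, y))"
    by (simp add: lift_change[OF c d t y] fderiv_transition_J[OF c d y])
qed

text \<open>The vector \<open>(\<tau>, 0)\<close>, which keeps the chart coordinate fixed, is the
  horizontal lift minus its vertical part. Differentiating along the vertical part gives a
  divergence up to the divergence of the lift itself, and that is cancelled by
  \<open>fderiv_vol_hlift\<close>.\<close>

lemma fderiv_density:
  assumes F: "fsmooth F" and c: "c \<in> A" and t: "t \<in> U" and y: "y \<in> snd c ` fst c"
  shows "fderiv (\<lambda>p. rep F c p * complex_of_real (vol c p)) (t, y) (\<tau>, 0)
    = hderiv \<tau> F t (chart_inv c y) * of_real (vol c (t, y))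
     - (\<Sum>b\<in>Basis. fderiv (\<lambda>y. ((\<tau> *s lift c (t, y)) \<bullet> b) *\<^sub>R (F t (chart_inv c y) * of_real (vol c (t, y)))) y b)"
proof -
  define P where "P p = rep F c p * complex_of_real (vol c p)" for p
  define X where "X y = \<tau> *s lift c (t, y)" for y
  let ?p = "(t, y)"
  note o = open_cdom[OF c]
  have p: "?p \<in> cdom c" using t y by (simp add: cdom_def)
  have sF: "smooth_on (cdom c) (rep F c)" by (rule fsmoothD[OF F c])
  have sP: "smooth_on (cdom c) P"
    unfolding P_def by (intro smooth_on_mult smooth_on_of_real smooth_vol sF o c)
  have linP: "linear (fderiv P ?p)" by (rule smooth_on_linear[OF o sP p])
  have dv: "((\<lambda>y. (t, y)) has_derivative (\<lambda>v. (0, v))) (at y)" by (auto intro!: derivative_eq_intros)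
  have dP: "((\<lambda>y. P (t, y)) has_derivative (\<lambda>v. fderiv P ?p (0, v))) (at y)"
    using has_derivative_compose[OF dv smooth_on_has_derivative[OF o sP p]] .
  have dX: "(X has_derivative (\<lambda>v. \<tau> *s fderiv (lift c) ?p (0, v))) (at y)"
    unfolding X_def
    by (intro bounded_linear.has_derivative[OF bounded_linear_scalar_mult_right]
        has_derivative_compose[OF dv smooth_on_has_derivative[OF o smooth_lift[OF c] p]])
  have "(\<Sum>b\<in>Basis. fderiv (\<lambda>y. (X y \<bullet> b) *\<^sub>R P (t, y)) y b)
     = (\<Sum>b\<in>Basis. (X y \<bullet> b) *\<^sub>R fderiv P ?p (0, b) + ((\<tau> *s fderiv (lift c) ?p (0, b)) \<bullet> b) *\<^sub>R P ?p)"
    by (rule sum.cong[OF refl])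
      (simp add: fderiv_eqI[OF has_derivative_scaleR[OF has_derivative_inner_left[OF dX] dP]])
  also have "\<dots> = fderiv P ?p (0, X y) + (\<Sum>b\<in>Basis. (\<tau> *s fderiv (lift c) ?p (0, b)) \<bullet> b) *\<^sub>R P ?p"
  proof -
    have "(0 :: complex, X y) = (\<Sum>b\<in>Basis. (X y \<bullet> b) *\<^sub>R (0, b))"
    proof -
      have "(\<Sum>b\<in>B. (X y \<bullet> b) *\<^sub>R (0 :: complex, b)) = (0, \<Sum>b\<in>B. (X y \<bullet> b) *\<^sub>R b)" for B
        by (induction B rule: infinite_finite_induct) (auto simp: zero_prod_def)
      then show ?thesis by (simp add: euclidean_representation)
    qed
    then have "fderiv P ?p (0, X y) = (\<Sum>b\<in>Basis. (X y \<bullet> b) *\<^sub>R fderiv P ?p (0, b))"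
      by (simp only: linear_sum[OF linP] linear_scale[OF linP])
    then show ?thesis by (simp only: sum.distrib scaleR_sum_left)
  qed
  finally have div: "(\<Sum>b\<in>Basis. fderiv (\<lambda>y. (X y \<bullet> b) *\<^sub>R P (t, y)) y b)
     = fderiv P ?p (0, X y) + (\<Sum>b\<in>Basis. (\<tau> *s fderiv (lift c) ?p (0, b)) \<bullet> b) *\<^sub>R P ?p" .
  have h: "hlift c \<tau> ?p = (\<tau>, 0) + (0, X y)" by (simp add: hlift_def X_def)
  have "fderiv P ?p (\<tau>, 0) + fderiv P ?p (0, X y) = fderiv P ?p (hlift c \<tau> ?p)"
    unfolding h linear_add[OF linP] ..
  also have "\<dots> = rep F c ?p * of_real (fderiv (vol c) ?p (hlift c \<tau> ?p)) + fderiv (rep F c) ?p (hlift c \<tau> ?p) * of_real (vol c ?p)"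
    unfolding P_def
    using fderiv_eqI[OF has_derivative_mult[OF smooth_on_has_derivative[OF o sF p]
        bounded_linear.has_derivative[OF bounded_linear_of_real[where 'a = complex]
          smooth_on_has_derivative[OF o smooth_vol[OF c] p]]]] by simp
  also have "\<dots> = hderiv \<tau> F t (chart_inv c y) * of_real (vol c ?p)
      - (\<Sum>b\<in>Basis. (\<tau> *s fderiv (lift c) ?p (0, b)) \<bullet> b) *\<^sub>R P ?p"
    using rep_hderiv[OF F c p, of \<tau>]
    unfolding fderiv_vol_hlift[OF c p] P_def by (simp add: rep_def scaleR_conv_of_real)
  finally have "fderiv P ?p (\<tau>, 0) = hderiv \<tau> F t (chart_inv c y) * of_real (vol c ?p)
      - (\<Sum>b\<in>Basis. fderiv (\<lambda>y. (X y \<bullet> b) *\<^sub>R P (t, y)) y b)"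
    unfolding div by (simp add: algebra_simps)
  then show ?thesis by (simp add: P_def[abs_def] X_def[abs_def] rep_def)
qed

text \<open>Charts and partition functions do not depend on \<open>t\<close>, so the derivative
  passes under each integral. By \<open>fderiv_density\<close> it is the wanted integrand up to a
  divergence, which integrates to zero over the fibre.\<close>

theorem has_derivative_fint:
  assumes F: "fsmooth F" and t: "t \<in> U"
  shows "(fint F has_derivative (\<lambda>\<tau>. fint (hderiv \<tau> F) t)) (at t)"
proof -
  interpret dens: mfd_density A "\<lambda>c y. vol c (t, y)" by (rule mfd_density_vol[OF t])
  define P where "P c p = rep F c p * complex_of_real (vol c p)" for c p
  define K where "K q = snd (fst q) ` pou_support q" for q :: "('z, 'n) chart \<times> ('z \<Rightarrow> real)"
  define G where "G q s y = of_real (snd q (chart_inv (fst q) y)) * P (fst q) (s, y)" for q :: "('z, 'n) chart \<times> ('z \<Rightarrow> real)" and s y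
  define G' where "G' q s y \<tau> = of_real (snd q (chart_inv (fst q) y)) * fderiv (P (fst q)) (s, y) (\<tau>, 0)"
    for q :: "('z, 'n) chart \<times> ('z \<Rightarrow> real)" and s y \<tau>
  have K: "compact (K q)" "K q \<subseteq> snd (fst q) ` fst (fst q)" if "q \<in> pou" for q
    unfolding K_def using compact_chart_image[OF pou_chart[OF that] closed_pou_support pou_support_chart[OF that]]
      pou_support_chart[OF that] by auto
  have off: "snd q (chart_inv (fst q) y) = 0" if "q \<in> pou" "y \<in> snd (fst q) ` fst (fst q) - K q" for q y
    using that pou_zero[of "chart_inv (fst q) y" q] chart_chart_inv[OF pou_chart[OF that(1)], of y]
    unfolding K_def by (metis DiffD1 DiffD2 image_eqI)
  have sP: "smooth_on (cdom c) (P c)" if "c \<in> A" for c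
    unfolding P_def by (intro smooth_on_mult smooth_on_of_real smooth_vol fsmoothD[OF F] open_cdom that)
  have one: "((\<lambda>s. LINT y:K q|lborel. G q s y) has_derivative (\<lambda>\<tau>. LINT y:K q|lborel. G' q t y \<tau>)) (at t)" if q: "q \<in> pou" for q
  proof (rule has_derivative_integral_compact[OF U K(1)[OF q] t])
    let ?c = "fst q"
    have c: "?c \<in> A" by (rule pou_chart[OF q])
    have sub: "U \<times> K q \<subseteq> cdom ?c" using K(2)[OF q] by (auto simp: cdom_def)
    have r: "continuous_on (K q) (\<lambda>y. snd q (chart_inv ?c y))"
      by (rule continuous_on_subset[OF smooth_on_imp_continuous_on[OF pou_smooth[OF q c]] K(2)[OF q]])
    show "continuous_on (K q) (G q s)" if "s \<in> U" for s
      unfolding G_def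
      by (intro continuous_intros r continuous_on_compose2[OF smooth_on_imp_continuous_on[OF sP[OF c]]])
        (use sub that in auto)
    show "((\<lambda>s. G q s y) has_derivative G' q s y) (at s)" if "s \<in> U" "y \<in> K q" for s y
    proof -
      have p: "(s, y) \<in> cdom ?c" using sub that by auto
      have "((\<lambda>s. (s, y)) has_derivative (\<lambda>\<tau>. (\<tau>, 0))) (at s)" by (auto intro!: derivative_eq_intros)
      from has_derivative_compose[OF this smooth_on_has_derivative[OF open_cdom[OF c] sP[OF c] p]]
      show ?thesis unfolding G_def G'_def by (rule has_derivative_mult_right)
    qed
    show "continuous_on (U \<times> K q) (\<lambda>(s, y). G' q s y \<tau>)" for \<tau>
      unfolding G'_def case_prod_unfold
      by (intro continuous_intros continuous_on_compose2[OF r]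
          continuous_on_compose2[OF smooth_on_imp_continuous_on[OF smooth_on_fderiv[OF sP[OF c]]]])
        (use sub in auto)
  qed
  have eqF: "fint F s = (\<Sum>q\<in>pou. LINT y:K q|lborel. G q s y)" if s: "s \<in> U" for s
    unfolding fint_eq[OF s]
  proof (rule sum.cong[OF refl])
    fix q assume q: "q \<in> pou"
    have "(LINT y:snd (fst q) ` fst (fst q)|lborel. G q s y) = (LINT y:K q|lborel. G q s y)"
      by (rule set_integral_cong_support[OF K(2)[OF q]]) (use off[OF q] in \<open>simp add: G_def\<close>)
    then show "(LINT y:snd (fst q) ` fst (fst q)|lborel. of_real (snd q (chart_inv (fst q) y)) * F s (chart_inv (fst q) y)
       * of_real (vol (fst q) (s, y))) = (LINT y:K q|lborel. G q s y)"
      by (simp add: G_def P_def rep_def mult.assoc)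
  qed
  have "((\<lambda>s. \<Sum>q\<in>pou. LINT y:K q|lborel. G q s y) has_derivative (\<lambda>\<tau>. \<Sum>q\<in>pou. LINT y:K q|lborel. G' q t y \<tau>)) (at t)"
    by (intro has_derivative_sum one)
  then have "(fint F has_derivative (\<lambda>\<tau>. \<Sum>q\<in>pou. LINT y:K q|lborel. G' q t y \<tau>)) (at t)"
    by (rule has_derivative_transform_within_open[OF _ U t]) (simp add: eqF)
  moreover have "(\<Sum>q\<in>pou. LINT y:K q|lborel. G' q t y \<tau>) = fint (hderiv \<tau> F) t" for \<tau>
  proof -
    define Y where "Y q y = (\<Sum>b\<in>Basis. fderiv (\<lambda>y. ((\<tau> *s lift (fst q) (t, y)) \<bullet> b) *\<^sub>R
        (F t (chart_inv (fst q) y) * of_real (vol (fst q) (t, y)))) y b)" for q :: "('z, 'n) chart \<times> ('z \<Rightarrow> real)" and y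
    have "(LINT y:K q|lborel. G' q t y \<tau>) = (LINT y:snd (fst q) ` fst (fst q)|lborel.
        of_real (snd q (chart_inv (fst q) y)) * hderiv \<tau> F t (chart_inv (fst q) y) * of_real (vol (fst q) (t, y)))
       - (LINT y:snd (fst q) ` fst (fst q)|lborel. of_real (snd q (chart_inv (fst q) y)) * Y q y)"
      if q: "q \<in> pou" for q
    proof -
      let ?c = "fst q" let ?S = "snd ?c ` fst ?c"
      have c: "?c \<in> A" by (rule pou_chart[OF q])
      have o: "open ?S" using open_chart_img[OF c] .
      have eq: "G' q t y \<tau> = of_real (snd q (chart_inv ?c y)) * hderiv \<tau> F t (chart_inv ?c y) * of_real (vol ?c (t, y))
         - of_real (snd q (chart_inv ?c y)) * Y q y" if "y \<in> ?S" for y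
        unfolding G'_def P_def Y_def fderiv_density[OF F c t that] by (simp only: right_diff_distrib mult.assoc)
      have i1: "set_integrable lborel ?S (\<lambda>y. of_real (snd q (chart_inv ?c y)) * hderiv \<tau> F t (chart_inv ?c y) * of_real (vol ?c (t, y)))"
        by (rule dens.dens_integrable[OF chart_cont_slice[OF fsmooth_hderiv[OF F] t] q])
      have sub: "{t} \<times> K q \<subseteq> cdom ?c" using K(2)[OF q] t by (auto simp: cdom_def)
      have "set_integrable lborel (K q) (\<lambda>y. G' q t y \<tau>)"
      proof (rule set_integrable_compact[OF K(1)[OF q]])
        show "continuous_on (K q) (\<lambda>y. G' q t y \<tau>)"
          unfolding G'_def
          by (intro continuous_intros continuous_on_subset[OF smooth_on_imp_continuous_on[OF pou_smooth[OF q c]] K(2)[OF q]]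
              continuous_on_compose2[OF smooth_on_imp_continuous_on[OF smooth_on_fderiv[OF sP[OF c]]]])
            (use sub in auto)
      qed
      then have i2: "set_integrable lborel ?S (\<lambda>y. G' q t y \<tau>)"
        by (subst set_integrable_cong_support[OF K(2)[OF q]]) (use off[OF q] in \<open>auto simp: G'_def\<close>)
      have i3: "set_integrable lborel ?S (\<lambda>y. of_real (snd q (chart_inv ?c y)) * Y q y)"
      proof -
        have "set_integrable lborel ?S (\<lambda>y. of_real (snd q (chart_inv ?c y)) * hderiv \<tau> F t (chart_inv ?c y) * of_real (vol ?c (t, y))
          - G' q t y \<tau>)"
          by (rule set_integral_diff(1)[OF i1 i2])
        then show ?thesis by (rule set_integrable_cong[THEN iffD1, rotated -1]) (auto simp: eq)
      qed
      have "(LINT y:K q|lborel. G' q t y \<tau>) = (LINT y:?S|lborel. G' q t y \<tau>)"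
        by (rule set_integral_cong_support[OF K(2)[OF q], symmetric]) (use off[OF q] in \<open>simp add: G'_def\<close>)
      also have "\<dots> = (LINT y:?S|lborel. of_real (snd q (chart_inv ?c y)) * hderiv \<tau> F t (chart_inv ?c y) * of_real (vol ?c (t, y))
         - of_real (snd q (chart_inv ?c y)) * Y q y)"
        by (rule set_lebesgue_integral_cong) (use o eq in auto)
      finally show ?thesis using set_integral_diff(2)[OF i1 i3] by simp
    qed
    then have "(\<Sum>q\<in>pou. LINT y:K q|lborel. G' q t y \<tau>) = fint (hderiv \<tau> F) t
       - (\<Sum>q\<in>pou. LINT y:snd (fst q) ` fst (fst q)|lborel. of_real (snd q (chart_inv (fst q) y)) * Y q y)"
      unfolding fint_eq[OF t] by (simp add: sum_subtractf)
    then show ?thesis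
      using dens.divergence_theorem[OF vector_field_lift[OF t], of "F t" \<tau>] smooth_slice[OF F t] by (simp add: Y_def)
  qed
  ultimately show ?thesis by simp
qed

end

section \<open>The homogeneous Monge--Ampere equation\<close>

context fibration
begin

lemma hlift_J: "J_prod (hlift c \<tau> p) = hlift c (\<i> * \<tau>) p"
  by (simp add: J_prod_def hlift_def vector_scalar_mult_def vec_eq_iff mult.assoc)

text \<open>The lifts at a point form a real plane, on which an alternating form is determined by
  one number; \<open>Im (cnj s * s')\<close> is the determinant of \<open>s\<close> and
  \<open>s'\<close>.\<close>

lemma Omega_hlift_hlift:
  assumes c: "c \<in> A" and p: "p \<in> cdom c"
  shows "Omega c p (hlift c s p) (hlift c s' p) = Im (cnj s * s') * Omega c p (hlift c 1 p) (hlift c \<i> p)"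
proof -
  note B = bilinear_Omega[OF c p]
  have e: "hlift c s p = Re s *\<^sub>R hlift c 1 p + Im s *\<^sub>R hlift c \<i> p" for s
    using hlift_eq[of c s p] hlift_eq[of c 1 p] hlift_eq[of c \<i> p] by (simp add: zero_prod_def)
  have z: "Omega c p X X = 0" for X using Omega_antisym[OF c p, of X X] by simp
  have a: "Omega c p (hlift c \<i> p) (hlift c 1 p) = - Omega c p (hlift c 1 p) (hlift c \<i> p)"
    by (rule Omega_antisym[OF c p])
  show ?thesis
    unfolding e[of s] e[of s'] bilinear_ladd[OF B] bilinear_radd[OF B] bilinear_lmul[OF B] bilinear_rmul[OF B] z a
    by (simp add: algebra_simps)
qed

end

locale monge_ampere = fibration A V g U \<phi>
  for A :: "('z::t2_space, 'n::finite) chart set" and V :: "'j \<Rightarrow> 'z set" and g U \<phi> +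
  assumes semi: "\<forall>c\<in>A. \<forall>p \<in> U \<times> snd c ` fst c. semipositive_form J_prod (curvature_form_pullback V \<phi> c p)"
    and null: "\<forall>c\<in>A. \<forall>p \<in> U \<times> snd c ` fst c. \<forall>w.
           divided_power (curvature_form_pullback V \<phi> c p) (CARD('n) + 1) w = 0"
begin

text \<open>A nonzero value would be positive by semipositivity. Horizontal and vertical vectors
  being orthogonal, it would make the form positive definite together with the fibre form, and
  \<open>pf_sum_pos\<close> would contradict the vanishing of the top power.\<close>

lemma Omega_hlift_1_i:
  assumes c: "c \<in> A" and p: "p \<in> cdom c"
  shows "Omega c p (hlift c 1 p) (hlift c \<i> p) = 0"
proof (rule ccontr)
  define r where "r = Omega c p (hlift c 1 p) (hlift c \<i> p)"
  assume "Omega c p (hlift c 1 p) (hlift c \<i> p) \<noteq> 0"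
  then have "r \<noteq> 0" by (simp add: r_def)
  have p': "p \<in> U \<times> snd c ` fst c" using p by (simp add: cdom_def)
  have "semipositive_form J_prod (curvature_form_pullback V \<phi> c p)" using semi c p' by blast
  from this[unfolded semipositive_form_def, rule_format, of "hlift c 1 p"]
  have "r \<ge> 0" by (simp add: curvature_form_pullback_eq[OF c p] r_def hlift_J)
  with \<open>r \<noteq> 0\<close> have r: "r > 0" by simp
  note B = bilinear_Omega[OF c p]
  have pos: "Omega c p v (J_prod v) > 0" if v: "v \<noteq> 0" for v
  proof -
    define s w where "s = fst v" and "w = snd v - s *s lift c p"
    have dv: "v = hlift c s p + (0, w)" by (simp add: s_def w_def hlift_def)
    have Jv: "J_prod v = hlift c (\<i> * s) p + (0, J_vec w)"
      unfolding dv linear_add[OF linear_J_prod] hlift_J by (simp add: J_prod_def J_vec_def)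
    have x: "Omega c p (0, w) (hlift c s' p) = 0" for s'
      using Omega_antisym[OF c p, of "(0, w)" "hlift c s' p"] Omega_hlift[OF c p] by simp
    have "Omega c p v (J_prod v) = Omega c p (hlift c s p) (hlift c (\<i> * s) p) + Omega c p (0, w) (0, J_vec w)"
      unfolding Jv unfolding dv bilinear_ladd[OF B] bilinear_radd[OF B] by (simp add: Omega_hlift[OF c p] x)
    also have "Omega c p (hlift c s p) (hlift c (\<i> * s) p) = (cmod s)\<^sup>2 * r"
      unfolding Omega_hlift_hlift[OF c p, of s] r_def[symmetric] by (simp add: cmod_power2) (simp add: power2_eq_square)
    finally have eq: "Omega c p v (J_prod v) = (cmod s)\<^sup>2 * r + Omega c p (0, w) (0, J_vec w)" .
    show ?thesis
    proof (cases "w = 0")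
      case True
      then have "s \<noteq> 0" using v dv by (auto simp: hlift_def zero_prod_def)
      moreover have "Omega c p (0, w) (0, J_vec w) = 0"
        using bilinear_lzero[OF B] True by (simp add: zero_prod_def)
      ultimately show ?thesis using eq r by simp
    next
      case False
      then show ?thesis using eq r Omega_fibre_pos[OF c p False] by (simp add: add_nonneg_pos)
    qed
  qed
  let ?i = "from_nat_into (UNIV::'n set)"
  have b: "bij_betw ?i {..<CARD('n)} UNIV" by (rule bij_betw_from_nat_into_finite) simp
  define e where "e = case_nat (1, 0) (\<lambda>i. (0, axis (?i i) 1) :: complex \<times> (complex^'n))"
  have "pf_sum (Omega c p) (CARD('n) + 1) (adapted_frame J_prod e) > 0"
  proof (rule pf_sum_pos[OF linear_J_prod _ B Omega_antisym[OF c p] Omega_J_J[OF c p]])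
    fix k :: "nat \<Rightarrow> complex" assume "\<exists>i<CARD('n) + 1. k i \<noteq> 0"
    then obtain l where l: "l < CARD('n) + 1" "k l \<noteq> 0" by blast
    let ?x = "\<Sum>i<CARD('n) + 1. Re (k i) *\<^sub>R e i + Im (k i) *\<^sub>R J_prod (e i)"
    have x: "?x = (Re (k 0) *\<^sub>R e 0 + Im (k 0) *\<^sub>R J_prod (e 0)) + (\<Sum>i<CARD('n). Re (k (Suc i)) *\<^sub>R e (Suc i) + Im (k (Suc i)) *\<^sub>R J_prod (e (Suc i)))"
      by (simp only: Suc_eq_plus1[symmetric] sum.lessThan_Suc_shift)
    have f: "fst (\<Sum>i\<in>I. h i) = (\<Sum>i\<in>I. fst (h i))" "snd (\<Sum>i\<in>I. h i) = (\<Sum>i\<in>I. snd (h i))" for h :: "nat \<Rightarrow> complex \<times> (complex^'n)" and I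
      by (induction I rule: infinite_finite_induct) auto
    have "?x \<noteq> 0"
    proof (cases l)
      case 0
      have "fst ?x = k 0" unfolding x by (simp add: f e_def J_prod_def complex_eq_iff)
      then show ?thesis using l 0 by (metis fst_zero)
    next
      case (Suc m)
      have m: "m < CARD('n)" using l Suc by simp
      have "snd ?x $ ?i m = (\<Sum>i<CARD('n). if i = m then k (Suc i) else 0)"
        unfolding x snd_add f vector_add_component sum_component
      proof -
        have "snd (Re (k 0) *\<^sub>R e 0 + Im (k 0) *\<^sub>R J_prod (e 0)) = 0"
          by (simp add: e_def J_prod_def vec_eq_iff)
        moreover have "(\<Sum>i<CARD('n). snd (Re (k (Suc i)) *\<^sub>R e (Suc i) + Im (k (Suc i)) *\<^sub>R J_prod (e (Suc i))) $ ?i m)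
            = (\<Sum>i<CARD('n). if i = m then k (Suc i) else 0)"
        proof (rule sum.cong[OF refl])
          fix i assume i: "i \<in> {..<CARD('n)}"
          have "?i i = ?i m \<longleftrightarrow> i = m" using b m i by (auto simp: bij_betw_def dest: inj_onD)
          then show "snd (Re (k (Suc i)) *\<^sub>R e (Suc i) + Im (k (Suc i)) *\<^sub>R J_prod (e (Suc i))) $ ?i m = (if i = m then k (Suc i) else 0)"
            by (auto simp: e_def J_prod_def axis_def complex_eq_iff)
        qed
        ultimately show "snd (Re (k 0) *\<^sub>R e 0) $ ?i m + snd (Im (k 0) *\<^sub>R J_prod (e 0)) $ ?i m
           + (\<Sum>i<CARD('n). snd (Re (k (Suc i)) *\<^sub>R e (Suc i)) $ ?i m + snd (Im (k (Suc i)) *\<^sub>R J_prod (e (Suc i))) $ ?i m)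
           = (\<Sum>i<CARD('n). if i = m then k (Suc i) else 0)"
          by (simp only: snd_add vector_add_component[symmetric]) simp
      qed
      then have xl: "snd ?x $ ?i m = k l" using m Suc by simp
      show ?thesis
      proof
        assume "?x = 0"
        then have "snd ?x $ ?i m = 0" by (simp only: snd_zero zero_index)
        then show False using xl l by simp
      qed
    qed
    then show "Omega c p ?x (J_prod ?x) > 0" by (rule pos)
  qed auto
  moreover have "divided_power (curvature_form_pullback V \<phi> c p) (CARD('n) + 1) (adapted_frame J_prod e) = 0"
    using null c p' by blast
  then have "form_power (curvature_form_pullback V \<phi> c p) (CARD('n) + 1) (adapted_frame J_prod e) = 0"
    unfolding divided_power_def by (metis divide_eq_0_iff fact_nonzero)
  moreover have "form_power (curvature_form_pullback V \<phi> c p) (CARD('n) + 1) (adapted_frame J_prod e)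
      = of_real (pf_sum (Omega c p) (CARD('n) + 1) (adapted_frame J_prod e) / 2 ^ (CARD('n) + 1))"
    by (rule form_power_eq_pf_sum[OF curvature_form_pullback_eq[OF c p]])
  ultimately show False by (metis divide_eq_0_iff of_real_eq_0_iff power_not_zero zero_neq_numeral less_irrefl)
qed

text \<open>Every vector is the lift of its first component plus a vertical vector.\<close>

lemma Omega_hlift_null:
  assumes c: "c \<in> A" and p: "p \<in> cdom c"
  shows "Omega c p (hlift c \<tau> p) Y = 0"
proof -
  note B = bilinear_Omega[OF c p]
  have "Y = hlift c (fst Y) p + (0, snd Y - fst Y *s lift c p)" by (simp add: hlift_def)
  then show ?thesis
    using Omega_hlift_hlift[OF c p, of \<tau> "fst Y"] Omega_hlift_1_i[OF c p] Omega_hlift[OF c p]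
    by (metis bilinear_radd[OF B] add.right_neutral mult_zero_right)
qed

text \<open>The bracket of the vector fields \<open>hlift c 1\<close> and \<open>hlift c \<i>\<close> is vertical and lies in the kernel of the curvature form, which is positive on the fibres.\<close>

lemma lift_holomorphic_along_leaves:
  assumes c: "c \<in> A" and p: "p \<in> cdom c"
  shows "fderiv (lift c) p (hlift c \<i> p) = \<i> *s fderiv (lift c) p (hlift c 1 p)"
proof -
  note B = bilinear_Omega[OF c p]
  let ?q1 = "fderiv (lift c) p (hlift c 1 p)" and ?qi = "fderiv (lift c) p (hlift c \<i> p)"
  have fr: "fderiv (\<lambda>q. Omega c q (hlift c \<tau> p) Y) p d = - Omega c p (0, \<tau> *s fderiv (lift c) p d) Y" for \<tau> Y d
    by (rule fderiv_Omega_frozen[OF c p Omega_hlift_null[OF c]])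
  have z: "Omega c p Y (hlift c \<tau> p) = 0" for Y \<tau>
    using Omega_antisym[OF c p, of Y "hlift c \<tau> p"] Omega_hlift_null[OF c p] by simp
  \<comment> \<open>Closedness is applied to the two lifts and a vertical vector. The derivative
    along the vertical vector drops out by \<open>z\<close>, since both contracted vectors lie in
    the kernel; the other two compare \<open>?qi\<close> with \<open>\<i> *s ?q1\<close>.\<close>
  have "Omega c p (0, ?qi - \<i> *s ?q1) (0, b) = 0" for b
  proof -
    have "Omega c p (0, ?qi) (0, b) - Omega c p (0, \<i> *s ?q1) (0, b) = 0"
      using Omega_closed[OF c p, of "hlift c \<i> p" "(0, b)" "hlift c 1 p"]
        fderiv_Omega_swap[OF c p, of "(0, b)" "hlift c 1 p" "hlift c \<i> p"] by (simp add: fr z)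
    moreover have "(0 :: complex, ?qi - \<i> *s ?q1) = (0, ?qi) - (0, \<i> *s ?q1)" by simp
    ultimately show ?thesis by (simp only: bilinear_lsub[OF B])
  qed
  from this[of "J_vec (?qi - \<i> *s ?q1)"] show ?thesis
    using Omega_fibre_pos[OF c p, of "?qi - \<i> *s ?q1"] by auto
qed

end

context fibration
begin

section \<open>Derivatives along the (1,0) lift and its conjugate\<close>

definition dV :: "(complex \<Rightarrow> 'z \<Rightarrow> complex) \<Rightarrow> complex \<Rightarrow> 'z \<Rightarrow> complex"
  where "dV F t z = (hderiv 1 F t z - \<i> * hderiv \<i> F t z) / 2"

definition dVbar :: "(complex \<Rightarrow> 'z \<Rightarrow> complex) \<Rightarrow> complex \<Rightarrow> 'z \<Rightarrow> complex"
  where "dVbar F t z = (hderiv 1 F t z + \<i> * hderiv \<i> F t z) / 2"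

lemma rep_dV: "rep (dV F) c p = (rep (hderiv 1 F) c p - \<i> * rep (hderiv \<i> F) c p) / 2"
  and rep_dVbar: "rep (dVbar F) c p = (rep (hderiv 1 F) c p + \<i> * rep (hderiv \<i> F) c p) / 2"
  by (simp_all add: rep_def dV_def dVbar_def)

lemma fsmooth_dV: "fsmooth F \<Longrightarrow> fsmooth (dV F)"
  unfolding fsmooth_def[of "dV F"] rep_dV[abs_def]
  by (auto intro!: smooth_on_divide smooth_on_diff smooth_on_mult smooth_on_const open_cdom fsmoothD fsmooth_hderiv)

lemma fsmooth_dVbar: "fsmooth F \<Longrightarrow> fsmooth (dVbar F)"
  unfolding fsmooth_def[of "dVbar F"] rep_dVbar[abs_def]
  by (auto intro!: smooth_on_divide smooth_on_add smooth_on_mult smooth_on_const open_cdom fsmoothD fsmooth_hderiv)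

lemma fint_combination:
  assumes "t \<in> U" "fsmooth F" "fsmooth G"
  shows "fint (\<lambda>t z. (F t z + k * G t z) / 2) t = (fint F t + k * fint G t) / 2"
proof -
  interpret dens: mfd_density A "\<lambda>c y. vol c (t, y)" by (rule mfd_density_vol[OF assms(1)])
  have c: "chart_cont (F t)" "chart_cont (G t)" using assms chart_cont_slice by auto
  have kG: "chart_cont (\<lambda>z. k * G t z)" using c(2) by (auto simp: chart_cont_def intro!: continuous_intros)
  have "(\<lambda>z. (F t z + k * G t z) / 2) = (\<lambda>z. (1 / 2) * (F t z + k * G t z))" by (simp add: fun_eq_iff)
  then show ?thesis unfolding fint_def
    by (simp only: dens.dens_integral_mult dens.dens_integral_add[OF c(1) kG]) simp
qed

lemma wirtinger_fint:
  assumes "fsmooth F" "t \<in> U"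
  shows "wirtinger (fint F) t = fint (dV F) t" "wirtinger_bar (fint F) t = fint (dVbar F) t"
proof -
  have d: "fderiv (fint F) t \<tau> = fint (hderiv \<tau> F) t" for \<tau>
    using fderiv_eqI[OF has_derivative_fint[OF assms]] by simp
  show "wirtinger (fint F) t = fint (dV F) t" "wirtinger_bar (fint F) t = fint (dVbar F) t"
    using fint_combination[OF assms(2) fsmooth_hderiv[OF assms(1)] fsmooth_hderiv[OF assms(1)], of 1 "- \<i>" \<i>]
      fint_combination[OF assms(2) fsmooth_hderiv[OF assms(1)] fsmooth_hderiv[OF assms(1)], of 1 \<i> \<i>]
    by (simp_all add: del_def dbar_def d dV_def[abs_def] dVbar_def[abs_def])
qed

text \<open>By \<open>has_derivative_fint\<close> the class of fibre integrals is closed under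
  differentiation; agreement with an integral is asked on \<open>U\<close> only, where
  \<open>fint\<close> is meaningful.\<close>

lemma smooth_on_fint: "fsmooth F \<Longrightarrow> smooth_on U (fint F)"
proof (rule smooth_on_coinduct[of "\<lambda>f. \<exists>F. fsmooth F \<and> (\<forall>s\<in>U. f s = fint F s)"])
  fix f assume "\<exists>F. fsmooth F \<and> (\<forall>s\<in>U. f s = fint F s)"
  then obtain F where F: "fsmooth F" "\<And>s. s \<in> U \<Longrightarrow> f s = fint F s" by blast
  have der: "(f has_derivative (\<lambda>\<tau>. fint (hderiv \<tau> F) s)) (at s)" if "s \<in> U" for s
    by (rule has_derivative_transform_within_open[OF has_derivative_fint[OF F(1) that] U that]) (simp add: F)
  then have "f differentiable_on U"
    by (meson differentiableI differentiable_at_imp_differentiable_on)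
  moreover have "\<exists>G. fsmooth G \<and> (\<forall>s\<in>U. fderiv f s v = fint G s)" for v
    using fderiv_eqI[OF der] fsmooth_hderiv[OF F(1)] by (intro exI[of _ "hderiv v F"]) auto
  ultimately show "f differentiable_on U \<and> (\<forall>v. \<exists>F. fsmooth F \<and> (\<forall>s\<in>U. fderiv f s v = fint F s))" by blast
qed blast

section \<open>Pointwise pairing of sections and the covariant derivative along V\<close>

abbreviation H where "H \<equiv> hol_sections A V g"

lemma H_transition: "u \<in> H \<Longrightarrow> z \<in> V j \<Longrightarrow> z \<in> V k \<Longrightarrow> u (j, z) = g j k z * u (k, z)"
  unfolding hol_sections_def by blast

lemma H_outside: "u \<in> H \<Longrightarrow> z \<notin> V j \<Longrightarrow> u (j, z) = 0"
  unfolding hol_sections_def by blast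

definition ip :: "('j \<times> 'z \<Rightarrow> complex) \<Rightarrow> ('j \<times> 'z \<Rightarrow> complex) \<Rightarrow> complex \<Rightarrow> 'z \<Rightarrow> complex"
  where "ip u v t z = pointwise_inner V (\<lambda>j. \<phi> j t) u v z"

definition coef :: "('z, 'n) chart \<Rightarrow> 'j \<Rightarrow> ('j \<times> 'z \<Rightarrow> complex) \<Rightarrow> complex^'n \<Rightarrow> complex"
  where "coef c j u y = u (j, chart_inv c y)"

text \<open>The factor \<open>|g|^2\<close> from the two coefficients cancels against the one from
  the weight.\<close>

lemma ip_frame:
  assumes u: "u \<in> H" and v: "v \<in> H" and t: "t \<in> U" and z: "z \<in> V j"
  shows "ip u v t z = u (j, z) * cnj (v (j, z)) * of_real (exp (- \<phi> j t z))"
proof -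
  define k where "k = frame_at V z"
  have zk: "z \<in> V k" by (simp add: k_def frame_at_mem)
  have g: "g k j z \<noteq> 0" using lb z zk unfolding line_bundle_def by blast
  have uv: "u (k, z) = g k j z * u (j, z)" "v (k, z) = g k j z * v (j, z)"
    using H_transition u v z zk by blast+
  have "\<phi> k t z - \<phi> j t z = ln ((cmod (g k j z))\<^sup>2)"
    using sm t z zk unfolding smooth_metric_pullback_def by blast
  then have "- \<phi> k t z = - \<phi> j t z - ln ((cmod (g k j z))\<^sup>2)" by simp
  then have e: "exp (- \<phi> k t z) = exp (- \<phi> j t z) / (cmod (g k j z))\<^sup>2"
    using g by (simp add: exp_diff)
  have gg: "g k j z * cnj (g k j z) = of_real ((cmod (g k j z))\<^sup>2)" by (rule complex_norm_square[symmetric])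
  have "u (k, z) * cnj (v (k, z)) * x = u (j, z) * cnj (v (j, z)) * ((g k j z * cnj (g k j z)) * x)" for x
    unfolding uv by (simp add: mult_ac)
  from this[of "of_real (exp (- \<phi> k t z))", unfolded gg mult.assoc] have "u (k, z) * cnj (v (k, z)) * of_real (exp (- \<phi> k t z))
    = u (j, z) * cnj (v (j, z)) * (of_real ((cmod (g k j z))\<^sup>2) * of_real (exp (- \<phi> j t z) / (cmod (g k j z))\<^sup>2))"
    unfolding e mult.assoc .
  also have "of_real ((cmod (g k j z))\<^sup>2) * complex_of_real (exp (- \<phi> j t z) / (cmod (g k j z))\<^sup>2) = of_real (exp (- \<phi> j t z))"
    using g unfolding of_real_mult[symmetric] by simp
  finally show ?thesis by (simp add: ip_def pointwise_inner_def k_def Let_def)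
qed

lemma holo_coef:
  assumes "u \<in> H" "c \<in> A"
  shows "holo_on (snd c ` (fst c \<inter> V j)) (coef c j u)"
  using assms unfolding hol_sections_def holo_fun_on_def coef_def[abs_def] by blast

lemma rep_ip:
  assumes "u \<in> H" "v \<in> H" "c \<in> A" "p \<in> fdom c j"
  shows "rep (ip u v) c p = coef c j u (snd p) * cnj (coef c j v (snd p)) * of_real (exp (- weight c j p))"
  using ip_frame[OF assms(1,2), of "fst p" "chart_inv c (snd p)" j] assms(3,4)
  by (auto simp: rep_def coef_def weight_def fdom_iff cdom_def case_prod_unfold)

context
  fixes c :: "('z, 'n) chart" and j :: 'j
  assumes c: "c \<in> A"
begin

lemma fdom_cdom: "p \<in> fdom c j \<Longrightarrow> p \<in> cdom c"
  by (simp add: fdom_iff[OF c])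

lemma snd_fdom: "p \<in> fdom c j \<Longrightarrow> snd p \<in> snd c ` (fst c \<inter> V j)"
  by (auto simp: fdom_def)

lemma has_derivative_coef:
  assumes u: "u \<in> H" and p: "p \<in> fdom c j"
  shows "((\<lambda>p. coef c j u (snd p)) has_derivative (\<lambda>d. fderiv (coef c j u) (snd p) (snd d))) (at p)"
  by (rule has_derivative_compose[OF bounded_linear_imp_has_derivative[OF bounded_linear_snd]
        holo_on_has_derivative[OF holo_coef[OF u c] snd_fdom[OF p]]])

lemma smooth_coef: "u \<in> H \<Longrightarrow> smooth_on (fdom c j) (\<lambda>p. coef c j u (snd p))"
proof -
  assume u: "u \<in> H"
  have o: "open (snd c ` (fst c \<inter> V j))" using open_chart_image[OF c open_V] .
  show ?thesis
    by (rule smooth_on_subset[OF holo_on_comp_snd(1)[OF o holo_coef[OF u c]]]) (auto simp: fdom_def)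
qed

lemma has_derivative_exp_weight:
  assumes p: "p \<in> fdom c j"
  shows "((\<lambda>p. complex_of_real (exp (- weight c j p))) has_derivative
    (\<lambda>d. - of_real (fderiv (weight c j) p d) * of_real (exp (- weight c j p)))) (at p)"
proof -
  have "((\<lambda>p. exp (- weight c j p)) has_derivative (\<lambda>d. (- fderiv (weight c j) p d) * exp (- weight c j p))) (at p)"
    by (intro has_derivative_exp has_derivative_minus smooth_on_has_derivative[OF open_fdom[OF c] smooth_weight[OF c] p])
  from bounded_linear.has_derivative[OF bounded_linear_of_real[where 'a = complex] this] show ?thesis by simp
qed

definition dcoef :: "('j \<times> 'z \<Rightarrow> complex) \<Rightarrow> complex \<times> (complex^'n) \<Rightarrow> complex"
  where "dcoef u p = fderiv (coef c j u) (snd p) (lift c p)"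

definition dweight :: "complex \<times> (complex^'n) \<Rightarrow> complex"
  where "dweight p = (of_real (fderiv (weight c j) p (hlift c 1 p)) - \<i> * of_real (fderiv (weight c j) p (hlift c \<i> p))) / 2"

text \<open>The coefficient of \<open>\<nabla>_V u\<close> in the local frame: the connection form
  of the line bundle is minus the (1,0)-part of the differential of the weight, and
  \<open>dcoef\<close> and \<open>dweight\<close> are the derivatives of the coefficient and of the
  weight along V.\<close>

definition cov :: "('j \<times> 'z \<Rightarrow> complex) \<Rightarrow> complex \<times> (complex^'n) \<Rightarrow> complex"
  where "cov u p = dcoef u p - coef c j u (snd p) * dweight p"

lemma fderiv_coef_hlift:
  assumes u: "u \<in> H" and p: "p \<in> fdom c j"
  shows "fderiv (coef c j u) (snd p) (snd (hlift c \<tau> p)) = \<tau> * dcoef u p"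
  using holo_on_fderiv_scale[OF holo_coef[OF u c] snd_fdom[OF p]] by (simp add: hlift_def dcoef_def)

lemma fsmooth_rep_cong:
  assumes "p \<in> fdom c j" "\<And>q. q \<in> fdom c j \<Longrightarrow> rep F c q = f q" "fsmooth F"
  shows "rep (hderiv \<tau> F) c p = fderiv f p (hlift c \<tau> p)"
  unfolding rep_hderiv[OF assms(3) c fdom_cdom[OF assms(1)]]
  using fderiv_cong[OF open_fdom[OF c] assms(1,2)] by simp

end

lemma fsmooth_ip:
  assumes u: "u \<in> H" and v: "v \<in> H"
  shows "fsmooth (ip u v)"
  unfolding fsmooth_def
proof (intro ballI smooth_on_local)
  fix c p assume c: "c \<in> A" and p: "p \<in> cdom c"
  let ?j = "frame c p"
  have o: "open (fdom c ?j)" by (rule open_fdom[OF c])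
  have "smooth_on (fdom c ?j) (rep (ip u v) c)"
    by (rule smooth_on_cong[OF o, THEN iffD2, OF rep_ip[OF u v c, where j = ?j]], assumption)
      (intro smooth_on_mult smooth_on_cnj smooth_on_of_real smooth_on_exp smooth_on_uminus smooth_coef smooth_weight o c u v)
  then show "\<exists>N. open N \<and> p \<in> N \<and> smooth_on N (rep (ip u v) c)" using o fdom_frame[OF c p] by blast
qed

text \<open>V is of type (1,0) and so annihilates the conjugate of the holomorphic coefficient of
  \<open>v\<close>; what remains is the derivative of \<open>u\<close> together with that of the
  weight.\<close>

lemma rep_dV_ip:
  assumes u: "u \<in> H" and v: "v \<in> H" and c: "c \<in> A" and p: "p \<in> fdom c j"
  shows "rep (dV (ip u v)) c p = cov c j u p * cnj (coef c j v (snd p)) * of_real (exp (- weight c j p))"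
proof -
  let ?f = "\<lambda>p. coef c j u (snd p) * cnj (coef c j v (snd p)) * of_real (exp (- weight c j p))"
  have "fderiv ?f p = (\<lambda>d. (coef c j u (snd p) * cnj (coef c j v (snd p))) * (- of_real (fderiv (weight c j) p d) * of_real (exp (- weight c j p)))
     + (coef c j u (snd p) * cnj (fderiv (coef c j v) (snd p) (snd d)) + fderiv (coef c j u) (snd p) (snd d) * cnj (coef c j v (snd p)))
      * of_real (exp (- weight c j p)))"
    by (intro fderiv_eqI has_derivative_mult has_derivative_coef[OF c] has_derivative_exp_weight[OF c]
        bounded_linear.has_derivative[OF bounded_linear_cnj] u v p)
  then have D: "rep (hderiv \<tau> (ip u v)) c p =
     (coef c j u (snd p) * cnj (coef c j v (snd p))) * (- of_real (fderiv (weight c j) p (hlift c \<tau> p)) * of_real (exp (- weight c j p)))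
     + (coef c j u (snd p) * cnj (\<tau> * dcoef c j v p) + (\<tau> * dcoef c j u p) * cnj (coef c j v (snd p)))
      * of_real (exp (- weight c j p))" for \<tau>
    using fsmooth_rep_cong[where \<tau> = \<tau>, OF c p rep_ip[OF u v c, where j = j] fsmooth_ip[OF u v]]
      fderiv_coef_hlift[OF c u p, of \<tau>] fderiv_coef_hlift[OF c v p, of \<tau>] by simp
  show ?thesis unfolding rep_dV D cov_def[OF c] dweight_def[OF c] by (simp add: field_simps)
qed

end

context monge_ampere
begin

text \<open>Three contributions to the derivative of \<open>cov\<close> along the conjugate of V
  vanish separately: that of \<open>dcoef\<close> by holomorphy of the coefficient and by
  \<open>lift_holomorphic_along_leaves\<close>, that of the coefficient itself by holomorphy, and
  that of \<open>dweight\<close> because the curvature form vanishes on the lifts and the lift is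
  holomorphic along the leaves.\<close>

lemma has_derivative_cov:
  assumes u: "u \<in> H" and c: "c \<in> A" and p: "p \<in> fdom c j"
  shows "(cov c j u has_derivative fderiv (cov c j u) p) (at p)"
    and "fderiv (cov c j u) p (hlift c 1 p) + \<i> * fderiv (cov c j u) p (hlift c \<i> p) = 0"
proof -
  let ?S = "snd c ` (fst c \<inter> V j)" and ?h = "coef c j u" and ?w = "weight c j"
  note pc = fdom_cdom[OF c p] and sp = snd_fdom[OF c p]
  have oS: "open ?S" using open_chart_image[OF c open_V] .
  note h = holo_coef[OF u c, of j]
  note ow = open_fdom[OF c, of j] and sw = smooth_weight[OF c, of j]
  define k where "k x = fderiv ?h x (lift c p)" for x
  have hk: "holo_on ?S k" unfolding k_def by (rule holo_on_fderiv[OF oS h])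
  define D1 where "D1 d = fderiv k (snd p) (snd d) + fderiv ?h (snd p) (fderiv (lift c) p d)" for d
  have d1: "(dcoef c j u has_derivative D1) (at p)"
    unfolding dcoef_def[OF c, abs_def] D1_def[abs_def] k_def[abs_def]
    by (rule smooth_on_has_derivative_moving[OF oS holo_on_smooth_on[OF oS h] sp
          bounded_linear_imp_has_derivative[OF bounded_linear_snd]
          smooth_on_has_derivative[OF open_cdom[OF c] smooth_lift[OF c] pc]])
  define E where "E \<sigma> d = fderiv2 ?w p d (hlift c \<sigma> p) + fderiv ?w p (0, \<sigma> *s fderiv (lift c) p d)" for \<sigma> d
  have dE: "((\<lambda>p. fderiv ?w p (hlift c \<sigma> p)) has_derivative E \<sigma>) (at p)" for \<sigma>
    unfolding E_def[abs_def] fderiv2_def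
    by (rule smooth_on_has_derivative_moving[OF ow sw p has_derivative_ident has_derivative_hlift[OF c pc]])
  define D2 where "D2 d = (of_real (E 1 d) - \<i> * of_real (E \<i> d)) / 2" for d
  have d2: "(dweight c j has_derivative D2) (at p)"
    unfolding dweight_def[OF c, abs_def] D2_def[abs_def]
    by (intro bounded_linear.has_derivative[OF bounded_linear_divide] has_derivative_diff
        bounded_linear.has_derivative[OF bounded_linear_mult_right]
        bounded_linear.has_derivative[OF bounded_linear_of_real] dE)
  have d: "(cov c j u has_derivative (\<lambda>d. D1 d - (?h (snd p) * D2 d + fderiv ?h (snd p) (snd d) * dweight c j p))) (at p)"
    unfolding cov_def[OF c, abs_def]
    by (intro has_derivative_diff has_derivative_mult d1 d2 has_derivative_coef[OF c u p])
  note e = fderiv_eqI[OF d]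
  show "(cov c j u has_derivative fderiv (cov c j u) p) (at p)" unfolding e by (rule d)
  let ?q = "fderiv (lift c) p (hlift c 1 p)"
  note q = lift_holomorphic_along_leaves[OF c pc]
  have k\<tau>: "fderiv k (snd p) (snd (hlift c \<tau> p)) = \<tau> * fderiv k (snd p) (lift c p)" for \<tau>
    unfolding hlift_def by (simp add: holo_on_fderiv_scale[OF hk sp])
  have 1: "D1 (hlift c 1 p) + \<i> * D1 (hlift c \<i> p) = 0"
    unfolding D1_def k\<tau> q holo_on_fderiv_scale[OF h sp] by (simp add: algebra_simps)
  have 2: "fderiv ?h (snd p) (snd (hlift c 1 p)) + \<i> * fderiv ?h (snd p) (snd (hlift c \<i> p)) = 0"
    unfolding fderiv_coef_hlift[OF c u p] by simp
  have 3: "D2 (hlift c 1 p) + \<i> * D2 (hlift c \<i> p) = 0"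
  proof -
    note Bw = bilinear_fderiv2[OF ow sw p]
    have J1: "J_prod (hlift c 1 p) = hlift c \<i> p" "J_prod (hlift c \<i> p) = - hlift c 1 p"
      by (simp add: hlift_J) (simp add: hlift_def J_prod_def vec_eq_iff)
    \<comment> \<open>On this pair the Levi form is half the sum of the second derivatives along
      both lifts, so its vanishing means that the weight is harmonic along the leaf.\<close>
    have "levi J_prod ?w p (hlift c 1 p) (hlift c \<i> p) = 0"
      using Omega_eq[OF c p] Omega_hlift_null[OF c pc] by simp
    then have lv: "fderiv2 ?w p (hlift c \<i> p) (hlift c \<i> p) + fderiv2 ?w p (hlift c 1 p) (hlift c 1 p) = 0"
      unfolding levi_def J1 by (simp add: bilinear_rneg[OF Bw])
    have sy: "fderiv2 ?w p (hlift c \<i> p) (hlift c 1 p) = fderiv2 ?w p (hlift c 1 p) (hlift c \<i> p)"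
      by (rule fderiv2_symmetric[OF ow sw p])
    have "fderiv ?w p (0, \<i> *s (\<i> *s ?q)) = - fderiv ?w p (0, ?q)"
    proof -
      have "(0 :: complex, \<i> *s (\<i> *s ?q)) = - (0, ?q)" by (simp add: vec_eq_iff)
      then show ?thesis by (simp only: linear_neg[OF smooth_on_linear[OF ow sw p]])
    qed
    then have x: "E \<i> (hlift c \<i> p) = - E 1 (hlift c 1 p)" "E \<i> (hlift c 1 p) = E 1 (hlift c \<i> p)"
      unfolding E_def q using lv sy by simp_all
    show ?thesis unfolding D2_def x by (simp add: complex_eq_iff)
  qed
  have "fderiv (cov c j u) p (hlift c 1 p) + \<i> * fderiv (cov c j u) p (hlift c \<i> p)
     = (D1 (hlift c 1 p) + \<i> * D1 (hlift c \<i> p)) - ?h (snd p) * (D2 (hlift c 1 p) + \<i> * D2 (hlift c \<i> p))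
      - (fderiv ?h (snd p) (snd (hlift c 1 p)) + \<i> * fderiv ?h (snd p) (snd (hlift c \<i> p))) * dweight c j p"
    unfolding e by (simp add: algebra_simps)
  then show "fderiv (cov c j u) p (hlift c 1 p) + \<i> * fderiv (cov c j u) p (hlift c \<i> p) = 0"
    unfolding 1 2 3 by simp
qed

text \<open>By \<open>has_derivative_cov\<close> the conjugate of V does not see \<open>cov\<close>;
  applied to the conjugate coefficient and to the weight, it yields the conjugate of
  \<open>cov\<close>.\<close>

lemma rep_dVbar_dV_ip:
  assumes u: "u \<in> H" and c: "c \<in> A" and p: "p \<in> fdom c j"
  shows "rep (dVbar (dV (ip u u))) c p = cov c j u p * cnj (cov c j u p) * of_real (exp (- weight c j p))"
proof -
  let ?f = "\<lambda>p. cov c j u p * cnj (coef c j u (snd p)) * of_real (exp (- weight c j p))"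
  define a where "a = cov c j u p"
  define a' where "a' \<tau> = fderiv (cov c j u) p (hlift c \<tau> p)" for \<tau>
  define h where "h = coef c j u (snd p)"
  define h' where "h' = dcoef c j u p"
  define w where "w \<tau> = fderiv (weight c j) p (hlift c \<tau> p)" for \<tau>
  define x where "x = complex_of_real (exp (- weight c j p))"
  have "fderiv ?f p = (\<lambda>d. (cov c j u p * cnj (coef c j u (snd p))) * (- of_real (fderiv (weight c j) p d) * of_real (exp (- weight c j p)))
     + (cov c j u p * cnj (fderiv (coef c j u) (snd p) (snd d)) + fderiv (cov c j u) p d * cnj (coef c j u (snd p)))
      * of_real (exp (- weight c j p)))"
    by (intro fderiv_eqI has_derivative_mult has_derivative_coef[OF c] has_derivative_exp_weight[OF c]
        bounded_linear.has_derivative[OF bounded_linear_cnj] has_derivative_cov(1)[OF u c] u p)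
  then have D: "rep (hderiv \<tau> (dV (ip u u))) c p =
     (a * cnj h) * (- of_real (w \<tau>) * x) + (a * cnj (\<tau> * h') + a' \<tau> * cnj h) * x" for \<tau>
    using fsmooth_rep_cong[where \<tau> = \<tau>, OF c p rep_dV_ip[OF u u c, where j = j] fsmooth_dV[OF fsmooth_ip[OF u u]]]
      fderiv_coef_hlift[OF c u p, of \<tau>] by (simp add: a_def a'_def h_def h'_def w_def x_def)
  have "rep (dVbar (dV (ip u u))) c p = (a' 1 + \<i> * a' \<i>) * cnj h * x / 2
     + a * (cnj h' - cnj h * ((of_real (w 1) + \<i> * of_real (w \<i>)) / 2)) * x"
    unfolding rep_dVbar D by (simp add: field_simps)
  moreover have "a' 1 + \<i> * a' \<i> = 0" unfolding a'_def by (rule has_derivative_cov(2)[OF u c p])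
  moreover have "cnj h' - cnj h * ((of_real (w 1) + \<i> * of_real (w \<i>)) / 2) = cnj a"
    unfolding a_def cov_def[OF c] dweight_def[OF c] h_def h'_def w_def by simp
  ultimately show ?thesis by (simp add: a_def x_def)
qed

end

section \<open>Holomorphic sections\<close>

context compact_mfd
begin

lemma chart_cont_imp_continuous:
  fixes f :: "'z \<Rightarrow> 'b::topological_space"
  assumes "chart_cont f"
  shows "continuous_on UNIV f"
proof (rule continuous_at_imp_continuous_on, rule ballI)
  fix z
  obtain c where c: "c \<in> A" "z \<in> fst c" by (rule chart_at)
  have "continuous_on (fst c) (\<lambda>z. f (chart_inv c (snd c z)))"
    by (rule continuous_on_compose2[OF _ continuous_on_chart[OF c(1)], of "snd c ` fst c" "\<lambda>y. f (chart_inv c y)"])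
      (use assms c in \<open>auto simp: chart_cont_def\<close>)
  then have "continuous_on (fst c) f" by (rule continuous_on_eq) (simp add: chart_inv_chart[OF c(1)])
  then show "isCont f z" using open_chart_dom[OF c(1)] c(2) by (simp add: continuous_on_eq_continuous_at)
qed

end

context fibration
begin

lemma H_add: "u \<in> H \<Longrightarrow> v \<in> H \<Longrightarrow> (\<lambda>x. a * u x + b * v x) \<in> H"
proof -
  assume u: "u \<in> H" and v: "v \<in> H"
  have "holo_on S (\<lambda>y. a * f y + b * h y)" if fh: "holo_on S f" "holo_on S h" for S f h
    unfolding holo_on_def
  proof
    fix x assume x: "x \<in> S"
    obtain D E where D: "(f has_derivative D) (at x)" "\<forall>v. D (\<i> *s v) = \<i> * D v"
      and E: "(h has_derivative E) (at x)" "\<forall>v. E (\<i> *s v) = \<i> * E v"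
      using fh x unfolding holo_on_def by meson
    show "\<exists>D. ((\<lambda>y. a * f y + b * h y) has_derivative D) (at x) \<and> (\<forall>v. D (\<i> *s v) = \<i> * D v)"
      by (rule exI[of _ "\<lambda>v. a * D v + b * E v"])
        (use D E in \<open>auto intro!: has_derivative_add has_derivative_mult_right simp: algebra_simps\<close>)
  qed
  then have "holo_fun_on A (V j) (\<lambda>z. a * u (j, z) + b * v (j, z))" for j
    using u v unfolding hol_sections_def holo_fun_on_def by blast
  moreover have "a * u (j, z) + b * v (j, z) = g j k z * (a * u (k, z) + b * v (k, z))" if "z \<in> V j \<inter> V k" for j k z
  proof -
    note e = H_transition[OF u IntD1[OF that] IntD2[OF that]] H_transition[OF v IntD1[OF that] IntD2[OF that]]
    show ?thesis by (subst e(1), subst e(2)) (simp only: distrib_left mult.left_commute)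
  qed
  moreover have "a * u (j, z) + b * v (j, z) = 0" if "z \<notin> V j" for j z
    using H_outside[OF u that] H_outside[OF v that] by simp
  ultimately show ?thesis unfolding hol_sections_def by blast
qed

lemma H_zero: "(\<lambda>x. 0) \<in> H"
proof -
  have "holo_on S (\<lambda>y. 0)" for S unfolding holo_on_def by (intro ballI exI[of _ "\<lambda>_. 0"]) auto
  then show ?thesis unfolding hol_sections_def holo_fun_on_def by auto
qed

lemma H_sum: "finite E \<Longrightarrow> (\<And>x. x \<in> E \<Longrightarrow> e x \<in> H) \<Longrightarrow> (\<lambda>p. \<Sum>x\<in>E. k x * e x p) \<in> H"
proof (induction E rule: finite_induct)
  case (insert x E)
  then show ?case using H_add[of "e x" "\<lambda>p. \<Sum>x\<in>E. k x * e x p" "k x" 1] by simp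
qed (simp add: H_zero)

lemma ip_self:
  assumes u: "u \<in> H" and t: "t \<in> U" and z: "z \<in> V j"
  shows "ip u u t z = of_real ((cmod (u (j, z)))\<^sup>2 * exp (- \<phi> j t z))"
  unfolding ip_frame[OF u u t z] complex_norm_square[symmetric] by simp

text \<open>By the Schwarz lemma, a section that vanishes at the centres of sufficiently small balls covering
  the manifold has norm at most half its maximum everywhere, hence is zero.  So evaluation at finitely
  many points is injective.\<close>

lemma section_norm_decrease:
  assumes t: "t \<in> U"
  obtains j W where "z \<in> V j" "open W" "z \<in> W"
    "\<And>u M w. u \<in> H \<Longrightarrow> u (j, z) = 0 \<Longrightarrow> M > 0 \<Longrightarrow> (\<And>w. Re (ip u u t w) \<le> M\<^sup>2) \<Longrightarrow> w \<in> W \<Longrightarrow> Re (ip u u t w) < M\<^sup>2"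
proof -
  obtain c where c: "c \<in> A" "z \<in> fst c" by (rule chart_at)
  define j where "j = frame_at V z"
  have zj: "z \<in> V j" by (simp add: j_def frame_at_mem)
  let ?S = "snd c ` (fst c \<inter> V j)" and ?y0 = "snd c z"
  have o: "open ?S" using open_chart_image[OF c(1) open_V] .
  have y0: "?y0 \<in> ?S" using c zj by auto
  then obtain R where R: "R > 0" "cball ?y0 R \<subseteq> ?S" using o by (metis open_contains_cball)
  have "continuous_on (cball ?y0 R) (\<lambda>y. weight c j (t, y))"
    by (rule continuous_on_compose2[OF smooth_on_imp_continuous_on[OF smooth_weight[OF c(1), of j]]])
      (use R t in \<open>auto simp: fdom_def intro!: continuous_intros\<close>)
  then have "bounded ((\<lambda>y. weight c j (t, y)) ` cball ?y0 R)"
    by (intro compact_imp_bounded compact_continuous_image) auto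
  then obtain B where "\<forall>x\<in>(\<lambda>y. weight c j (t, y)) ` cball ?y0 R. norm x \<le> B"
    unfolding bounded_iff by blast
  then have B: "\<bar>weight c j (t, y)\<bar> \<le> B" if "y \<in> cball ?y0 R" for y using that by auto
  \<comment> \<open>With this radius the Schwarz bound \<open>2 * M * exp (B / 2) * r / R\<close> is
    \<open>M * exp (- B / 2) / 2\<close>; after squaring, the factor \<open>exp B\<close> from the
    weight is compensated and \<open>M^2 / 4\<close> remains.\<close>
  define r where "r = R * exp (- B) / 4"
  have r: "r > 0" using R by (simp add: r_def)
  define W where "W = {w \<in> fst c. snd c w \<in> ball ?y0 (min r R)}"
  have "open (fst c \<inter> snd c -` ball ?y0 (min r R))"
    by (rule continuous_open_preimage[OF continuous_on_chart[OF c(1)] open_chart_dom[OF c(1)]]) auto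
  then have oW: "open W" by (simp add: W_def vimage_def Int_def)
  show ?thesis
  proof (rule that[OF zj oW])
    show "z \<in> W" using c r R by (simp add: W_def)
    fix u M w assume u: "u \<in> H" and u0: "u (j, z) = 0" and M: "(M::real) > 0"
      and bd: "\<And>w. Re (ip u u t w) \<le> M\<^sup>2" and w: "w \<in> W"
    let ?h = "coef c j u"
    have hol: "holo_on (ball ?y0 R) ?h"
      by (rule holo_on_subset[OF holo_coef[OF u c(1)]]) (use R in auto)
    have N: "Re (ip u u t (chart_inv c y)) = (cmod (?h y))\<^sup>2 * exp (- weight c j (t, y))" if "y \<in> cball ?y0 R" for y
    proof -
      have "y \<in> ?S" using that R by blast
      then have "chart_inv c y \<in> V j" using chart_image_Int[OF c(1)] by auto
      from ip_self[OF u t this] show ?thesis by (simp add: coef_def weight_def)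
    qed
    \<comment> \<open>The factor 2 makes the inequality strict, as the Schwarz lemma
      demands.\<close>
    have bound: "cmod (?h y) < 2 * M * exp (B / 2)" if y: "y \<in> ball ?y0 R" for y
    proof -
      have yc: "y \<in> cball ?y0 R" using y by simp
      have "(cmod (?h y))\<^sup>2 = (cmod (?h y))\<^sup>2 * exp (- weight c j (t, y)) * exp (weight c j (t, y))"
        by (simp add: mult.assoc flip: exp_add)
      also have "\<dots> \<le> M\<^sup>2 * exp B"
        using bd[of "chart_inv c y"] B[OF yc] unfolding N[OF yc] by (intro mult_mono) auto
      also have "\<dots> = (M * exp (B / 2))\<^sup>2" by (simp add: power_mult_distrib flip: exp_of_nat_mult)
      finally have "cmod (?h y) \<le> M * exp (B / 2)" by (rule power2_le_imp_le) (use M in simp)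
      moreover have "M * exp (B / 2) > 0" using M by simp
      ultimately show ?thesis by linarith
    qed
    define y where "y = snd c w"
    have wy: "chart_inv c y = w" and y: "y \<in> ball ?y0 R" "dist ?y0 y < r"
      using w chart_inv_chart[OF c(1)] by (auto simp: W_def y_def)
    have yc: "y \<in> cball ?y0 R" using y by simp
    have "?h ?y0 = 0" using u0 chart_inv_chart[OF c] by (simp add: coef_def)
    from holo_on_Schwarz[OF hol bound this y(1)]
    have "cmod (?h y) \<le> 2 * M * exp (B / 2) * norm (y - ?y0) / R" .
    also have "\<dots> \<le> 2 * M * exp (B / 2) * r / R"
      using y(2) M R by (intro divide_right_mono mult_left_mono) (auto simp: dist_norm norm_minus_commute)
    also have "\<dots> = M * exp (- B / 2) / 2"
      using R by (simp add: r_def mult.assoc[symmetric] flip: exp_add)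
    finally have h: "cmod (?h y) \<le> M * exp (- B / 2) / 2" .
    have "Re (ip u u t w) = (cmod (?h y))\<^sup>2 * exp (- weight c j (t, y))" using N[OF yc] wy by simp
    also have "\<dots> \<le> (M * exp (- B / 2) / 2)\<^sup>2 * exp B"
      using h B[OF yc] by (intro mult_mono power_mono) auto
    also have "\<dots> = M\<^sup>2 / 4 * (exp (- B) * exp B)"
      by (simp add: power_divide power_mult_distrib flip: exp_of_nat_mult)
    also have "\<dots> = M\<^sup>2 / 4" by (simp flip: exp_add)
    also have "\<dots> < M\<^sup>2" using M by simp
    finally show "Re (ip u u t w) < M\<^sup>2" .
  qed
qed

lemma finite_separating_set:
  assumes t: "t \<in> U"
  shows "\<exists>E. finite E \<and> (\<forall>u\<in>H. (\<forall>x\<in>E. u x = 0) \<longrightarrow> u = (\<lambda>x. 0))"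
proof -
  have "\<exists>j W. open W \<and> z \<in> W \<and> (\<forall>u M w. u \<in> H \<longrightarrow> u (j, z) = 0 \<longrightarrow> M > 0 \<longrightarrow> (\<forall>w. Re (ip u u t w) \<le> M\<^sup>2) \<longrightarrow> w \<in> W \<longrightarrow> Re (ip u u t w) < M\<^sup>2)" for z
    by (rule section_norm_decrease[OF t, of z]) blast
  then obtain J W where W: "\<And>z. open (W z)" "\<And>z. z \<in> W z"
    "\<And>z u M w. u \<in> H \<Longrightarrow> u (J z, z) = 0 \<Longrightarrow> M > 0 \<Longrightarrow> (\<And>w. Re (ip u u t w) \<le> M\<^sup>2) \<Longrightarrow> w \<in> W z \<Longrightarrow> Re (ip u u t w) < M\<^sup>2"
    by metis
  obtain Z where Z: "finite Z" "UNIV \<subseteq> (\<Union>z\<in>Z. W z)"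
    by (rule compactE_image[OF compact_space, of UNIV W]) (use W in auto)
  have "u = (\<lambda>x. 0)" if u: "u \<in> H" and u0: "\<And>z. z \<in> Z \<Longrightarrow> u (J z, z) = 0" for u
  proof -
    have "continuous_on UNIV (\<lambda>z. Re (ip u u t z))"
      using chart_cont_imp_continuous[OF chart_cont_slice[OF fsmooth_ip[OF u u] t]] by (intro continuous_intros)
    then obtain z where z: "\<And>w. Re (ip u u t w) \<le> Re (ip u u t z)"
      using continuous_attains_sup[OF compact_space, of "\<lambda>z. Re (ip u u t z)"] by auto
    have nn: "Re (ip u u t w) \<ge> 0" for w using ip_self[OF u t frame_at_mem, of w] by simp
    have "Re (ip u u t z) = 0"
    proof (rule ccontr)
      assume "Re (ip u u t z) \<noteq> 0"
      then have pos: "Re (ip u u t z) > 0" using nn[of z] by simp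
      define M where "M = sqrt (Re (ip u u t z))"
      have M: "M > 0" "M\<^sup>2 = Re (ip u u t z)" using pos by (auto simp: M_def)
      obtain z' where z': "z' \<in> Z" "z \<in> W z'" using Z by auto
      have "Re (ip u u t z) < M\<^sup>2" by (rule W(3)[OF u u0[OF z'(1)] M(1) _ z'(2)]) (use z M in auto)
      then show False using M by simp
    qed
    then have zero: "Re (ip u u t w) = 0" for w using z[of w] nn[of w] by simp
    have "u (j, w) = 0" for j w
    proof (cases "w \<in> V j")
      case True
      then show ?thesis using zero[of w] ip_self[OF u t True] by simp
    next
      case False
      then show ?thesis by (rule H_outside[OF u])
    qed
    then show ?thesis by (auto simp: fun_eq_iff)
  qed
  then show ?thesis using Z(1) by (intro exI[of _ "(\<lambda>z. (J z, z)) ` Z"]) auto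
qed

lemma dual_basis:
  assumes t: "t \<in> U"
  obtains E e where "finite E" "\<And>x. x \<in> E \<Longrightarrow> e x \<in> H"
    "\<And>x y. x \<in> E \<Longrightarrow> y \<in> E \<Longrightarrow> e x y = (if x = y then 1 else 0)"
    "\<And>u p. u \<in> H \<Longrightarrow> u p = (\<Sum>x\<in>E. u x * e x p)"
proof -
  define P where "P E \<longleftrightarrow> finite E \<and> (\<forall>u\<in>H. (\<forall>x\<in>E. u x = 0) \<longrightarrow> u = (\<lambda>x. 0))" for E
  obtain E0 where "P E0" using finite_separating_set[OF t] unfolding P_def by metis
  from ex_has_least_nat[of P, OF this, of card]
  obtain E where E: "P E" "\<And>E'. P E' \<Longrightarrow> card E \<le> card E'" by metis
  have fin: "finite E" using E(1) by (simp add: P_def)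
  have sep: "u = (\<lambda>x. 0)" if "u \<in> H" "\<And>x. x \<in> E \<Longrightarrow> u x = 0" for u
    using E(1)[unfolded P_def] that by simp
  have "\<exists>v. v \<in> H \<and> (\<forall>y\<in>E. v y = (if x = y then 1 else 0))" if x: "x \<in> E" for x
  proof -
    have "card (E - {x}) < card E" using fin x by (rule card_Diff1_less)
    then have "\<not> P (E - {x})" using E(2) by (meson not_le)
    then obtain u where u: "u \<in> H" "\<And>y. y \<in> E - {x} \<Longrightarrow> u y = 0" "u \<noteq> (\<lambda>x. 0)"
      using fin unfolding P_def by blast
    have ux: "u x \<noteq> 0"
    proof
      assume "u x = 0"
      then have "u y = 0" if "y \<in> E" for y using u(2)[of y] that by (cases "y = x") auto
      then show False using sep[OF u(1)] u(3) by blast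
    qed
    have "(\<lambda>p. (1 / u x) * u p + 0 * u p) \<in> H" using u(1) u(1) by (rule H_add)
    moreover have "\<forall>y\<in>E. (1 / u x) * u y + 0 * u y = (if x = y then 1 else 0)" using ux u(2) by auto
    ultimately show ?thesis by blast
  qed
  then obtain e where e: "\<And>x. x \<in> E \<Longrightarrow> e x \<in> H" "\<And>x y. x \<in> E \<Longrightarrow> y \<in> E \<Longrightarrow> e x y = (if x = y then 1 else 0)"
    by metis
  have "u p = (\<Sum>x\<in>E. u x * e x p)" if u: "u \<in> H" for u p
  proof -
    define v where "v p = 1 * u p + (-1) * (\<Sum>x\<in>E. u x * e x p)" for p
    have "v \<in> H" unfolding v_def by (intro H_add u H_sum fin e(1))
    moreover have "v y = 0" if "y \<in> E" for y
    proof -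
      have "(\<Sum>x\<in>E. u x * e x y) = (\<Sum>x\<in>E. if x = y then u y else 0)"
        by (rule sum.cong[OF refl]) (simp add: e(2) that)
      then show ?thesis using fin that by (simp add: v_def)
    qed
    ultimately have "v = (\<lambda>x. 0)" by (rule sep)
    then have "v p = 0" by (rule fun_cong)
    then show ?thesis by (simp add: v_def)
  qed
  with e show ?thesis using that[OF fin, of e] by presburger
qed

end

section \<open>The Chern curvature\<close>

lemma sum_combination:
  fixes f g h :: "'b \<Rightarrow> complex"
  shows "((\<Sum>x\<in>E. f x * g x) + k * (\<Sum>x\<in>E. h x * g x)) / 2 = (\<Sum>x\<in>E. (f x + k * h x) / 2 * g x)"
  by (induction E rule: infinite_finite_induct) (auto simp: field_simps)

lemma sum_combination2:
  fixes f g h f' g' h' :: "'b \<Rightarrow> complex"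
  shows "((\<Sum>x\<in>E. f' x * g' x + f x * g x) + k * (\<Sum>x\<in>E. f' x * h' x + h x * g x)) / 2
    = (\<Sum>x\<in>E. (f x + k * h x) / 2 * g x) + (\<Sum>x\<in>E. f' x * ((g' x + k * h' x) / 2))"
  by (induction E rule: infinite_finite_induct) (auto simp: field_simps)

context fibration
begin

lemma L2_inner_eq_fint:
  assumes t: "t \<in> U"
  shows "L2_inner A V \<phi> t u v = fint (ip u v) t"
proof -
  have "L2_inner A V \<phi> t u v = (\<Sum>q\<in>pou. LINT y:snd (fst q) ` fst (fst q)|lborel. of_real (snd q (chart_inv (fst q) y)) *
      (ip u v t (chart_inv (fst q) y) * divided_power (curvature_form V (\<lambda>j. \<phi> j t) (fst q) y) CARD('n) std_frame))"
    unfolding L2_inner_def form_integral_def ip_def pou_def[symmetric] by (simp add: case_prod_unfold)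
  also have "\<dots> = fint (ip u v) t"
    unfolding fint_eq[OF t]
  proof (rule sum.cong[OF refl])
    fix q assume q: "q \<in> pou"
    have c: "fst q \<in> A" by (rule pou_chart[OF q])
    show "(LINT y:snd (fst q) ` fst (fst q)|lborel. of_real (snd q (chart_inv (fst q) y)) *
      (ip u v t (chart_inv (fst q) y) * divided_power (curvature_form V (\<lambda>j. \<phi> j t) (fst q) y) CARD('n) std_frame))
      = (LINT y:snd (fst q) ` fst (fst q)|lborel. of_real (snd q (chart_inv (fst q) y)) * ip u v t (chart_inv (fst q) y) * of_real (vol (fst q) (t, y)))"
      by (rule set_lebesgue_integral_cong)
        (use open_chart_img[OF c] t in \<open>auto simp: divided_power_eq_vol[OF c] cdom_def\<close>)
  qed
  finally show ?thesis .
qed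

definition hip :: "complex \<Rightarrow> ('j \<times> 'z \<Rightarrow> complex) \<Rightarrow> ('j \<times> 'z \<Rightarrow> complex) \<Rightarrow> complex"
  where "hip t u v = fint (ip u v) t"

lemma hip_sum_left:
  assumes t: "t \<in> U" and v: "v \<in> H" and E: "finite E" "\<And>x. x \<in> E \<Longrightarrow> e x \<in> H"
  shows "hip t (\<lambda>p. \<Sum>x\<in>E. k x * e x p) v = (\<Sum>x\<in>E. k x * hip t (e x) v)"
  using E
proof (induction E rule: finite_induct)
  interpret dens: mfd_density A "\<lambda>c y. vol c (t, y)" by (rule mfd_density_vol[OF t])
  case empty
  have "ip (\<lambda>p. 0) v t = (\<lambda>z. 0)" by (simp add: fun_eq_iff ip_def pointwise_inner_def Let_def)
  then show ?case using dens.dens_integral_mult[of 0 "\<lambda>_. 0"] by (simp add: hip_def fint_def)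
next
  interpret dens: mfd_density A "\<lambda>c y. vol c (t, y)" by (rule mfd_density_vol[OF t])
  case (insert x E)
  let ?s = "\<lambda>p. \<Sum>x\<in>E. k x * e x p"
  have s: "?s \<in> H" and ex: "e x \<in> H" using insert by (auto intro: H_sum)
  have "chart_cont (\<lambda>z. k x * ip (e x) v t z)"
    using chart_cont_slice[OF fsmooth_ip[OF ex v] t] by (auto simp: chart_cont_def intro!: continuous_intros)
  moreover have "ip (\<lambda>p. \<Sum>x\<in>insert x E. k x * e x p) v t = (\<lambda>z. k x * ip (e x) v t z + ip ?s v t z)"
    using insert.hyps by (simp add: fun_eq_iff ip_def pointwise_inner_def Let_def algebra_simps)
  ultimately show ?case
    using insert chart_cont_slice[OF fsmooth_ip[OF s v] t]
    by (simp add: hip_def fint_def dens.dens_integral_add dens.dens_integral_mult)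
qed

lemma hip_cnj:
  assumes t: "t \<in> U"
  shows "hip t v u = cnj (hip t u v)"
proof -
  interpret dens: mfd_density A "\<lambda>c y. vol c (t, y)" by (rule mfd_density_vol[OF t])
  have "ip v u t = (\<lambda>z. cnj (ip u v t z))"
    by (simp add: fun_eq_iff ip_def pointwise_inner_def Let_def)
  then show ?thesis by (simp add: hip_def fint_def dens.dens_integral_cnj)
qed

lemma hip_pos:
  assumes t: "t \<in> U" and u: "u \<in> H"
  shows "Im (hip t u u) = 0" "Re (hip t u u) \<ge> 0" "Re (hip t u u) = 0 \<Longrightarrow> u = (\<lambda>x. 0)"
proof -
  interpret dens: mfd_density A "\<lambda>c y. vol c (t, y)" by (rule mfd_density_vol[OF t])
  define n where "n z = (cmod (u (frame_at V z, z)))\<^sup>2 * exp (- \<phi> (frame_at V z) t z)" for z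
  have r: "ip u u t z = of_real (n z)" for z unfolding n_def by (rule ip_self[OF u t frame_at_mem])
  have n: "n z \<ge> 0" for z by (simp add: n_def)
  note cc = chart_cont_slice[OF fsmooth_ip[OF u u] t]
  show "Im (hip t u u) = 0" "Re (hip t u u) \<ge> 0"
    using dens.dens_integral_real(1,2)[OF cc r n] by (auto simp: hip_def fint_def)
  assume "Re (hip t u u) = 0"
  then have "n z = 0" for z using dens.dens_integral_real(3)[OF cc r n] by (simp add: hip_def fint_def)
  then have "ip u u t z = 0" for z using r by simp
  then have "u (j, z) = 0" for j z
    using ip_self[OF u t, of z j] H_outside[OF u, of z j] by (cases "z \<in> V j") auto
  then show "u = (\<lambda>x. 0)" by (auto simp: fun_eq_iff)
qed

lemma wirtinger_L2:
  assumes t: "t \<in> U" and u: "u \<in> H" and v: "v \<in> H"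
  shows "wirtinger (\<lambda>s. L2_inner A V \<phi> s u v) t = fint (dV (ip u v)) t"
proof -
  have "fderiv (\<lambda>s. L2_inner A V \<phi> s u v) t = fderiv (fint (ip u v)) t"
    by (rule fderiv_cong[OF U t]) (rule L2_inner_eq_fint)
  then show ?thesis using wirtinger_fint(1)[OF fsmooth_ip[OF u v] t] by (simp add: del_def)
qed

text \<open>In a basis independent of \<open>s\<close>, the defining equations of the connection
  form a linear system whose Gram matrix is smooth and positive definite; this gives existence with
  smooth coefficients. Positivity of the inner product gives the uniqueness that \<open>THE\<close>
  asks for.\<close>

lemma chern_connection_smooth:
  assumes t0: "t0 \<in> U" and u: "u \<in> H"
  obtains E :: "('j \<times> 'z) set" and e k where "finite E" "\<And>x. x \<in> E \<Longrightarrow> e x \<in> H" "\<And>x. x \<in> E \<Longrightarrow> smooth_on U (k x)"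
    "\<And>s. s \<in> U \<Longrightarrow> chern_connection H (L2_inner A V \<phi>) s u = (\<lambda>p. \<Sum>x\<in>E. k x s * e x p)"
    "\<And>s v. s \<in> U \<Longrightarrow> v \<in> H \<Longrightarrow> hip s (\<lambda>p. \<Sum>x\<in>E. k x s * e x p) v = fint (dV (ip u v)) s"
proof -
  obtain E e where fin: "finite E" and e: "\<And>x. x \<in> E \<Longrightarrow> e x \<in> H"
    and dual: "\<And>x y. x \<in> E \<Longrightarrow> y \<in> E \<Longrightarrow> e x y = (if x = y then 1 else 0)"
    and rp: "\<And>u p. u \<in> H \<Longrightarrow> u p = (\<Sum>x\<in>E. u x * e x p)"
    by (rule dual_basis[OF t0]) blast
  have right: "hip s w (\<lambda>p. \<Sum>x\<in>E. k x * e x p) = (\<Sum>x\<in>E. cnj (k x) * hip s w (e x))"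
    if s: "s \<in> U" and w: "w \<in> H" for s w k
  proof -
    have "hip s (\<lambda>p. \<Sum>x\<in>E. k x * e x p) w = (\<Sum>x\<in>E. k x * hip s (e x) w)"
      by (rule hip_sum_left[OF s w fin e])
    then show ?thesis by (simp add: hip_cnj[OF s, where v = w])
  qed
  have "\<exists>k. (\<forall>x\<in>E. smooth_on U (k x)) \<and> (\<forall>s\<in>U. \<forall>y\<in>E. (\<Sum>x\<in>E. k x s * hip s (e x) (e y)) = fint (dV (ip u (e y))) s)"
  proof (rule smooth_positive_definite_system[OF fin U])
    show "smooth_on U (\<lambda>s. hip s (e x) (e y))" if "x \<in> E" "y \<in> E" for x y
      unfolding hip_def by (intro smooth_on_fint fsmooth_ip e that)
    show "hip s (e y) (e x) = cnj (hip s (e x) (e y))" if "s \<in> U" for x y s by (rule hip_cnj[OF that])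
    show "smooth_on U (fint (dV (ip u (e y))))" if "y \<in> E" for y
      by (intro smooth_on_fint fsmooth_dV fsmooth_ip u e that)
    fix s and k :: "'j \<times> 'z \<Rightarrow> complex" assume s: "s \<in> U" and k: "\<exists>x\<in>E. k x \<noteq> 0"
    define w where "w p = (\<Sum>x\<in>E. k x * e x p)" for p
    have w: "w \<in> H" unfolding w_def by (rule H_sum[OF fin e])
    have "(\<Sum>x\<in>E. \<Sum>y\<in>E. k x * cnj (k y) * hip s (e x) (e y)) = (\<Sum>x\<in>E. k x * hip s (e x) w)"
      unfolding w_def by (simp add: right[OF s e] sum_distrib_left mult.assoc)
    also have "\<dots> = hip s w w" unfolding w_def by (rule hip_sum_left[OF s w[unfolded w_def] fin e, symmetric])
    finally have eq: "(\<Sum>x\<in>E. \<Sum>y\<in>E. k x * cnj (k y) * hip s (e x) (e y)) = hip s w w" .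
    have "w \<noteq> (\<lambda>x. 0)"
    proof
      assume w0: "w = (\<lambda>x. 0)"
      obtain y where y: "y \<in> E" "k y \<noteq> 0" using k by blast
      have "w y = (\<Sum>x\<in>E. if x = y then k y else 0)"
        unfolding w_def by (rule sum.cong[OF refl]) (simp add: dual y(1))
      then show False using y fin w0 by simp
    qed
    then show "0 < Re (\<Sum>x\<in>E. \<Sum>y\<in>E. k x * cnj (k y) * hip s (e x) (e y))"
      unfolding eq using hip_pos[OF s w] by (metis order_le_less)
  qed
  then obtain k where k: "\<And>x. x \<in> E \<Longrightarrow> smooth_on U (k x)"
    "\<And>s y. s \<in> U \<Longrightarrow> y \<in> E \<Longrightarrow> (\<Sum>x\<in>E. k x s * hip s (e x) (e y)) = fint (dV (ip u (e y))) s" by blast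
  \<comment> \<open>From the basis to an arbitrary test section: both sides are antilinear in
    \<open>v\<close>; on the right this is obtained by differentiating the expansion of
    \<open>hip r u v\<close>, whose coefficients are constant.\<close>
  have sol: "hip s (\<lambda>p. \<Sum>x\<in>E. k x s * e x p) v = fint (dV (ip u v)) s" if s: "s \<in> U" and v: "v \<in> H" for s v
  proof -
    let ?w = "\<lambda>p. \<Sum>x\<in>E. k x s * e x p"
    have w: "?w \<in> H" by (rule H_sum[OF fin e])
    have v': "v = (\<lambda>p. \<Sum>y\<in>E. v y * e y p)" by (rule ext) (rule rp[OF v])
    have "hip s ?w v = (\<Sum>y\<in>E. cnj (v y) * hip s ?w (e y))" using right[OF s w, of v] by (simp only: v'[symmetric])
    also have "\<dots> = (\<Sum>y\<in>E. cnj (v y) * fint (dV (ip u (e y))) s)"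
      by (rule sum.cong[OF refl]) (simp add: hip_sum_left[OF s e fin e] k(2)[OF s])
    also have "\<dots> = fint (dV (ip u v)) s"
    proof -
      have hl: "hip r u v = (\<Sum>y\<in>E. cnj (v y) * hip r u (e y))" if "r \<in> U" for r
        using right[OF that u, of v] by (simp only: v'[symmetric])
      have d: "((\<lambda>r. hip r u (e y)) has_derivative fderiv (\<lambda>r. hip r u (e y)) s) (at s)" if "y \<in> E" for y
        unfolding hip_def by (rule smooth_on_has_derivative[OF U smooth_on_fint[OF fsmooth_ip[OF u e[OF that]]] s])
      have "fderiv (fint (ip u v)) s = fderiv (\<lambda>r. \<Sum>y\<in>E. cnj (v y) * hip r u (e y)) s"
        by (rule fderiv_cong[OF U s]) (use hl in \<open>simp add: hip_def\<close>)
      also have "\<dots> = (\<lambda>\<tau>. \<Sum>y\<in>E. cnj (v y) * fderiv (\<lambda>r. hip r u (e y)) s \<tau>)"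
        by (intro fderiv_eqI has_derivative_sum has_derivative_mult_right d)
      finally have f: "fderiv (fint (ip u v)) s \<tau> = (\<Sum>y\<in>E. cnj (v y) * fderiv (fint (ip u (e y))) s \<tau>)" for \<tau>
        by (simp add: hip_def[abs_def])
      have "fint (dV (ip u v)) s = (\<Sum>y\<in>E. cnj (v y) * wirtinger (fint (ip u (e y))) s)"
        unfolding wirtinger_fint(1)[OF fsmooth_ip[OF u v] s, symmetric] del_def f
        using sum_combination[of "\<lambda>y. fderiv (fint (ip u (e y))) s 1" "\<lambda>y. cnj (v y)" E "- \<i>" "\<lambda>y. fderiv (fint (ip u (e y))) s \<i>"]
        by (simp add: mult.commute)
      also have "\<dots> = (\<Sum>y\<in>E. cnj (v y) * fint (dV (ip u (e y))) s)"
        by (rule sum.cong[OF refl]) (simp add: wirtinger_fint(1)[OF fsmooth_ip[OF u e] s])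
      finally show ?thesis by simp
    qed
    finally show ?thesis .
  qed
  have "chern_connection H (L2_inner A V \<phi>) s u = (\<lambda>p. \<Sum>x\<in>E. k x s * e x p)" if s: "s \<in> U" for s
    unfolding chern_connection_def
  proof (rule the_equality)
    let ?w = "\<lambda>p. \<Sum>x\<in>E. k x s * e x p"
    have w: "?w \<in> H" by (rule H_sum[OF fin e])
    show "?w \<in> H \<and> (\<forall>v\<in>H. L2_inner A V \<phi> s ?w v = wirtinger (\<lambda>s. L2_inner A V \<phi> s u v) s)"
      using w sol[OF s] wirtinger_L2[OF s u] L2_inner_eq_fint[OF s] by (simp add: hip_def)
    fix w' assume w': "w' \<in> H \<and> (\<forall>v\<in>H. L2_inner A V \<phi> s w' v = wirtinger (\<lambda>s. L2_inner A V \<phi> s u v) s)"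
    define d where "d p = 1 * w' p + (-1) * ?w p" for p
    have d: "d \<in> H" unfolding d_def using w' w by (intro H_add) auto
    have "hip s d d = hip s w' d - hip s ?w d"
    proof -
      \<comment> \<open>A difference regarded as a sum over two indices, so that
        \<open>hip_sum_left\<close> serves as additivity.\<close>
      have "hip s (\<lambda>p. \<Sum>x\<in>{True, False}. (if x then 1 else -1) * (if x then w' else ?w) p) d
        = (\<Sum>x\<in>{True, False}. (if x then 1 else -1) * hip s (if x then w' else ?w) d)"
        by (rule hip_sum_left[OF s d]) (use w w' in auto)
      then show ?thesis by (simp add: d_def[abs_def])
    qed
    also have "\<dots> = 0"
      using w' d sol[OF s d] wirtinger_L2[OF s u d] L2_inner_eq_fint[OF s, of w' d] by (simp add: hip_def)
    finally have "d = (\<lambda>x. 0)" using hip_pos(3)[OF s d] by simp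
    then show "w' = ?w" by (auto simp: d_def fun_eq_iff)
  qed
  with e k(1) sol show ?thesis using that[OF fin, of e k] by presburger
qed

end

context monge_ampere
begin

text \<open>Differentiating \<open>hip s (D_s u) u = fint (dV (ip u u)) s\<close> in the conjugate
  direction expresses \<open>I\<close> as minus the curvature term plus \<open>hip t D D\<close>.
  The curvature term is real because \<open>I\<close> and \<open>hip t D D\<close> are integrals of
  real functions.\<close>

theorem chern_curvature_nonpos:
  assumes t: "t \<in> U" and u: "u \<in> H"
  defines "\<Theta> \<equiv> L2_inner A V \<phi> t (chern_curvature H (L2_inner A V \<phi>) t u) u"
  shows "\<Theta> \<in> \<real>" "Re \<Theta> \<le> 0"
proof -
  interpret dens: mfd_density A "\<lambda>c y. vol c (t, y)" by (rule mfd_density_vol[OF t])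
  obtain E :: "('j \<times> 'z) set" and e k where fin: "finite E" and e: "\<And>x. x \<in> E \<Longrightarrow> e x \<in> H" and k: "\<And>x. x \<in> E \<Longrightarrow> smooth_on U (k x)"
    and conn: "\<And>s. s \<in> U \<Longrightarrow> chern_connection H (L2_inner A V \<phi>) s u = (\<lambda>p. \<Sum>x\<in>E. k x s * e x p)"
    and sol: "\<And>s v. s \<in> U \<Longrightarrow> v \<in> H \<Longrightarrow> hip s (\<lambda>p. \<Sum>x\<in>E. k x s * e x p) v = fint (dV (ip u v)) s"
    by (rule chern_connection_smooth[OF t u]) blast
  define D where "D p = (\<Sum>x\<in>E. k x t * e x p)" for p
  define kb where "kb x = wirtinger_bar (k x) t" for x
  have D: "D \<in> H" unfolding D_def by (rule H_sum[OF fin e])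
  have solD: "hip t D v = fint (dV (ip u v)) t" if "v \<in> H" for v
    unfolding D_def by (rule sol[OF t that])
  have dk: "(k x has_derivative fderiv (k x) t) (at t)" if "x \<in> E" for x
    by (rule smooth_on_has_derivative[OF U k[OF that] t])
  have "chern_curvature H (L2_inner A V \<phi>) t u = (\<lambda>p. \<Sum>x\<in>E. - kb x * e x p)"
  proof
    fix p
    have "fderiv (\<lambda>s. chern_connection H (L2_inner A V \<phi>) s u p) t = fderiv (\<lambda>s. \<Sum>x\<in>E. k x s * e x p) t"
      by (rule fderiv_cong[OF U t]) (simp add: conn)
    also have "\<dots> = (\<lambda>\<tau>. \<Sum>x\<in>E. fderiv (k x) t \<tau> * e x p)"
      by (intro fderiv_eqI has_derivative_sum has_derivative_mult_left dk)
    finally show "chern_curvature H (L2_inner A V \<phi>) t u p = (\<Sum>x\<in>E. - kb x * e x p)"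
      by (simp add: chern_curvature_def dbar_def kb_def sum_combination sum_negf del: divide_const_simps)
  qed
  then have \<Theta>1: "\<Theta> = - (\<Sum>x\<in>E. kb x * hip t (e x) u)"
    unfolding \<Theta>_def L2_inner_eq_fint[OF t] hip_def[symmetric]
    using hip_sum_left[OF t u fin e, where k = "\<lambda>x. - kb x"] by (simp add: sum_negf)
  define I where "I = fint (dVbar (dV (ip u u))) t"
  have "I = (\<Sum>x\<in>E. kb x * hip t (e x) u) + (\<Sum>x\<in>E. k x t * hip t (e x) D)"
  proof -
    have dh: "((\<lambda>s. hip s (e x) u) has_derivative fderiv (\<lambda>s. hip s (e x) u) t) (at t)" if "x \<in> E" for x
      unfolding hip_def by (rule smooth_on_has_derivative[OF U smooth_on_fint[OF fsmooth_ip[OF e[OF that] u]] t])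
    have "fderiv (fint (dV (ip u u))) t = fderiv (\<lambda>s. \<Sum>x\<in>E. k x s * hip s (e x) u) t"
      by (rule fderiv_cong[OF U t]) (simp add: sol[OF _ u, symmetric] hip_sum_left[OF _ u fin e])
    also have "\<dots> = (\<lambda>\<tau>. \<Sum>x\<in>E. k x t * fderiv (\<lambda>s. hip s (e x) u) t \<tau> + fderiv (k x) t \<tau> * hip t (e x) u)"
      by (intro fderiv_eqI has_derivative_sum has_derivative_mult dk dh)
    finally have "I = (\<Sum>x\<in>E. kb x * hip t (e x) u) + (\<Sum>x\<in>E. k x t * wirtinger_bar (\<lambda>s. hip s (e x) u) t)"
      unfolding I_def wirtinger_fint(2)[OF fsmooth_dV[OF fsmooth_ip[OF u u]] t, symmetric]
      by (simp add: dbar_def kb_def sum_combination2)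
    \<comment> \<open>By conjugate symmetry this is metric compatibility again, with
      \<open>u\<close> in the other slot.\<close>
    moreover have "wirtinger_bar (\<lambda>s. hip s (e x) u) t = hip t (e x) D" if x: "x \<in> E" for x
    proof -
      have "fderiv (\<lambda>s. hip s (e x) u) t = fderiv (\<lambda>s. cnj (hip s u (e x))) t"
        by (rule fderiv_cong[OF U t]) (rule hip_cnj)
      also have "\<dots> = (\<lambda>\<tau>. cnj (fderiv (fint (ip u (e x))) t \<tau>))"
        unfolding hip_def
        by (intro fderiv_eqI bounded_linear.has_derivative[OF bounded_linear_cnj]
            smooth_on_has_derivative[OF U smooth_on_fint[OF fsmooth_ip[OF u e[OF x]]] t])
      finally have "wirtinger_bar (\<lambda>s. hip s (e x) u) t = cnj (wirtinger (fint (ip u (e x))) t)"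
        by (simp add: dbar_def del_def)
      also have "\<dots> = cnj (hip t D (e x))"
        using wirtinger_fint(1)[OF fsmooth_ip[OF u e[OF x]] t] solD[OF e[OF x]] by simp
      finally show ?thesis using hip_cnj[OF t, of "e x" D] by simp
    qed
    ultimately show ?thesis by simp
  qed
  moreover have "(\<Sum>x\<in>E. k x t * hip t (e x) D) = hip t D D"
    unfolding D_def by (rule hip_sum_left[OF t D[unfolded D_def] fin e, symmetric])
  ultimately have \<Theta>2: "\<Theta> = hip t D D - I" using \<Theta>1 by simp
  let ?F = "dVbar (dV (ip u u)) t" and ?G = "dV (ip u D) t"
  have sm: "fsmooth (dVbar (dV (ip u u)))" "fsmooth (dV (ip u D))" "fsmooth (ip D D)"
    by (intro fsmooth_dVbar fsmooth_dV fsmooth_ip u D)+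
  have cc: "chart_cont ?F" "chart_cont ?G" "chart_cont (ip D D t)" using chart_cont_slice[OF _ t] sm by auto
  have cc': "chart_cont (\<lambda>z. (-1) * ?G z)" "chart_cont (\<lambda>z. (-1) * cnj (?G z))"
    using cc(2) by (auto simp: chart_cont_def intro!: continuous_intros)
  \<comment> \<open>The function \<open>|\<nabla>_V u - D|^2 * exp (- \<phi>)\<close> in expanded
    form; the terms of the expansion are globally defined and their integrals are known.\<close>
  define N where "N z = ?F z + (-1) * ?G z + (-1) * cnj (?G z) + ip D D t z" for z
  have "\<exists>r\<ge>0. N z = complex_of_real r \<and> (\<exists>r'\<ge>0. ?F z = complex_of_real r')" for z
  proof -
    obtain c where c: "c \<in> A" "z \<in> fst c" by (rule chart_at)
    let ?p = "(t, snd c z)" let ?j = "frame c ?p"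
    have pc: "?p \<in> cdom c" using t c by (simp add: cdom_def)
    note p = fdom_frame[OF c(1) pc]
    have rz: "rep Q c ?p = Q t z" for Q :: "complex \<Rightarrow> 'z \<Rightarrow> complex" by (simp add: rep_def chart_inv_chart[OF c])
    define a h x where "a = cov c ?j u ?p" and "h = coef c ?j D (snd ?p)" and "x = exp (- weight c ?j ?p)"
    have F: "?F z = a * cnj a * of_real x"
      using rep_dVbar_dV_ip[OF u c(1) p] unfolding rz a_def h_def x_def .
    have G: "?G z = a * cnj h * of_real x"
      using rep_dV_ip[OF u D c(1) p] unfolding rz a_def h_def x_def .
    have DD: "ip D D t z = h * cnj h * of_real x"
      using rep_ip[OF D D c(1) p] unfolding rz a_def h_def x_def .
    have "N z = (a - h) * cnj (a - h) * of_real x" unfolding N_def F G DD by (simp add: algebra_simps)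
    also have "\<dots> = of_real ((cmod (a - h))\<^sup>2 * x)" unfolding complex_norm_square[symmetric] by simp
    finally have 1: "N z = of_real ((cmod (a - h))\<^sup>2 * x)" .
    have 2: "?F z = of_real ((cmod a)\<^sup>2 * x)" unfolding F complex_norm_square[symmetric] by simp
    have "x > 0" by (simp add: x_def)
    then show ?thesis using 1 2 by (intro exI[of _ "(cmod (a - h))\<^sup>2 * x"] conjI exI[of _ "(cmod a)\<^sup>2 * x"]) auto
  qed
  then obtain r r' where r: "\<And>z. r z \<ge> 0" "\<And>z. N z = complex_of_real (r z)" and r': "\<And>z. r' z \<ge> 0" "\<And>z. ?F z = complex_of_real (r' z)"
    by metis
  have ccN: "chart_cont N" unfolding N_def by (intro chart_cont_add cc cc')
  \<comment> \<open>The cross terms integrate to \<open>hip t D D\<close> and its conjugate, because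
    \<open>D\<close> is an admissible test section in \<open>solD\<close>.\<close>
  have "dens.dens_integral N = I - hip t D D - cnj (hip t D D) + hip t D D"
  proof -
    have "dens.dens_integral N = dens.dens_integral ?F + (-1) * dens.dens_integral ?G + (-1) * cnj (dens.dens_integral ?G)
        + dens.dens_integral (ip D D t)"
      unfolding N_def
      by (simp only: dens.dens_integral_add chart_cont_add cc cc' dens.dens_integral_mult dens.dens_integral_cnj)
    then show ?thesis using solD[OF D] by (simp add: I_def hip_def fint_def)
  qed
  moreover have "Re (dens.dens_integral N) \<ge> 0" by (rule dens.dens_integral_real(2)[OF ccN r(2,1)])
  ultimately have "Re (hip t D D) \<le> Re I" by simp
  then show "Re \<Theta> \<le> 0" by (simp add: \<Theta>2)
  have "Im I = 0" using dens.dens_integral_real(1)[OF cc(1) r'(2,1)] by (simp add: I_def fint_def)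
  then show "\<Theta> \<in> \<real>" using hip_pos(1)[OF t D] by (simp add: \<Theta>2 complex_is_Real_iff)
qed

end

theorem corollary3p2:
  fixes A :: "('z::t2_space, 'n::finite) chart set"
    and V :: "'j \<Rightarrow> 'z set"
    and g :: "'j \<Rightarrow> 'j \<Rightarrow> 'z \<Rightarrow> complex"
    and U :: "complex set"
    and \<phi> :: "'j \<Rightarrow> complex \<Rightarrow> 'z \<Rightarrow> real"
  assumes "compact_complex_manifold A"
    and "positive_line_bundle A V g"
    and "open U" and "connected U"
    and "smooth_metric_pullback A V g U \<phi>"
    and "\<forall>t\<in>U. positive_metric A V (\<lambda>j. \<phi> j t)"
    and "\<forall>c\<in>A. \<forall>p \<in> U \<times> snd c ` fst c.
           semipositive_form J_prod (curvature_form_pullback V \<phi> c p)"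
    and "\<forall>c\<in>A. \<forall>p \<in> U \<times> snd c ` fst c. \<forall>w.
           divided_power (curvature_form_pullback V \<phi> c p) (CARD('n) + 1) w = 0"
  shows "\<forall>t\<in>U. \<forall>u \<in> hol_sections A V g.
           L2_inner A V \<phi> t (chern_curvature (hol_sections A V g) (L2_inner A V \<phi>) t u) u \<in> \<real> \<and>
           Re (L2_inner A V \<phi> t (chern_curvature (hol_sections A V g) (L2_inner A V \<phi>) t u) u) \<le> 0"
proof (intro ballI conjI)
  interpret monge_ampere A V g U \<phi>
    using assms unfolding positive_line_bundle_def by unfold_locales auto
  fix t u assume "t \<in> U" "u \<in> hol_sections A V g"
  from chern_curvature_nonpos[OF this]
  show "L2_inner A V \<phi> t (chern_curvature (hol_sections A V g) (L2_inner A V \<phi>) t u) u \<in> \<real>"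
    "Re (L2_inner A V \<phi> t (chern_curvature (hol_sections A V g) (L2_inner A V \<phi>) t u) u) \<le> 0"
    by simp_all
qed

end
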